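(* Let $E$ be a complete locally convex space. Then $\dot{\tilde{\mathcal{B}}}^{\{M_p\}}(\mathbb{R}^d;E)$ and $\dot{\tilde{\mathcal{B}}}^{\{M_p\}}(\mathbb{R}^d)\,\varepsilon\,E$ are isomorphic locally convex spaces.
   Context: Locally convex spaces are Hausdorff and over $\mathbb{C}$. $\mathbb{N}$ includes $0$; $D^\alpha=D_1^{\alpha_1}\cdots D_d^{\alpha_d}$, $D_j=i^{-1}\partial/\partial x_j$. $(M_p)_{p\in\mathbb{N}}$ is a sequence of positive numbers with $M_0=1$ satisfying: (M.1) $M_p^2\le M_{p-1}M_{p+1}$, $p\in\mathbb{Z}_+$; (M.2) $M_p\le c_0H^p\min_{0\le q\le p}M_{p-q}M_q$, $p\in\mathbb{N}$, for some $c_0,H\ge1$; (M.3) $\sum_{p=q+1}^\infty M_{p-1}/M_p\le c_0qM_q/M_{q+1}$, $q\in\mathbb{Z}_+$ (positive integers). $M_\alpha=M_{|\alpha|}$ for a multi-index $\alpha$. $\mathfrak{R}$ is the set of positive sequences $(t_j)_{j\in\mathbb{Z}_+}$ monotonically increasing to infinity; $T_k=\prod_{j=1}^kt_j$, $T_0=1$, $T_\alpha=T_{|\alpha|}$. $\mathcal{D}^{\{M_p\}}(\mathbb{R}^d)$ is the space of compactly supported $\varphi\in\mathcal{C}^\infty(\mathbb{R}^d)$ for which there is $h>0$ with $\sup_{\alpha,x}|D^\alpha\varphi(x)|/(h^{|\alpha|}M_\alpha)<\infty$. $\tilde{\mathcal{D}}^{\{M_p\}}_{L^\infty}(\mathbb{R}^d)$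 is the space of $\varphi\in\mathcal{C}^\infty(\mathbb{R}^d)$ with $\|\varphi\|_{(t_j)}=\sup_{\alpha\in\mathbb{N}^d}\sup_{x\in\mathbb{R}^d}|D^\alpha\varphi(x)|/(T_\alpha M_\alpha)<\infty$ for every $(t_j)\in\mathfrak{R}$, topologized by these norms. $\dot{\tilde{\mathcal{B}}}^{\{M_p\}}(\mathbb{R}^d)$ is the completion (closure) of $\mathcal{D}^{\{M_p\}}(\mathbb{R}^d)$ in $\tilde{\mathcal{D}}^{\{M_p\}}_{L^\infty}(\mathbb{R}^d)$, with the induced topology. $\dot{\tilde{\mathcal{B}}}^{\{M_p\}}(\mathbb{R}^d;E)$ is the space of all smooth $E$-valued functions $\varphi$ on $\mathbb{R}^d$ such that: (i) for each continuous seminorm $q$ on $E$ and each $(t_j)\in\mathfrak{R}$ there is $C>0$ with $q_{(t_j)}(\varphi)=\sup_{\alpha\in\mathbb{N}^d}\sup_{x\in\mathbb{R}^d}q\left(\frac{D^\alpha\varphi(x)}{T_\alpha M_\alpha}\right)\le C$; (ii) for every $\varepsilon>0$, $(t_j)\in\mathfrak{R}$ and continuous seminorm $q$ on $E$ there is a compact $K\subset\mathbb{R}^d$ with $q\left(\frac{D^\alpha\varphi(x)}{T_\alpha M_\alpha}\right)\le\varepsilon$ for all $\alpha\in\mathbb{N}^d$, $x\in\mathbb{R}^d\setminus K$. Its topology is generated by the seminorms $q_{(t_j)}$, with $q$ ranging over continuous seminorms on $E$ and $(t_j)\in\mathfrak{R}$. For a locally convex space $F$, $F'_c$ is the dual $F'$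 with the topology of uniform convergence on convex circled compact subsets of $F$. The $\varepsilon$ tensor product $F\varepsilon E$ is the space of all bilinear functionals on $F'_c\times E'_c$ that are hypocontinuous with respect to the equicontinuous subsets of $F'$ and $E'$, with the topology of uniform convergence on products of equicontinuous subsets of $F'$ and $E'$. *)

theory Defs
  imports "HOL-Analysis.Analysis" "HOL-Library.Function_Algebras"
begin

section \<open>Complex vector spaces\<close>

class complex_vector = real_vector +
  fixes scaleC :: "complex \<Rightarrow> 'a \<Rightarrow> 'a"  (infixr "*\<^sub>C" 75)
  assumes scaleC_add_right: "c *\<^sub>C (x + y) = c *\<^sub>C x + c *\<^sub>C y"
    and scaleC_add_left: "(c + d) *\<^sub>C x = c *\<^sub>C x + d *\<^sub>C x"
    and scaleC_scaleC: "c *\<^sub>C d *\<^sub>C x = (c * d) *\<^sub>C x"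
    and scaleR_scaleC: "r *\<^sub>R x = complex_of_real r *\<^sub>C x"

lemma scaleC_one: "1 *\<^sub>C x = x" for x :: "'a::complex_vector"
  using scaleR_scaleC[of 1 x] by simp

global_interpretation complex_vector: vector_space "scaleC :: complex \<Rightarrow> 'a \<Rightarrow> 'a::complex_vector"
  by unfold_locales (simp_all add: scaleC_add_right scaleC_add_left scaleC_scaleC scaleC_one)

instantiation complex :: complex_vector
begin

definition scaleC_complex_def: "c *\<^sub>C z = c * z" for z :: complex

instance
  by standard (simp_all add: scaleC_complex_def algebra_simps scaleR_conv_of_real)

end

instantiation "fun" :: (type, real_vector) real_vector
begin

definition scaleR_fun_def: "r *\<^sub>R f = (\<lambda>x. r *\<^sub>R f x)" for f :: "'a \<Rightarrow> 'b"

instance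
  by standard (simp_all add: scaleR_fun_def fun_eq_iff algebra_simps)

end

instantiation "fun" :: (type, complex_vector) complex_vector
begin

definition scaleC_fun_def: "c *\<^sub>C f = (\<lambda>x. c *\<^sub>C f x)" for f :: "'a \<Rightarrow> 'b"

instance
  by standard (simp_all add: scaleC_fun_def scaleR_fun_def fun_eq_iff
      scaleC_add_right scaleC_add_left scaleC_scaleC scaleR_scaleC)

end

definition clinear_on :: "'a::complex_vector set \<Rightarrow> ('a \<Rightarrow> 'b::complex_vector) \<Rightarrow> bool" where
  "clinear_on V f \<longleftrightarrow>
     (\<forall>x\<in>V. \<forall>y\<in>V. f (x + y) = f x + f y) \<and> (\<forall>c. \<forall>x\<in>V. f (c *\<^sub>C x) = c *\<^sub>C f x)"

definition circled :: "'a::complex_vector set \<Rightarrow> bool" where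
  "circled K \<longleftrightarrow> (\<forall>x\<in>K. \<forall>c. cmod c \<le> 1 \<longrightarrow> c *\<^sub>C x \<in> K)"


section \<open>Locally convex spaces\<close>

text \<open>
  A locally convex space is given by its topology \<open>T\<close>; the underlying vector space is the
  complex subspace \<open>topspace T\<close> of the ambient type.  This lets function spaces, which are
  proper subspaces of a function type, be treated on the same footing as an abstract space.
\<close>

definition locally_convex_space :: "'a::complex_vector topology \<Rightarrow> bool" where
  "locally_convex_space T \<longleftrightarrow>
     complex_vector.subspace (topspace T) \<and>
     continuous_map (prod_topology T T) T (\<lambda>(x, y). x + y) \<and>
     continuous_map (prod_topology euclidean T) T (\<lambda>(c, x). c *\<^sub>C x) \<and>
     (\<forall>U. openin T U \<and> 0 \<in> U \<longrightarrow> (\<exists>V. openin T V \<and> 0 \<in> V \<and> convex V \<and> V \<subseteq> U)) \<and>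
     Hausdorff_space T"

definition complete_lcs :: "'a::complex_vector topology \<Rightarrow> bool" where
  "complete_lcs T \<longleftrightarrow>
     (\<forall>\<F> \<le> principal (topspace T). \<F> \<noteq> bot \<longrightarrow>
        (\<forall>U. openin T U \<and> 0 \<in> U \<longrightarrow> (\<forall>\<^sub>F (x, y) in \<F> \<times>\<^sub>F \<F>. x - y \<in> U)) \<longrightarrow>
        (\<exists>l. limitin T (\<lambda>x. x) l \<F>))"

definition lcs_isomorphic ::
    "'a::complex_vector topology \<Rightarrow> 'b::complex_vector topology \<Rightarrow> bool" where
  "lcs_isomorphic S T \<longleftrightarrow>
     locally_convex_space S \<and> locally_convex_space T \<and>
     (\<exists>\<Phi>. clinear_on (topspace S) \<Phi> \<and> homeomorphic_map S T \<Phi>)"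

definition continuous_seminorm :: "'a::complex_vector topology \<Rightarrow> ('a \<Rightarrow> real) \<Rightarrow> bool" where
  "continuous_seminorm T q \<longleftrightarrow>
     (\<forall>x\<in>topspace T. 0 \<le> q x) \<and>
     (\<forall>x\<in>topspace T. \<forall>y\<in>topspace T. q (x + y) \<le> q x + q y) \<and>
     (\<forall>c. \<forall>x\<in>topspace T. q (c *\<^sub>C x) = cmod c * q x) \<and>
     continuous_map T euclideanreal q"

text \<open>
  Seminorms defined by suprema take values in \<^typ>\<open>ennreal\<close>, so that the supremum
  of an unbounded set is \<open>\<infinity>\<close> rather than an unspecified real number.
\<close>

definition seminorm_topology ::
    "'a::complex_vector set \<Rightarrow> ('a \<Rightarrow> ennreal) set \<Rightarrow> 'a topology" where
  "seminorm_topology V P = topology_generated_by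
     (insert V {{y \<in> V. p (y - x) < ennreal \<epsilon>} | p x \<epsilon>. p \<in> P \<and> x \<in> V \<and> 0 < \<epsilon>})"

lemma topspace_seminorm_topology [simp]: "topspace (seminorm_topology V P) = V"
  unfolding seminorm_topology_def topology_generated_by_topspace by auto


section \<open>Duality and the \<open>\<epsilon>\<close> tensor product\<close>

text \<open>
  Functionals on \<open>topspace T\<close> are represented by total functions vanishing outside
  \<open>topspace T\<close>, so that distinct functionals are distinct functions; likewise for
  bilinear functionals below.
\<close>

definition dual :: "'a::complex_vector topology \<Rightarrow> ('a \<Rightarrow> complex) set" where
  "dual T = {f. clinear_on (topspace T) f \<and> continuous_map T euclidean f \<and>
     (\<forall>x. x \<notin> topspace T \<longrightarrow> f x = 0)}"

definition equicontinuous_on :: "'a topology \<Rightarrow> ('a \<Rightarrow> complex) set \<Rightarrow> bool" where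
  "equicontinuous_on T A \<longleftrightarrow>
     (\<forall>x\<in>topspace T. \<forall>\<epsilon>>0. \<exists>U. openin T U \<and> x \<in> U \<and> (\<forall>f\<in>A. \<forall>y\<in>U. cmod (f y - f x) < \<epsilon>))"

definition equicontinuous_subsets ::
    "'a::complex_vector topology \<Rightarrow> ('a \<Rightarrow> complex) set set" where
  "equicontinuous_subsets T = {A. A \<subseteq> dual T \<and> equicontinuous_on T A}"

definition dual_c :: "'a::complex_vector topology \<Rightarrow> ('a \<Rightarrow> complex) topology" where
  "dual_c T = seminorm_topology (dual T)
     {\<lambda>f. SUP x\<in>K. ennreal (cmod (f x)) | K. compactin T K \<and> convex K \<and> circled K}"

definition hypocontinuous ::
    "'a::complex_vector topology \<Rightarrow> 'b::complex_vector topology \<Rightarrow> 'a set set \<Rightarrow> 'b set set \<Rightarrow>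
     ('a \<Rightarrow> 'b \<Rightarrow> complex) \<Rightarrow> bool" where
  "hypocontinuous S T \<A> \<B> b \<longleftrightarrow>
     (\<forall>y\<in>topspace T. continuous_map S euclidean (\<lambda>x. b x y)) \<and>
     (\<forall>x\<in>topspace S. continuous_map T euclidean (\<lambda>y. b x y)) \<and>
     (\<forall>A\<in>\<A>. \<forall>\<epsilon>>0. \<exists>V. openin T V \<and> 0 \<in> V \<and> (\<forall>x\<in>A. \<forall>y\<in>V. cmod (b x y) < \<epsilon>)) \<and>
     (\<forall>B\<in>\<B>. \<forall>\<epsilon>>0. \<exists>U. openin S U \<and> 0 \<in> U \<and> (\<forall>x\<in>U. \<forall>y\<in>B. cmod (b x y) < \<epsilon>))"

definition eps_product_carrier ::
    "'a::complex_vector topology \<Rightarrow> 'b::complex_vector topology \<Rightarrow>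
     (('a \<Rightarrow> complex) \<Rightarrow> ('b \<Rightarrow> complex) \<Rightarrow> complex) set" where
  "eps_product_carrier F E = {b.
     (\<forall>y\<in>dual E. clinear_on (dual F) (\<lambda>x. b x y)) \<and>
     (\<forall>x\<in>dual F. clinear_on (dual E) (\<lambda>y. b x y)) \<and>
     (\<forall>x y. x \<notin> dual F \<or> y \<notin> dual E \<longrightarrow> b x y = 0) \<and>
     hypocontinuous (dual_c F) (dual_c E) (equicontinuous_subsets F) (equicontinuous_subsets E) b}"

definition eps_product ::
    "'a::complex_vector topology \<Rightarrow> 'b::complex_vector topology \<Rightarrow>
     (('a \<Rightarrow> complex) \<Rightarrow> ('b \<Rightarrow> complex) \<Rightarrow> complex) topology"  (infixr "\<epsilon>\<otimes>" 70) where
  "F \<epsilon>\<otimes> E = seminorm_topology (eps_product_carrier F E)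
     {\<lambda>b. SUP (x, y)\<in>A \<times> B. ennreal (cmod (b x y)) | A B.
        A \<in> equicontinuous_subsets F \<and> B \<in> equicontinuous_subsets E}"


section \<open>Smooth functions with values in a locally convex space\<close>

definition has_partial ::
    "'e::complex_vector topology \<Rightarrow> 'd::finite \<Rightarrow> (real^'d \<Rightarrow> 'e) \<Rightarrow> real^'d \<Rightarrow> 'e \<Rightarrow> bool" where
  "has_partial E j \<phi> x l \<longleftrightarrow>
     limitin E (\<lambda>h::real. (\<phi> (x + h *\<^sub>R axis j 1) - \<phi> x) /\<^sub>R h) l (at 0)"

definition partial ::
    "'e::complex_vector topology \<Rightarrow> 'd::finite \<Rightarrow> (real^'d \<Rightarrow> 'e) \<Rightarrow> real^'d \<Rightarrow> 'e" where
  "partial E j \<phi> x = (THE l. has_partial E j \<phi> x l)"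

text \<open>
  \<open>\<phi>\<close> is \<open>C\<^sup>\<infinity>\<close> if all iterated partial derivatives, taken in any order, exist and are
  continuous into \<open>E\<close>; the empty list gives \<open>\<phi>\<close> itself.
\<close>

definition smooth :: "'e::complex_vector topology \<Rightarrow> (real^'d::finite \<Rightarrow> 'e) \<Rightarrow> bool" where
  "smooth E \<phi> \<longleftrightarrow> (\<forall>js.
     continuous_map euclidean E (foldr (partial E) js \<phi>) \<and>
     (\<forall>j x. \<exists>l. has_partial E j (foldr (partial E) js \<phi>) x l))"

definition D_op ::
    "'e::complex_vector topology \<Rightarrow> 'd::finite \<Rightarrow> (real^'d \<Rightarrow> 'e) \<Rightarrow> real^'d \<Rightarrow> 'e" where
  "D_op E j \<phi> = (\<lambda>x. inverse \<i> *\<^sub>C partial E j \<phi> x)"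

text \<open>
  \<open>D\<^sup>\<alpha>\<close> is the composition of the powers \<open>D_op E j ^^ \<alpha> j\<close>, the smallest index outermost; the
  order on the index type plays the role of the numbering \<open>1, \<dots>, d\<close> of the coordinates.
\<close>

definition D_multi ::
    "'e::complex_vector topology \<Rightarrow> ('d \<Rightarrow> nat) \<Rightarrow>
     (real^'d::{finite,linorder} \<Rightarrow> 'e) \<Rightarrow> real^'d::{finite,linorder} \<Rightarrow> 'e" where
  "D_multi E \<alpha> \<phi> = foldr (\<lambda>j. D_op E j ^^ \<alpha> j) (sorted_list_of_set UNIV) \<phi>"

definition multi_size :: "('d::finite \<Rightarrow> nat) \<Rightarrow> nat" where
  "multi_size \<alpha> = (\<Sum>j\<in>UNIV. \<alpha> j)"


section \<open>Ultradifferentiable functions\<close>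

text \<open>Komatsu's conditions (M.1), (M.2), (M.3), where (M.3) includes the convergence of the series.\<close>

definition weight_sequence :: "(nat \<Rightarrow> real) \<Rightarrow> bool" where
  "weight_sequence M \<longleftrightarrow>
     (\<forall>p. 0 < M p) \<and> M 0 = 1 \<and>
     (\<forall>p\<ge>1. (M p)\<^sup>2 \<le> M (p - 1) * M (p + 1)) \<and>
     (\<exists>c\<^sub>0 H. 1 \<le> c\<^sub>0 \<and> 1 \<le> H \<and>
        (\<forall>p. M p \<le> c\<^sub>0 * H ^ p * Min ((\<lambda>q. M (p - q) * M q) ` {0..p})) \<and>
        (\<forall>q\<ge>1. (\<lambda>p. M (p - 1) / M p) summable_on {q + 1..} \<and>
           (\<Sum>\<^sub>\<infinity>p\<in>{q + 1..}. M (p - 1) / M p) \<le> c\<^sub>0 * real q * M q / M (q + 1)))"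

text \<open>Only the values at indices \<open>j \<ge> 1\<close> of a sequence in \<open>\<RR>\<close> matter.\<close>

definition RR :: "(nat \<Rightarrow> real) set"  ("\<RR>") where
  "\<RR> = {t. (\<forall>j\<ge>1. 0 < t j) \<and> (\<forall>j\<ge>1. t j \<le> t (j + 1)) \<and> filterlim t at_top sequentially}"

text \<open>\<open>TM M t \<alpha>\<close> is \<open>T\<^sub>\<alpha> M\<^sub>\<alpha>\<close>.\<close>

definition TM :: "(nat \<Rightarrow> real) \<Rightarrow> (nat \<Rightarrow> real) \<Rightarrow> ('d::finite \<Rightarrow> nat) \<Rightarrow> real" where
  "TM M t \<alpha> = (\<Prod>j=1..multi_size \<alpha>. t j) * M (multi_size \<alpha>)"

definition D_Roumieu :: "(nat \<Rightarrow> real) \<Rightarrow> (real^'d::{finite,linorder} \<Rightarrow> complex) set" where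
  "D_Roumieu M = {\<phi>. smooth euclidean \<phi> \<and> compact (closure {x. \<phi> x \<noteq> 0}) \<and>
     (\<exists>h>0. (SUP \<alpha>. SUP x. ennreal (cmod (D_multi euclidean \<alpha> \<phi> x) /
        (h ^ multi_size \<alpha> * M (multi_size \<alpha>)))) < \<infinity>)}"

definition ultra_norm ::
    "(nat \<Rightarrow> real) \<Rightarrow> (nat \<Rightarrow> real) \<Rightarrow> (real^'d::{finite,linorder} \<Rightarrow> complex) \<Rightarrow> ennreal" where
  "ultra_norm M t \<phi> = (SUP \<alpha>. SUP x. ennreal (cmod (D_multi euclidean \<alpha> \<phi> x) / TM M t \<alpha>))"

definition DLinf_tilde :: "(nat \<Rightarrow> real) \<Rightarrow> (real^'d::{finite,linorder} \<Rightarrow> complex) topology" where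
  "DLinf_tilde M = seminorm_topology
     {\<phi>. smooth euclidean \<phi> \<and> (\<forall>t\<in>\<RR>. ultra_norm M t \<phi> < \<infinity>)}
     (ultra_norm M ` \<RR>)"

text \<open>The completion is taken inside the complete space \<open>DLinf_tilde M\<close>, i.e. as a closure.\<close>

definition Bdot_tilde :: "(nat \<Rightarrow> real) \<Rightarrow> (real^'d::{finite,linorder} \<Rightarrow> complex) topology" where
  "Bdot_tilde M = subtopology (DLinf_tilde M) (DLinf_tilde M closure_of D_Roumieu M)"

definition ultra_seminorm ::
    "'e::complex_vector topology \<Rightarrow> (nat \<Rightarrow> real) \<Rightarrow> ('e \<Rightarrow> real) \<Rightarrow> (nat \<Rightarrow> real) \<Rightarrow>
     (real^'d::{finite,linorder} \<Rightarrow> 'e) \<Rightarrow> ennreal" where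
  "ultra_seminorm E M q t \<phi> =
     (SUP \<alpha>. SUP x. ennreal (q (D_multi E \<alpha> \<phi> x /\<^sub>R TM M t \<alpha>)))"

definition Bdot_tilde_vec_carrier ::
    "(nat \<Rightarrow> real) \<Rightarrow> 'e::complex_vector topology \<Rightarrow> (real^'d::{finite,linorder} \<Rightarrow> 'e) set" where
  "Bdot_tilde_vec_carrier M E = {\<phi>. smooth E \<phi> \<and>
     (\<forall>q t. continuous_seminorm E q \<and> t \<in> \<RR> \<longrightarrow>
        (\<exists>C>0. ultra_seminorm E M q t \<phi> \<le> ennreal C)) \<and>
     (\<forall>\<epsilon>>0. \<forall>q t. continuous_seminorm E q \<and> t \<in> \<RR> \<longrightarrow>
        (\<exists>K. compact K \<and> (\<forall>\<alpha>. \<forall>x\<in>- K. q (D_multi E \<alpha> \<phi> x /\<^sub>R TM M t \<alpha>) \<le> \<epsilon>)))}"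

definition Bdot_tilde_vec ::
    "(nat \<Rightarrow> real) \<Rightarrow> 'e::complex_vector topology \<Rightarrow> (real^'d::{finite,linorder} \<Rightarrow> 'e) topology" where
  "Bdot_tilde_vec M E = seminorm_topology (Bdot_tilde_vec_carrier M E)
     {ultra_seminorm E M q t | q t. continuous_seminorm E q \<and> t \<in> \<RR>}"

end

theory Submission
  imports Defs
begin

text \<open>
  The isomorphism sends \<open>\<phi>\<close> to the bilinear functional \<open>(f, e) \<mapsto> f (e \<circ> \<phi>)\<close> (\<open>pairing\<close>). Its inverse
  sends \<open>b\<close> to the function \<open>x \<mapsto> R \<delta>\<^sub>x\<close>, where \<open>R f\<close> is the vector with \<open>e (R f) = b f e\<close> for
  all \<open>e\<close> in the dual of \<open>E\<close> (\<open>represent\<close>, \<open>density\<close>).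

  The forward direction rests on two facts. The weighted derivatives of \<open>\<phi>\<close> form a precompact
  subset of \<open>E\<close>, because those of high order and those far away are uniformly small
  (\<open>precompact_weighted\<close>). As \<open>E\<close> is complete, they lie in a compact disc, so \<open>e \<circ> \<phi>\<close> depends
  continuously on \<open>e\<close> for uniform convergence on compact discs (\<open>N_comp_continuous\<close>). And the
  functions \<open>e \<circ> \<phi>\<close>, with \<open>e\<close> in the polar of a neighbourhood, form a compact disc of the scalar
  space (\<open>compact_comp_polar\<close>): the polar is compact for pointwise convergence by the theorem of
  Alaoglu, and on it pointwise convergence is uniform on precompact sets. These are the two halves
  of hypocontinuity (\<open>pairing_carrier\<close>).

  For the inverse, the Mackey-Arens theorem produces \<open>R f\<close> from the continuity of \<open>b f\<close>, and
  hypocontinuity makes \<open>R\<close> continuous for uniform convergence on compact sets. Functionals on the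
  scalar space that are bounded by a common norm and converge pointwise converge uniformly on
  compact sets; hence the difference quotients of the evaluation functionals converge, and the
  derivatives of \<open>x \<mapsto> R \<delta>\<^sub>x\<close> are the images under \<open>R\<close> of the derivatives of \<open>\<delta>\<^sub>x\<close>
  (\<open>represent_tendsto_0\<close>, \<open>has_partial_represent_delta\<close>); decay at infinity follows in the same way.
  The Mackey-Arens theorem for the scalar space, applied to \<open>f \<mapsto> b f e\<close>, shows that this
  functional is evaluation at some \<open>g\<close>, and testing with \<open>\<delta>\<^sub>x\<close> gives \<open>g = e \<circ> \<phi>\<close>; so the two
  constructions are inverse to each other (\<open>pairing_density\<close>). The Hahn-Banach theorem, in the form
  \<open>q x = sup \<bar>e x\<bar>\<close> over the polar of \<open>q\<close>, compares the seminorms of the two sides.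

  One has to know that the closure of the compactly supported ultradifferentiable functions
  consists of all functions whose weighted derivatives vanish at infinity (\<open>Bdot_tilde_eq\<close>). This
  needs cutoff functions with uniform bounds (\<open>cutoff\<close>). They are obtained by averaging a
  trapezoidal function infinitely often, over intervals of lengths proportional to
  \<open>M p / M (p + 1)\<close>: the lengths are summable by (M.3), and each derivative turns one of the averages
  into a difference quotient, which costs the factor \<open>M (p + 1) / M p\<close>.
\<close>

section \<open>Locally convex spaces and their continuous seminorms\<close>

lemma scaleC_zero_left [simp]: "0 *\<^sub>C x = (0::'a::complex_vector)"
  by (rule complex_vector.scale_zero_left)

lemma scaleC_zero_right [simp]: "c *\<^sub>C (0::'a::complex_vector) = 0"
  by (rule complex_vector.scale_zero_right)

lemma scaleC_minus1: "(-1) *\<^sub>C x = - (x::'a::complex_vector)"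
  by (metis complex_vector.scale_minus_left scaleC_one)

lemma zero_clinear_on:
  assumes "clinear_on V f" "0 \<in> V" shows "f 0 = 0"
  using assms unfolding clinear_on_def by (metis scaleC_zero_left)

lemma diff_clinear_on:
  assumes "clinear_on V f" "complex_vector.subspace V" "x \<in> V" "y \<in> V"
  shows "f (x - y) = f x - f y"
proof -
  have "- y \<in> V" using assms complex_vector.subspace_neg by blast
  moreover have "f (- y) = - f y"
    using assms unfolding clinear_on_def by (metis scaleC_minus1)
  ultimately show ?thesis
    using assms unfolding clinear_on_def by (metis add_uminus_conv_diff)
qed

lemma subspace_scaleR:
  assumes "complex_vector.subspace V" "x \<in> V" shows "r *\<^sub>R x \<in> V"
  using assms by (simp add: scaleR_scaleC complex_vector.subspace_scale)

definition seminorm_on :: "'a::complex_vector set \<Rightarrow> ('a \<Rightarrow> real) \<Rightarrow> bool" where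
  "seminorm_on V q \<longleftrightarrow> (\<forall>x\<in>V. 0 \<le> q x) \<and> (\<forall>x\<in>V. \<forall>y\<in>V. q (x + y) \<le> q x + q y) \<and>
     (\<forall>c. \<forall>x\<in>V. q (c *\<^sub>C x) = cmod c * q x)"

lemma continuous_seminorm_iff:
  "continuous_seminorm E q \<longleftrightarrow> seminorm_on (topspace E) q \<and> continuous_map E euclideanreal q"
  unfolding continuous_seminorm_def seminorm_on_def by auto

lemma seminorm_on_zero: "seminorm_on V q \<Longrightarrow> 0 \<in> V \<Longrightarrow> q 0 = 0"
  unfolding seminorm_on_def by (metis scaleC_zero_left norm_zero mult_zero_left)

lemma seminorm_on_minus: "seminorm_on V q \<Longrightarrow> x \<in> V \<Longrightarrow> q (- x) = q x"
  unfolding seminorm_on_def by (metis scaleC_minus1 norm_minus_cancel norm_one mult_1)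

lemma seminorm_on_scaleR: "seminorm_on V q \<Longrightarrow> x \<in> V \<Longrightarrow> q (r *\<^sub>R x) = \<bar>r\<bar> * q x"
  unfolding seminorm_on_def by (metis scaleR_scaleC norm_of_real)

lemma seminorm_on_commute:
  assumes "seminorm_on V q" "complex_vector.subspace V" "x \<in> V" "y \<in> V"
  shows "q (x - y) = q (y - x)"
  using seminorm_on_minus[OF assms(1) complex_vector.subspace_diff[OF assms(2,3,4)]] by simp

lemma seminorm_on_triangle:
  assumes "seminorm_on V q" "complex_vector.subspace V" "x \<in> V" "y \<in> V" "z \<in> V"
  shows "q (x - z) \<le> q (x - y) + q (y - z)"
proof -
  have "q ((x - y) + (y - z)) \<le> q (x - y) + q (y - z)"
    using assms complex_vector.subspace_diff[OF assms(2)] unfolding seminorm_on_def by blast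
  then show ?thesis by simp
qed

lemma seminorm_on_abs_diff:
  assumes "seminorm_on V q" "complex_vector.subspace V" "x \<in> V" "y \<in> V"
  shows "\<bar>q x - q y\<bar> \<le> q (x - y)"
proof -
  have 0: "0 \<in> V" using assms complex_vector.subspace_0 by blast
  have "q x \<le> q (x - y) + q y" "q y \<le> q (y - x) + q x"
    using seminorm_on_triangle[OF assms(1,2,3,4) 0] seminorm_on_triangle[OF assms(1,2,4,3) 0] by auto
  then show ?thesis using seminorm_on_commute[OF assms] by simp
qed

lemma seminorm_on_add: "seminorm_on V p \<Longrightarrow> seminorm_on V q \<Longrightarrow> seminorm_on V (\<lambda>x. p x + q x)"
  unfolding seminorm_on_def by (auto simp: algebra_simps) (smt (verit))

lemma seminorm_on_mult: "seminorm_on V q \<Longrightarrow> 0 \<le> r \<Longrightarrow> seminorm_on V (\<lambda>x. r * q x)"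
  unfolding seminorm_on_def by (auto simp: algebra_simps) (metis distrib_left mult_left_mono)

lemma seminorm_on_clinear: "clinear_on V f \<Longrightarrow> seminorm_on V (\<lambda>x. cmod (f x))"
  unfolding seminorm_on_def clinear_on_def
  by (auto simp: scaleC_complex_def norm_mult norm_triangle_ineq)

locale lcs =
  fixes E :: "'a::complex_vector topology"
  assumes lcs: "locally_convex_space E"
begin

lemma subsp: "complex_vector.subspace (topspace E)"
  using lcs unfolding locally_convex_space_def by blast

lemma zero_in: "0 \<in> topspace E" using subsp complex_vector.subspace_0 by blast
lemma add_in: "x \<in> topspace E \<Longrightarrow> y \<in> topspace E \<Longrightarrow> x + y \<in> topspace E"
  using subsp complex_vector.subspace_add by blast
lemma diff_in: "x \<in> topspace E \<Longrightarrow> y \<in> topspace E \<Longrightarrow> x - y \<in> topspace E"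
  using subsp complex_vector.subspace_diff by blast
lemma scaleC_in: "x \<in> topspace E \<Longrightarrow> c *\<^sub>C x \<in> topspace E"
  using subsp complex_vector.subspace_scale by blast
lemma scaleR_in: "x \<in> topspace E \<Longrightarrow> r *\<^sub>R x \<in> topspace E"
  using subsp subspace_scaleR by blast
lemma minus_in: "x \<in> topspace E \<Longrightarrow> - x \<in> topspace E"
  using subsp complex_vector.subspace_neg by blast

lemma continuous_add: "continuous_map (prod_topology E E) E (\<lambda>(x, y). x + y)"
  using lcs unfolding locally_convex_space_def by blast

lemma continuous_scale: "continuous_map (prod_topology euclidean E) E (\<lambda>(c, x). c *\<^sub>C x)"
  using lcs unfolding locally_convex_space_def by blast

lemma continuous_map_plus:
  assumes "continuous_map X E f" "continuous_map X E g"
  shows "continuous_map X E (\<lambda>x. f x + g x)"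
proof -
  have "continuous_map X (prod_topology E E) (\<lambda>x. (f x, g x))"
    using assms by (simp add: continuous_map_pairedI)
  from continuous_map_compose[OF this continuous_add] show ?thesis by (simp add: o_def)
qed

lemma continuous_map_scaleC:
  assumes "continuous_map X euclidean c" "continuous_map X E g"
  shows "continuous_map X E (\<lambda>x. c x *\<^sub>C g x)"
proof -
  have "continuous_map X (prod_topology euclidean E) (\<lambda>x. (c x, g x))"
    using assms by (simp add: continuous_map_pairedI)
  from continuous_map_compose[OF this continuous_scale] show ?thesis by (simp add: o_def)
qed

lemma continuous_map_translate:
  assumes "a \<in> topspace E" shows "continuous_map E E (\<lambda>x. x + a)"
  by (rule continuous_map_plus) (use assms in auto)

lemma openin_translate:
  assumes "openin E U" "a \<in> topspace E"
  shows "openin E {x \<in> topspace E. x + a \<in> U}"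
  using openin_continuous_map_preimage[OF continuous_map_translate[OF assms(2)] assms(1)] .

lemma openin_scale:
  assumes "openin E U"
  shows "openin E {x \<in> topspace E. c *\<^sub>C x \<in> U}"
proof -
  have "continuous_map E E (\<lambda>x. c *\<^sub>C x)" by (rule continuous_map_scaleC) auto
  from openin_continuous_map_preimage[OF this assms] show ?thesis .
qed

text \<open>
  A convex neighbourhood of 0 need not be circled. The scalar multiplication maps a small disc
  times a neighbourhood into it, and the convex hull of that image is convex and circled.
\<close>

lemma circled_convex_nbhd:
  assumes "openin E U" "0 \<in> U"
  obtains C W where "C \<subseteq> U" "convex C" "circled C" "openin E W" "0 \<in> W" "W \<subseteq> C"
proof -
  obtain V where V: "openin E V" "0 \<in> V" "convex V" "V \<subseteq> U"
    using lcs assms unfolding locally_convex_space_def by meson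
  have "openin (prod_topology euclidean E)
      {z \<in> topspace (prod_topology euclidean E). (case z of (c, x) \<Rightarrow> c *\<^sub>C x) \<in> V}"
    using openin_continuous_map_preimage[OF continuous_scale V(1)] .
  moreover have "(0, 0) \<in> {z \<in> topspace (prod_topology euclidean E).
      (case z of (c::complex, x) \<Rightarrow> c *\<^sub>C x) \<in> V}"
    using V zero_in by auto
  ultimately obtain A B where AB: "openin euclidean A" "openin E B" "0 \<in> A" "0 \<in> B"
    and sub: "A \<times> B \<subseteq> {z \<in> topspace (prod_topology euclidean E). (case z of (c, x) \<Rightarrow> c *\<^sub>C x) \<in> V}"
    unfolding openin_prod_topology_alt by (elim allE[of _ 0]) blast
  from AB(1,3) obtain \<delta> where \<delta>: "\<delta> > 0" "ball 0 \<delta> \<subseteq> A"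
    by (auto simp: open_contains_ball)
  define N where "N = {c *\<^sub>C x | c x. cmod c < \<delta> \<and> x \<in> B}"
  define C where "C = convex hull N"
  have NV: "N \<subseteq> V" using sub \<delta> unfolding N_def by fastforce
  have CU: "C \<subseteq> U" using NV V(3,4) unfolding C_def by (meson hull_minimal order_trans)
  have "circled C" unfolding circled_def
  proof (intro ballI allI impI)
    fix x c assume x: "x \<in> C" and c: "cmod c \<le> 1"
    have lin: "linear (\<lambda>x::'a. c *\<^sub>C x)"
      by (rule linearI) (auto simp: scaleC_add_right scaleR_scaleC scaleC_scaleC mult.commute)
    have "(\<lambda>x. c *\<^sub>C x) ` N \<subseteq> N"
    proof clarify
      fix y assume "y \<in> N"
      then obtain b z where bz: "y = b *\<^sub>C z" "cmod b < \<delta>" "z \<in> B" unfolding N_def by auto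
      have "cmod (c * b) < \<delta>" using bz(2) mult_right_mono[OF c, of "cmod b"] by (simp add: norm_mult)
      then show "c *\<^sub>C y \<in> N" unfolding N_def bz(1) scaleC_scaleC using bz(3) by blast
    qed
    then have "(\<lambda>x. c *\<^sub>C x) ` C \<subseteq> C"
      unfolding C_def using convex_hull_linear_image[OF lin, of N] by (metis hull_mono)
    then show "c *\<^sub>C x \<in> C" using x by auto
  qed
  moreover
  define W where "W = {x \<in> topspace E. (2 / of_real \<delta>) *\<^sub>C x \<in> B}"
  have "openin E W" unfolding W_def by (rule openin_scale[OF AB(2)])
  moreover have "0 \<in> W" using AB zero_in unfolding W_def by auto
  moreover have "W \<subseteq> N"
  proof
    fix x assume "x \<in> W"
    then have 1: "(2 / of_real \<delta>) *\<^sub>C x \<in> B" unfolding W_def by auto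
    have "x = (of_real (\<delta>/2)) *\<^sub>C ((2 / of_real \<delta>) *\<^sub>C x)"
      using \<delta>(1) by (simp add: scaleC_scaleC scaleC_one)
    moreover have "cmod (of_real (\<delta>/2)) < \<delta>" using \<delta>(1) by (simp add: norm_divide)
    ultimately show "x \<in> N" using 1 unfolding N_def by blast
  qed
  ultimately show ?thesis
    using that[of C W] CU hull_subset[of N convex] unfolding C_def by auto
qed

text \<open>
  Boundedness on a neighbourhood \<open>W\<close> of 0 suffices: the dilation and translation of
  \<open>W\<close> are neighbourhoods on which \<open>p\<close> varies little.
\<close>

lemma seminorm_dominated_imp_continuous:
  assumes p: "seminorm_on (topspace E) p" and W: "openin E W" "0 \<in> W" "\<And>x. x \<in> W \<Longrightarrow> p x \<le> K"
  shows "continuous_seminorm E p"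
proof -
  have K: "0 \<le> K" using W zero_in seminorm_on_zero[OF p] by force
  have "openin E {x \<in> topspace E. p x \<in> U}" if U: "open U" for U
  proof (subst openin_subopen, intro ballI)
    fix x assume x: "x \<in> {x \<in> topspace E. p x \<in> U}"
    then obtain e where e: "e > 0" "ball (p x) e \<subseteq> U" using U open_contains_ball by blast
    define r where "r = (K + 1) / e"
    have r: "r > 0" using e K unfolding r_def by simp
    define W' where "W' = {y \<in> topspace E. y + - x \<in> {y \<in> topspace E. of_real r *\<^sub>C y \<in> W}}"
    have "openin E W'" unfolding W'_def
      by (intro openin_translate openin_scale W minus_in) (use x in auto)
    moreover have "x \<in> W'" unfolding W'_def using x zero_in W by auto
    moreover have "W' \<subseteq> {x \<in> topspace E. p x \<in> U}"
    proof
      fix y assume y: "y \<in> W'"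
      then have yE: "y \<in> topspace E" and "of_real r *\<^sub>C (y - x) \<in> W" unfolding W'_def by auto
      then have "p (of_real r *\<^sub>C (y - x)) \<le> K" using W by blast
      moreover have "p (of_real r *\<^sub>C (y - x)) = r * p (y - x)"
        using p diff_in[of y x] yE x r unfolding seminorm_on_def by auto
      ultimately have "p (y - x) \<le> K / r" using r by (simp add: field_simps)
      also have "\<dots> < e" using e K unfolding r_def by (simp add: field_simps)
      finally have "\<bar>p y - p x\<bar> < e"
        using seminorm_on_abs_diff[OF p subsp yE, of x] x by auto
      then show "y \<in> {x \<in> topspace E. p x \<in> U}"
        using e yE by (auto simp: dist_real_def subset_eq abs_minus_commute)
    qed
    ultimately show "\<exists>T. openin E T \<and> x \<in> T \<and> T \<subseteq> {x \<in> topspace E. p x \<in> U}" by blast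
  qed
  then have "continuous_map E euclideanreal p"
    by (simp add: continuous_map_def)
  then show ?thesis using p by (simp add: continuous_seminorm_iff)
qed

lemma continuous_seminorm_0: "continuous_seminorm E q \<Longrightarrow> q 0 = 0"
  using seminorm_on_zero[OF _ zero_in] by (auto simp: continuous_seminorm_iff)

lemma openin_seminorm_ball:
  assumes "continuous_seminorm E q" "x \<in> topspace E"
  shows "openin E {y \<in> topspace E. q (y - x) < e}"
proof -
  have "continuous_map E euclideanreal (\<lambda>y. q (y + - x))"
    using continuous_map_compose[OF continuous_map_translate[OF minus_in[OF assms(2)]], of euclideanreal q] assms(1)
    by (simp add: continuous_seminorm_iff o_def)
  from openin_continuous_map_preimage[OF this, of "{..<e}"] show ?thesis by simp
qed

lemma continuous_seminorm_le:
  assumes "continuous_seminorm E q" "seminorm_on (topspace E) p"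
    "\<And>x. x \<in> topspace E \<Longrightarrow> p x \<le> q x"
  shows "continuous_seminorm E p"
  using seminorm_dominated_imp_continuous[OF assms(2) openin_seminorm_ball[OF assms(1) zero_in, of 1], of 1]
    zero_in continuous_seminorm_0[OF assms(1)] assms(3) by force

lemma continuous_seminorm_add:
  assumes "continuous_seminorm E p" "continuous_seminorm E q"
  shows "continuous_seminorm E (\<lambda>x. p x + q x)"
  using assms unfolding continuous_seminorm_iff
  by (blast intro: seminorm_on_add continuous_map_add)

lemma continuous_seminorm_mult:
  assumes "continuous_seminorm E q" "0 \<le> r"
  shows "continuous_seminorm E (\<lambda>x. r * q x)"
  using assms unfolding continuous_seminorm_iff
  by (blast intro: seminorm_on_mult continuous_map_real_mult_left)

lemma continuous_seminorm_zero: "continuous_seminorm E (\<lambda>x. 0)"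
  unfolding continuous_seminorm_iff seminorm_on_def by auto

text \<open>
  The gauge of a convex circled neighbourhood is a continuous seminorm, so the continuous
  seminorms describe the topology.
\<close>

lemma gauge_exists:
  assumes "openin E U" "0 \<in> U"
  obtains q where "continuous_seminorm E q" "\<And>x. x \<in> topspace E \<Longrightarrow> q x < 1 \<Longrightarrow> x \<in> U"
proof -
  obtain C W where C: "C \<subseteq> U" "convex C" "circled C" "openin E W" "0 \<in> W" "W \<subseteq> C"
    using circled_convex_nbhd[OF assms] by blast
  define R where "R x = {r::real. r > 0 \<and> (\<exists>c\<in>C. x = r *\<^sub>R c)}" for x
  define q where "q x = Inf (R x)" for x
  have zC: "0 \<in> C" using C by blast
  have bdd: "bdd_below (R x)" for x unfolding R_def by (rule bdd_belowI[of _ 0]) auto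
  have ne: "R x \<noteq> {}" if "x \<in> topspace E" for x
  proof -
    have "continuous_map euclidean E (\<lambda>c::complex. c *\<^sub>C x)"
      by (rule continuous_map_scaleC) (use that in auto)
    from openin_continuous_map_preimage[OF this C(4)]
    have "open {c. c *\<^sub>C x \<in> W}" by simp
    moreover have "0 \<in> {c. c *\<^sub>C x \<in> W}" using C by simp
    ultimately obtain d where d: "d > 0" "ball 0 d \<subseteq> {c. c *\<^sub>C x \<in> W}"
      using open_contains_ball by blast
    then have "complex_of_real (d/2) *\<^sub>C x \<in> W" by (auto simp: subset_eq)
    then have "(d/2) *\<^sub>R x \<in> C" using C by (auto simp: scaleR_scaleC)
    then have "2/d \<in> R x" unfolding R_def using d(1)
      by (intro CollectI conjI bexI[of _ "(d/2) *\<^sub>R x"]) auto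
    then show ?thesis by auto
  qed
  have nonneg: "0 \<le> q x" if "x \<in> topspace E" for x
    unfolding q_def by (rule cInf_greatest[OF ne[OF that]]) (auto simp: R_def)
  have circ: "r *\<^sub>R c \<in> C" if "c \<in> C" "\<bar>r\<bar> \<le> 1" for c r
    using C(3) that unfolding circled_def by (metis scaleR_scaleC norm_of_real)
  have upward: "s \<in> R x" if r: "r \<in> R x" and rs: "r \<le> s" for x r s
  proof -
    obtain c where c: "c \<in> C" "x = r *\<^sub>R c" "r > 0" using r unfolding R_def by auto
    have "x = s *\<^sub>R ((r/s) *\<^sub>R c)" using c rs by simp
    moreover have "(r/s) *\<^sub>R c \<in> C" using circ[OF c(1), of "r/s"] c rs by simp
    ultimately show ?thesis unfolding R_def using c(3) rs by (auto intro!: bexI[of _ "(r/s) *\<^sub>R c"])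
  qed
  have lt: "s \<in> R x" if x: "x \<in> topspace E" and s: "q x < s" for x s
  proof -
    obtain r where "r \<in> R x" "r < s"
      using s ne[OF x] unfolding q_def by (meson cInf_lessD)
    then show ?thesis using upward by force
  qed
  have tri: "q (x + y) \<le> q x + q y" if x: "x \<in> topspace E" and y: "y \<in> topspace E" for x y
  proof (rule field_le_epsilon)
    fix e :: real assume e: "e > 0"
    define r s where "r = q x + e/2" and "s = q y + e/2"
    have "r \<in> R x" "s \<in> R y" using lt[OF x] lt[OF y] e by (auto simp: r_def s_def)
    then obtain c d where cd: "c \<in> C" "x = r *\<^sub>R c" "d \<in> C" "y = s *\<^sub>R d" and pos: "r > 0" "s > 0"
      unfolding R_def by auto
    have "(r/(r+s)) *\<^sub>R c + (s/(r+s)) *\<^sub>R d \<in> C"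
      by (rule convexD[OF C(2) cd(1,3)]) (use pos in \<open>simp_all add: add_divide_distrib[symmetric]\<close>)
    moreover have "x + y = (r+s) *\<^sub>R ((r/(r+s)) *\<^sub>R c + (s/(r+s)) *\<^sub>R d)"
      using pos cd by (simp add: scaleR_add_right)
    ultimately have "r + s \<in> R (x + y)" unfolding R_def using pos by auto
    then have "q (x+y) \<le> r + s" unfolding q_def using bdd by (rule cInf_lower)
    then show "q (x + y) \<le> q x + q y + e" unfolding r_def s_def by simp
  qed
  have hom1: "q (c *\<^sub>C x) \<le> cmod c * q x" if x: "x \<in> topspace E" for c x
  proof (cases "c = 0")
    case True
    have "e \<in> R 0" if "e > 0" for e using that zC unfolding R_def by (auto intro!: bexI[of _ 0])
    then have "q 0 \<le> e" if "e > 0" for e unfolding q_def using bdd that by (meson cInf_lower)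
    then have "q 0 \<le> 0" by (meson dense_ge)
    then show ?thesis using True by simp
  next
    case False
    show ?thesis
    proof (rule field_le_epsilon)
      fix e :: real assume e: "e > 0"
      define r where "r = q x + e / cmod c"
      have "r \<in> R x" using lt[OF x] e False by (auto simp: r_def)
      then obtain d where d: "d \<in> C" "x = r *\<^sub>R d" "r > 0" unfolding R_def by auto
      have "c *\<^sub>C x = (cmod c * r) *\<^sub>R ((c / of_real (cmod c)) *\<^sub>C d)"
        using False unfolding d(2) scaleR_scaleC scaleC_scaleC by (simp add: field_simps)
      moreover have "(c / of_real (cmod c)) *\<^sub>C d \<in> C"
        using C(3) d(1) False unfolding circled_def by (auto simp: norm_divide)
      ultimately have "cmod c * r \<in> R (c *\<^sub>C x)" unfolding R_def using d(3) False by auto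
      then have "q (c *\<^sub>C x) \<le> cmod c * r" unfolding q_def using bdd by (rule cInf_lower)
      then show "q (c *\<^sub>C x) \<le> cmod c * q x + e" using False unfolding r_def by (simp add: distrib_left)
    qed
  qed
  have hom: "q (c *\<^sub>C x) = cmod c * q x" if x: "x \<in> topspace E" for c x
  proof (cases "c = 0")
    case True then show ?thesis using hom1[OF x, of c] nonneg[OF scaleC_in[OF x, of c]] by simp
  next
    case False
    have "q (inverse c *\<^sub>C (c *\<^sub>C x)) \<le> cmod (inverse c) * q (c *\<^sub>C x)"
      by (rule hom1[OF scaleC_in[OF x]])
    then have "q x \<le> q (c *\<^sub>C x) / cmod c"
      using False by (simp add: scaleC_scaleC scaleC_one norm_inverse divide_inverse mult.commute)
    then have "cmod c * q x \<le> q (c *\<^sub>C x)" using False by (simp add: field_simps)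
    then show ?thesis using hom1[OF x, of c] by simp
  qed
  have sn: "seminorm_on (topspace E) q" unfolding seminorm_on_def using nonneg tri hom by blast
  have "q x \<le> 1" if "x \<in> W" for x
  proof -
    have "1 \<in> R x" using that C unfolding R_def by auto
    then show ?thesis unfolding q_def using bdd by (rule cInf_lower)
  qed
  then have "continuous_seminorm E q"
    by (rule seminorm_dominated_imp_continuous[OF sn C(4,5)])
  moreover have "x \<in> U" if "x \<in> topspace E" "q x < 1" for x
  proof -
    have "1 \<in> R x" using lt that by blast
    then show ?thesis using C unfolding R_def by auto
  qed
  ultimately show ?thesis using that by blast
qed

lemma openin_iff_seminorm:
  "openin E U \<longleftrightarrow> U \<subseteq> topspace E \<and>
     (\<forall>x\<in>U. \<exists>q. continuous_seminorm E q \<and> (\<forall>y\<in>topspace E. q (y - x) < 1 \<longrightarrow> y \<in> U))" (is "_ \<longleftrightarrow> ?R")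
proof
  assume U: "openin E U"
  have sub: "U \<subseteq> topspace E" using openin_subset[OF U] .
  have "\<exists>q. continuous_seminorm E q \<and> (\<forall>y\<in>topspace E. q (y - x) < 1 \<longrightarrow> y \<in> U)" if x: "x \<in> U" for x
  proof -
    have xE: "x \<in> topspace E" using x sub by auto
    obtain q where "continuous_seminorm E q"
      "\<And>y. y \<in> topspace E \<Longrightarrow> q y < 1 \<Longrightarrow> y \<in> {y \<in> topspace E. y + x \<in> U}"
      using gauge_exists[OF openin_translate[OF U xE]] zero_in x by auto
    then show ?thesis using diff_in[OF _ xE] by (intro exI[of _ q]) fastforce
  qed
  then show ?R using sub by blast
next
  assume R: ?R
  show "openin E U"
  proof (subst openin_subopen, intro ballI)
    fix x assume x: "x \<in> U"
    then obtain q where q: "continuous_seminorm E q" "\<forall>y\<in>topspace E. q (y - x) < 1 \<longrightarrow> y \<in> U"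
      using R by blast
    have xE: "x \<in> topspace E" using R x by auto
    have "x \<in> {y \<in> topspace E. q (y - x) < 1}"
      using xE continuous_seminorm_0[OF q(1)] by simp
    then show "\<exists>T. openin E T \<and> x \<in> T \<and> T \<subseteq> U"
      using openin_seminorm_ball[OF q(1) xE, of 1] q(2) by blast
  qed
qed

lemma limitin_iff_seminorm:
  "limitin E f l F \<longleftrightarrow> l \<in> topspace E \<and> (\<forall>\<^sub>F z in F. f z \<in> topspace E) \<and>
     (\<forall>q. continuous_seminorm E q \<longrightarrow> ((\<lambda>z. q (f z - l)) \<longlongrightarrow> 0) F)" (is "_ \<longleftrightarrow> ?R")
proof
  assume L: "limitin E f l F"
  then have l: "l \<in> topspace E" and ev: "\<And>U. openin E U \<Longrightarrow> l \<in> U \<Longrightarrow> \<forall>\<^sub>F z in F. f z \<in> U"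
    unfolding limitin_def by auto
  have "((\<lambda>z. q (f z - l)) \<longlongrightarrow> 0) F" if q: "continuous_seminorm E q" for q
  proof (rule tendstoI)
    fix e :: real assume e: "e > 0"
    have "q 0 = 0" using continuous_seminorm_0[OF q] .
    then have "\<forall>\<^sub>F z in F. f z \<in> {y \<in> topspace E. q (y - l) < e}"
      by (intro ev openin_seminorm_ball q l) (use l e in auto)
    then show "\<forall>\<^sub>F z in F. dist (q (f z - l)) 0 < e"
      by eventually_elim (use q diff_in[OF _ l] in \<open>auto simp: continuous_seminorm_def\<close>)
  qed
  then show ?R using l ev[OF openin_topspace l] by auto
next
  assume R: ?R
  show "limitin E f l F" unfolding limitin_def
  proof (intro conjI allI impI)
    show "l \<in> topspace E" using R by blast
    fix U assume U: "openin E U \<and> l \<in> U"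
    then obtain q where q: "continuous_seminorm E q" "\<forall>y\<in>topspace E. q (y - l) < 1 \<longrightarrow> y \<in> U"
      using openin_iff_seminorm by meson
    have "\<forall>\<^sub>F z in F. q (f z - l) < 1"
      using R q(1) by (intro order_tendstoD(2)[of _ 0]) auto
    moreover have "\<forall>\<^sub>F z in F. f z \<in> topspace E" using R by blast
    ultimately show "\<forall>\<^sub>F z in F. f z \<in> U" by eventually_elim (use q in auto)
  qed
qed

lemma seminorm_separates:
  assumes "x \<in> topspace E" "x \<noteq> 0"
  obtains q where "continuous_seminorm E q" "q x > 0"
proof -
  have "Hausdorff_space E" using lcs unfolding locally_convex_space_def by blast
  then obtain U V where UV: "openin E U" "openin E V" "0 \<in> U" "x \<in> V" "disjnt U V"
    using assms zero_in unfolding Hausdorff_space_def by (metis (no_types))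
  then obtain q where q: "continuous_seminorm E q" "\<And>x. x \<in> topspace E \<Longrightarrow> q x < 1 \<Longrightarrow> x \<in> U"
    using gauge_exists[OF UV(1,3)] by blast
  have "x \<notin> U" using UV unfolding disjnt_iff by auto
  then have "q x \<ge> 1" using q(2)[OF assms(1)] by linarith
  then show ?thesis using that[OF q(1)] by auto
qed

lemma limit_unique: "limitin E f l F \<Longrightarrow> limitin E f m F \<Longrightarrow> F \<noteq> bot \<Longrightarrow> l = m"
  using limitin_Hausdorff_unique[of E f l F m] lcs unfolding locally_convex_space_def by simp

lemma limitin_add:
  assumes "limitin E f l F" "limitin E g m F" shows "limitin E (\<lambda>z. f z + g z) (l + m) F"
proof -
  have "limitin (prod_topology E E) (\<lambda>z. (f z, g z)) (l, m) F"
    using assms by (simp add: limitin_pairwise o_def)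
  from continuous_map_limit[OF continuous_add this] show ?thesis by (simp add: o_def)
qed

subsection \<open>Dual spaces\<close>

text \<open>The polar of the unit ball of a seminorm.\<close>

definition polar :: "('a \<Rightarrow> real) \<Rightarrow> ('a \<Rightarrow> complex) set" where
  "polar q = {f \<in> dual E. \<forall>x\<in>topspace E. cmod (f x) \<le> q x}"

lemma dual_seminorm: "f \<in> dual E \<Longrightarrow> continuous_seminorm E (\<lambda>x. cmod (f x))"
  unfolding dual_def continuous_seminorm_iff by (auto intro: seminorm_on_clinear continuous_map_norm)

lemma dualI:
  assumes f: "clinear_on (topspace E) f" "\<And>x. x \<notin> topspace E \<Longrightarrow> f x = 0"
    and q: "continuous_seminorm E q" "\<And>x. x \<in> topspace E \<Longrightarrow> cmod (f x) \<le> q x"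
  shows "f \<in> dual E"
proof -
  have "openin E {x \<in> topspace E. f x \<in> U}" if U: "open U" for U
  proof (subst openin_iff_seminorm, intro conjI ballI)
    fix x assume x: "x \<in> {x \<in> topspace E. f x \<in> U}"
    then obtain e where e: "e > 0" "ball (f x) e \<subseteq> U" using U open_contains_ball by blast
    have "\<forall>y\<in>topspace E. (1/e) * q (y - x) < 1 \<longrightarrow> y \<in> {x \<in> topspace E. f x \<in> U}"
    proof (intro ballI impI)
      fix y assume y: "y \<in> topspace E" "(1/e) * q (y - x) < 1"
      have "cmod (f y - f x) = cmod (f (y - x))"
        using diff_clinear_on[OF f(1) subsp] y x by auto
      also have "\<dots> \<le> q (y - x)" using q(2) diff_in y x by auto
      also have "\<dots> < e" using y e by (simp add: field_simps)
      finally show "y \<in> {x \<in> topspace E. f x \<in> U}"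
        using e y by (auto simp: dist_norm norm_minus_commute subset_eq)
    qed
    then show "\<exists>q. continuous_seminorm E q \<and> (\<forall>y\<in>topspace E. q (y - x) < 1 \<longrightarrow> y \<in> {x \<in> topspace E. f x \<in> U})"
      using continuous_seminorm_mult[OF q(1), of "1/e"] e by (intro exI[of _ "\<lambda>x. (1/e) * q x"]) auto
  qed auto
  then have "continuous_map E euclidean f" by (simp add: continuous_map_def)
  then show ?thesis using f unfolding dual_def by auto
qed

lemma dual_clinear: "f \<in> dual E \<Longrightarrow> clinear_on (topspace E) f"
  unfolding dual_def by auto

lemma dual_add_apply: "f \<in> dual E \<Longrightarrow> x \<in> topspace E \<Longrightarrow> y \<in> topspace E \<Longrightarrow> f (x + y) = f x + f y"
  unfolding dual_def clinear_on_def by blast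

lemma dual_scaleC_apply: "f \<in> dual E \<Longrightarrow> x \<in> topspace E \<Longrightarrow> f (c *\<^sub>C x) = c * f x"
  unfolding dual_def clinear_on_def scaleC_complex_def by blast

lemma dual_diff_apply: "f \<in> dual E \<Longrightarrow> x \<in> topspace E \<Longrightarrow> y \<in> topspace E \<Longrightarrow> f (x - y) = f x - f y"
  using diff_clinear_on[OF dual_clinear subsp] by blast

lemma dual_scaleR_apply: "f \<in> dual E \<Longrightarrow> x \<in> topspace E \<Longrightarrow> f (r *\<^sub>R x) = r *\<^sub>R f x"
  by (simp add: scaleR_scaleC dual_scaleC_apply scaleC_complex_def)

lemma dual_outside: "f \<in> dual E \<Longrightarrow> x \<notin> topspace E \<Longrightarrow> f x = 0"
  unfolding dual_def by auto

lemma dual_subspace: "complex_vector.subspace (dual E)"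
  unfolding complex_vector.subspace_def
proof (intro conjI ballI allI)
  show "0 \<in> dual E"
    by (rule dualI[OF _ _ continuous_seminorm_zero]) (auto simp: clinear_on_def)
next
  fix f g assume fg: "f \<in> dual E" "g \<in> dual E"
  have "clinear_on (topspace E) (f + g)"
    unfolding clinear_on_def plus_fun_apply
    by (simp add: dual_add_apply[OF fg(1)] dual_add_apply[OF fg(2)] dual_scaleC_apply[OF fg(1)]
        dual_scaleC_apply[OF fg(2)] scaleC_complex_def distrib_left)
  then show "f + g \<in> dual E"
    by (rule dualI[OF _ _ continuous_seminorm_add[OF dual_seminorm[OF fg(1)] dual_seminorm[OF fg(2)]]])
      (simp_all add: dual_outside[OF fg(1)] dual_outside[OF fg(2)] norm_triangle_ineq)
next
  fix c f assume f: "f \<in> dual E"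
  have "clinear_on (topspace E) (c *\<^sub>C f)"
    unfolding clinear_on_def scaleC_fun_def
    by (simp add: dual_add_apply[OF f] dual_scaleC_apply[OF f] scaleC_complex_def distrib_left)
  moreover have "(c *\<^sub>C f) x = c * f x" for x
    by (simp only: scaleC_fun_def scaleC_complex_def)
  ultimately show "c *\<^sub>C f \<in> dual E"
    using dualI[of "c *\<^sub>C f", OF _ _ continuous_seminorm_mult[OF dual_seminorm[OF f], of "cmod c"]]
    by (simp add: dual_outside[OF f] norm_mult)
qed

text \<open>
  Equicontinuity at 0 alone gives a common neighbourhood; its gauge dominates all the functionals by
  homogeneity.
\<close>

lemma equicontinuous_dominated:
  assumes "A \<in> equicontinuous_subsets E"
  obtains q where "continuous_seminorm E q" "A \<subseteq> polar q"
proof -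
  have A: "A \<subseteq> dual E" "equicontinuous_on E A" using assms unfolding equicontinuous_subsets_def by auto
  obtain U where U: "openin E U" "0 \<in> U" "\<forall>f\<in>A. \<forall>y\<in>U. cmod (f y - f 0) < 1"
    using bspec[OF A(2)[unfolded equicontinuous_on_def] zero_in, rule_format, of 1] by auto
  obtain q where q: "continuous_seminorm E q" "\<And>x. x \<in> topspace E \<Longrightarrow> q x < 1 \<Longrightarrow> x \<in> U"
    using gauge_exists[OF U(1,2)] by blast
  have "cmod (f x) \<le> q x" if f: "f \<in> A" and x: "x \<in> topspace E" for f x
  proof (rule field_le_epsilon)
    fix e :: real assume e: "e > 0"
    define r where "r = q x + e"
    have qx: "q x \<ge> 0" using q(1) x unfolding continuous_seminorm_def by auto
    then have r: "r > 0" using e unfolding r_def by simp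
    have fE: "f \<in> dual E" using f A by auto
    have "q (inverse r *\<^sub>R x) = inverse r * q x"
      using seminorm_on_scaleR[of "topspace E" q x "inverse r"] q(1) x r by (simp add: continuous_seminorm_iff)
    also have "\<dots> < 1" using r e unfolding r_def by (simp add: field_simps)
    finally have "inverse r *\<^sub>R x \<in> U" using q(2) scaleR_in x by auto
    then have "cmod (f (inverse r *\<^sub>R x)) < 1"
      using U(3) f zero_clinear_on[OF dual_clinear[OF fE] zero_in] by auto
    then have "cmod (f x) < r"
      using r x fE by (simp add: dual_scaleR_apply field_simps)
    then show "cmod (f x) \<le> q x + e" unfolding r_def by simp
  qed
  then have "A \<subseteq> polar q" unfolding polar_def using A by auto
  then show ?thesis using that q(1) by blast
qed

lemma polar_equicontinuous:
  assumes q: "continuous_seminorm E q"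
  shows "polar q \<in> equicontinuous_subsets E"
proof -
  have "equicontinuous_on E (polar q)" unfolding equicontinuous_on_def
  proof (intro ballI allI impI)
    fix x and e :: real assume x: "x \<in> topspace E" and e: "e > 0"
    have "\<forall>f\<in>polar q. \<forall>y\<in>{y \<in> topspace E. q (y - x) < e}. cmod (f y - f x) < e"
    proof (intro ballI)
      fix f y assume f: "f \<in> polar q" and y: "y \<in> {y \<in> topspace E. q (y - x) < e}"
      have "cmod (f y - f x) = cmod (f (y - x))" using f x y unfolding polar_def by (auto simp: dual_diff_apply)
      also have "\<dots> \<le> q (y - x)" using f diff_in[of y x] x y unfolding polar_def by auto
      finally show "cmod (f y - f x) < e" using y by auto
    qed
    moreover have "x \<in> {y \<in> topspace E. q (y - x) < e}"
      using x e continuous_seminorm_0[OF q] by simp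
    ultimately show "\<exists>U. openin E U \<and> x \<in> U \<and> (\<forall>f\<in>polar q. \<forall>y\<in>U. cmod (f y - f x) < e)"
      using openin_seminorm_ball[OF q x] by blast
  qed
  then show ?thesis unfolding equicontinuous_subsets_def polar_def by auto
qed

lemma equicontinuous_subset: "A \<in> equicontinuous_subsets E \<Longrightarrow> B \<subseteq> A \<Longrightarrow> B \<in> equicontinuous_subsets E"
  unfolding equicontinuous_subsets_def equicontinuous_on_def by (auto; meson subsetD)

end

subsection \<open>The Hahn-Banach theorem\<close>

definition sublinear_on :: "'a::real_vector set \<Rightarrow> ('a \<Rightarrow> real) \<Rightarrow> bool" where
  "sublinear_on V p \<longleftrightarrow> (\<forall>x\<in>V. \<forall>y\<in>V. p (x + y) \<le> p x + p y) \<and> (\<forall>r\<ge>0. \<forall>x\<in>V. p (r *\<^sub>R x) = r * p x)"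

text \<open>
  Lowering a sublinear functional as much as possible along the ray spanned by \<open>y\<close>; this makes
  it additive in the direction \<open>y\<close>. A sublinear functional that cannot be lowered is linear.
\<close>

definition lower_along :: "'a::real_vector set \<Rightarrow> ('a \<Rightarrow> real) \<Rightarrow> 'a \<Rightarrow> 'a \<Rightarrow> real" where
  "lower_along V p y x = (if x \<in> V then INF r\<in>{0..}. p (x + r *\<^sub>R y) - r * p y else 0)"

lemma lower_along:
  assumes V: "subspace V" and p: "sublinear_on V p" and y: "y \<in> V"
  shows "sublinear_on V (lower_along V p y)"
    and "\<And>x r. x \<in> V \<Longrightarrow> r \<ge> 0 \<Longrightarrow> lower_along V p y x \<le> p (x + r *\<^sub>R y) - r * p y"
proof -
  note V' = subspace_add[OF V] subspace_scale[OF V] subspace_0[OF V]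
  have add: "p (a + b) \<le> p a + p b" if "a \<in> V" "b \<in> V" for a b
    using p that unfolding sublinear_on_def by blast
  have hom: "p (r *\<^sub>R a) = r * p a" if "a \<in> V" "r \<ge> 0" for r a
    using p that unfolding sublinear_on_def by blast
  have p0: "p 0 = 0" using hom[OF V'(3), of 0] by simp
  have lb: "- p (- x) \<le> p (x + r *\<^sub>R y) - r * p y" if x: "x \<in> V" and r: "r \<ge> 0" for x r
  proof -
    have "p (r *\<^sub>R y) \<le> p (x + r *\<^sub>R y) + p (- x)"
      using add[of "x + r *\<^sub>R y" "- x"] x y subspace_neg[OF V x] by (simp add: V')
    then show ?thesis using hom[OF y r] by simp
  qed
  have bdd: "bdd_below ((\<lambda>r. p (x + r *\<^sub>R y) - r * p y) ` {0..})" if "x \<in> V" for x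
    using lb[OF that] by (auto intro!: bdd_belowI[of _ "- p (- x)"])
  show le: "lower_along V p y x \<le> p (x + r *\<^sub>R y) - r * p y" if "x \<in> V" "r \<ge> 0" for x r
    using that unfolding lower_along_def by (auto intro!: cINF_lower2[OF bdd])
  have ge: "lower_along V p y x \<ge> m" if "x \<in> V" "\<And>r. r \<ge> 0 \<Longrightarrow> m \<le> p (x + r *\<^sub>R y) - r * p y" for x m
    using that unfolding lower_along_def by (auto intro!: cINF_greatest)
  show "sublinear_on V (lower_along V p y)"
    unfolding sublinear_on_def
  proof (intro conjI ballI allI impI)
    fix a b assume a: "a \<in> V" and b: "b \<in> V"
    have "lower_along V p y (a + b) - (p (b + s *\<^sub>R y) - s * p y) \<le> lower_along V p y a" if s: "s \<ge> 0" for s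
    proof (rule ge[OF a])
      fix r :: real assume r: "r \<ge> 0"
      have "lower_along V p y (a + b) \<le> p (a + b + (r + s) *\<^sub>R y) - (r + s) * p y"
        using le[of "a + b" "r + s"] a b r s V' by auto
      moreover have "p (a + b + (r + s) *\<^sub>R y) \<le> p (a + r *\<^sub>R y) + p (b + s *\<^sub>R y)"
        using add[of "a + r *\<^sub>R y" "b + s *\<^sub>R y"] a b y V' by (simp add: algebra_simps)
      ultimately show "lower_along V p y (a + b) - (p (b + s *\<^sub>R y) - s * p y) \<le> p (a + r *\<^sub>R y) - r * p y"
        by (simp add: algebra_simps)
    qed
    then have "lower_along V p y (a + b) - lower_along V p y a \<le> lower_along V p y b"
      by (intro ge[OF b]) (simp add: algebra_simps)
    then show "lower_along V p y (a + b) \<le> lower_along V p y a + lower_along V p y b" by simp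
  next
    fix r :: real and a assume r: "0 \<le> r" and a: "a \<in> V"
    show "lower_along V p y (r *\<^sub>R a) = r * lower_along V p y a"
    proof (cases "r = 0")
      case True
      have "p (0 + s *\<^sub>R y) - s * p y = 0" if "s \<ge> 0" for s using hom[OF y that] by simp
      then have "lower_along V p y 0 = (INF s\<in>{0::real..}. 0)"
        unfolding lower_along_def using V' by auto
      then show ?thesis using True by simp
    next
      case False
      then have r: "r > 0" using r by simp
      have *: "p (r *\<^sub>R a + (r * s) *\<^sub>R y) - (r * s) * p y = r * (p (a + s *\<^sub>R y) - s * p y)" for s
        using hom[of "a + s *\<^sub>R y" r] a y r V' by (simp add: algebra_simps)
      show ?thesis
      proof (rule antisym)
        have "lower_along V p y (r *\<^sub>R a) / r \<le> lower_along V p y a"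
        proof (rule ge[OF a])
          fix s :: real assume s: "s \<ge> 0"
          have "lower_along V p y (r *\<^sub>R a) \<le> r * (p (a + s *\<^sub>R y) - s * p y)"
            using le[of "r *\<^sub>R a" "r * s"] * r s V' a by simp
          then show "lower_along V p y (r *\<^sub>R a) / r \<le> p (a + s *\<^sub>R y) - s * p y"
            using r by (simp add: field_simps)
        qed
        then show "lower_along V p y (r *\<^sub>R a) \<le> r * lower_along V p y a" using r by (simp add: field_simps)
        show "r * lower_along V p y a \<le> lower_along V p y (r *\<^sub>R a)"
        proof (rule ge)
          show "r *\<^sub>R a \<in> V" using V' a by auto
          fix s :: real assume s: "s \<ge> 0"
          have "r * lower_along V p y a \<le> r * (p (a + (s/r) *\<^sub>R y) - (s/r) * p y)"
            using le[OF a, of "s/r"] r s by simp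
          also have "\<dots> = p (r *\<^sub>R a + s *\<^sub>R y) - s * p y" using *[of "s/r"] r by simp
          finally show "r * lower_along V p y a \<le> p (r *\<^sub>R a + s *\<^sub>R y) - s * p y" .
        qed
      qed
    qed
  qed
qed

text \<open>
  Zorn's lemma yields a minimal sublinear functional below \<open>q\<close>, since the infimum of a
  chain is again sublinear. By minimality \<open>lower_along\<close> leaves it unchanged.
\<close>

lemma minimal_sublinear:
  fixes V :: "'a::real_vector set"
  assumes V: "subspace V" and q: "sublinear_on V q"
  shows "\<exists>f. (\<forall>x\<in>V. f x \<le> q x) \<and> (\<forall>x\<in>V. \<forall>y\<in>V. f (x + y) = f x + f y) \<and>
    (\<forall>r. \<forall>x\<in>V. f (r *\<^sub>R x) = r * f x)"
proof -
  define q' where "q' x = (if x \<in> V then q x else 0)" for x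
  define A where "A = {p. sublinear_on V p \<and> (\<forall>x. x \<notin> V \<longrightarrow> p x = 0) \<and> (\<forall>x\<in>V. p x \<le> q x)}"
  define P where "P = (\<lambda>f g :: 'a \<Rightarrow> real. \<forall>x. g x \<le> f x)"
  note V' = subspace_add[OF V] subspace_scale[OF V] subspace_0[OF V]
  have lb: "- q (- x) \<le> p x" if "p \<in> A" "x \<in> V" for p x
  proof -
    have p: "sublinear_on V p" and le: "p (- x) \<le> q (- x)" using that subspace_neg[OF V] unfolding A_def by auto
    have "p 0 = 0" using p V'(3) unfolding sublinear_on_def by (metis mult_zero_left order_refl scaleR_zero_left)
    moreover have "p (x + - x) \<le> p x + p (- x)" using p that subspace_neg[OF V] unfolding sublinear_on_def by blast
    ultimately show ?thesis using le by simp
  qed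
  have po: "partial_order_on A (relation_of P A)"
    unfolding relation_of_def P_def partial_order_on_def preorder_on_def
    by (auto simp: refl_on_def trans_def antisym_def fun_eq_iff intro: order_trans order_antisym)
  have "\<exists>m\<in>A. \<forall>a\<in>A. P m a \<longrightarrow> a = m"
  proof (rule predicate_Zorn[OF po])
    fix C assume C: "C \<in> Chains (relation_of P A)"
    have CA: "C \<subseteq> A" using C unfolding Chains_def relation_of_def by auto
    have chain: "P a b \<or> P b a" if "a \<in> C" "b \<in> C" for a b
      using C that unfolding Chains_def relation_of_def by auto
    show "\<exists>u\<in>A. \<forall>a\<in>C. P a u"
    proof (cases "C = {}")
      case True
      have "q' \<in> A" using q V' unfolding A_def q'_def sublinear_on_def by auto
      then show ?thesis using True by auto
    next
      case False
      define u where "u x = (if x \<in> V then INF a\<in>C. a x else 0)" for x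
      have bdd: "bdd_below ((\<lambda>a. a x) ` C)" if "x \<in> V" for x
        using lb[OF _ that] CA by (intro bdd_belowI[of _ "- q (- x)"]) auto
      have le: "u x \<le> a x" if "a \<in> C" "x \<in> V" for a x
        unfolding u_def using that by (auto intro: cINF_lower[OF bdd])
      have ge: "m \<le> u x" if "x \<in> V" "\<And>a. a \<in> C \<Longrightarrow> m \<le> a x" for m x
        unfolding u_def using that False by (auto intro: cINF_greatest)
      have "sublinear_on V u" unfolding sublinear_on_def
      proof (intro conjI ballI allI impI)
        fix x y assume x: "x \<in> V" and y: "y \<in> V"
        have "u (x + y) - b y \<le> u x" if b: "b \<in> C" for b
        proof (rule ge[OF x])
          fix a assume a: "a \<in> C"
          obtain c where c: "c \<in> C" "c x \<le> a x" "c y \<le> b y"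
            using chain[OF a b] a b unfolding P_def by auto
          have "c (x + y) \<le> c x + c y" using c CA x y unfolding A_def sublinear_on_def by auto
          then show "u (x + y) - b y \<le> a x" using le[OF c(1), of "x+y"] c V' x y by auto
        qed
        then have "u (x + y) - u x \<le> u y" by (intro ge[OF y]) (simp add: algebra_simps)
        then show "u (x + y) \<le> u x + u y" by simp
      next
        fix r :: real and x assume r: "0 \<le> r" and x: "x \<in> V"
        have hom: "a (r *\<^sub>R x) = r * a x" if "a \<in> C" "0 \<le> r" "x \<in> V" for a r x
          using that CA unfolding A_def sublinear_on_def by auto
        show "u (r *\<^sub>R x) = r * u x"
        proof (cases "r = 0")
          case True
          have "a 0 = 0" if "a \<in> C" for a using hom[OF that, of 0 0] V' by auto
          then have "(\<lambda>a. a 0) ` C = {0}" using \<open>C \<noteq> {}\<close> by force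
          then show ?thesis using True V'(3) unfolding u_def by simp
        next
          case False
          then have r: "r > 0" using r by simp
          show ?thesis
          proof (rule antisym)
            have "u (r *\<^sub>R x) / r \<le> u x"
            proof (rule ge[OF x])
              fix a assume a: "a \<in> C"
              show "u (r *\<^sub>R x) / r \<le> a x" using le[OF a, of "r *\<^sub>R x"] hom[OF a _ x, of r] V' x r
                by (simp add: field_simps)
            qed
            then show "u (r *\<^sub>R x) \<le> r * u x" using r by (simp add: field_simps)
            show "r * u x \<le> u (r *\<^sub>R x)"
            proof (rule ge)
              show "r *\<^sub>R x \<in> V" using V' x by auto
              fix a assume a: "a \<in> C"
              show "r * u x \<le> a (r *\<^sub>R x)" using le[OF a x] hom[OF a _ x, of r] r by simp
            qed
          qed
        qed
      qed
      moreover have "u x \<le> q x" if "x \<in> V" for x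
        using False le[OF _ that] CA that unfolding A_def by force
      ultimately have "u \<in> A" unfolding A_def u_def by auto
      moreover have "P a u" if "a \<in> C" for a
        unfolding P_def using le[OF that] that CA unfolding u_def A_def by auto
      ultimately show ?thesis by blast
    qed
  qed
  then obtain m where m: "m \<in> A" "\<And>a. a \<in> A \<Longrightarrow> P m a \<Longrightarrow> a = m" by blast
  have sub: "sublinear_on V m" and out: "\<And>x. x \<notin> V \<Longrightarrow> m x = 0" and le: "\<And>x. x \<in> V \<Longrightarrow> m x \<le> q x"
    using m(1) unfolding A_def by auto
  have add: "m (x + y) = m x + m y" if x: "x \<in> V" and y: "y \<in> V" for x y
  proof -
    note L = lower_along[OF V sub y]
    have "lower_along V m y x \<le> m x" if "x \<in> V" for x using L(2)[OF that, of 0] by simp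
    moreover have "lower_along V m y x = 0" if "x \<notin> V" for x using that unfolding lower_along_def by simp
    ultimately have "lower_along V m y = m"
      using m(2)[of "lower_along V m y"] L(1) le out unfolding A_def P_def by (smt (verit) mem_Collect_eq)
    then have "m x \<le> m (x + y) - m y" using L(2)[OF x, of 1] by simp
    moreover have "m (x + y) \<le> m x + m y" using sub x y unfolding sublinear_on_def by blast
    ultimately show ?thesis by simp
  qed
  have neg: "m (- x) = - m x" if "x \<in> V" for x
  proof -
    have "m 0 = 0" using add[OF V'(3) V'(3)] by simp
    then show ?thesis using add[OF that subspace_neg[OF V that]] by simp
  qed
  have "m (r *\<^sub>R x) = r * m x" if "x \<in> V" for r x
  proof (cases "r \<ge> 0")
    case True then show ?thesis using sub that unfolding sublinear_on_def by blast
  next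
    case False
    then have "0 \<le> - r" by simp
    then have "m ((- r) *\<^sub>R x) = (- r) * m x" using sub that unfolding sublinear_on_def by blast
    then show ?thesis using neg[OF V'(2)[OF that], of r] by simp
  qed
  then show ?thesis using le add by blast
qed

context lcs
begin

text \<open>
  Lowering \<open>q\<close> along \<open>z\<close> before choosing a minimal functional forces the
  real part of \<open>f z\<close> to be \<open>q z\<close>. A complex functional is recovered from
  its real part \<open>g\<close> by \<open>f x = g x - \<i> * g (\<i> x)\<close>, and a rotation of
  \<open>x\<close> carries the bound over from \<open>g\<close> to \<open>f\<close>.
\<close>

theorem Hahn_Banach:
  assumes q: "continuous_seminorm E q" and z: "z \<in> topspace E"
  obtains f where "f \<in> polar q" "f z = of_real (q z)"
proof -
  let ?V = "topspace E"
  have V: "subspace ?V"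
    unfolding real_vector.subspace_def using zero_in add_in scaleR_in by blast
  have sn: "seminorm_on ?V q" using q by (simp add: continuous_seminorm_iff)
  have qsub: "sublinear_on ?V q"
    using sn seminorm_on_scaleR[OF sn] unfolding sublinear_on_def seminorm_on_def by auto
  note L = lower_along[OF V qsub z]
  obtain g where g: "\<And>x. x \<in> ?V \<Longrightarrow> g x \<le> lower_along ?V q z x"
    "\<And>x y. x \<in> ?V \<Longrightarrow> y \<in> ?V \<Longrightarrow> g (x + y) = g x + g y"
    "\<And>r x. x \<in> ?V \<Longrightarrow> g (r *\<^sub>R x) = r * g x"
    using minimal_sublinear[OF V L(1)] by metis
  have gq: "g x \<le> q x" if "x \<in> ?V" for x using g(1)[OF that] L(2)[OF that, of 0] by simp
  have gz: "q z \<le> g z"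
    using g(1)[OF minus_in[OF z]] L(2)[OF minus_in[OF z], of 1] g(3)[OF z, of "-1"]
      seminorm_on_zero[OF sn zero_in] by simp
  define f where "f x = (if x \<in> ?V then Complex (g x) (- g (\<i> *\<^sub>C x)) else 0)" for x
  have decomp: "c *\<^sub>C x = Re c *\<^sub>R x + Im c *\<^sub>R (\<i> *\<^sub>C x)" for c and x :: 'a
    unfolding scaleR_scaleC scaleC_scaleC by (metis complex_eq mult.commute scaleC_add_left)
  have gC: "g (c *\<^sub>C x) = Re c * g x + Im c * g (\<i> *\<^sub>C x)" if "x \<in> ?V" for c x
    unfolding decomp[of c x] using that g scaleR_in scaleC_in by auto
  have lin: "clinear_on ?V f" unfolding clinear_on_def
  proof (intro conjI ballI allI)
    fix x y assume "x \<in> ?V" "y \<in> ?V"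
    then show "f (x + y) = f x + f y"
      unfolding f_def by (simp add: add_in g scaleC_in scaleC_add_right complex_eq_iff)
  next
    fix c x assume x: "x \<in> ?V"
    have "g (\<i> *\<^sub>C (c *\<^sub>C x)) = Re c * g (\<i> *\<^sub>C x) - Im c * g x"
      using gC[OF x, of "\<i> * c"] by (simp add: scaleC_scaleC)
    then show "f (c *\<^sub>C x) = c *\<^sub>C f x"
      using x gC[OF x, of c] unfolding f_def by (simp add: scaleC_in scaleC_complex_def complex_eq_iff algebra_simps)
  qed
  have bound: "cmod (f x) \<le> q x" if x: "x \<in> ?V" for x
  proof (cases "f x = 0")
    case True then show ?thesis using sn x unfolding seminorm_on_def by auto
  next
    case False
    define c where "c = of_real (cmod (f x)) / f x"
    have c1: "cmod c = 1" using False unfolding c_def by (simp add: norm_divide)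
    have "f (c *\<^sub>C x) = of_real (cmod (f x))"
      using lin x False unfolding clinear_on_def scaleC_complex_def c_def by simp
    then have "cmod (f x) = Re (f (c *\<^sub>C x))" by simp
    also have "\<dots> = g (c *\<^sub>C x)" using x scaleC_in unfolding f_def by simp
    also have "\<dots> \<le> q (c *\<^sub>C x)" using gq scaleC_in x by blast
    also have "\<dots> = q x" using sn x c1 unfolding seminorm_on_def by auto
    finally show ?thesis .
  qed
  have "f x = 0" if "x \<notin> ?V" for x using that unfolding f_def by simp
  then have "f \<in> polar q" unfolding polar_def using dualI[OF lin _ q bound] bound by blast
  moreover have "f z = of_real (q z)"
  proof -
    have "Re (f z) = q z" using gz gq[OF z] z unfolding f_def by auto
    moreover have "cmod (f z) \<le> q z" using bound z by auto
    ultimately have "(Re (f z))\<^sup>2 + (Im (f z))\<^sup>2 \<le> (Re (f z))\<^sup>2"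
      by (metis cmod_power2 norm_ge_zero power_mono)
    then show ?thesis using \<open>Re (f z) = q z\<close> by (simp add: complex_eq_iff)
  qed
  ultimately show ?thesis using that by blast
qed

lemma seminorm_le_iff_polar:
  assumes "continuous_seminorm E q" "z \<in> topspace E"
  shows "q z \<le> r \<longleftrightarrow> (\<forall>f\<in>polar q. cmod (f z) \<le> r)"
proof
  assume "\<forall>f\<in>polar q. cmod (f z) \<le> r"
  moreover obtain f where "f \<in> polar q" "f z = of_real (q z)" using Hahn_Banach[OF assms] .
  ultimately show "q z \<le> r" by (metis abs_le_D1 norm_of_real)
qed (use assms in \<open>auto simp: polar_def intro: order_trans\<close>)

lemma dual_separates:
  assumes "x \<in> topspace E" "y \<in> topspace E" "\<And>f. f \<in> dual E \<Longrightarrow> f x = f y"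
  shows "x = y"
proof (rule ccontr)
  assume "x \<noteq> y"
  then obtain q where q: "continuous_seminorm E q" "q (x - y) > 0"
    using seminorm_separates[OF diff_in[OF assms(1,2)]] by auto
  obtain f where f: "f \<in> polar q" "f (x - y) = of_real (q (x - y))"
    using Hahn_Banach[OF q(1) diff_in[OF assms(1,2)]] .
  have "f \<in> dual E" using f(1) unfolding polar_def by simp
  then have "f (x - y) = 0" using assms dual_diff_apply[of f x y] by simp
  then show False using f(2) q(2) by simp
qed

end

section \<open>Topologies generated by directed families of seminorms\<close>

lemma (in lcs) continuous_map_linearI:
  assumes S: "lcs S" and f: "clinear_on (topspace S) f" "f ` topspace S \<subseteq> topspace E"
    and q: "\<And>q. continuous_seminorm E q \<Longrightarrow> continuous_seminorm S (\<lambda>x. q (f x))"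
  shows "continuous_map S E f"
proof -
  have "openin S {x \<in> topspace S. f x \<in> U}" if U: "openin E U" for U
  proof (subst lcs.openin_iff_seminorm[OF S], intro conjI ballI)
    fix x assume x: "x \<in> {x \<in> topspace S. f x \<in> U}"
    then obtain q where q': "continuous_seminorm E q" "\<forall>y\<in>topspace E. q (y - f x) < 1 \<longrightarrow> y \<in> U"
      using U openin_iff_seminorm by auto
    have "\<forall>y\<in>topspace S. q (f (y - x)) < 1 \<longrightarrow> y \<in> {x \<in> topspace S. f x \<in> U}"
      using x q' f diff_clinear_on[OF f(1) lcs.subsp[OF S]] by auto
    then show "\<exists>q. continuous_seminorm S q \<and> (\<forall>y\<in>topspace S. q (y - x) < 1 \<longrightarrow> y \<in> {x \<in> topspace S. f x \<in> U})"
      using q[OF q'(1)] by (intro exI[of _ "\<lambda>x. q (f x)"]) auto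
  qed auto
  then show ?thesis using f(2) by (auto simp: continuous_map_def)
qed

locale seminorm_family =
  fixes V :: "'a::complex_vector set" and P :: "('a \<Rightarrow> ennreal) set"
  assumes V: "complex_vector.subspace V"
    and fin: "p \<in> P \<Longrightarrow> x \<in> V \<Longrightarrow> p x < \<infinity>"
    and sn: "p \<in> P \<Longrightarrow> seminorm_on V (\<lambda>x. enn2real (p x))"
    and ne: "P \<noteq> {}"
    and directed: "p \<in> P \<Longrightarrow> p' \<in> P \<Longrightarrow> \<exists>r\<in>P. \<forall>x\<in>V. p x \<le> r x \<and> p' x \<le> r x"
    and separating: "x \<in> V \<Longrightarrow> (\<And>p. p \<in> P \<Longrightarrow> p x = 0) \<Longrightarrow> x = 0"
begin

abbreviation "T \<equiv> seminorm_topology V P"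

lemma diff: "x \<in> V \<Longrightarrow> y \<in> V \<Longrightarrow> x - y \<in> V"
  using V complex_vector.subspace_diff by blast

lemma less_iff: "p \<in> P \<Longrightarrow> x \<in> V \<Longrightarrow> p x < ennreal e \<longleftrightarrow> enn2real (p x) < e"
  using fin[of p x] by (cases "p x") (auto simp: ennreal_less_iff)

lemma directed2: "p \<in> P \<Longrightarrow> p' \<in> P \<Longrightarrow> \<exists>r\<in>P. \<forall>x\<in>V. enn2real (p x) \<le> enn2real (r x) \<and> enn2real (p' x) \<le> enn2real (r x)"
  using directed[of p p'] fin by (metis enn2real_mono infinity_ennreal_def)

lemma openin_iff:
  "openin T U \<longleftrightarrow> U \<subseteq> V \<and> (\<forall>x\<in>U. \<exists>p\<in>P. \<exists>e>0. \<forall>y\<in>V. enn2real (p (y - x)) < e \<longrightarrow> y \<in> U)" (is "_ \<longleftrightarrow> ?R U")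
proof
  assume "openin T U"
  then have "generate_topology_on
      (insert V {{y \<in> V. p (y - x) < ennreal \<epsilon>} | p x \<epsilon>. p \<in> P \<and> x \<in> V \<and> 0 < \<epsilon>}) U"
    unfolding seminorm_topology_def openin_topology_generated_by_iff .
  then show "?R U"
  proof (induction rule: generate_topology_on.induct)
    case Empty then show ?case by simp
  next
    case (Int a b)
    have "\<exists>p\<in>P. \<exists>e>0. \<forall>y\<in>V. enn2real (p (y - x)) < e \<longrightarrow> y \<in> a \<inter> b" if x: "x \<in> a \<inter> b" for x
    proof -
      obtain p e where p: "p \<in> P" "e > 0" "\<forall>y\<in>V. enn2real (p (y - x)) < e \<longrightarrow> y \<in> a"
        using Int.IH(1) x by blast
      obtain p' e' where p': "p' \<in> P" "e' > 0" "\<forall>y\<in>V. enn2real (p' (y - x)) < e' \<longrightarrow> y \<in> b"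
        using Int.IH(2) x by blast
      obtain r where r: "r \<in> P" "\<forall>x\<in>V. enn2real (p x) \<le> enn2real (r x) \<and> enn2real (p' x) \<le> enn2real (r x)"
        using directed2[OF p(1) p'(1)] by blast
      have "x \<in> V" using x Int by auto
      then have "enn2real (p (y - x)) \<le> enn2real (r (y - x)) \<and> enn2real (p' (y - x)) \<le> enn2real (r (y - x))"
        if "y \<in> V" for y using r(2) diff[OF that] by blast
      then have "\<forall>y\<in>V. enn2real (r (y - x)) < min e e' \<longrightarrow> y \<in> a \<inter> b"
        using p(3) p'(3) by (metis IntI min_less_iff_conj order.strict_trans1)
      then show ?thesis using r(1) p(2) p'(2) by (intro bexI[of _ r] exI[of _ "min e e'"]) auto
    qed
    then show ?case using Int by auto
  next
    case (UN K)
    show ?case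
    proof (intro conjI ballI)
      show "\<Union> K \<subseteq> V" using UN by blast
      fix x assume "x \<in> \<Union> K"
      then obtain k where k: "k \<in> K" "x \<in> k" by blast
      then obtain p e where "p \<in> P" "e > 0" "\<forall>y\<in>V. enn2real (p (y - x)) < e \<longrightarrow> y \<in> k" using UN by meson
      then show "\<exists>p\<in>P. \<exists>e>0. \<forall>y\<in>V. enn2real (p (y - x)) < e \<longrightarrow> y \<in> \<Union> K" using k by blast
    qed
  next
    case (Basis s)
    then consider "s = V" | p z e where "s = {y \<in> V. p (y - z) < ennreal e}" "p \<in> P" "z \<in> V" "e > 0" by auto
    then show ?case
    proof cases
      case 1 then show ?thesis using ne zero_less_one by blast
    next
      case 2
      have "\<forall>y\<in>V. enn2real (p (y - x)) < e - enn2real (p (x - z)) \<longrightarrow> y \<in> s" if x: "x \<in> s" for x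
      proof (intro ballI impI)
        fix y assume y: "y \<in> V" "enn2real (p (y - x)) < e - enn2real (p (x - z))"
        have "enn2real (p (y - z)) \<le> enn2real (p (y - x)) + enn2real (p (x - z))"
          using seminorm_on_triangle[OF sn[OF 2(2)] V y(1) _ 2(3), of x] x 2 by auto
        then have "enn2real (p (y - z)) < e" using y by simp
        then show "y \<in> s" using 2 y less_iff[OF 2(2)] diff by auto
      qed
      moreover have "enn2real (p (x - z)) < e" if "x \<in> s" for x using that 2 less_iff[OF 2(2)] diff by auto
      ultimately show ?thesis using 2 by (metis (no_types, lifting) diff_gt_0_iff_gt mem_Collect_eq subsetI)
    qed
  qed
next
  assume R: "?R U"
  show "openin T U"
  proof (subst openin_subopen, intro ballI)
    fix x assume x: "x \<in> U"
    then obtain p e where p: "p \<in> P" "e > 0" "\<forall>y\<in>V. enn2real (p (y - x)) < e \<longrightarrow> y \<in> U" using R by meson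
    have xV: "x \<in> V" using x R by auto
    have "openin T {y \<in> V. p (y - x) < ennreal e}"
      unfolding seminorm_topology_def
      by (rule topology_generated_by_Basis) (use p xV in auto)
    moreover have "x \<in> {y \<in> V. p (y - x) < ennreal e}"
      using xV less_iff[OF p(1), of 0] p(2) seminorm_on_zero[OF sn[OF p(1)]] complex_vector.subspace_0[OF V] by auto
    moreover have "{y \<in> V. p (y - x) < ennreal e} \<subseteq> U"
      using p(3) less_iff[OF p(1)] diff[OF _ xV] by auto
    ultimately show "\<exists>T'. openin T T' \<and> x \<in> T' \<and> T' \<subseteq> U" by blast
  qed
qed

lemma openin_ball: 
  assumes "p \<in> P" "x \<in> V"
  shows "openin T {y \<in> V. enn2real (p (y - x)) < e}"
  unfolding openin_iff
proof (intro conjI ballI)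
  fix z assume z: "z \<in> {y \<in> V. enn2real (p (y - x)) < e}"
  have "\<forall>y\<in>V. enn2real (p (y - z)) < e - enn2real (p (z - x)) \<longrightarrow> y \<in> {y \<in> V. enn2real (p (y - x)) < e}"
    using seminorm_on_triangle[OF sn[OF assms(1)] V _ _ assms(2), of _ z] z by fastforce
  then show "\<exists>p'\<in>P. \<exists>e'>0. \<forall>y\<in>V. enn2real (p' (y - z)) < e' \<longrightarrow> y \<in> {y \<in> V. enn2real (p (y - x)) < e}"
    using assms(1) z by (intro bexI[of _ p] exI[of _ "e - enn2real (p (z - x))"]) auto
qed auto

lemma center: "p \<in> P \<Longrightarrow> x \<in> V \<Longrightarrow> e > 0 \<Longrightarrow> x \<in> {y \<in> V. enn2real (p (y - x)) < e}"
  using seminorm_on_zero[OF sn] complex_vector.subspace_0[OF V] by auto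

text \<open>
  The balls of the generators are convex, and generators that separate the points make the topology
  Hausdorff.
\<close>

theorem locally_convex: "locally_convex_space T"
  unfolding locally_convex_space_def topspace_seminorm_topology
proof (intro conjI allI impI)
  show "complex_vector.subspace V" by (rule V)
next
  have "openin (prod_topology T T) {z \<in> topspace (prod_topology T T). (case z of (x, y) \<Rightarrow> x + y) \<in> U}"
    if U: "openin T U" for U
    unfolding openin_prod_topology_alt
  proof (intro allI impI)
    fix x y assume "(x, y) \<in> {z \<in> topspace (prod_topology T T). (case z of (x, y) \<Rightarrow> x + y) \<in> U}"
    then have x: "x \<in> V" and y: "y \<in> V" and xy: "x + y \<in> U" by auto
    obtain p e where p: "p \<in> P" "e > 0" "\<forall>z\<in>V. enn2real (p (z - (x + y))) < e \<longrightarrow> z \<in> U"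
      using U xy unfolding openin_iff by meson
    define B where "B x = {z \<in> V. enn2real (p (z - x)) < e/2}" for x
    have "a + b \<in> U" if ab: "a \<in> B x" "b \<in> B y" for a b
    proof -
      have "enn2real (p ((a - x) + (b - y))) \<le> enn2real (p (a - x)) + enn2real (p (b - y))"
        using sn[OF p(1)] diff ab x y unfolding seminorm_on_def B_def by blast
      also have "\<dots> < e" using ab unfolding B_def by auto
      finally have "enn2real (p (a + b - (x + y))) < e" by (simp add: algebra_simps)
      then show ?thesis using p(3) complex_vector.subspace_add[OF V] ab unfolding B_def by blast
    qed
    then have "B x \<times> B y \<subseteq> {z \<in> topspace (prod_topology T T). (case z of (x, y) \<Rightarrow> x + y) \<in> U}"
      unfolding B_def by auto
    moreover have "openin T (B x)" "openin T (B y)" "x \<in> B x" "y \<in> B y"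
      unfolding B_def by (rule openin_ball[OF p(1) x] openin_ball[OF p(1) y]
          center[OF p(1) x half_gt_zero[OF p(2)]] center[OF p(1) y half_gt_zero[OF p(2)]])+
    ultimately show "\<exists>U' W. openin T U' \<and> openin T W \<and> x \<in> U' \<and> y \<in> W \<and>
       U' \<times> W \<subseteq> {z \<in> topspace (prod_topology T T). (case z of (x, y) \<Rightarrow> x + y) \<in> U}" by blast
  qed
  then show "continuous_map (prod_topology T T) T (\<lambda>(x, y). x + y)"
    using complex_vector.subspace_add[OF V] by (auto simp: continuous_map_def)
next
  have "openin (prod_topology euclidean T) {z \<in> topspace (prod_topology euclidean T). (case z of (c, x) \<Rightarrow> c *\<^sub>C x) \<in> U}"
    if U: "openin T U" for U
    unfolding openin_prod_topology_alt
  proof (intro allI impI)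
    fix c :: complex and x assume "(c, x) \<in> {z \<in> topspace (prod_topology euclidean T). (case z of (c, x) \<Rightarrow> c *\<^sub>C x) \<in> U}"
    then have x: "x \<in> V" and cx: "c *\<^sub>C x \<in> U" by auto
    obtain p e where p: "p \<in> P" "e > 0" "\<forall>z\<in>V. enn2real (p (z - c *\<^sub>C x)) < e \<longrightarrow> z \<in> U"
      using U cx unfolding openin_iff by meson
    define n where "n z = enn2real (p z)" for z
    have n: "seminorm_on V n" using sn[OF p(1)] unfolding n_def .
    have n0: "n x \<ge> 0" unfolding n_def by simp
    define d where "d = min 1 (e / (2 * (n x + 1)))"
    define d' where "d' = e / (2 * (cmod c + 1))"
    have pc: "cmod c + 1 > 0" by (smt (verit) norm_ge_zero)
    have d: "d > 0" "d' > 0" using p(2) n0 pc unfolding d_def d'_def by auto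
    have "a *\<^sub>C y \<in> U" if ay: "a \<in> ball c d" "y \<in> {z \<in> V. n (z - x) < d'}" for a y
    proof -
      have y: "y \<in> V" and ny: "n (y - x) < d'" and ac: "cmod (a - c) < d"
        using ay by (auto simp: dist_norm norm_minus_commute)
      have a: "cmod a \<le> cmod c + 1"
        using ac norm_triangle_ineq2[of a c] unfolding d_def by auto
      note S = complex_vector.subspace_scale[OF V] 
      have "a *\<^sub>C y - c *\<^sub>C x = a *\<^sub>C (y - x) + (a - c) *\<^sub>C x"
        by (simp add: complex_vector.scale_right_diff_distrib complex_vector.scale_left_diff_distrib)
      moreover have "n (a *\<^sub>C (y - x) + (a - c) *\<^sub>C x) \<le> n (a *\<^sub>C (y - x)) + n ((a - c) *\<^sub>C x)"
        using n S diff x y unfolding seminorm_on_def by blast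
      moreover have "n (a *\<^sub>C (y - x)) = cmod a * n (y - x)" "n ((a - c) *\<^sub>C x) = cmod (a - c) * n x"
        using n diff[OF y x] x unfolding seminorm_on_def by blast+
      moreover have "cmod a * n (y - x) < e / 2"
      proof -
        have "cmod a * n (y - x) \<le> (cmod c + 1) * n (y - x)"
          using a by (intro mult_right_mono) (auto simp: n_def)
        also have "\<dots> < (cmod c + 1) * d'" using ny pc by simp
        also have "\<dots> = e / 2" using pc unfolding d'_def by (simp add: field_simps)
        finally show ?thesis .
      qed
      moreover have "cmod (a - c) * n x \<le> e / 2"
      proof -
        have "cmod (a - c) * n x \<le> (e / (2 * (n x + 1))) * (n x + 1)"
          using ac n0 p(2) unfolding d_def by (intro mult_mono) auto
        also have "\<dots> = e / 2" using n0 by (simp add: field_simps)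
        finally show ?thesis .
      qed
      ultimately have "n (a *\<^sub>C y - c *\<^sub>C x) < e" by simp
      then show ?thesis using p(3) S y unfolding n_def by blast
    qed
    then have "ball c d \<times> {z \<in> V. n (z - x) < d'} \<subseteq> {z \<in> topspace (prod_topology euclidean T). (case z of (c, x) \<Rightarrow> c *\<^sub>C x) \<in> U}"
      by auto
    moreover have "openin T {z \<in> V. n (z - x) < d'}" "x \<in> {z \<in> V. n (z - x) < d'}"
      unfolding n_def using openin_ball[OF p(1) x] center[OF p(1) x d(2)] by auto
    moreover have "openin euclidean (ball c d)" "c \<in> ball c d" using d by auto
    ultimately show "\<exists>U' W. openin euclidean U' \<and> openin T W \<and> c \<in> U' \<and> x \<in> W \<and>
       U' \<times> W \<subseteq> {z \<in> topspace (prod_topology euclidean T). (case z of (c, x) \<Rightarrow> c *\<^sub>C x) \<in> U}" by blast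
  qed
  then show "continuous_map (prod_topology euclidean T) T (\<lambda>(c, x). c *\<^sub>C x)"
    using complex_vector.subspace_scale[OF V] by (auto simp: continuous_map_def)
next
  fix U assume U: "openin T U \<and> 0 \<in> U"
  then obtain p e where p: "p \<in> P" "e > 0" "\<forall>z\<in>V. enn2real (p (z - 0)) < e \<longrightarrow> z \<in> U"
    unfolding openin_iff by meson
  have 0: "0 \<in> V" using complex_vector.subspace_0[OF V] .
  define B where "B = {z \<in> V. enn2real (p (z - 0)) < e}"
  have "convex B"
  proof (rule convexI)
    fix x y and u v :: real assume xy: "x \<in> B" "y \<in> B" and uv: "0 \<le> u" "0 \<le> v" "u + v = 1"
    have *: "x \<in> V" "y \<in> V" "u *\<^sub>R x \<in> V" "v *\<^sub>R y \<in> V" using xy subspace_scaleR[OF V] unfolding B_def by auto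
    have "enn2real (p (u *\<^sub>R x + v *\<^sub>R y)) \<le> enn2real (p (u *\<^sub>R x)) + enn2real (p (v *\<^sub>R y))"
      using sn[OF p(1)] * unfolding seminorm_on_def by blast
    also have "\<dots> = u * enn2real (p x) + v * enn2real (p y)"
      using seminorm_on_scaleR[OF sn[OF p(1)]] * uv by simp
    also have "\<dots> < e" using convex_bound_lt[of "enn2real (p x)" e "enn2real (p y)" u v] xy uv
      unfolding B_def by simp
    finally show "u *\<^sub>R x + v *\<^sub>R y \<in> B" unfolding B_def using complex_vector.subspace_add[OF V] * by auto
  qed
  moreover have "openin T B" "0 \<in> B" unfolding B_def
    using openin_ball[OF p(1) 0] center[OF p(1) 0 p(2)] by auto
  ultimately show "\<exists>W. openin T W \<and> 0 \<in> W \<and> convex W \<and> W \<subseteq> U"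
    using p(3) unfolding B_def by blast
next
  show "Hausdorff_space T" unfolding Hausdorff_space_def topspace_seminorm_topology
  proof (intro allI impI)
    fix x y assume xy: "x \<in> V \<and> y \<in> V \<and> x \<noteq> y"
    then have "x - y \<in> V" "x - y \<noteq> 0" using diff by auto
    then obtain p where p: "p \<in> P" "p (x - y) \<noteq> 0" using separating by blast
    define e where "e = enn2real (p (x - y))"
    have e: "e > 0" using p fin[OF p(1) \<open>x - y \<in> V\<close>] unfolding e_def
      by (simp add: enn2real_positive_iff zero_less_iff_neq_zero)
    define B where "B x = {z \<in> V. enn2real (p (z - x)) < e/2}" for x
    have "disjnt (B x) (B y)" unfolding disjnt_iff
    proof (intro allI notI)
      fix z assume z: "z \<in> B x \<and> z \<in> B y"
      then have zV: "z \<in> V" unfolding B_def by auto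
      have "e \<le> enn2real (p (x - z)) + enn2real (p (z - y))"
        unfolding e_def using seminorm_on_triangle[OF sn[OF p(1)] V, of x z y] xy zV by auto
      also have "enn2real (p (x - z)) = enn2real (p (z - x))"
        using seminorm_on_commute[OF sn[OF p(1)] V, of x z] xy zV by auto
      finally show False using z unfolding B_def by auto
    qed
    moreover have "openin T (B x)" "openin T (B y)" "x \<in> B x" "y \<in> B y"
      unfolding B_def using openin_ball[OF p(1), of _ "e/2"] center[OF p(1) _ half_gt_zero[OF e]] xy by auto
    ultimately show "\<exists>U W. openin T U \<and> openin T W \<and> x \<in> U \<and> y \<in> W \<and> disjnt U W" by blast
  qed
qed

sublocale lcs T by unfold_locales (rule locally_convex)

lemma generator_continuous: 
  assumes "p \<in> P" shows "continuous_seminorm T (\<lambda>x. enn2real (p x))"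
proof -
  have 0: "0 \<in> V" using complex_vector.subspace_0[OF V] .
  show ?thesis
    by (rule seminorm_dominated_imp_continuous[OF _ openin_ball[OF assms 0, of 1], of _ 1])
      (use sn[OF assms] center[OF assms 0, of 1] in auto)
qed

text \<open>
  A single generator suffices because the family is directed: its balls form a base of the
  neighbourhoods of 0.
\<close>

lemma seminorm_le_generator:
  assumes q: "continuous_seminorm T q"
  obtains p C where "p \<in> P" "C > 0" "\<forall>x\<in>V. q x \<le> C * enn2real (p x)"
proof -
  have 0: "0 \<in> V" using complex_vector.subspace_0[OF V] .
  have "openin T {y \<in> V. q (y - 0) < 1}" using openin_seminorm_ball[OF q, of 0 1] 0 by simp
  then obtain p e where p: "p \<in> P" "e > 0" "\<forall>z\<in>V. enn2real (p (z - 0)) < e \<longrightarrow> z \<in> {y \<in> V. q (y - 0) < 1}"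
    using continuous_seminorm_0[OF q] 0 unfolding openin_iff by force
  have "q x \<le> (1/e) * enn2real (p x)" if x: "x \<in> V" for x
  proof -
    have "q x \<le> (enn2real (p x) + d) / e" if d: "d > 0" for d
    proof -
      define r where "r = e / (enn2real (p x) + d)"
      have r: "r > 0" unfolding r_def using d p(2) by (simp add: add_nonneg_pos)
      have "enn2real (p (r *\<^sub>R x)) = r * enn2real (p x)"
        using seminorm_on_scaleR[OF sn[OF p(1)] x, of r] r by simp
      also have "\<dots> < e" unfolding r_def using d p(2)
        by (simp add: divide_less_eq add_nonneg_pos)
      finally have "q (r *\<^sub>R x) < 1" using p(3) subspace_scaleR[OF V x, of r] by simp
      moreover have "q (r *\<^sub>R x) = r * q x"
        using seminorm_on_scaleR[of V q x r] q x r by (simp add: continuous_seminorm_iff)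
      ultimately have "q x < 1 / r" using r by (simp add: field_simps)
      also have "1 / r = (enn2real (p x) + d) / e" unfolding r_def by simp
      finally show ?thesis by simp
    qed
    then have "e * q x \<le> enn2real (p x) + d" if "d > 0" for d using that p(2) by (simp add: field_simps)
    then have "e * q x \<le> enn2real (p x)" by (rule field_le_epsilon)
    then show ?thesis using p(2) by (simp add: field_simps)
  qed
  then show ?thesis using that[of p "1/e"] p by auto
qed

lemma seminorm_family_subspace:
  assumes "complex_vector.subspace W" "W \<subseteq> V"
  shows "seminorm_family W P"
proof
  show "complex_vector.subspace W" "P \<noteq> {}" using assms ne by auto
  show "p \<in> P \<Longrightarrow> x \<in> W \<Longrightarrow> p x < \<infinity>" for p x using fin assms by blast
  show "p \<in> P \<Longrightarrow> seminorm_on W (\<lambda>x. enn2real (p x))" for p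
    using sn[of p] assms(2) unfolding seminorm_on_def by blast
  show "p \<in> P \<Longrightarrow> p' \<in> P \<Longrightarrow> \<exists>r\<in>P. \<forall>x\<in>W. p x \<le> r x \<and> p' x \<le> r x" for p p'
    using directed[of p p'] assms(2) by blast
  show "x \<in> W \<Longrightarrow> (\<And>p. p \<in> P \<Longrightarrow> p x = 0) \<Longrightarrow> x = 0" for x using separating assms(2) by blast
qed

lemma subtopology_subspace:
  assumes W: "complex_vector.subspace W" "W \<subseteq> V"
  shows "subtopology T W = seminorm_topology W P"
proof -
  interpret W: seminorm_family W P by (rule seminorm_family_subspace[OF W])
  have "openin (subtopology T W) U \<longleftrightarrow> openin (seminorm_topology W P) U" for U
  proof
    assume "openin (subtopology T W) U"
    then obtain U' where "openin T U'" "U = U' \<inter> W" unfolding openin_subtopology by blast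
    then show "openin (seminorm_topology W P) U"
      using W(2) unfolding openin_iff W.openin_iff by (metis IntD1 IntD2 IntI inf_le2 subset_iff)
  next
    assume U: "openin (seminorm_topology W P) U"
    then have UW: "U \<subseteq> W" unfolding W.openin_iff by blast
    define B where "B = (\<lambda>(x, p, e). {y \<in> V. enn2real (p (y - x)) < e})"
    define I where "I = {(x, p, e). x \<in> U \<and> p \<in> P \<and> e > 0 \<and> (\<forall>y\<in>W. enn2real (p (y - x)) < e \<longrightarrow> y \<in> U)}"
    have "openin T (\<Union> (B ` I))"
      by (rule openin_Union) (use UW W(2) openin_ball in \<open>auto simp: B_def I_def\<close>)
    moreover have "U = \<Union> (B ` I) \<inter> W"
    proof
      show "\<Union> (B ` I) \<inter> W \<subseteq> U" unfolding B_def I_def by auto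
      show "U \<subseteq> \<Union> (B ` I) \<inter> W"
      proof
        fix x assume x: "x \<in> U"
        then obtain p e where p: "p \<in> P" "e > 0" "\<forall>y\<in>W. enn2real (p (y - x)) < e \<longrightarrow> y \<in> U"
          using U unfolding W.openin_iff by meson
        then have "(x, p, e) \<in> I" unfolding I_def using x by auto
        moreover have "x \<in> B (x, p, e)" unfolding B_def using center[OF p(1) _ p(2), of x] x UW W(2) by auto
        ultimately show "x \<in> \<Union> (B ` I) \<inter> W" using x UW by blast
      qed
    qed
    ultimately show "openin (subtopology T W) U" unfolding openin_subtopology by blast
  qed
  then show ?thesis by (simp add: topology_eq)
qed

end

section \<open>Compactness\<close>

subsection \<open>Ultrafilters\<close>

lemma ultrafilter_below:
  fixes F :: "'a filter"
  assumes F: "F \<noteq> bot"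
  shows "\<exists>G\<le>F. G \<noteq> bot \<and> (\<forall>P. eventually P G \<or> eventually (\<lambda>x. \<not> P x) G)"
proof -
  define A where "A = {G. G \<le> F \<and> G \<noteq> bot}"
  define R where "R = (\<lambda>G H :: 'a filter. H \<le> G)"
  have po: "partial_order_on A (relation_of R A)"
    unfolding relation_of_def R_def partial_order_on_def preorder_on_def
    by (auto simp: refl_on_def trans_def antisym_def)
  have "\<exists>m\<in>A. \<forall>a\<in>A. R m a \<longrightarrow> a = m"
  proof (rule predicate_Zorn[OF po])
    fix C assume C: "C \<in> Chains (relation_of R A)"
    have CA: "C \<subseteq> A" using C unfolding Chains_def relation_of_def by auto
    have chain: "a \<le> b \<or> b \<le> a" if "a \<in> C" "b \<in> C" for a b
      using C that unfolding Chains_def relation_of_def R_def by auto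
    show "\<exists>u\<in>A. \<forall>a\<in>C. R a u"
    proof (cases "C = {}")
      case True
      then show ?thesis using F unfolding A_def by auto
    next
      case False
      have "eventually (\<lambda>_. False) (Inf C) \<longleftrightarrow> (\<exists>b\<in>C. eventually (\<lambda>_. False) b)"
      proof (rule eventually_Inf_base[OF False])
        fix a b assume "a \<in> C" "b \<in> C"
        then show "\<exists>x\<in>C. x \<le> inf a b" using chain[of a b] by (metis inf.absorb1 inf.absorb2 order_refl)
      qed
      then have "Inf C \<noteq> bot" using CA unfolding A_def trivial_limit_def by auto
      moreover have "Inf C \<le> F" using False CA unfolding A_def by (metis Inf_lower2 ex_in_conv mem_Collect_eq subsetD)
      ultimately have "Inf C \<in> A" unfolding A_def by auto
      then show ?thesis unfolding R_def by (auto intro: Inf_lower)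
    qed
  qed
  then obtain m where m: "m \<in> A" "\<And>a. a \<in> A \<Longrightarrow> a \<le> m \<Longrightarrow> a = m" unfolding R_def by blast
  have "eventually P m" if nP: "\<not> eventually (\<lambda>x. \<not> P x) m" for P
  proof -
    have "inf m (principal {x. P x}) \<noteq> bot"
      using nP by (simp add: trivial_limit_def eventually_inf_principal)
    moreover have "inf m (principal {x. P x}) \<le> F" using m(1) unfolding A_def by (auto intro: le_infI1)
    ultimately have "inf m (principal {x. P x}) = m" using m(2) unfolding A_def by auto
    then have "m \<le> principal {x. P x}" by (metis inf_le2)
    then show ?thesis by (simp add: le_principal)
  qed
  then show ?thesis using m(1) unfolding A_def by blast
qed

lemma ultrafilter_finite_union:
  assumes U: "\<And>P. eventually P G \<or> eventually (\<lambda>x. \<not> P x) G" and nb: "G \<noteq> bot"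
    and I: "finite I" and ev: "eventually (\<lambda>x. \<exists>i\<in>I. P i x) G"
  shows "\<exists>i\<in>I. eventually (P i) G"
proof (rule ccontr)
  assume "\<not> ?thesis"
  then have "\<forall>i\<in>I. eventually (\<lambda>x. \<not> P i x) G" using U by blast
  then have "eventually (\<lambda>x. \<forall>i\<in>I. \<not> P i x) G" using I by (simp add: eventually_ball_finite)
  with ev have "eventually (\<lambda>_. False) G" by eventually_elim auto
  then show False using nb by (simp add: trivial_limit_def)
qed

text \<open>
  The complements of the finite unions of a cover without finite subcover generate a proper filter;
  an ultrafilter below it converges to no point of the cover.
\<close>

lemma compactin_ultrafilterI:
  fixes X :: "'a topology"
  assumes K: "K \<subseteq> topspace X"
    and lim: "\<And>G. G \<le> principal K \<Longrightarrow> G \<noteq> bot \<Longrightarrow> (\<And>P. eventually P G \<or> eventually (\<lambda>x. \<not> P x) G) \<Longrightarrow>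
      \<exists>l\<in>K. limitin X (\<lambda>x. x) l G"
  shows "compactin X K"
  unfolding compactin_def
proof (intro conjI allI impI K)
  fix \<U> assume \<U>: "(\<forall>U\<in>\<U>. openin X U) \<and> K \<subseteq> \<Union>\<U>"
  show "\<exists>\<F>. finite \<F> \<and> \<F> \<subseteq> \<U> \<and> K \<subseteq> \<Union>\<F>"
  proof (rule ccontr)
    assume no: "\<nexists>\<F>. finite \<F> \<and> \<F> \<subseteq> \<U> \<and> K \<subseteq> \<Union>\<F>"
    define B where "B = {principal (K - \<Union>\<F>) | \<F>. finite \<F> \<and> \<F> \<subseteq> \<U>}"
    have base: "eventually P (Inf B) \<longleftrightarrow> (\<exists>b\<in>B. eventually P b)" for P
    proof (rule eventually_Inf_base)
      show "B \<noteq> {}" unfolding B_def by blast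
      fix a b assume "a \<in> B" "b \<in> B"
      then obtain F1 F2 where F: "finite F1" "F1 \<subseteq> \<U>" "finite F2" "F2 \<subseteq> \<U>"
        "a = principal (K - \<Union>F1)" "b = principal (K - \<Union>F2)" unfolding B_def by blast
      then have "principal (K - \<Union>(F1 \<union> F2)) \<in> B" unfolding B_def by blast
      moreover have "principal (K - \<Union>(F1 \<union> F2)) \<le> inf a b" using F by auto
      ultimately show "\<exists>x\<in>B. x \<le> inf a b" by blast
    qed
    have "Inf B \<noteq> bot"
    proof
      assume "Inf B = bot"
      then have "eventually (\<lambda>_. False) (Inf B)" by simp
      then obtain b where "b \<in> B" "eventually (\<lambda>_. False) b" unfolding base by blast
      then obtain \<F> where F: "finite \<F>" "\<F> \<subseteq> \<U>" and b: "b = principal (K - \<Union>\<F>)"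
        unfolding B_def by blast
      have "K \<subseteq> \<Union>\<F>" using \<open>eventually (\<lambda>_. False) b\<close> unfolding b eventually_principal by blast
      then show False using no F by blast
    qed
    from ultrafilter_below[OF this]
    obtain G where G: "G \<le> Inf B" "G \<noteq> bot" "\<forall>P. eventually P G \<or> eventually (\<lambda>x. \<not> P x) G"
      by (elim exE conjE)
    have GF: "G \<le> principal (K - \<Union>\<F>)" if "finite \<F>" "\<F> \<subseteq> \<U>" for \<F>
    proof -
      have "principal (K - \<Union>\<F>) \<in> B" unfolding B_def using that by blast
      then show ?thesis by (rule order_trans[OF G(1) Inf_lower])
    qed
    obtain l where l: "l \<in> K" "limitin X (\<lambda>x. x) l G"
      using lim[OF _ G(2) G(3)[rule_format]] GF[of "{}"] by auto
    then obtain U where U: "U \<in> \<U>" "l \<in> U" "openin X U" using \<U> by blast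
    have "eventually (\<lambda>x. x \<in> U) G" using limitinD[OF l(2) U(3,2)] .
    moreover have "eventually (\<lambda>x. x \<in> K - U) G" using GF[of "{U}"] U by (simp add: le_principal)
    ultimately have "eventually (\<lambda>_. False) G" by eventually_elim auto
    then show False using G(2) by (simp add: trivial_limit_def)
  qed
qed

subsection \<open>Precompact sets and their closed absolutely convex hulls\<close>

definition abs_hull :: "'a::complex_vector set \<Rightarrow> 'a set" where
  "abs_hull S = \<Inter>{C. convex C \<and> circled C \<and> S \<subseteq> C}"

lemma abs_hull_minimal: "convex C \<Longrightarrow> circled C \<Longrightarrow> S \<subseteq> C \<Longrightarrow> abs_hull S \<subseteq> C"
  unfolding abs_hull_def by auto

lemma abs_hull_superset: "S \<subseteq> abs_hull S"
  unfolding abs_hull_def by auto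

lemma convex_abs_hull: "convex (abs_hull S)"
  unfolding abs_hull_def by (rule convex_Inter) auto

lemma circled_abs_hull: "circled (abs_hull S)"
  unfolding abs_hull_def circled_def by auto

lemma subspace_convex: "complex_vector.subspace V \<Longrightarrow> convex V"
  by (auto intro!: convexI simp: complex_vector.subspace_add subspace_scaleR)

lemma subspace_circled: "complex_vector.subspace V \<Longrightarrow> circled V"
  unfolding circled_def by (simp add: complex_vector.subspace_scale)

context lcs
begin

definition precompact :: "'a set \<Rightarrow> bool" where
  "precompact S \<longleftrightarrow> S \<subseteq> topspace E \<and> (\<forall>q e. continuous_seminorm E q \<longrightarrow> e > 0 \<longrightarrow>
     (\<exists>G. finite G \<and> G \<subseteq> topspace E \<and> (\<forall>x\<in>S. \<exists>g\<in>G. q (x - g) < e)))"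

lemma seminorm_ineqs:
  assumes "continuous_seminorm E q"
  shows "x \<in> topspace E \<Longrightarrow> y \<in> topspace E \<Longrightarrow> q (x + y) \<le> q x + q y"
    and "x \<in> topspace E \<Longrightarrow> q (c *\<^sub>C x) = cmod c * q x"
    and "x \<in> topspace E \<Longrightarrow> 0 \<le> q x"
    and "x \<in> topspace E \<Longrightarrow> q (r *\<^sub>R x) = \<bar>r\<bar> * q x"
    and "x \<in> topspace E \<Longrightarrow> y \<in> topspace E \<Longrightarrow> z \<in> topspace E \<Longrightarrow> q (x - z) \<le> q (x - y) + q (y - z)"
    and "x \<in> topspace E \<Longrightarrow> y \<in> topspace E \<Longrightarrow> q (x - y) = q (y - x)"
proof -
  have q: "seminorm_on (topspace E) q" using assms by (simp add: continuous_seminorm_iff)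
  show "x \<in> topspace E \<Longrightarrow> y \<in> topspace E \<Longrightarrow> q (x + y) \<le> q x + q y"
    and "x \<in> topspace E \<Longrightarrow> q (c *\<^sub>C x) = cmod c * q x"
    and "x \<in> topspace E \<Longrightarrow> 0 \<le> q x" using q unfolding seminorm_on_def by blast+
qed (use assms seminorm_on_triangle[OF _ subsp, of q] seminorm_on_commute[OF _ subsp, of q]
      seminorm_on_scaleR[of "topspace E" q] in \<open>simp_all add: continuous_seminorm_iff\<close>)

lemma compact_imp_precompact:
  assumes K: "compactin E K" shows "precompact K"
  unfolding precompact_def
proof (intro conjI allI impI)
  show KE: "K \<subseteq> topspace E" using compactin_subset_topspace[OF K] .
  fix q and e :: real assume q: "continuous_seminorm E q" and e: "e > 0"
  define B where "B g = {y \<in> topspace E. q (y - g) < e}" for g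
  have "\<exists>\<F>. finite \<F> \<and> \<F> \<subseteq> B ` K \<and> K \<subseteq> \<Union>\<F>"
  proof (rule compactinD[OF K])
    show "openin E U" if "U \<in> B ` K" for U
      using that openin_seminorm_ball[OF q] KE unfolding B_def by auto
    show "K \<subseteq> \<Union> (B ` K)" using KE e continuous_seminorm_0[OF q] unfolding B_def by force
  qed
  then obtain G where "finite G" "G \<subseteq> K" "K \<subseteq> \<Union> (B ` G)"
    by (metis finite_subset_image)
  then show "\<exists>G. finite G \<and> G \<subseteq> topspace E \<and> (\<forall>x\<in>K. \<exists>g\<in>G. q (x - g) < e)"
    using KE unfolding B_def by (intro exI[of _ G]) auto
qed

text \<open>By induction on \<open>G\<close>: the unit disc of coefficients is covered by finitely many small discs.\<close>

lemma precompact_polydisc: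
  assumes "finite G" "G \<subseteq> topspace E" "continuous_seminorm E q" "e > 0"
  shows "\<exists>H. finite H \<and> H \<subseteq> topspace E \<and>
    (\<forall>c. (\<forall>g\<in>G. cmod (c g) \<le> 1) \<longrightarrow> (\<exists>h\<in>H. q ((\<Sum>g\<in>G. c g *\<^sub>C g) - h) < e))"
  using assms
proof (induction arbitrary: e rule: finite_induct)
  case empty
  then show ?case using zero_in continuous_seminorm_0[OF empty.prems(2)] by (intro exI[of _ "{0}"]) auto
next
  case (insert a G)
  note q = seminorm_ineqs[OF insert.prems(2)]
  have a: "a \<in> topspace E" and G: "G \<subseteq> topspace E" using insert.prems by auto
  obtain H where H: "finite H" "H \<subseteq> topspace E"
    "\<And>c. (\<forall>g\<in>G. cmod (c g) \<le> 1) \<Longrightarrow> (\<exists>h\<in>H. q ((\<Sum>g\<in>G. c g *\<^sub>C g) - h) < e/2)"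
    using insert.IH[OF G insert.prems(2), of "e/2"] insert.prems(3) by auto
  define d where "d = e / (2 * (q a + 1))"
  have d: "d > 0" using insert.prems(3) q(3)[OF a] unfolding d_def by simp
  obtain L where L: "finite L" "cball (0::complex) 1 \<subseteq> (\<Union>x\<in>L. ball x d)"
    using compact_cball[of "0::complex" 1] d unfolding compact_eq_totally_bounded by blast
  define H' where "H' = (\<lambda>(l, h). l *\<^sub>C a + h) ` (L \<times> H)"
  have "\<exists>h\<in>H'. q ((\<Sum>g\<in>insert a G. c g *\<^sub>C g) - h) < e" if c: "\<forall>g\<in>insert a G. cmod (c g) \<le> 1" for c
  proof -
    obtain h where h: "h \<in> H" "q ((\<Sum>g\<in>G. c g *\<^sub>C g) - h) < e/2" using H(3) c by blast
    have "c a \<in> cball 0 1" using c by simp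
    then obtain l where l: "l \<in> L" "cmod (c a - l) < d"
      using L(2) by (metis (no_types, lifting) UN_E mem_ball dist_norm norm_minus_commute subsetD)
    let ?s = "\<Sum>g\<in>G. c g *\<^sub>C g"
    have sE: "?s \<in> topspace E" using G complex_vector.subspace_sum[OF subsp] scaleC_in by (metis (no_types, lifting) subsetD)
    have hE: "h \<in> topspace E" using h H by auto
    have "q ((\<Sum>g\<in>insert a G. c g *\<^sub>C g) - (l *\<^sub>C a + h)) = q ((c a - l) *\<^sub>C a + (?s - h))"
      using insert.hyps by (simp add: complex_vector.scale_left_diff_distrib algebra_simps)
    also have "\<dots> \<le> cmod (c a - l) * q a + q (?s - h)"
      using q(1)[OF scaleC_in[OF a] diff_in[OF sE hE], of "c a - l"] q(2)[OF a] by simp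
    also have "\<dots> < e"
    proof -
      have "cmod (c a - l) * q a \<le> d * (q a + 1)" using l d q(3)[OF a] by (intro mult_mono) auto
      also have "\<dots> = e/2" using q(3)[OF a] unfolding d_def by (simp add: field_simps)
      finally show ?thesis using h by simp
    qed
    finally show ?thesis using l h unfolding H'_def by force
  qed
  moreover have "finite H'" "H' \<subseteq> topspace E"
    using L(1) H(1,2) a unfolding H'_def by (auto intro: add_in scaleC_in)
  ultimately show ?case by blast
qed

text \<open>
  The hull stays near the combinations of a finite net with coefficients in the unit disc, since the
  points near such combinations form a convex circled set.
\<close>

lemma precompact_abs_hull:
  assumes S: "precompact S" shows "precompact (abs_hull S)"
  unfolding precompact_def
proof (intro conjI allI impI)
  have SE: "S \<subseteq> topspace E" using S unfolding precompact_def by auto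
  show HE: "abs_hull S \<subseteq> topspace E"
    by (rule abs_hull_minimal[OF subspace_convex[OF subsp] subspace_circled[OF subsp] SE])
  fix q and e :: real assume q: "continuous_seminorm E q" and e: "e > 0"
  note qi = seminorm_ineqs[OF q]
  obtain G where G: "finite G" "G \<subseteq> topspace E" "\<And>x. x \<in> S \<Longrightarrow> \<exists>g\<in>G. q (x - g) < e/2"
    using S q half_gt_zero[OF e] unfolding precompact_def by meson
  define P where "P = {\<Sum>g\<in>G. c g *\<^sub>C g | c. \<forall>g\<in>G. cmod (c g) \<le> 1}"
  have PE: "P \<subseteq> topspace E"
    unfolding P_def using G(2) by (auto intro!: complex_vector.subspace_sum[OF subsp] scaleC_in)
  have Pcirc: "c *\<^sub>C p \<in> P" if "p \<in> P" "cmod c \<le> 1" for c p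
  proof -
    obtain d where d: "p = (\<Sum>g\<in>G. d g *\<^sub>C g)" "\<forall>g\<in>G. cmod (d g) \<le> 1" using \<open>p \<in> P\<close> unfolding P_def by auto
    have "c *\<^sub>C p = (\<Sum>g\<in>G. (c * d g) *\<^sub>C g)"
      unfolding d(1) by (simp add: complex_vector.scale_sum_right scaleC_scaleC)
    moreover have "\<forall>g\<in>G. cmod (c * d g) \<le> 1" using d(2) that(2) by (simp add: norm_mult mult_le_one)
    ultimately show ?thesis unfolding P_def by (intro CollectI exI[of _ "\<lambda>g. c * d g"]) simp
  qed
  have Pconv: "u *\<^sub>R p + v *\<^sub>R p' \<in> P" if "p \<in> P" "p' \<in> P" and uv: "0 \<le> u" "0 \<le> v" "u + v = 1" for p p' u v
  proof -
    obtain d where d: "p = (\<Sum>g\<in>G. d g *\<^sub>C g)" "\<forall>g\<in>G. cmod (d g) \<le> 1" using \<open>p \<in> P\<close> unfolding P_def by auto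
    obtain d' where d': "p' = (\<Sum>g\<in>G. d' g *\<^sub>C g)" "\<forall>g\<in>G. cmod (d' g) \<le> 1" using \<open>p' \<in> P\<close> unfolding P_def by auto
    have "u *\<^sub>R p + v *\<^sub>R p' = (\<Sum>g\<in>G. (of_real u * d g + of_real v * d' g) *\<^sub>C g)"
      unfolding d(1) d'(1) by (simp add: scaleR_scaleC complex_vector.scale_sum_right scaleC_scaleC scaleC_add_left sum.distrib)
    moreover have "cmod (of_real u * d g + of_real v * d' g) \<le> 1" if g: "g \<in> G" for g
    proof -
      have "cmod (of_real u * d g + of_real v * d' g) \<le> u * cmod (d g) + v * cmod (d' g)"
        using norm_triangle_ineq[of "of_real u * d g" "of_real v * d' g"] uv by (simp add: norm_mult)
      also have "\<dots> \<le> 1" using convex_bound_le[of "cmod (d g)" 1 "cmod (d' g)" u v] d d' g uv by auto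
      finally show ?thesis .
    qed
    ultimately show ?thesis unfolding P_def
      by (intro CollectI exI[of _ "\<lambda>g. of_real u * d g + of_real v * d' g"]) simp
  qed
  define D where "D = {y \<in> topspace E. \<exists>p\<in>P. q (y - p) < e/2}"
  have "S \<subseteq> D"
  proof
    fix x assume x: "x \<in> S"
    obtain g where g: "g \<in> G" "q (x - g) < e/2" using G(3)[OF x] by blast
    have "g = (\<Sum>h\<in>G. (if h = g then 1 else 0) *\<^sub>C h)"
      using sum.remove[OF G(1) g(1), of "\<lambda>h. (if h = g then 1 else 0) *\<^sub>C h"] by (simp add: scaleC_one)
    then have "g \<in> P" unfolding P_def by (intro CollectI exI[of _ "\<lambda>h. if h = g then 1 else 0"]) auto
    then show "x \<in> D" unfolding D_def using g SE x by blast
  qed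
  moreover have "circled D" unfolding circled_def
  proof (intro ballI allI impI)
    fix x c assume x: "x \<in> D" and c: "cmod c \<le> 1"
    then obtain p where p: "p \<in> P" "q (x - p) < e/2" and xE: "x \<in> topspace E" unfolding D_def by blast
    have "q (c *\<^sub>C x - c *\<^sub>C p) = cmod c * q (x - p)"
      using qi(2)[OF diff_in[OF xE], of p c] p PE by (auto simp: complex_vector.scale_right_diff_distrib)
    also have "\<dots> \<le> q (x - p)" using mult_right_mono[OF c, of "q (x - p)"] qi(3)[OF diff_in[OF xE], of p] p PE by auto
    finally show "c *\<^sub>C x \<in> D" unfolding D_def using p(2) Pcirc[OF p(1) c] scaleC_in[OF xE] by force
  qed
  moreover have "convex D"
  proof (rule convexI)
    fix x y and u v :: real assume xy: "x \<in> D" "y \<in> D" and uv: "0 \<le> u" "0 \<le> v" "u + v = 1"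
    then obtain p p' where p: "p \<in> P" "q (x - p) < e/2" "x \<in> topspace E" and p': "p' \<in> P" "q (y - p') < e/2" "y \<in> topspace E"
      unfolding D_def by blast
    have xp: "x - p \<in> topspace E" "y - p' \<in> topspace E" using p p' PE diff_in by auto
    have "q (u *\<^sub>R x + v *\<^sub>R y - (u *\<^sub>R p + v *\<^sub>R p')) = q (u *\<^sub>R (x - p) + v *\<^sub>R (y - p'))"
      by (simp add: algebra_simps)
    also have "\<dots> \<le> u * q (x - p) + v * q (y - p')"
      using qi(1)[OF scaleR_in[OF xp(1)] scaleR_in[OF xp(2)], of u v] qi(4)[OF xp(1)] qi(4)[OF xp(2)] uv by simp
    also have "\<dots> < e/2" using convex_bound_lt[OF p(2) p'(2) uv] .
    finally show "u *\<^sub>R x + v *\<^sub>R y \<in> D"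
      unfolding D_def using Pconv[OF p(1) p'(1) uv] add_in scaleR_in p(3) p'(3) by blast
  qed
  ultimately have HD: "abs_hull S \<subseteq> D" using abs_hull_minimal by blast
  obtain H where H: "finite H" "H \<subseteq> topspace E"
    "\<And>c. (\<forall>g\<in>G. cmod (c g) \<le> 1) \<Longrightarrow> (\<exists>h\<in>H. q ((\<Sum>g\<in>G. c g *\<^sub>C g) - h) < e/2)"
    using precompact_polydisc[OF G(1,2) q half_gt_zero[OF e]] by blast
  have "\<exists>h\<in>H. q (x - h) < e" if x: "x \<in> abs_hull S" for x
  proof -
    obtain p where p: "p \<in> P" "q (x - p) < e/2" "x \<in> topspace E" using x HD unfolding D_def by blast
    obtain h where h: "h \<in> H" "q (p - h) < e/2" using p(1) H(3) unfolding P_def by blast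
    have "q (x - h) \<le> q (x - p) + q (p - h)" using qi(5)[OF p(3), of p h] p h PE H(2) by auto
    then show ?thesis using p h by force
  qed
  then show "\<exists>G. finite G \<and> G \<subseteq> topspace E \<and> (\<forall>x\<in>abs_hull S. \<exists>g\<in>G. q (x - g) < e)" using H by blast
qed

definition seminorm_closure :: "'a set \<Rightarrow> 'a set" where
  "seminorm_closure C = {x \<in> topspace E. \<forall>q. continuous_seminorm E q \<longrightarrow> (\<forall>e>0. \<exists>c\<in>C. q (x - c) < e)}"

text \<open>
  A finite cover by small sets has a member that belongs to a given ultrafilter, so every
  ultrafilter on the closure is Cauchy and converges by completeness.
\<close>

lemma complete_precompact_closure_compact:
  assumes E: "complete_lcs E" and C: "precompact C"
  shows "compactin E (seminorm_closure C)"
proof (rule compactin_ultrafilterI)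
  let ?K = "seminorm_closure C"
  show KE: "?K \<subseteq> topspace E" unfolding seminorm_closure_def by auto
  have CE: "C \<subseteq> topspace E" using C unfolding precompact_def by auto
  fix G :: "'a filter" assume G: "G \<le> principal ?K" "G \<noteq> bot" "\<And>P. eventually P G \<or> eventually (\<lambda>x. \<not> P x) G"
  have evK: "eventually (\<lambda>x. x \<in> ?K) G" using G(1) by (simp add: le_principal)
  have "\<forall>\<^sub>F (x, y) in G \<times>\<^sub>F G. x - y \<in> U" if U: "openin E U \<and> 0 \<in> U" for U
  proof -
    obtain q where q: "continuous_seminorm E q" "\<And>x. x \<in> topspace E \<Longrightarrow> q x < 1 \<Longrightarrow> x \<in> U"
      using gauge_exists U by blast
    note qi = seminorm_ineqs[OF q(1)]
    obtain H where H: "finite H" "H \<subseteq> topspace E" "\<And>x. x \<in> C \<Longrightarrow> \<exists>g\<in>H. q (x - g) < 1/4"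
      using C q(1) unfolding precompact_def by (metis zero_less_divide_1_iff zero_less_numeral)
    have "\<exists>g\<in>H. q (x - g) < 1/2" if x: "x \<in> ?K" for x
    proof -
      obtain c where c: "c \<in> C" "q (x - c) < 1/4"
        using x q(1) unfolding seminorm_closure_def by (auto dest!: spec[of _ q] spec[of _ "1/4"])
      obtain g where g: "g \<in> H" "q (c - g) < 1/4" using H(3) c by blast
      have "q (x - g) \<le> q (x - c) + q (c - g)" using qi(5)[of x c g] x c g KE CE H(2) by auto
      then show ?thesis using c g by force
    qed
    then have "eventually (\<lambda>x. \<exists>g\<in>H. x \<in> topspace E \<and> q (x - g) < 1/2) G"
      using evK by (rule_tac eventually_mono[OF evK]) (use KE in blast)
    then obtain g where g: "g \<in> H" "eventually (\<lambda>x. x \<in> topspace E \<and> q (x - g) < 1/2) G"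
      using ultrafilter_finite_union[OF G(3,2) H(1), of "\<lambda>g x. x \<in> topspace E \<and> q (x - g) < 1/2"] by blast
    have "x - y \<in> U" if "x \<in> topspace E \<and> q (x - g) < 1/2" "y \<in> topspace E \<and> q (y - g) < 1/2" for x y
    proof -
      have gE: "g \<in> topspace E" using g H by auto
      have "q (x - y) \<le> q (x - g) + q (y - g)" using qi(5)[of x g y] qi(6)[of g y] that gE by auto
      then show ?thesis using q(2)[OF diff_in[of x y]] that by auto
    qed
    then show ?thesis
      unfolding eventually_prod_filter using g(2) by blast
  qed
  moreover have "G \<le> principal (topspace E)" using G(1) KE by (meson order_trans principal_le_iff)
  ultimately obtain l where l: "limitin E (\<lambda>x. x) l G" using E G(2) unfolding complete_lcs_def by blast
  have lE: "l \<in> topspace E" using limitin_topspace[OF l] .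
  have "\<exists>c\<in>C. q (l - c) < e" if q: "continuous_seminorm E q" and e: "e > 0" for q e
  proof -
    note qi = seminorm_ineqs[OF q]
    have "eventually (\<lambda>x. q (x - l) < e/2) G"
      using l q e unfolding limitin_iff_seminorm by (intro order_tendstoD(2)[of _ 0]) auto
    with evK have "eventually (\<lambda>x. x \<in> ?K \<and> q (x - l) < e/2) G" by eventually_elim auto
    then obtain x where x: "x \<in> ?K" "q (x - l) < e/2" using G(2) by (metis (no_types, lifting) eventually_happens)
    obtain c where c: "c \<in> C" "q (x - c) < e/2"
      using x(1) q e unfolding seminorm_closure_def by (auto dest!: spec[of _ q] spec[of _ "e/2"])
    have xE: "x \<in> topspace E" "c \<in> topspace E" using x c KE CE by auto
    have "q (l - c) \<le> q (x - l) + q (x - c)" using qi(5)[OF lE xE] qi(6)[OF lE xE(1)] by simp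
    then show ?thesis using c x by force
  qed
  then have "l \<in> ?K" unfolding seminorm_closure_def using lE by blast
  then show "\<exists>l\<in>?K. limitin E (\<lambda>x. x) l G" using l by blast
qed

text \<open>The closure of the absolutely convex hull.\<close>

theorem precompact_in_compact_disc:
  assumes E: "complete_lcs E" and S: "precompact S"
  obtains K where "compactin E K" "convex K" "circled K" "S \<subseteq> K"
proof -
  define C where "C = abs_hull S"
  define K where "K = seminorm_closure C"
  have Cpre: "precompact C" unfolding C_def by (rule precompact_abs_hull[OF S])
  then have CE: "C \<subseteq> topspace E" unfolding precompact_def by auto
  have Cconv: "convex C" and Ccirc: "circled C" unfolding C_def by (rule convex_abs_hull circled_abs_hull)+
  have "S \<subseteq> K"
  proof
    fix x assume "x \<in> S"
    then have "x \<in> C" using abs_hull_superset unfolding C_def by blast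
    then show "x \<in> K" unfolding K_def seminorm_closure_def using CE
      by (intro CollectI conjI allI impI bexI[of _ x]) (auto dest: continuous_seminorm_0)
  qed
  moreover have "convex K"
  proof (rule convexI)
    fix x y and u v :: real assume xy: "x \<in> K" "y \<in> K" and uv: "0 \<le> u" "0 \<le> v" "u + v = 1"
    have xyE: "x \<in> topspace E" "y \<in> topspace E" using xy unfolding K_def seminorm_closure_def by auto
    have "\<exists>c\<in>C. q (u *\<^sub>R x + v *\<^sub>R y - c) < e" if q: "continuous_seminorm E q" and e: "e > 0" for q e
    proof -
      note qi = seminorm_ineqs[OF q]
      obtain p p' where p: "p \<in> C" "q (x - p) < e" and p': "p' \<in> C" "q (y - p') < e"
        using xy q e unfolding K_def seminorm_closure_def by blast
      have xp: "x - p \<in> topspace E" "y - p' \<in> topspace E" using p p' CE xyE diff_in by auto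
      have "q (u *\<^sub>R x + v *\<^sub>R y - (u *\<^sub>R p + v *\<^sub>R p')) = q (u *\<^sub>R (x - p) + v *\<^sub>R (y - p'))"
        by (simp add: algebra_simps)
      also have "\<dots> \<le> u * q (x - p) + v * q (y - p')"
        using qi(1)[OF scaleR_in[OF xp(1)] scaleR_in[OF xp(2)], of u v] qi(4)[OF xp(1)] qi(4)[OF xp(2)] uv by simp
      also have "\<dots> < e" using convex_bound_lt[OF p(2) p'(2) uv] .
      finally show ?thesis using convexD[OF Cconv p(1) p'(1) uv] by blast
    qed
    then show "u *\<^sub>R x + v *\<^sub>R y \<in> K"
      unfolding K_def seminorm_closure_def using add_in scaleR_in xyE by blast
  qed
  moreover have "circled K" unfolding circled_def
  proof (intro ballI allI impI)
    fix x c assume x: "x \<in> K" and c: "cmod c \<le> 1"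
    have xE: "x \<in> topspace E" using x unfolding K_def seminorm_closure_def by auto
    have "\<exists>p\<in>C. q (c *\<^sub>C x - p) < e" if q: "continuous_seminorm E q" and e: "e > 0" for q e
    proof -
      note qi = seminorm_ineqs[OF q]
      obtain p where p: "p \<in> C" "q (x - p) < e" using x q e unfolding K_def seminorm_closure_def by blast
      have "q (c *\<^sub>C x - c *\<^sub>C p) = cmod c * q (x - p)"
        using qi(2)[OF diff_in[OF xE], of p c] p CE by (auto simp: complex_vector.scale_right_diff_distrib)
      also have "\<dots> \<le> q (x - p)" using mult_right_mono[OF c, of "q (x - p)"] qi(3)[OF diff_in[OF xE], of p] p CE by auto
      finally show ?thesis using Ccirc p c unfolding circled_def by force
    qed
    then show "c *\<^sub>C x \<in> K" unfolding K_def seminorm_closure_def using scaleC_in[OF xE] by blast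
  qed
  moreover have "compactin E K" unfolding K_def by (rule complete_precompact_closure_compact[OF E Cpre])
  ultimately show ?thesis using that by blast
qed

subsection \<open>Compact discs\<close>

definition compact_disc :: "'a set \<Rightarrow> bool" where
  "compact_disc K \<longleftrightarrow> compactin E K \<and> convex K \<and> circled K \<and> 0 \<in> K"

lemma compact_disc_zero: "compact_disc {0}"
  unfolding compact_disc_def circled_def using zero_in by auto

text \<open>
  The sum of two compact discs is a compact disc containing both, which makes the seminorms of
  \<open>dual_c E\<close> directed.
\<close>

lemma compact_disc_sum:
  assumes "compact_disc K" "compact_disc L"
  shows "compact_disc ((\<lambda>(x, y). x + y) ` (K \<times> L))"
  unfolding compact_disc_def
proof (intro conjI)
  have "compactin (prod_topology E E) (K \<times> L)"
    using assms unfolding compact_disc_def by (simp add: compactin_Times)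
  then show "compactin E ((\<lambda>(x, y). x + y) ` (K \<times> L))" using image_compactin continuous_add by blast
  show "convex ((\<lambda>(x, y). x + y) ` (K \<times> L))"
  proof (rule convexI)
    fix z z' and u v :: real
    assume z: "z \<in> (\<lambda>(x, y). x + y) ` (K \<times> L)" "z' \<in> (\<lambda>(x, y). x + y) ` (K \<times> L)"
      and uv: "0 \<le> u" "0 \<le> v" "u + v = 1"
    obtain x y x' y' where xy: "x \<in> K" "y \<in> L" "z = x + y" "x' \<in> K" "y' \<in> L" "z' = x' + y'" using z by auto
    have "u *\<^sub>R x + v *\<^sub>R x' \<in> K" "u *\<^sub>R y + v *\<^sub>R y' \<in> L"
      using assms xy uv unfolding compact_disc_def convex_def by auto
    moreover have "u *\<^sub>R z + v *\<^sub>R z' = (u *\<^sub>R x + v *\<^sub>R x') + (u *\<^sub>R y + v *\<^sub>R y')"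
      unfolding xy by (simp add: algebra_simps)
    ultimately show "u *\<^sub>R z + v *\<^sub>R z' \<in> (\<lambda>(x, y). x + y) ` (K \<times> L)" by force
  qed
  show "circled ((\<lambda>(x, y). x + y) ` (K \<times> L))"
    unfolding circled_def
  proof (intro ballI allI impI)
    fix z and c :: complex assume "z \<in> (\<lambda>(x, y). x + y) ` (K \<times> L)" and c: "cmod c \<le> 1"
    then obtain x y where xy: "x \<in> K" "y \<in> L" "z = x + y" by auto
    then have "c *\<^sub>C x \<in> K" "c *\<^sub>C y \<in> L" "c *\<^sub>C z = c *\<^sub>C x + c *\<^sub>C y"
      using assms c unfolding compact_disc_def circled_def by (auto simp: scaleC_add_right)
    then show "c *\<^sub>C z \<in> (\<lambda>(x, y). x + y) ` (K \<times> L)" by force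
  qed
  show "0 \<in> (\<lambda>(x, y). x + y) ` (K \<times> L)" using assms unfolding compact_disc_def by force
qed

lemma compact_disc_scale:
  assumes "compact_disc K"
  shows "compact_disc ((\<lambda>x. c *\<^sub>C x) ` K)"
  unfolding compact_disc_def
proof (intro conjI)
  have "continuous_map E E (\<lambda>x. c *\<^sub>C x)" by (rule continuous_map_scaleC) auto
  then show "compactin E ((\<lambda>x. c *\<^sub>C x) ` K)" using image_compactin assms unfolding compact_disc_def by blast
  have lin: "linear (\<lambda>x::'a. c *\<^sub>C x)"
    by (rule linearI) (auto simp: scaleC_add_right scaleR_scaleC scaleC_scaleC mult.commute)
  show "convex ((\<lambda>x. c *\<^sub>C x) ` K)" using convex_linear_image[OF lin] assms unfolding compact_disc_def by blast
  show "circled ((\<lambda>x. c *\<^sub>C x) ` K)"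
    unfolding circled_def
  proof (intro ballI allI impI)
    fix z d assume "z \<in> (\<lambda>x. c *\<^sub>C x) ` K" and d: "cmod d \<le> 1"
    then obtain x where x: "x \<in> K" "z = c *\<^sub>C x" by auto
    then have "d *\<^sub>C z = c *\<^sub>C (d *\<^sub>C x)" "d *\<^sub>C x \<in> K"
      using assms d unfolding compact_disc_def circled_def by (auto simp: scaleC_scaleC mult.commute)
    then show "d *\<^sub>C z \<in> (\<lambda>x. c *\<^sub>C x) ` K" by blast
  qed
  show "0 \<in> (\<lambda>x. c *\<^sub>C x) ` K" using assms unfolding compact_disc_def by force
qed

lemma compact_disc_singleton:
  assumes "x \<in> topspace E"
  shows "compact_disc ((\<lambda>c. c *\<^sub>C x) ` cball 0 1)"
  unfolding compact_disc_def
proof (intro conjI)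
  have "continuous_map euclidean E (\<lambda>c::complex. c *\<^sub>C x)"
    by (rule continuous_map_scaleC) (use assms in auto)
  then show "compactin E ((\<lambda>c. c *\<^sub>C x) ` cball 0 1)"
    by (intro image_compactin[of euclidean]) auto
  have lin: "linear (\<lambda>c. c *\<^sub>C x)"
    by (rule linearI) (auto simp: scaleC_add_left scaleR_scaleC scaleC_scaleC scaleC_complex_def)
  show "convex ((\<lambda>c. c *\<^sub>C x) ` cball 0 1)" using convex_linear_image[OF lin] by blast
  show "circled ((\<lambda>c. c *\<^sub>C x) ` cball 0 1)"
    unfolding circled_def by (auto simp: scaleC_scaleC norm_mult mult_le_one)
  show "0 \<in> (\<lambda>c. c *\<^sub>C x) ` cball 0 1" by force
qed

end

section \<open>Duality\<close>

subsection \<open>Suprema of seminorms\<close>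

lemma SUP_ennreal_bound:
  assumes "0 \<le> r" "\<And>i. i \<in> I \<Longrightarrow> a i \<le> r"
  shows "(SUP i\<in>I. ennreal (a i)) \<le> ennreal r" "(SUP i\<in>I. ennreal (a i)) < \<infinity>"
    "enn2real (SUP i\<in>I. ennreal (a i)) \<le> r"
proof -
  show *: "(SUP i\<in>I. ennreal (a i)) \<le> ennreal r" using assms by (intro SUP_least ennreal_leI)
  then show "(SUP i\<in>I. ennreal (a i)) < \<infinity>" by (simp add: order.strict_trans1)
  show "enn2real (SUP i\<in>I. ennreal (a i)) \<le> r" using * assms(1) by (metis enn2real_leI)
qed

lemma le_enn2real_SUP:
  assumes "(SUP i\<in>I. ennreal (a i)) < \<infinity>" "i \<in> I"
  shows "a i \<le> enn2real (SUP i\<in>I. ennreal (a i))"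
proof -
  have *: "ennreal (a i) \<le> (SUP i\<in>I. ennreal (a i))" using assms(2) by (rule SUP_upper)
  show ?thesis
  proof (cases "a i \<ge> 0")
    case True
    then have "a i = enn2real (ennreal (a i))" by simp
    also have "\<dots> \<le> enn2real (SUP i\<in>I. ennreal (a i))" using * assms(1) by (intro enn2real_mono) auto
    finally show ?thesis .
  next
    case False
    then show ?thesis by (smt (verit) enn2real_nonneg)
  qed
qed

lemma seminorm_on_SUP:
  assumes V: "complex_vector.subspace V" and n: "\<And>i. i \<in> I \<Longrightarrow> seminorm_on V (n i)"
    and fin: "\<And>x. x \<in> V \<Longrightarrow> (SUP i\<in>I. ennreal (n i x)) < \<infinity>"
  shows "seminorm_on V (\<lambda>x. enn2real (SUP i\<in>I. ennreal (n i x)))"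
proof -
  define N where "N x = enn2real (SUP i\<in>I. ennreal (n i x))" for x
  have le: "n i x \<le> N x" if "i \<in> I" "x \<in> V" for i x unfolding N_def using le_enn2real_SUP[OF fin] that by blast
  have ge: "N x \<le> r" if "0 \<le> r" "\<And>i. i \<in> I \<Longrightarrow> n i x \<le> r" for r x
    unfolding N_def using that by (rule SUP_ennreal_bound(3))
  have N0: "0 \<le> N x" for x unfolding N_def by simp
  have hom: "N (c *\<^sub>C x) \<le> cmod c * N x" if x: "x \<in> V" for c x
  proof (rule ge)
    show "0 \<le> cmod c * N x" using N0 by simp
    fix i assume i: "i \<in> I"
    have "n i (c *\<^sub>C x) = cmod c * n i x" using n[OF i] x unfolding seminorm_on_def by blast
    then show "n i (c *\<^sub>C x) \<le> cmod c * N x" using le[OF i x] by (simp add: mult_left_mono)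
  qed
  have "seminorm_on V N" unfolding seminorm_on_def
  proof (intro conjI ballI allI)
    fix x y assume xy: "x \<in> V" "y \<in> V"
    show "N (x + y) \<le> N x + N y"
    proof (rule ge)
      fix i assume i: "i \<in> I"
      have "n i (x + y) \<le> n i x + n i y" using n[OF i] xy unfolding seminorm_on_def by blast
      then show "n i (x + y) \<le> N x + N y" using le[OF i xy(1)] le[OF i xy(2)] by simp
    qed (use N0 in simp)
  next
    fix c x assume x: "x \<in> V"
    show "N (c *\<^sub>C x) = cmod c * N x"
    proof (cases "c = 0")
      case True then show ?thesis using hom[OF x, of c] N0[of "c *\<^sub>C x"] by simp
    next
      case False
      have "N (inverse c *\<^sub>C (c *\<^sub>C x)) \<le> cmod (inverse c) * N (c *\<^sub>C x)"
        by (rule hom) (rule complex_vector.subspace_scale[OF V x])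
      then have "N x \<le> inverse (cmod c) * N (c *\<^sub>C x)"
        using False by (simp add: scaleC_scaleC scaleC_one norm_inverse)
      then have "cmod c * N x \<le> N (c *\<^sub>C x)"
        using False by (simp add: field_simps)

      then show ?thesis using hom[OF x, of c] by simp
    qed
  qed (rule N0)
  then show ?thesis unfolding N_def .
qed

lemma seminorm_on_eval:
  "complex_vector.subspace V \<Longrightarrow> seminorm_on V (\<lambda>f :: 'a \<Rightarrow> complex. cmod (f x))"
  unfolding seminorm_on_def
  by (auto simp: norm_triangle_ineq scaleC_fun_def scaleC_complex_def norm_mult)

subsection \<open>The dual with the topology of uniform convergence on compact discs\<close>

context lcs
begin

lemma functional_bounded_on_compact:
  assumes "compactin E K" "f \<in> dual E"
  obtains r where "0 \<le> r" "\<And>x. x \<in> K \<Longrightarrow> cmod (f x) \<le> r"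
proof -
  have "compactin euclidean (f ` K)" using assms image_compactin unfolding dual_def by blast
  then have "bounded (f ` K)" by (simp add: compact_imp_bounded)
  then obtain r where "\<forall>x\<in>K. cmod (f x) \<le> r" unfolding bounded_iff by blast
  then show ?thesis using that[of "max 0 r"] by (simp add: le_max_iff_disj)
qed

lemma circled_zero_mem: "circled K \<Longrightarrow> K \<noteq> {} \<Longrightarrow> 0 \<in> K"
  unfolding circled_def by (metis ex_in_conv norm_zero scaleC_zero_left zero_le_one)

lemma dual_c_family: "seminorm_family (dual E)
  {\<lambda>f. SUP x\<in>K. ennreal (cmod (f x)) | K. compactin E K \<and> convex K \<and> circled K}"
proof -
  let ?P = "{\<lambda>f::'a \<Rightarrow> complex. SUP x\<in>K. ennreal (cmod (f x)) | K. compactin E K \<and> convex K \<and> circled K}"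
  have fin: "(SUP x\<in>K. ennreal (cmod (f x))) < \<infinity>" if "compactin E K" "f \<in> dual E" for K f
    by (rule functional_bounded_on_compact[OF that]) (rule SUP_ennreal_bound(2))
  show ?thesis
  proof
    show "complex_vector.subspace (dual E)" by (rule dual_subspace)
    show "p \<in> ?P \<Longrightarrow> f \<in> dual E \<Longrightarrow> p f < \<infinity>" for p f using fin by blast
    show "seminorm_on (dual E) (\<lambda>x. enn2real (p x))" if p: "p \<in> ?P" for p
    proof -
      obtain K where K: "compactin E K" "p = (\<lambda>f. SUP x\<in>K. ennreal (cmod (f x)))" using p by blast
      show ?thesis unfolding K(2)
        by (rule seminorm_on_SUP[OF dual_subspace seminorm_on_eval[OF dual_subspace] fin[OF K(1)]])
    qed
    show "?P \<noteq> {}" using compact_disc_zero unfolding compact_disc_def by blast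
    show "\<exists>r\<in>?P. \<forall>x\<in>dual E. p x \<le> r x \<and> p' x \<le> r x" if p: "p \<in> ?P" "p' \<in> ?P" for p p'
    proof -
      obtain K where K: "compactin E K" "convex K" "circled K" "p = (\<lambda>f. SUP x\<in>K. ennreal (cmod (f x)))" using p by blast
      obtain L where L: "compactin E L" "convex L" "circled L" "p' = (\<lambda>f. SUP x\<in>L. ennreal (cmod (f x)))" using p by blast
      show ?thesis
      proof (cases "K = {} \<or> L = {}")
        case True
        then show ?thesis using K L p by (auto intro: bexI[of _ p] bexI[of _ p'])
      next
        case False
        let ?M = "(\<lambda>(x, y). x + y) ` (K \<times> L)"
        have 0: "0 \<in> K" "0 \<in> L" using False K L circled_zero_mem by auto
        then have M: "compact_disc ?M" using K L compact_disc_sum unfolding compact_disc_def by blast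
        have "K \<subseteq> ?M" "L \<subseteq> ?M" using 0 by force+
        then show ?thesis using M unfolding K(4) L(4) compact_disc_def
          by (intro bexI[of _ "\<lambda>f. SUP x\<in>?M. ennreal (cmod (f x))"]) (blast intro: SUP_subset_mono)+
      qed
    qed
    show "f = 0" if f: "f \<in> dual E" "\<And>p. p \<in> ?P \<Longrightarrow> p f = 0" for f
    proof
      fix x show "f x = 0 x"
      proof (cases "x \<in> topspace E")
        case True
        let ?K = "(\<lambda>c. c *\<^sub>C x) ` cball 0 1"
        have K: "compact_disc ?K" using compact_disc_singleton[OF True] .
        then have 0: "(SUP x\<in>?K. ennreal (cmod (f x))) = 0"
          by (intro f(2)) (auto simp: compact_disc_def)
        have "x \<in> ?K" by (rule image_eqI[of _ _ 1]) (simp_all add: scaleC_one)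
        then have "ennreal (cmod (f x)) \<le> 0" unfolding 0[symmetric] by (rule SUP_upper)
        then show ?thesis by simp
      next
        case False then show ?thesis using dual_outside[OF f(1)] by simp
      qed
    qed
  qed
qed

lemma lcs_dual_c: "lcs (dual_c E)"
  unfolding dual_c_def by (rule lcs.intro) (rule seminorm_family.locally_convex[OF dual_c_family])

lemma topspace_dual_c [simp]: "topspace (dual_c E) = dual E"
  unfolding dual_c_def by simp

text \<open>The constant in the estimate by a generator is absorbed by a dilation of the disc.\<close>

lemma dual_c_seminorm_bound:
  assumes "continuous_seminorm (dual_c E) p"
  obtains K where "compact_disc K"
    "\<forall>f\<in>dual E. \<forall>r\<ge>0. (\<forall>x\<in>K. cmod (f x) \<le> r) \<longrightarrow> p f \<le> r"
proof -
  obtain n C where n: "n \<in> {\<lambda>f. SUP x\<in>K. ennreal (cmod (f x)) | K. compactin E K \<and> convex K \<and> circled K}"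
    "C > 0" "\<forall>f\<in>dual E. p f \<le> C * enn2real (n f)"
    using seminorm_family.seminorm_le_generator[OF dual_c_family assms[unfolded dual_c_def]] by blast
  then obtain K where K: "compactin E K" "convex K" "circled K" "n = (\<lambda>f. SUP x\<in>K. ennreal (cmod (f x)))" by blast
  have le: "p f \<le> r" if f: "f \<in> dual E" and r: "0 \<le> r" "\<And>x. x \<in> K \<Longrightarrow> cmod (f x) \<le> r / C" for f r
  proof -
    have "enn2real (n f) \<le> r / C" unfolding K(4) using r n(2) by (intro SUP_ennreal_bound(3)) auto
    then have "C * enn2real (n f) \<le> r" using n(2) by (simp add: field_simps)
    then show ?thesis using n(3) f by force
  qed
  show ?thesis
  proof (cases "K = {}")
    case True
    then show ?thesis using that[OF compact_disc_zero] le by auto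
  next
    case False
    then have K': "compact_disc K" using K circled_zero_mem unfolding compact_disc_def by auto
    show ?thesis
    proof (rule that[OF compact_disc_scale[OF K', of "of_real C"]], intro ballI allI impI)
      fix f and r :: real assume f: "f \<in> dual E" and r: "0 \<le> r" "\<forall>x\<in>(\<lambda>x. of_real C *\<^sub>C x) ` K. cmod (f x) \<le> r"
      have "cmod (f x) \<le> r / C" if x: "x \<in> K" for x
      proof -
        have "x \<in> topspace E" using x compactin_subset_topspace[OF K(1)] by auto
        then show ?thesis using bspec[OF r(2), of "of_real C *\<^sub>C x"] x n(2) f by (simp add: dual_scaleC_apply norm_mult field_simps)
      qed
      then show "p f \<le> r" using le f r(1) by blast
    qed
  qed
qed

lemma dual_c_seminormI:
  assumes p: "seminorm_on (dual E) p" and K: "compact_disc K"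
    and le: "\<forall>f\<in>dual E. \<forall>r\<ge>0. (\<forall>x\<in>K. cmod (f x) \<le> r) \<longrightarrow> p f \<le> r"
  shows "continuous_seminorm (dual_c E) p"
proof -
  let ?n = "\<lambda>f. SUP x\<in>K. ennreal (cmod (f x))"
  have n: "?n \<in> {\<lambda>f. SUP x\<in>K. ennreal (cmod (f x)) | K. compactin E K \<and> convex K \<and> circled K}"
    using K unfolding compact_disc_def by blast
  show ?thesis
  proof (rule lcs.continuous_seminorm_le[OF lcs_dual_c seminorm_family.generator_continuous[OF dual_c_family n, folded dual_c_def]])
    show "seminorm_on (topspace (dual_c E)) p" using p by simp
    fix f assume "f \<in> topspace (dual_c E)"
    then have f: "f \<in> dual E" by simp
    show "p f \<le> enn2real (?n f)"
      by (rule le[rule_format, OF f]) (use le_enn2real_SUP seminorm_family.fin[OF dual_c_family n f] in auto)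
  qed
qed

subsection \<open>The Mackey-Arens theorem\<close>

lemma cmod_add_square:
  "(cmod (z + of_real t * w))\<^sup>2 = (cmod z)\<^sup>2 + 2 * t * Re (cnj z * w) + t\<^sup>2 * (cmod w)\<^sup>2"
  unfolding cmod_power2 by (simp add: power2_eq_square algebra_simps)

text \<open>
  If no point of a compact disc \<open>K\<close> represents \<open>u\<close> on finitely many functionals, take the point
  \<open>k\<close> of \<open>K\<close> minimizing the sum of the squares of the errors. By the variational inequality,
  the combination of the functionals with the conjugate errors as coefficients violates the
  bound on \<open>u\<close>.
\<close>

lemma represent_finitely_many:
  assumes u: "clinear_on (dual E) u" and K: "compact_disc K"
    and le: "\<forall>f\<in>dual E. \<forall>r\<ge>0. (\<forall>x\<in>K. cmod (f x) \<le> r) \<longrightarrow> cmod (u f) \<le> r"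
    and F: "finite F" "F \<subseteq> dual E"
  shows "\<exists>k\<in>K. \<forall>f\<in>F. f k = u f"
proof -
  have KE: "K \<subseteq> topspace E" using K compactin_subset_topspace unfolding compact_disc_def by blast
  define h where "h k = (\<Sum>f\<in>F. (cmod (f k - u f))\<^sup>2)" for k
  have "continuous_map E euclideanreal h"
    unfolding h_def
    by (intro continuous_map_sum[OF F(1)] continuous_map_real_pow continuous_map_norm continuous_map_diff)
      (use F(2) in \<open>auto simp: dual_def\<close>)
  then have "compact (h ` K)" using image_compactin K unfolding compact_disc_def by fastforce
  moreover have "h ` K \<noteq> {}" using K unfolding compact_disc_def by auto
  ultimately obtain k where k: "k \<in> K" "\<And>x. x \<in> K \<Longrightarrow> h k \<le> h x"
    using compact_attains_inf[of "h ` K"] by auto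
  have kE: "k \<in> topspace E" using k KE by auto
  define d where "d f = f k - u f" for f
  define g where "g = (\<lambda>x. \<Sum>f\<in>F. cnj (d f) * f x)"
  have gsum: "g = (\<Sum>f\<in>F. cnj (d f) *\<^sub>C f)"
    using F(1) unfolding g_def by (induction F) (auto simp: fun_eq_iff scaleC_fun_def scaleC_complex_def)
  have gE: "g \<in> dual E" unfolding gsum
    using F(2) by (intro complex_vector.subspace_sum[OF dual_subspace] complex_vector.subspace_scale[OF dual_subspace]) auto
  have "u (\<Sum>f\<in>F. cnj (d f) *\<^sub>C f) = (\<Sum>f\<in>F. cnj (d f) * u f)"
    using F
  proof (induction F rule: finite_induct)
    case empty
    show ?case
      unfolding sum.empty by (rule zero_clinear_on[OF u complex_vector.subspace_0[OF dual_subspace]])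
  next
    case (insert a F)
    have "(\<Sum>f\<in>F. cnj (d f) *\<^sub>C f) \<in> dual E" "cnj (d a) *\<^sub>C a \<in> dual E"
      using insert.prems by (auto intro!: complex_vector.subspace_sum[OF dual_subspace] complex_vector.subspace_scale[OF dual_subspace])
    then have "u (cnj (d a) *\<^sub>C a + (\<Sum>f\<in>F. cnj (d f) *\<^sub>C f)) = cnj (d a) * u a + u (\<Sum>f\<in>F. cnj (d f) *\<^sub>C f)"
    proof -
      have "u (cnj (d a) *\<^sub>C a + (\<Sum>f\<in>F. cnj (d f) *\<^sub>C f)) = u (cnj (d a) *\<^sub>C a) + u (\<Sum>f\<in>F. cnj (d f) *\<^sub>C f)"
        using u \<open>(\<Sum>f\<in>F. cnj (d f) *\<^sub>C f) \<in> dual E\<close> \<open>cnj (d a) *\<^sub>C a \<in> dual E\<close>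
        unfolding clinear_on_def by blast
      moreover have "u (cnj (d a) *\<^sub>C a) = cnj (d a) *\<^sub>C u a"
        using u insert.prems unfolding clinear_on_def by blast
      ultimately show ?thesis by (simp only: scaleC_complex_def)
    qed
    then show ?case using insert by (simp only: sum.insert[OF insert.hyps] insert_subset simp_thms)
  qed
  then have ug: "u g = (\<Sum>f\<in>F. cnj (d f) * u f)" unfolding gsum .
  \<comment> \<open>the variational inequality: the squared error cannot decrease along the segment from \<open>k\<close> to \<open>x\<close>\<close>
  have var: "Re (g k) \<le> Re (g x)" if x: "x \<in> K" for x
  proof -
    have xE: "x \<in> topspace E" using x KE by auto
    define A where "A = Re (g x) - Re (g k)"
    have A_alt: "A = (\<Sum>f\<in>F. Re (cnj (d f) * (f x - f k)))"
      unfolding A_def g_def by (simp add: right_diff_distrib sum_subtractf sum.distrib)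
    define B where "B = (\<Sum>f\<in>F. (cmod (f x - f k))\<^sup>2)"
    have B: "B \<ge> 0" unfolding B_def by (simp add: sum_nonneg)
    have *: "- (t * B) \<le> 2 * A" if t: "0 < t" "t \<le> 1" for t
    proof -
      have "(1 - t) *\<^sub>R k + t *\<^sub>R x \<in> K" using K k(1) x t unfolding compact_disc_def convex_def by auto
      then have "h k \<le> h ((1 - t) *\<^sub>R k + t *\<^sub>R x)" using k by blast
      also have "\<dots> = (\<Sum>f\<in>F. (cmod (d f + of_real t * (f x - f k)))\<^sup>2)"
        unfolding h_def
      proof (rule sum.cong[OF refl])
        fix f assume "f \<in> F"
        then have eq: "f ((1 - t) *\<^sub>R k + t *\<^sub>R x) = (1 - t) *\<^sub>R f k + t *\<^sub>R f x"
          using F kE xE by (simp add: dual_add_apply dual_scaleR_apply scaleR_in subset_iff)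
        show "(cmod (f ((1 - t) *\<^sub>R k + t *\<^sub>R x) - u f))\<^sup>2 = (cmod (d f + of_real t * (f x - f k)))\<^sup>2"
          unfolding d_def eq by (simp add: scaleR_conv_of_real algebra_simps)
      qed
      also have "\<dots> = (\<Sum>f\<in>F. (cmod (d f))\<^sup>2 + 2 * t * Re (cnj (d f) * (f x - f k)) + t\<^sup>2 * (cmod (f x - f k))\<^sup>2)"
        by (rule sum.cong[OF refl]) (rule cmod_add_square)
      also have "\<dots> = h k + 2 * t * A + t\<^sup>2 * B"
        unfolding h_def d_def[symmetric] A_alt B_def by (simp only: sum.distrib sum_distrib_left)
      finally have "0 \<le> t * (2 * A + t * B)" by (simp add: power2_eq_square algebra_simps)
      then show ?thesis using t by (simp add: zero_le_mult_iff)
    qed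
    have "A \<ge> 0"
    proof (rule ccontr)
      assume "\<not> ?thesis"
      then have A: "A < 0" by simp
      define t where "t = min 1 (- A / (B + 1))"
      have t: "0 < t" "t \<le> 1" unfolding t_def using A B by (auto simp: divide_neg_pos)
      have "t * B \<le> (- A / (B + 1)) * B" unfolding t_def using B by (intro mult_right_mono) auto
      also have "\<dots> \<le> - A" using A B by (simp add: field_simps)
      finally show False using *[OF t] A by simp
    qed
    then show ?thesis unfolding A_def by simp
  qed
  have bnd: "cmod (g x) \<le> - Re (g k)" if x: "x \<in> K" for x
  proof (cases "g x = 0")
    case True
    have "0 \<in> K" using K unfolding compact_disc_def by auto
    then have "Re (g k) \<le> Re (g 0)" using var by blast
    moreover have "g 0 = 0" using zero_clinear_on[OF dual_clinear[OF gE] zero_in] .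
    ultimately show ?thesis using True by simp
  next
    case False
    define c where "c = - of_real (cmod (g x)) / g x"
    have "cmod c \<le> 1" using False unfolding c_def by (simp add: norm_divide)
    then have "c *\<^sub>C x \<in> K" using K x unfolding compact_disc_def circled_def by auto
    then have "Re (g k) \<le> Re (g (c *\<^sub>C x))" using var by blast
    also have "g (c *\<^sub>C x) = - of_real (cmod (g x))"
      using dual_scaleC_apply[OF gE, of x c] x KE False unfolding c_def by auto
    finally show ?thesis by simp
  qed
  have "0 \<le> - Re (g k)" using bnd[OF k(1)] norm_ge_zero order_trans by blast
  then have "cmod (u g) \<le> - Re (g k)" using le gE bnd by blast
  moreover have "Re (u g) = Re (g k) - (\<Sum>f\<in>F. (cmod (d f))\<^sup>2)"
  proof -
    have "(\<Sum>f\<in>F. (cmod (d f))\<^sup>2) = (\<Sum>f\<in>F. Re (cnj (d f) * f k) - Re (cnj (d f) * u f))"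
    proof (rule sum.cong[OF refl])
      fix f
      show "(cmod (d f))\<^sup>2 = Re (cnj (d f) * f k) - Re (cnj (d f) * u f)"
        unfolding cmod_power2 d_def by (simp add: power2_eq_square algebra_simps)
    qed
    moreover have "Re (u g) = (\<Sum>f\<in>F. Re (cnj (d f) * u f))" unfolding ug Re_sum ..
    moreover have "Re (g k) = (\<Sum>f\<in>F. Re (cnj (d f) * f k))" unfolding g_def Re_sum ..
    ultimately show ?thesis by (simp only: sum_subtractf)
  qed
  moreover have "- Re (u g) \<le> cmod (u g)" using abs_Re_le_cmod[of "u g"] by simp
  ultimately have "(\<Sum>f\<in>F. (cmod (d f))\<^sup>2) \<le> 0" by simp
  then have "\<forall>f\<in>F. (cmod (d f))\<^sup>2 = 0"
    using sum_nonneg_eq_0_iff[OF F(1), of "\<lambda>f. (cmod (d f))\<^sup>2"] sum_nonneg[of F "\<lambda>f. (cmod (d f))\<^sup>2"] by force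
  then show ?thesis using k(1) unfolding d_def by auto
qed

text \<open>
  The points of \<open>K\<close> that represent \<open>u\<close> on one functional form a closed
  set, and by \<open>represent_finitely_many\<close> these closed sets have the finite intersection
  property.
\<close>

theorem Mackey_Arens:
  assumes u: "clinear_on (dual E) u" and cont: "continuous_seminorm (dual_c E) (\<lambda>f. cmod (u f))"
  obtains x where "x \<in> topspace E" "\<And>f. f \<in> dual E \<Longrightarrow> f x = u f"
proof -
  obtain K where K: "compact_disc K"
    "\<forall>f\<in>dual E. \<forall>r\<ge>0. (\<forall>x\<in>K. cmod (f x) \<le> r) \<longrightarrow> cmod (u f) \<le> r"
    using dual_c_seminorm_bound[OF cont] by blast
  define S where "S f = {x \<in> topspace E. f x \<in> {u f}}" for f
  have "closedin E (S f)" if "f \<in> dual E" for f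
    unfolding S_def by (rule closedin_continuous_map_preimage[of _ euclidean]) (use that in \<open>auto simp: dual_def\<close>)
  then have "\<forall>C\<in>S ` dual E. closedin E C" by blast
  moreover have "\<forall>\<F>. finite \<F> \<and> \<F> \<subseteq> S ` dual E \<longrightarrow> K \<inter> \<Inter>\<F> \<noteq> {}"
  proof (intro allI impI, elim conjE)
    fix \<F> assume fin: "finite \<F>" "\<F> \<subseteq> S ` dual E"
    obtain F where F: "F \<subseteq> dual E" "finite F" "\<F> = S ` F"
      using finite_subset_image[OF fin] by blast
    obtain k where k: "k \<in> K" "\<forall>f\<in>F. f k = u f" using represent_finitely_many[OF u K F(2,1)] by blast
    have "k \<in> topspace E" using k(1) K(1) compactin_subset_topspace unfolding compact_disc_def by blast
    then show "K \<inter> \<Inter>\<F> \<noteq> {}" using k unfolding F(3) S_def by auto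
  qed
  moreover have "(\<forall>C\<in>S ` dual E. closedin E C) \<and>
      (\<forall>\<F>. finite \<F> \<and> \<F> \<subseteq> S ` dual E \<longrightarrow> K \<inter> \<Inter>\<F> \<noteq> {}) \<longrightarrow> K \<inter> \<Inter>(S ` dual E) \<noteq> {}"
    using K(1) unfolding compact_disc_def compactin_fip by blast
  ultimately have "K \<inter> \<Inter>(S ` dual E) \<noteq> {}" by blast
  then obtain x where x: "x \<in> K" "x \<in> \<Inter>(S ` dual E)" by blast
  have "x \<in> topspace E" using x(1) K(1) compactin_subset_topspace unfolding compact_disc_def by blast
  then show ?thesis using that[of x] x(2) unfolding S_def by blast
qed

subsection \<open>The Alaoglu theorem\<close>

text \<open>
  The polar is the closed subset of a product of discs that is cut out by the linear equations, so
  Tychonoff's theorem applies.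
\<close>

theorem compact_polar:
  assumes q: "continuous_seminorm E q"
  shows "compactin (product_topology (\<lambda>_. euclidean) UNIV) (polar q)"
proof -
  let ?X = "product_topology (\<lambda>_::'a. euclidean :: complex topology) UNIV"
  define D where "D = (\<Pi>\<^sub>E x\<in>UNIV. if x \<in> topspace E then cball (0::complex) (q x) else {0})"
  have ev: "continuous_map ?X euclidean (\<lambda>f. f x)" for x
    using continuous_map_product_projection[of x UNIV "\<lambda>_. euclidean"] by simp
  have D: "compactin ?X D" unfolding D_def by (subst compactin_PiE) auto
  have cl: "closedin ?X {f \<in> topspace ?X. f (x + y) - f x - f y \<in> {0}}" for x y
    by (rule closedin_continuous_map_preimage[of _ euclidean]) (intro continuous_map_diff ev, simp)
  have cl2: "closedin ?X {f \<in> topspace ?X. f (c *\<^sub>C x) - c * f x \<in> {0}}" for c x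
  proof (rule closedin_continuous_map_preimage[of _ euclidean])
    have "continuous_map ?X euclidean (\<lambda>f. c * f x)"
      using continuous_map_compose[OF ev[of x], of euclidean "\<lambda>z. c * z"] by (simp add: o_def continuous_intros)
    then show "continuous_map ?X euclidean (\<lambda>f. f (c *\<^sub>C x) - c * f x)" by (intro continuous_map_diff ev)
  qed simp
  define I where "I = {({f \<in> topspace ?X. f (x + y) - f x - f y \<in> {0}}) | x y. x \<in> topspace E \<and> y \<in> topspace E}
    \<union> {({f \<in> topspace ?X. f (c *\<^sub>C x) - c * f x \<in> {0}}) | c x. x \<in> topspace E}"
  have "closedin ?X (\<Inter>I)"
  proof (rule closedin_Inter)
    show "I \<noteq> {}" unfolding I_def using zero_in by blast
    show "closedin ?X S" if "S \<in> I" for S using that cl cl2 unfolding I_def by blast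
  qed
  moreover have "polar q = \<Inter>I \<inter> D"
  proof (rule set_eqI)
    fix f
    have D_iff: "f \<in> D \<longleftrightarrow> (\<forall>x. if x \<in> topspace E then cmod (f x) \<le> q x else f x = 0)"
      unfolding D_def by (auto simp: PiE_iff)
    have I_iff: "f \<in> \<Inter>I \<longleftrightarrow> clinear_on (topspace E) f"
    proof
      assume f: "f \<in> \<Inter>I"
      show "clinear_on (topspace E) f" unfolding clinear_on_def scaleC_complex_def
      proof (intro conjI ballI allI)
        fix x y assume "x \<in> topspace E" "y \<in> topspace E"
        then have "{f \<in> topspace ?X. f (x + y) - f x - f y \<in> {0}} \<in> I" unfolding I_def by blast
        then have "f (x + y) - f x - f y = 0" using f by blast
        then show "f (x + y) = f x + f y" by (simp add: diff_eq_eq add.commute)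
      next
        fix c x assume "x \<in> topspace E"
        then have "{f \<in> topspace ?X. f (c *\<^sub>C x) - c * f x \<in> {0}} \<in> I" unfolding I_def by blast
        then have "f (c *\<^sub>C x) - c * f x = 0" using f by blast
        then show "f (c *\<^sub>C x) = c * f x" by simp
      qed
    qed (auto simp: I_def clinear_on_def scaleC_complex_def)
    show "f \<in> polar q \<longleftrightarrow> f \<in> \<Inter>I \<inter> D"
    proof
      assume "f \<in> polar q"
      then show "f \<in> \<Inter>I \<inter> D" unfolding Int_iff D_iff I_iff polar_def dual_def by auto
    next
      assume "f \<in> \<Inter>I \<inter> D"
      then have f: "clinear_on (topspace E) f" "\<And>x. x \<in> topspace E \<Longrightarrow> cmod (f x) \<le> q x"
        "\<And>x. x \<notin> topspace E \<Longrightarrow> f x = 0" unfolding Int_iff D_iff I_iff by (auto split: if_splits)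
      then show "f \<in> polar q" unfolding polar_def using dualI[OF f(1,3) q f(2)] by blast
    qed
  qed
  ultimately show ?thesis using closed_Int_compactin[OF _ D] by metis
qed

end

section \<open>Smooth functions with values in a locally convex space\<close>

abbreviation partials :: "'e::complex_vector topology \<Rightarrow> 'd::finite list \<Rightarrow> (real^'d \<Rightarrow> 'e) \<Rightarrow> real^'d \<Rightarrow> 'e" where
  "partials E js \<phi> \<equiv> foldr (partial E) js \<phi>"

text \<open>
  Up to a power of \<open>inverse \<i>\<close>, the operator \<open>D_multi E \<alpha>\<close> is the iterated partial derivative
  along this list.
\<close>

definition multi_list :: "('d::{finite,linorder} \<Rightarrow> nat) \<Rightarrow> 'd list" where
  "multi_list \<alpha> = concat (map (\<lambda>j. replicate (\<alpha> j) j) (sorted_list_of_set UNIV))"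

lemma count_multi_list: "count (mset (multi_list \<alpha>)) j = \<alpha> j"
proof -
  have "count (mset (concat (map (\<lambda>j. replicate (\<alpha> j) j) L))) j = (if j \<in> set L then \<alpha> j else 0)"
    if "distinct L" for L
    using that by (induction L) auto
  then show ?thesis unfolding multi_list_def by simp
qed

lemma length_multi_list: "length (multi_list \<alpha>) = multi_size \<alpha>"
proof -
  have "length (multi_list \<alpha>) = sum_list (map \<alpha> (sorted_list_of_set UNIV))"
    unfolding multi_list_def by (simp add: length_concat o_def)
  also have "\<dots> = sum \<alpha> (set (sorted_list_of_set UNIV))"
    by (rule sum.distinct_set_conv_list[symmetric]) simp
  finally show ?thesis unfolding multi_size_def by simp
qed

lemma mset_multi_list_count: "mset (multi_list (count (mset js))) = mset js"
  by (rule multiset_eqI) (rule count_multi_list)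

lemma multi_size_count: "multi_size (count (mset js)) = length js" for js :: "'d::{finite,linorder} list"
  using arg_cong[OF mset_multi_list_count[of js], of size] by (simp add: length_multi_list)

context lcs
begin

lemma has_partial_unique: "has_partial E j \<phi> x l \<Longrightarrow> has_partial E j \<phi> x m \<Longrightarrow> l = m"
  unfolding has_partial_def using limit_unique[of _ l "at (0::real)" m] by simp

lemma partial_eq: "has_partial E j \<phi> x l \<Longrightarrow> partial E j \<phi> x = l"
  unfolding partial_def using has_partial_unique by blast

lemma smoothI:
  assumes G0: "G [] = \<phi>" and cont: "\<And>js. continuous_map euclidean E (G js)"
    and der: "\<And>js j x. has_partial E j (G js) x (G (j # js) x)"
  shows "smooth E \<phi>" "partials E js \<phi> = G js"
proof -
  have eq: "partials E js \<phi> = G js" for js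
  proof (induction js)
    case (Cons j js)
    have "partial E j (G js) = G (j # js)" by (rule ext) (rule partial_eq[OF der])
    then show ?case using Cons by simp
  qed (simp add: G0)
  show "partials E js \<phi> = G js" by (rule eq)
  show "smooth E \<phi>" unfolding smooth_def eq using cont der by blast
qed

lemma smoothD:
  assumes "smooth E \<phi>"
  shows "continuous_map euclidean E (partials E js \<phi>)"
    and "has_partial E j (partials E js \<phi>) x (partials E (j # js) \<phi> x)"
    and "partials E js \<phi> x \<in> topspace E" and "\<phi> x \<in> topspace E"
proof -
  have *: "continuous_map euclidean E (partials E js \<phi>)" for js using assms unfolding smooth_def by blast
  show "continuous_map euclidean E (partials E js \<phi>)" by (rule *)
  show "partials E js \<phi> x \<in> topspace E" using * unfolding continuous_map_def by auto
  show "\<phi> x \<in> topspace E" using *[of "[]"] unfolding continuous_map_def by auto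
  obtain l where "has_partial E j (partials E js \<phi>) x l" using assms unfolding smooth_def by blast
  then show "has_partial E j (partials E js \<phi>) x (partials E (j # js) \<phi> x)"
    using partial_eq[of j "partials E js \<phi>" x l] by simp
qed

lemma has_partial_linear:
  assumes F: "lcs F" and f: "continuous_map E F f" "clinear_on (topspace E) f"
    and \<phi>: "\<And>x. \<phi> x \<in> topspace E" and d: "has_partial E j \<phi> x l"
  shows "has_partial F j (\<lambda>x. f (\<phi> x)) x (f l)"
proof -
  have "limitin F (f \<circ> (\<lambda>h. (\<phi> (x + h *\<^sub>R axis j 1) - \<phi> x) /\<^sub>R h)) (f l) (at 0)"
    using continuous_map_limit[OF f(1)] d unfolding has_partial_def by blast
  moreover have "f ((\<phi> y - \<phi> x) /\<^sub>R h) = (f (\<phi> y) - f (\<phi> x)) /\<^sub>R h" for y h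
    using f(2) diff_in[OF \<phi> \<phi>, of y x] diff_clinear_on[OF f(2) subsp \<phi> \<phi>, of y x]
    unfolding scaleR_scaleC clinear_on_def by auto
  ultimately show ?thesis unfolding has_partial_def by (simp add: o_def)
qed

lemma smooth_linear:
  assumes F: "lcs F" and f: "continuous_map E F f" "clinear_on (topspace E) f" and \<phi>: "smooth E \<phi>"
  shows "smooth F (\<lambda>x. f (\<phi> x))" "partials F js (\<lambda>x. f (\<phi> x)) = (\<lambda>x. f (partials E js \<phi> x))"
proof -
  interpret F: lcs F by (rule F)
  have c: "continuous_map euclidean F (\<lambda>x. f (partials E js \<phi> x))" for js
    using continuous_map_compose[OF smoothD(1)[OF \<phi>] f(1)] by (simp add: o_def)
  have d: "has_partial F j (\<lambda>x. f (partials E js \<phi> x)) x (f (partials E (j # js) \<phi> x))" for js j x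
    by (rule has_partial_linear[OF F f smoothD(3)[OF \<phi>] smoothD(2)[OF \<phi>]])
  show "smooth F (\<lambda>x. f (\<phi> x))" by (rule F.smoothI(1)[OF _ c d]) simp
  show "partials F js (\<lambda>x. f (\<phi> x)) = (\<lambda>x. f (partials E js \<phi> x))" by (rule F.smoothI(2)[OF _ c d]) simp
qed

lemma smooth_scaleC:
  assumes "smooth E \<phi>"
  shows "smooth E (\<lambda>x. c *\<^sub>C \<phi> x)" "partials E js (\<lambda>x. c *\<^sub>C \<phi> x) = (\<lambda>x. c *\<^sub>C partials E js \<phi> x)"
proof -
  have "continuous_map E E (\<lambda>x. c *\<^sub>C x)" by (rule continuous_map_scaleC) auto
  moreover have "clinear_on (topspace E) (\<lambda>x. c *\<^sub>C x)"
    unfolding clinear_on_def by (simp add: scaleC_add_right scaleC_scaleC mult.commute)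
  ultimately show "smooth E (\<lambda>x. c *\<^sub>C \<phi> x)" "partials E js (\<lambda>x. c *\<^sub>C \<phi> x) = (\<lambda>x. c *\<^sub>C partials E js \<phi> x)"
    using smooth_linear[OF lcs_axioms _ _ assms] by blast+
qed

lemma smooth_add:
  assumes \<phi>: "smooth E \<phi>" and \<psi>: "smooth E \<psi>"
  shows "smooth E (\<lambda>x. \<phi> x + \<psi> x)" "partials E js (\<lambda>x. \<phi> x + \<psi> x) = (\<lambda>x. partials E js \<phi> x + partials E js \<psi> x)"
proof -
  have c: "continuous_map euclidean E (\<lambda>x. partials E js \<phi> x + partials E js \<psi> x)" for js
    by (rule continuous_map_plus[OF smoothD(1)[OF \<phi>] smoothD(1)[OF \<psi>]])
  have d: "has_partial E j (\<lambda>x. partials E js \<phi> x + partials E js \<psi> x) x (partials E (j # js) \<phi> x + partials E (j # js) \<psi> x)" for js j x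
    using limitin_add[OF smoothD(2)[OF \<phi>, unfolded has_partial_def] smoothD(2)[OF \<psi>, unfolded has_partial_def]]
    unfolding has_partial_def scaleR_right_distrib[symmetric] by (simp add: add_diff_add)
  show "smooth E (\<lambda>x. \<phi> x + \<psi> x)" by (rule smoothI(1)[OF _ c d]) simp
  show "partials E js (\<lambda>x. \<phi> x + \<psi> x) = (\<lambda>x. partials E js \<phi> x + partials E js \<psi> x)"
    by (rule smoothI(2)[OF _ c d]) simp
qed

lemma smooth_zero: "smooth E (\<lambda>x. 0)"
proof -
  have d: "has_partial E j (\<lambda>x. 0) x 0" for j x unfolding has_partial_def using zero_in by simp
  have c: "continuous_map euclidean E (\<lambda>x. 0)" using zero_in by simp
  show ?thesis by (rule smoothI(1)[of "\<lambda>_ _. 0", OF refl c d])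
qed

lemma D_multi_eq:
  fixes \<phi> :: "real^'d::{finite,linorder} \<Rightarrow> 'a"
  assumes \<phi>: "smooth E \<phi>"
  shows "D_multi E \<alpha> \<phi> = (\<lambda>x. (inverse \<i>) ^ multi_size \<alpha> *\<^sub>C partials E (multi_list \<alpha>) \<phi> x)"
proof -
  have 1: "D_op E j (\<lambda>x. c *\<^sub>C partials E js \<phi> x) = (\<lambda>x. (inverse \<i> * c) *\<^sub>C partials E (j # js) \<phi> x)" for j c js
  proof
    fix x
    have hp: "has_partial E j (\<lambda>x. c *\<^sub>C partials E js \<phi> x) x (c *\<^sub>C partials E (j # js) \<phi> x)"
      by (rule has_partial_linear[OF lcs_axioms _ _ smoothD(3)[OF \<phi>] smoothD(2)[OF \<phi>]])
        (auto intro!: continuous_map_scaleC simp: clinear_on_def scaleC_add_right scaleC_scaleC mult.commute)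
    show "D_op E j (\<lambda>x. c *\<^sub>C partials E js \<phi> x) x = (inverse \<i> * c) *\<^sub>C partials E (j # js) \<phi> x"
      unfolding D_op_def partial_eq[OF hp] by (simp only: scaleC_scaleC)
  qed
  have 2: "(D_op E j ^^ n) (\<lambda>x. c *\<^sub>C partials E js \<phi> x) =
      (\<lambda>x. ((inverse \<i>) ^ n * c) *\<^sub>C partials E (replicate n j @ js) \<phi> x)" for j n c js
    by (induction n) (simp_all add: 1 mult.assoc del: foldr_Cons foldr_append inverse_i)
  have 3: "foldr (\<lambda>j. D_op E j ^^ \<alpha> j) L \<phi> = (\<lambda>x. (inverse \<i>) ^ sum_list (map \<alpha> L) *\<^sub>C
      partials E (concat (map (\<lambda>j. replicate (\<alpha> j) j) L)) \<phi> x)" for L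
    by (induction L) (simp_all add: 2 power_add scaleC_one del: foldr_append inverse_i)
  have "sum_list (map \<alpha> (sorted_list_of_set UNIV)) = multi_size \<alpha>"
    using length_multi_list[of \<alpha>] unfolding multi_list_def by (simp add: length_concat o_def)
  then show ?thesis unfolding D_multi_def 3 multi_list_def by simp
qed

lemma D_multi_in: "smooth E \<phi> \<Longrightarrow> D_multi E \<alpha> \<phi> x \<in> topspace E"
  unfolding D_multi_eq by (intro scaleC_in smoothD(3))

end

lemma lcs_complex: "lcs (euclidean :: complex topology)"
proof
  have "continuous_map euclidean euclidean (\<lambda>(x, y). x + y :: complex)"
    by (auto simp: case_prod_beta intro!: continuous_intros)
  moreover have "continuous_map euclidean euclidean (\<lambda>(c, x). c *\<^sub>C x :: complex)"
    by (auto simp: case_prod_beta scaleC_complex_def intro!: continuous_intros)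
  moreover have "\<exists>V. open V \<and> 0 \<in> V \<and> convex V \<and> V \<subseteq> U" if U: "open U" "0 \<in> U" for U :: "complex set"
  proof -
    obtain e where "e > 0" "ball 0 e \<subseteq> U" using U open_contains_ball by blast
    then show ?thesis by (intro exI[of _ "ball 0 e"]) auto
  qed
  ultimately show "locally_convex_space (euclidean :: complex topology)"
    unfolding locally_convex_space_def prod_topology_euclidean
    by (auto simp: complex_vector.subspace_UNIV)
qed

interpretation complex: lcs "euclidean :: complex topology" by (rule lcs_complex)

lemma (in lcs) dual_continuous_map: "f \<in> dual E \<Longrightarrow> continuous_map E euclidean f"
  unfolding dual_def by auto

lemma (in lcs) smooth_dual:
  assumes f: "f \<in> dual E" and \<phi>: "smooth E \<phi>"
  shows "smooth euclidean (\<lambda>x. f (\<phi> x))" "partials euclidean js (\<lambda>x. f (\<phi> x)) = (\<lambda>x. f (partials E js \<phi> x))"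
  using smooth_linear[OF lcs_complex dual_continuous_map[OF f] dual_clinear[OF f] \<phi>] by blast+

lemma (in lcs) D_multi_dual:
  assumes f: "f \<in> dual E" and \<phi>: "smooth E \<phi>"
  shows "D_multi euclidean \<alpha> (\<lambda>x. f (\<phi> x)) x = f (D_multi E \<alpha> \<phi> x)"
  unfolding D_multi_eq[OF \<phi>] complex.D_multi_eq[OF smooth_dual(1)[OF f \<phi>]] smooth_dual(2)[OF f \<phi>]
  using dual_scaleC_apply[OF f smoothD(3)[OF \<phi>]] by (simp add: scaleC_complex_def)

section \<open>Partial derivatives of complex-valued functions\<close>

abbreviation pd :: "'d::finite list \<Rightarrow> (real^'d \<Rightarrow> complex) \<Rightarrow> real^'d \<Rightarrow> complex" where
  "pd js \<phi> \<equiv> partials euclidean js \<phi>"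

lemma has_partial_iff_vector_derivative:
  "has_partial euclidean j \<phi> x l \<longleftrightarrow>
   ((\<lambda>h. \<phi> (x + h *\<^sub>R axis j 1)) has_vector_derivative l) (at 0)" for \<phi> :: "real^'d \<Rightarrow> complex"
proof -
  let ?q = "\<lambda>h. (\<phi> (x + h *\<^sub>R axis j 1) - \<phi> x) /\<^sub>R h"
  have "((\<lambda>h. \<phi> (x + h *\<^sub>R axis j 1)) has_vector_derivative l) (at 0) \<longleftrightarrow>
      ((\<lambda>h. norm (\<phi> (x + h *\<^sub>R axis j 1) - \<phi> x - h *\<^sub>R l) / norm h) \<longlongrightarrow> 0) (at 0)"
    unfolding has_vector_derivative_def has_derivative_at by (simp add: bounded_linear_scaleR_left)
  also have "\<dots> \<longleftrightarrow> ((\<lambda>h. norm (?q h - l)) \<longlongrightarrow> 0) (at 0)"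
  proof (rule tendsto_cong)
    have "norm (\<phi> (x + h *\<^sub>R axis j 1) - \<phi> x - h *\<^sub>R l) / norm h = norm (?q h - l)" if h: "h \<noteq> 0" for h
    proof -
      have "?q h - l = (\<phi> (x + h *\<^sub>R axis j 1) - \<phi> x - h *\<^sub>R l) /\<^sub>R h"
        using h by (simp add: scaleR_diff_right)
      then show ?thesis by (simp add: divide_inverse_commute)
    qed
    then show "\<forall>\<^sub>F h in at 0. norm (\<phi> (x + h *\<^sub>R axis j 1) - \<phi> x - h *\<^sub>R l) / norm h = norm (?q h - l)"
      by (auto simp: eventually_at_filter)
  qed
  also have "\<dots> \<longleftrightarrow> (?q \<longlongrightarrow> l) (at 0)"
    unfolding tendsto_norm_zero_iff by (rule Lim_null[symmetric])
  finally show ?thesis unfolding has_partial_def by simp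
qed

lemma line_derivative:
  assumes "smooth euclidean \<phi>"
  shows "((\<lambda>t. pd js \<phi> (x + t *\<^sub>R axis j 1)) has_vector_derivative pd (j # js) \<phi> (x + s *\<^sub>R axis j 1)) (at s)"
proof -
  have "((\<lambda>h. pd js \<phi> ((x + s *\<^sub>R axis j 1) + h *\<^sub>R axis j 1)) has_vector_derivative
      pd (j # js) \<phi> (x + s *\<^sub>R axis j 1)) (at (s - s))"
    using complex.smoothD(2)[OF assms, of j js "x + s *\<^sub>R axis j 1"]
    unfolding has_partial_iff_vector_derivative by simp
  moreover have "((\<lambda>t::real. t - s) has_vector_derivative 1) (at s)"
    by (auto intro!: derivative_eq_intros)
  ultimately have "((\<lambda>h. pd js \<phi> ((x + s *\<^sub>R axis j 1) + h *\<^sub>R axis j 1)) \<circ> (\<lambda>t. t - s)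
      has_vector_derivative 1 *\<^sub>R pd (j # js) \<phi> (x + s *\<^sub>R axis j 1)) (at s)"
    by (intro vector_diff_chain_at)
  moreover have "(\<lambda>h. pd js \<phi> ((x + s *\<^sub>R axis j 1) + h *\<^sub>R axis j 1)) \<circ> (\<lambda>t. t - s) =
      (\<lambda>t. pd js \<phi> (x + t *\<^sub>R axis j 1))"
    by (auto simp: fun_eq_iff algebra_simps)
  ultimately show ?thesis by simp
qed

lemma vector_derivative_bound:
  fixes f :: "real \<Rightarrow> 'a::real_normed_vector"
  assumes S: "convex S" and d: "\<And>t. t \<in> S \<Longrightarrow> (f has_vector_derivative f' t) (at t)"
    and B: "\<And>t. t \<in> S \<Longrightarrow> norm (f' t) \<le> B" and ab: "a \<in> S" "b \<in> S"
  shows "norm (f a - f b) \<le> B * \<bar>a - b\<bar>"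
proof -
  have "norm (f a - f b) \<le> B * norm (a - b)"
  proof (rule differentiable_bound[OF S _ _ ab, where f' = "\<lambda>t h. h *\<^sub>R f' t"])
    fix t assume t: "t \<in> S"
    show "(f has_derivative (\<lambda>h. h *\<^sub>R f' t)) (at t within S)"
      using d[OF t] unfolding has_vector_derivative_def by (rule has_derivative_at_withinI)
    show "onorm (\<lambda>h. h *\<^sub>R f' t) \<le> B"
    proof (rule onorm_le)
      fix h :: real
      show "norm (h *\<^sub>R f' t) \<le> B * norm h"
        using B[OF t] by (simp add: mult.commute[of "\<bar>h\<bar>"] mult_right_mono)
    qed
  qed
  then show ?thesis by simp
qed

lemma increment_bound:
  assumes \<phi>: "smooth euclidean \<phi>" and B: "\<And>y. cmod (pd (j # js) \<phi> y) \<le> B"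
  shows "cmod (pd js \<phi> (x + h *\<^sub>R axis j 1) - pd js \<phi> x) \<le> B * \<bar>h\<bar>"
  using vector_derivative_bound[OF convex_UNIV line_derivative[OF \<phi>, of js x j] B, of h 0] by simp

subsection \<open>Symmetry of the mixed partial derivatives\<close>

text \<open>
  The mean value inequality, once in each direction, compares the second difference with the mixed
  derivative. As the second difference is symmetric, so is the mixed derivative.
\<close>

lemma mixed_difference:
  fixes \<phi> :: "real^'d \<Rightarrow> complex"
  assumes \<phi>: "smooth euclidean \<phi>" and e: "e > 0"
  obtains d where "d > 0" "\<forall>s t. \<bar>s\<bar> < d \<and> \<bar>t\<bar> < d \<longrightarrow>
    cmod (pd js \<phi> (x + s *\<^sub>R axis i 1 + t *\<^sub>R axis j 1) - pd js \<phi> (x + s *\<^sub>R axis i 1)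
      - pd js \<phi> (x + t *\<^sub>R axis j 1) + pd js \<phi> x - (s * t) *\<^sub>R pd (i # j # js) \<phi> x) \<le> e * \<bar>s\<bar> * \<bar>t\<bar>"
proof -
  define L where "L = pd (i # j # js) \<phi> x"
  define a b :: "real^'d" where "a = axis i 1" and "b = axis j 1"
  define g where "g = pd js \<phi>"
  define g' where "g' = pd (j # js) \<phi>"
  have "isCont (pd (i # j # js) \<phi>) x"
    using complex.smoothD(1)[OF \<phi>, of "i # j # js"] by (simp add: continuous_on_eq_continuous_at del: foldr_Cons)
  then obtain d0 where d0: "d0 > 0" "\<And>y. dist y x < d0 \<Longrightarrow> dist (pd (i # j # js) \<phi> y) L < e"
    unfolding continuous_at_eps_delta L_def using e by (auto simp del: foldr_Cons)
  define d where "d = d0 / 2"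
  have d: "d > 0" using d0 unfolding d_def by simp
  have step: "cmod (g' (x + t *\<^sub>R b + s *\<^sub>R a) - g' (x + t *\<^sub>R b) - s *\<^sub>R L) \<le> e * \<bar>s\<bar>"
    if st: "\<bar>s\<bar> < d" "\<bar>t\<bar> < d" for s t
  proof -
    have "cmod ((g' (x + t *\<^sub>R b + s *\<^sub>R a) - s *\<^sub>R L) - (g' (x + t *\<^sub>R b + 0 *\<^sub>R a) - 0 *\<^sub>R L)) \<le> e * \<bar>s - 0\<bar>"
    proof (rule vector_derivative_bound[of "{-d<..<d}"
        "\<lambda>s. g' (x + t *\<^sub>R b + s *\<^sub>R a) - s *\<^sub>R L" "\<lambda>s. pd (i # j # js) \<phi> (x + t *\<^sub>R b + s *\<^sub>R a) - L"])
      fix r assume r: "r \<in> {-d<..<d}"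
      have "((\<lambda>s. s *\<^sub>R L) has_vector_derivative 1 *\<^sub>R L) (at r)"
        by (auto simp: has_vector_derivative_def intro!: derivative_eq_intros)
      then show "((\<lambda>s. g' (x + t *\<^sub>R b + s *\<^sub>R a) - s *\<^sub>R L) has_vector_derivative
          pd (i # j # js) \<phi> (x + t *\<^sub>R b + r *\<^sub>R a) - L) (at r)"
        unfolding g'_def a_def using has_vector_derivative_diff[OF line_derivative[OF \<phi>, of "j # js" "x + t *\<^sub>R b" i r]]
        by (simp del: foldr_Cons)
      have "norm (t *\<^sub>R b + r *\<^sub>R a) \<le> \<bar>t\<bar> + \<bar>r\<bar>"
        using norm_triangle_ineq[of "t *\<^sub>R b" "r *\<^sub>R a"] unfolding a_def b_def by simp
      also have "\<dots> < d0" using r st unfolding d_def by auto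
      finally have "dist (x + t *\<^sub>R b + r *\<^sub>R a) x < d0" by (simp add: dist_norm)
      from d0(2)[OF this] show "cmod (pd (i # j # js) \<phi> (x + t *\<^sub>R b + r *\<^sub>R a) - L) \<le> e"
        by (simp add: dist_norm del: foldr_Cons)
    qed (use st d in auto)
    then show ?thesis by (simp add: algebra_simps)
  qed
  have "cmod (g (x + s *\<^sub>R a + t *\<^sub>R b) - g (x + s *\<^sub>R a) - g (x + t *\<^sub>R b) + g x - (s * t) *\<^sub>R L) \<le> e * \<bar>s\<bar> * \<bar>t\<bar>"
    if st: "\<bar>s\<bar> < d" "\<bar>t\<bar> < d" for s t
  proof -
    have "cmod ((g (x + s *\<^sub>R a + t *\<^sub>R b) - g (x + t *\<^sub>R b) - t *\<^sub>R (s *\<^sub>R L))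
        - (g (x + s *\<^sub>R a + 0 *\<^sub>R b) - g (x + 0 *\<^sub>R b) - 0 *\<^sub>R (s *\<^sub>R L))) \<le> (e * \<bar>s\<bar>) * \<bar>t - 0\<bar>"
    proof (rule vector_derivative_bound[of "{-d<..<d}"
        "\<lambda>t. g (x + s *\<^sub>R a + t *\<^sub>R b) - g (x + t *\<^sub>R b) - t *\<^sub>R (s *\<^sub>R L)"
        "\<lambda>t. g' (x + s *\<^sub>R a + t *\<^sub>R b) - g' (x + t *\<^sub>R b) - s *\<^sub>R L"])
      fix r assume r: "r \<in> {-d<..<d}"
      have lin: "((\<lambda>t. t *\<^sub>R (s *\<^sub>R L)) has_vector_derivative s *\<^sub>R L) (at r)"
        unfolding has_vector_derivative_def
        by (rule bounded_linear_imp_has_derivative[OF bounded_linear_scaleR_left])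
      have line: "((\<lambda>t. g (y + t *\<^sub>R b)) has_vector_derivative g' (y + r *\<^sub>R b)) (at r)" for y
        unfolding g_def g'_def b_def by (rule line_derivative[OF \<phi>])
      show "((\<lambda>t. g (x + s *\<^sub>R a + t *\<^sub>R b) - g (x + t *\<^sub>R b) - t *\<^sub>R (s *\<^sub>R L)) has_vector_derivative
          g' (x + s *\<^sub>R a + r *\<^sub>R b) - g' (x + r *\<^sub>R b) - s *\<^sub>R L) (at r)"
        by (rule has_vector_derivative_diff[OF has_vector_derivative_diff[OF line line] lin])
      show "cmod (g' (x + s *\<^sub>R a + r *\<^sub>R b) - g' (x + r *\<^sub>R b) - s *\<^sub>R L) \<le> e * \<bar>s\<bar>"
      proof -
        have "\<bar>r\<bar> < d" using r by auto
        then show ?thesis using step[of s r] st by (simp add: add_ac)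
      qed
    qed (use st d in auto)
    then show ?thesis by (simp add: algebra_simps)
  qed
  then show ?thesis using that[OF d] unfolding g_def a_def b_def L_def by blast
qed

lemma pd_swap:
  fixes \<phi> :: "real^'d \<Rightarrow> complex"
  assumes \<phi>: "smooth euclidean \<phi>"
  shows "pd (i # j # js) \<phi> = pd (j # i # js) \<phi>"
proof
  fix x
  define L where "L = pd (i # j # js) \<phi> x"
  define L' where "L' = pd (j # i # js) \<phi> x"
  have "cmod (L - L') \<le> 0 + e" if e: "e > 0" for e
  proof -
    have e2: "e / 2 > 0" using e by simp
    obtain d where d: "d > 0" "\<forall>s t. \<bar>s\<bar> < d \<and> \<bar>t\<bar> < d \<longrightarrow>
      cmod (pd js \<phi> (x + s *\<^sub>R axis i 1 + t *\<^sub>R axis j 1) - pd js \<phi> (x + s *\<^sub>R axis i 1)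
      - pd js \<phi> (x + t *\<^sub>R axis j 1) + pd js \<phi> x - (s * t) *\<^sub>R L) \<le> e/2 * \<bar>s\<bar> * \<bar>t\<bar>"
      using mixed_difference[OF \<phi> e2, of js x i j] unfolding L_def by blast
    obtain d' where d': "d' > 0" "\<forall>s t. \<bar>s\<bar> < d' \<and> \<bar>t\<bar> < d' \<longrightarrow>
      cmod (pd js \<phi> (x + s *\<^sub>R axis j 1 + t *\<^sub>R axis i 1) - pd js \<phi> (x + s *\<^sub>R axis j 1)
      - pd js \<phi> (x + t *\<^sub>R axis i 1) + pd js \<phi> x - (s * t) *\<^sub>R L') \<le> e/2 * \<bar>s\<bar> * \<bar>t\<bar>"
      using mixed_difference[OF \<phi> e2, of js x j i] unfolding L'_def by blast
    define s where "s = min d d' / 2"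
    have s: "s > 0" "\<bar>s\<bar> < d" "\<bar>s\<bar> < d'" using d d' unfolding s_def by auto
    define Y where "Y = pd js \<phi> (x + s *\<^sub>R axis i 1 + s *\<^sub>R axis j 1) - pd js \<phi> (x + s *\<^sub>R axis i 1)
      - pd js \<phi> (x + s *\<^sub>R axis j 1) + pd js \<phi> x"
    have 1: "cmod (Y - (s * s) *\<^sub>R L) \<le> e/2 * \<bar>s\<bar> * \<bar>s\<bar>" using d(2) s unfolding Y_def by blast
    have "cmod (pd js \<phi> (x + s *\<^sub>R axis j 1 + s *\<^sub>R axis i 1) - pd js \<phi> (x + s *\<^sub>R axis j 1)
      - pd js \<phi> (x + s *\<^sub>R axis i 1) + pd js \<phi> x - (s * s) *\<^sub>R L') \<le> e/2 * \<bar>s\<bar> * \<bar>s\<bar>"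
      using d'(2) s by blast
    then have 2: "cmod (Y - (s * s) *\<^sub>R L') \<le> e/2 * \<bar>s\<bar> * \<bar>s\<bar>" unfolding Y_def by (simp add: algebra_simps)
    have "(s * s) * cmod (L - L') = cmod ((Y - (s * s) *\<^sub>R L') - (Y - (s * s) *\<^sub>R L))"
      using s by (simp add: flip: scaleR_diff_right)
    also have "\<dots> \<le> (s * s) * e" using norm_triangle_ineq4[of "Y - (s * s) *\<^sub>R L'" "Y - (s * s) *\<^sub>R L"] 1 2 s
      by (simp add: field_simps)
    finally show ?thesis using s by simp
  qed
  then have "cmod (L - L') \<le> 0" by (rule field_le_epsilon)
  then show "pd (i # j # js) \<phi> x = pd (j # i # js) \<phi> x" unfolding L_def L'_def by simp
qed

lemma pd_mset:
  fixes \<phi> :: "real^'d \<Rightarrow> complex"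
  assumes \<phi>: "smooth euclidean \<phi>" and "mset js = mset js'"
  shows "pd js \<phi> = pd js' \<phi>"
proof -
  have move: "pd (us @ a # vs) \<phi> = pd (a # us @ vs) \<phi>" for us a vs
  proof (induction us)
    case (Cons u us)
    have "pd ((u # us) @ a # vs) \<phi> = partial euclidean u (pd (us @ a # vs) \<phi>)" by simp
    also have "\<dots> = pd (u # a # us @ vs) \<phi>" unfolding Cons.IH by simp
    also have "\<dots> = pd (a # u # us @ vs) \<phi>" by (rule pd_swap[OF \<phi>])
    finally show ?case by simp
  qed simp
  show ?thesis using assms(2)
  proof (induction js arbitrary: js')
    case (Cons a js)
    then have "a \<in> set js'" by (metis list.set_intros(1) mset_eq_setD)
    then obtain us vs where js': "js' = us @ a # vs" by (meson split_list)
    then have "mset js = mset (us @ vs)" using Cons.prems by simp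
    then have "pd js \<phi> = pd (us @ vs) \<phi>" by (rule Cons.IH)
    then have "pd (a # js) \<phi> = pd (a # us @ vs) \<phi>" by simp
    then show ?case unfolding js' move .
  qed simp
qed

subsection \<open>Products\<close>

fun splits :: "'a list \<Rightarrow> ('a list \<times> 'a list) list" where
  "splits [] = [([], [])]"
| "splits (j # js) = map (\<lambda>(a, b). (j # a, b)) (splits js) @ map (\<lambda>(a, b). (a, j # b)) (splits js)"

lemma length_splits: "length (splits js) = 2 ^ length js"
  by (induction js) auto

lemma splits_length: "(a, b) \<in> set (splits js) \<Longrightarrow> length a + length b = length js"
  by (induction js arbitrary: a b) auto

lemma smooth_mult:
  fixes f g :: "real^'d \<Rightarrow> complex"
  assumes f: "smooth euclidean f" and g: "smooth euclidean g"
  shows "smooth euclidean (\<lambda>x. f x * g x)"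
    and "pd js (\<lambda>x. f x * g x) = (\<lambda>x. \<Sum>(a, b)\<leftarrow>splits js. pd a f x * pd b g x)"
proof -
  define G where "G js = (\<lambda>x. \<Sum>(a, b)\<leftarrow>splits js. pd a f x * pd b g x)" for js
  have cont: "continuous_on UNIV (\<lambda>x. \<Sum>(a, b)\<leftarrow>L. pd a f x * pd b g x)" for L
  proof (induction L)
    case (Cons p L)
    obtain a b where p: "p = (a, b)" by force
    have "continuous_on UNIV (pd a f)" "continuous_on UNIV (pd b g)"
      using complex.smoothD(1)[OF f] complex.smoothD(1)[OF g] by auto
    then show ?case using Cons by (auto simp: p intro!: continuous_intros)
  qed simp
  have prod: "has_partial euclidean j (\<lambda>x. pd a f x * pd b g x) x
      (pd (j # a) f x * pd b g x + pd a f x * pd (j # b) g x)" for j a b x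
    using has_vector_derivative_mult[OF
        complex.smoothD(2)[OF f, unfolded has_partial_iff_vector_derivative]
        complex.smoothD(2)[OF g, unfolded has_partial_iff_vector_derivative], of a x j b]
    unfolding has_partial_iff_vector_derivative by (simp add: add.commute del: foldr_Cons)
  have "has_partial euclidean j (\<lambda>x. \<Sum>(a, b)\<leftarrow>L. pd a f x * pd b g x) x
      (\<Sum>(a, b)\<leftarrow>map (\<lambda>(a, b). (j # a, b)) L @ map (\<lambda>(a, b). (a, j # b)) L. pd a f x * pd b g x)" for L j x
  proof (induction L)
    case Nil
    show ?case unfolding has_partial_iff_vector_derivative by simp
  next
    case (Cons p L)
    obtain a b where p: "p = (a, b)" by force
    show ?case
      using has_vector_derivative_add[OF prod[of j a b x, unfolded has_partial_iff_vector_derivative]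
          Cons.IH[unfolded has_partial_iff_vector_derivative]]
      unfolding has_partial_iff_vector_derivative by (simp add: p algebra_simps del: foldr_Cons)
  qed
  then have der: "has_partial euclidean j (G js) x (G (j # js) x)" for j js x
    unfolding G_def by (simp del: foldr_Cons map_append)
  have c: "continuous_map euclidean euclidean (G js)" for js unfolding G_def using cont by simp
  show "smooth euclidean (\<lambda>x. f x * g x)" by (rule complex.smoothI(1)[OF _ c der]) (simp add: G_def)
  show "pd js (\<lambda>x. f x * g x) = (\<lambda>x. \<Sum>(a, b)\<leftarrow>splits js. pd a f x * pd b g x)"
    using complex.smoothI(2)[OF _ c der, of "\<lambda>x. f x * g x" js] by (simp add: G_def)
qed

lemma pd_mult_bound:
  fixes f g :: "real^'d \<Rightarrow> complex"
  assumes f: "smooth euclidean f" and g: "smooth euclidean g"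
    and C: "\<And>a b. length a + length b = length js \<Longrightarrow> cmod (pd a f x) * cmod (pd b g x) \<le> C"
  shows "cmod (pd js (\<lambda>x. f x * g x) x) \<le> 2 ^ length js * C"
proof -
  have "cmod (\<Sum>(a, b)\<leftarrow>L. pd a f x * pd b g x) \<le> real (length L) * C"
    if "\<And>a b. (a, b) \<in> set L \<Longrightarrow> length a + length b = length js" for L
    using that
  proof (induction L)
    case (Cons p L)
    obtain a b where p: "p = (a, b)" by force
    have "cmod (pd a f x * pd b g x + (\<Sum>(a, b)\<leftarrow>L. pd a f x * pd b g x)) \<le>
        cmod (pd a f x) * cmod (pd b g x) + cmod (\<Sum>(a, b)\<leftarrow>L. pd a f x * pd b g x)"
      by (rule order_trans[OF norm_triangle_ineq]) (simp add: norm_mult)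
    also have "\<dots> \<le> C + real (length L) * C"
      using Cons C[of a b] p by (intro add_mono) auto
    finally show ?case by (simp add: p algebra_simps)
  qed simp
  from this[of "splits js", OF splits_length] show ?thesis
    unfolding smooth_mult(2)[OF f g] length_splits by simp
qed

section \<open>Ultradifferentiable cutoff functions\<close>

subsection \<open>Moving averages\<close>

text \<open>
  The mean of \<open>f\<close> over the interval from \<open>x - a\<close> to \<open>x\<close>, written with an antiderivative so that the
  mean value theorem yields all the estimates.
\<close>

definition antiderivative :: "(real \<Rightarrow> real) \<Rightarrow> real \<Rightarrow> real" where
  "antiderivative f = (SOME F. \<forall>x. (F has_real_derivative f x) (at x))"

definition moving_average :: "real \<Rightarrow> (real \<Rightarrow> real) \<Rightarrow> real \<Rightarrow> real" where
  "moving_average a f x = (antiderivative f x - antiderivative f (x - a)) / a"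

lemma antiderivative:
  assumes "continuous_on UNIV f"
  shows "(antiderivative f has_real_derivative f x) (at x)"
proof -
  have "\<exists>F. \<forall>x :: real. - \<infinity> < ereal x \<longrightarrow> ereal x < \<infinity> \<longrightarrow> (F has_vector_derivative f x) (at x)"
    by (rule einterval_antiderivative) (use assms in \<open>auto simp: continuous_on_eq_continuous_at\<close>)
  then have "\<exists>F. \<forall>x. (F has_real_derivative f x) (at x)"
    by (simp add: has_real_derivative_iff_has_vector_derivative)
  then have "\<forall>x. (antiderivative f has_real_derivative f x) (at x)"
    unfolding antiderivative_def by (rule someI_ex)
  then show ?thesis by blast
qed

lemma antiderivative_shift:
  assumes "continuous_on UNIV f"
  shows "((\<lambda>x. antiderivative f (x + c)) has_real_derivative f (x + c)) (at x)"
  using DERIV_shift[of "antiderivative f" "f (x + c)" x c] antiderivative[OF assms, of "x + c"] by simp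

lemma moving_average_derivative:
  assumes "continuous_on UNIV f"
  shows "(moving_average a f has_real_derivative (f x - f (x - a)) / a) (at x)"
proof -
  have "((\<lambda>x. (antiderivative f x - antiderivative f (x + - a)) / a) has_real_derivative (f x - f (x + - a)) / a) (at x)"
    by (intro DERIV_cdivide DERIV_diff antiderivative[OF assms] antiderivative_shift[OF assms])
  then show ?thesis unfolding moving_average_def[abs_def] by simp
qed

lemma moving_average_value:
  assumes "a > 0" "continuous_on UNIV f"
  obtains z where "x - a < z" "z < x" "moving_average a f x = f z"
proof -
  obtain z where z: "x - a < z" "z < x" "antiderivative f x - antiderivative f (x - a) = (x - (x - a)) * f z"
    using MVT2[of "x - a" x "antiderivative f" f] antiderivative[OF assms(2)] assms(1) by auto
  then show ?thesis using that[of z] assms(1) unfolding moving_average_def by simp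
qed

text \<open>The mean value theorem also compares the averages of two functions, at two places.\<close>

lemma moving_average_diff:
  assumes a: "a > 0" and f: "continuous_on UNIV f" and g: "continuous_on UNIV g"
  obtains z where "moving_average a f (x + c) - moving_average a g x = f (z + c) - g z"
proof -
  let ?F = "\<lambda>t. antiderivative f (t + c) - antiderivative g t"
  obtain z where z: "?F x - ?F (x - a) = (x - (x - a)) * (f (z + c) - g z)"
    using MVT2[of "x - a" x ?F "\<lambda>t. f (t + c) - g t"]
      DERIV_diff[OF antiderivative_shift[OF f] antiderivative[OF g]] a by auto
  have eq: "x - a + c = x + c - a" by simp
  have "moving_average a f (x + c) - moving_average a g x = (?F x - ?F (x - a)) / a"
    unfolding moving_average_def eq by (simp add: diff_divide_distrib)
  also have "\<dots> = f (z + c) - g z" unfolding z using a by simp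
  finally show ?thesis using that by blast
qed

subsection \<open>Infinitely many moving averages\<close>

locale averaging =
  fixes a :: "nat \<Rightarrow> real" and f0 :: "real \<Rightarrow> real"
  assumes a_pos: "\<And>i. a i > 0" and a_sum: "summable a"
    and f0_lip: "\<And>x y. \<bar>f0 x - f0 y\<bar> \<le> \<bar>x - y\<bar>"
begin

text \<open>The average over the interval of length \<open>a k\<close> is the outermost one, that of length \<open>a (k + m - 1)\<close> the innermost.\<close>

fun stage :: "nat \<Rightarrow> nat \<Rightarrow> real \<Rightarrow> real" where
  "stage k 0 = f0"
| "stage k (Suc m) = moving_average (a k) (stage (Suc k) m)"

definition limit_stage :: "nat \<Rightarrow> real \<Rightarrow> real" where
  "limit_stage k x = f0 x + (\<Sum>m. stage k (Suc m) x - stage k m x)"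

lemma lip_continuous:
  assumes "\<And>x y. \<bar>f x - f y\<bar> \<le> \<bar>x - y :: real\<bar>" shows "continuous_on UNIV (f :: real \<Rightarrow> real)"
proof (rule continuous_onI)
  fix x e :: real assume "e > 0"
  moreover have "dist (f x') (f x) \<le> e" if "dist x' x < e" for x'
    using assms[of x' x] that by (simp add: dist_real_def)
  ultimately show "\<exists>d>0. \<forall>x'\<in>UNIV. dist x' x < d \<longrightarrow> dist (f x') (f x) \<le> e" by blast
qed

lemma stage_lip: "\<bar>stage k m x - stage k m y\<bar> \<le> \<bar>x - y\<bar>"
proof (induction m arbitrary: k x y)
  case (Suc m)
  have c: "continuous_on UNIV (stage (Suc k) m)" by (rule lip_continuous) (rule Suc.IH)
  obtain z where "moving_average (a k) (stage (Suc k) m) (y + (x - y)) - moving_average (a k) (stage (Suc k) m) y =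
      stage (Suc k) m (z + (x - y)) - stage (Suc k) m z"
    using moving_average_diff[OF a_pos c c] .
  then show ?case using Suc.IH[of "Suc k" "z + (x - y)" z] by simp
qed (use f0_lip in simp)

lemma stage_cont: "continuous_on UNIV (stage k m)"
  by (rule lip_continuous) (rule stage_lip)

text \<open>
  The two stages differ in the innermost average only, which is over an interval of length
  \<open>a (k + m)\<close> and is applied to the Lipschitz function \<open>f0\<close>.
\<close>

lemma stage_step: "\<bar>stage k (Suc m) x - stage k m x\<bar> \<le> a (k + m)"
proof (induction m arbitrary: k x)
  case 0
  obtain z where z: "x - a k < z" "z < x" "moving_average (a k) (stage (Suc k) 0) x = stage (Suc k) 0 z"
    using moving_average_value[OF a_pos stage_cont] .
  then show ?case using f0_lip[of z x] by simp
next
  case (Suc m)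
  obtain z where "moving_average (a k) (stage (Suc k) (Suc m)) (x + 0) - moving_average (a k) (stage (Suc k) m) x =
      stage (Suc k) (Suc m) (z + 0) - stage (Suc k) m z"
    using moving_average_diff[OF a_pos stage_cont stage_cont] .
  then show ?case using Suc.IH[of "Suc k" z] by simp
qed

lemma stage_value: "\<exists>z. x - (\<Sum>i<m. a (k + i)) \<le> z \<and> z \<le> x \<and> stage k m x = f0 z"
proof (induction m arbitrary: k x)
  case (Suc m)
  obtain y where y: "x - a k < y" "y < x" "moving_average (a k) (stage (Suc k) m) x = stage (Suc k) m y"
    using moving_average_value[OF a_pos stage_cont] .
  obtain z where "y - (\<Sum>i<m. a (Suc k + i)) \<le> z" "z \<le> y" "stage (Suc k) m y = f0 z"
    using Suc.IH[where k = "Suc k" and x = y] by blast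
  moreover have "(\<Sum>i<Suc m. a (k + i)) = a k + (\<Sum>i<m. a (Suc k + i))"
    by (subst sum.lessThan_Suc_shift) simp
  ultimately show ?case using y by (intro exI[of _ z]) auto
qed auto

lemma tail: "summable (\<lambda>i. a (k + i))"
  using a_sum by (simp add: add.commute)

lemma limit_stage_LIMSEQ: "(\<lambda>m. stage k m x) \<longlonglongrightarrow> limit_stage k x"
  and limit_stage_dist: "\<bar>limit_stage k x - stage k m x\<bar> \<le> (\<Sum>i. a (k + (i + m)))"
proof -
  define d where "d m = stage k (Suc m) x - stage k m x" for m
  have le: "norm (d m) \<le> a (k + m)" for m unfolding d_def using stage_step by simp
  have d: "summable d" "summable (\<lambda>m. norm (d m))"
    using summable_comparison_test'[OF tail le] summable_comparison_test'[OF tail, of 0 "\<lambda>m. norm (d m)"] le by auto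
  have tele: "stage k m x = f0 x + sum d {..<m}" for m
    unfolding d_def using sum_lessThan_telescope[of "\<lambda>m. stage k m x" m] by (simp del: stage.simps(2))
  have lim: "limit_stage k x = f0 x + suminf d" unfolding limit_stage_def d_def[abs_def] ..
  have "(\<lambda>m. f0 x + sum d {..<m}) \<longlonglongrightarrow> f0 x + suminf d"
    by (intro tendsto_add tendsto_const summable_LIMSEQ d)
  then show "(\<lambda>m. stage k m x) \<longlonglongrightarrow> limit_stage k x" by (simp only: tele lim)
  have "limit_stage k x - stage k m x = (\<Sum>i. d (i + m))"
    unfolding tele[of m] lim using suminf_split_initial_segment[OF d(1), of m] by simp
  also have "\<bar>\<dots>\<bar> \<le> (\<Sum>i. norm (d (i + m)))"
    using summable_norm[OF summable_ignore_initial_segment[OF d(2), of m]] by simp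
  also have "\<dots> \<le> (\<Sum>i. a (k + (i + m)))"
    by (rule suminf_le[OF le summable_ignore_initial_segment[OF d(2)] summable_ignore_initial_segment[OF tail]])
  finally show "\<bar>limit_stage k x - stage k m x\<bar> \<le> (\<Sum>i. a (k + (i + m)))" .
qed

lemma limit_stage_lip: "\<bar>limit_stage k x - limit_stage k y\<bar> \<le> \<bar>x - y\<bar>"
  by (rule tendsto_upperbound[OF tendsto_rabs[OF tendsto_diff[OF limit_stage_LIMSEQ limit_stage_LIMSEQ]]])
    (simp_all add: stage_lip)

lemma limit_stage_cont: "continuous_on UNIV (limit_stage k)"
  by (rule lip_continuous) (rule limit_stage_lip)

text \<open>The stages converge uniformly, so the outermost average passes to the limit.\<close>

lemma limit_stage_unfold: "limit_stage k = moving_average (a k) (limit_stage (Suc k))"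
proof
  fix x
  have "(\<lambda>m. stage k (Suc m) x) \<longlonglongrightarrow> moving_average (a k) (limit_stage (Suc k)) x"
  proof (rule LIM_zero_cancel, rule Lim_null_comparison)
    have "norm (stage k (Suc m) x - moving_average (a k) (limit_stage (Suc k)) x) \<le> (\<Sum>i. a (Suc k + (i + m)))" for m
    proof -
      obtain z where "moving_average (a k) (stage (Suc k) m) (x + 0) - moving_average (a k) (limit_stage (Suc k)) x =
          stage (Suc k) m (z + 0) - limit_stage (Suc k) z"
        using moving_average_diff[OF a_pos stage_cont limit_stage_cont] .
      then show ?thesis using limit_stage_dist[of "Suc k" z m] by (simp add: abs_minus_commute)
    qed
    then show "\<forall>\<^sub>F m in sequentially. norm (stage k (Suc m) x - moving_average (a k) (limit_stage (Suc k)) x)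
        \<le> (\<Sum>i. a (Suc k + (i + m)))" by auto
    show "(\<lambda>m. \<Sum>i. a (Suc k + (i + m))) \<longlonglongrightarrow> 0"
      using suminf_exist_split2[OF tail[of "Suc k"]] by simp
  qed
  moreover have "(\<lambda>m. stage k (Suc m) x) \<longlonglongrightarrow> limit_stage k x"
    by (rule LIMSEQ_Suc[OF limit_stage_LIMSEQ])
  ultimately show "limit_stage k x = moving_average (a k) (limit_stage (Suc k)) x"
    using LIMSEQ_unique by blast
qed

lemma limit_stage_const:
  assumes "\<And>z. x - (\<Sum>i. a i) \<le> z \<Longrightarrow> z \<le> x \<Longrightarrow> f0 z = c"
  shows "limit_stage 0 x = c"
proof -
  have "stage 0 m x = c" for m
  proof -
    obtain z where z: "x - (\<Sum>i<m. a (0 + i)) \<le> z" "z \<le> x" "stage 0 m x = f0 z" using stage_value by blast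
    have "(\<Sum>i<m. a i) \<le> (\<Sum>i. a i)" using a_sum a_pos by (intro sum_le_suminf) (auto intro: less_imp_le)
    then show ?thesis using assms z by simp
  qed
  then have "(\<lambda>m. c) \<longlonglongrightarrow> limit_stage 0 x" using limit_stage_LIMSEQ[of 0 x] by simp
  then show ?thesis using LIMSEQ_unique tendsto_const by blast
qed

lemma limit_stage_bound:
  assumes "\<And>z. \<bar>f0 z\<bar> \<le> c" shows "\<bar>limit_stage k x\<bar> \<le> c"
proof (rule tendsto_upperbound[OF tendsto_rabs[OF limit_stage_LIMSEQ]])
  have "\<bar>stage k m x\<bar> \<le> c" for m
  proof -
    obtain z where "stage k m x = f0 z" using stage_value by blast
    then show ?thesis using assms by simp
  qed
  then show "\<forall>\<^sub>F m in sequentially. \<bar>stage k m x\<bar> \<le> c" by simp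
qed simp

text \<open>Each derivative replaces one of the averages by a difference quotient.\<close>

fun limit_deriv :: "nat \<Rightarrow> nat \<Rightarrow> real \<Rightarrow> real" where
  "limit_deriv k 0 = limit_stage k"
| "limit_deriv k (Suc n) = (\<lambda>x. (limit_deriv (Suc k) n x - limit_deriv (Suc k) n (x - a k)) / a k)"

lemma limit_deriv: "(limit_deriv k n has_real_derivative limit_deriv k (Suc n) x) (at x)"
proof (induction n arbitrary: k x)
  case 0
  show ?case using moving_average_derivative[OF limit_stage_cont, of "a k" "Suc k" x] limit_stage_unfold[of k] by simp
next
  case (Suc n)
  have "((\<lambda>x. limit_deriv (Suc k) n (x + - a k)) has_real_derivative limit_deriv (Suc k) (Suc n) (x + - a k)) (at x)"
    using DERIV_shift[of "limit_deriv (Suc k) n" _ x "- a k"] Suc.IH by blast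
  then have "((\<lambda>x. (limit_deriv (Suc k) n x - limit_deriv (Suc k) n (x + - a k)) / a k) has_real_derivative
      (limit_deriv (Suc k) (Suc n) x - limit_deriv (Suc k) (Suc n) (x + - a k)) / a k) (at x)"
    by (intro DERIV_cdivide DERIV_diff Suc.IH)
  then show ?case by simp
qed

lemma limit_deriv_bound:
  assumes c: "\<And>z. \<bar>f0 z\<bar> \<le> c"
  shows "\<bar>limit_deriv k n x\<bar> \<le> c * (\<Prod>i<n. 2 / a (k + i))"
proof (induction n arbitrary: k x)
  case 0 then show ?case using limit_stage_bound[OF c] by simp
next
  case (Suc n)
  let ?B = "c * (\<Prod>i<n. 2 / a (Suc k + i))"
  have "\<bar>limit_deriv k (Suc n) x\<bar> \<le> (?B + ?B) / a k"
    using Suc.IH[of "Suc k" x] Suc.IH[of "Suc k" "x - a k"] a_pos[of k]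
    by (simp only: limit_deriv.simps abs_divide abs_of_pos) (intro divide_right_mono, auto)
  also have "\<dots> = c * (\<Prod>i<Suc n. 2 / a (k + i))"
    by (subst prod.lessThan_Suc_shift) (simp add: field_simps)
  finally show ?case .
qed

end


subsection \<open>Weight sequences\<close>

locale weight =
  fixes M :: "nat \<Rightarrow> real"
  assumes weight: "weight_sequence M"
begin

lemma M_pos: "M p > 0" and M_0: "M 0 = 1"
  using weight unfolding weight_sequence_def by blast+

lemma M_square: "(M (Suc p))\<^sup>2 \<le> M p * M (Suc (Suc p))"
proof -
  have "\<forall>p\<ge>1. (M p)\<^sup>2 \<le> M (p - 1) * M (p + 1)" using weight unfolding weight_sequence_def by blast
  from this[rule_format, of "Suc p"] show ?thesis by simp
qed

lemma M_ratio_mono: "p \<le> q \<Longrightarrow> M (Suc p) / M p \<le> M (Suc q) / M q"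
proof (rule lift_Suc_mono_le[of "\<lambda>p. M (Suc p) / M p"])
  show "M (Suc n) / M n \<le> M (Suc (Suc n)) / M (Suc n)" for n
    using M_square[of n] M_pos by (simp add: divide_simps power2_eq_square mult.commute)
qed

text \<open>By (M.1) the ratios of consecutive terms increase.\<close>

lemma M_mult: "M p * M q \<le> M (p + q)"
proof (induction q)
  case 0 then show ?case by (simp add: M_0)
next
  case (Suc q)
  have "M p * M (Suc q) = (M p * M q) * (M (Suc q) / M q)" using M_pos[of q] by simp
  also have "\<dots> \<le> M (p + q) * (M (Suc (p + q)) / M (p + q))"
    using Suc M_ratio_mono[of q "p + q"] M_pos by (intro mult_mono) (auto intro: less_imp_le)
  also have "\<dots> = M (p + Suc q)" using M_pos[of "p + q"] by simp
  finally show ?case .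
qed

lemma M_ratio_summable: "summable (\<lambda>p. M p / M (Suc p))"
proof -
  have "(\<lambda>p. M (p - 1) / M p) summable_on {1 + 1..}"
    using weight unfolding weight_sequence_def by blast
  moreover have "{1 + 1..} = (\<lambda>i::nat. i + 2) ` UNIV"
    by (auto simp: image_iff) presburger
  ultimately have "((\<lambda>p. M (p - 1) / M p) \<circ> (\<lambda>i. i + 2)) summable_on UNIV"
    by (simp add: summable_on_reindex[symmetric] inj_on_def)
  then have "(\<lambda>p. M (Suc p) / M (Suc (Suc p))) summable_on UNIV" by (simp add: o_def)
  then have "summable (\<lambda>p. M (Suc p) / M (Suc (Suc p)))"
    by (rule summable_on_imp_summable)
  then show ?thesis by (rule iffD1[OF summable_Suc_iff])
qed

text \<open>
  The averages of a trapezoidal function with shoulders of height 1. The lengths of the intervals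
  add up to at most 1, so the plateau and the support change by at most 1.
\<close>

lemma real_cutoff:
  "\<exists>h>0. \<forall>r\<ge>0. \<exists>v. (\<forall>n x. (v n has_real_derivative v (Suc n) x) (at x)) \<and>
     (\<forall>n x. \<bar>v n x\<bar> \<le> h ^ n * M n) \<and> (\<forall>x. \<bar>x\<bar> \<le> r \<longrightarrow> v 0 x = 1) \<and> (\<forall>x. \<bar>x\<bar> \<ge> r + 3 \<longrightarrow> v 0 x = 0)"
proof -
  define S where "S = (\<Sum>p. M p / M (Suc p))"
  have S: "S \<ge> 0" unfolding S_def using M_pos by (intro suminf_nonneg M_ratio_summable) (auto intro: less_imp_le)
  \<comment> \<open>normalizes the total length of the intervals to at most 1\<close>
  define c where "c = 1 / (1 + S)"
  have c: "c > 0" using S unfolding c_def by simp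
  define a where "a p = c * (M p / M (Suc p))" for p
  have a: "a p > 0" for p using c M_pos unfolding a_def by simp
  have suma: "summable a" unfolding a_def by (intro summable_mult M_ratio_summable)
  have "(\<Sum>p. a p) = c * S" unfolding a_def S_def by (rule suminf_mult[OF M_ratio_summable])
  also have "\<dots> \<le> 1" using S unfolding c_def by simp
  finally have sum1: "(\<Sum>p. a p) \<le> 1" .
  have prod: "(\<Prod>i<n. 2 / a i) = (2 / c) ^ n * M n" for n
  proof (induction n)
    case (Suc n)
    have "2 / a n = (2 / c) * (M (Suc n) / M n)" unfolding a_def using c M_pos[of n] M_pos[of "Suc n"] by simp
    then show ?case using Suc M_pos[of n] by simp
  qed (simp add: M_0)
  have "\<exists>v. (\<forall>n x. (v n has_real_derivative v (Suc n) x) (at x)) \<and>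
     (\<forall>n x. \<bar>v n x\<bar> \<le> (2 / c) ^ n * M n) \<and> (\<forall>x. \<bar>x\<bar> \<le> r \<longrightarrow> v 0 x = 1) \<and> (\<forall>x. \<bar>x\<bar> \<ge> r + 3 \<longrightarrow> v 0 x = 0)"
    if r: "r \<ge> 0" for r
  proof -
    define f0 where "f0 x = max 0 (min 1 (r + 2 - \<bar>x\<bar>))" for x :: real
    interpret averaging a f0
    proof
      show "\<bar>f0 x - f0 y\<bar> \<le> \<bar>x - y\<bar>" for x y unfolding f0_def by linarith
    qed (use a suma in auto)
    have "\<bar>limit_deriv 0 n x\<bar> \<le> (2 / c) ^ n * M n" for n x
      using limit_deriv_bound[of 1 0 n x] prod[of n] by (auto simp: f0_def)
    moreover have "limit_deriv 0 0 x = 1" if "\<bar>x\<bar> \<le> r" for x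
      using limit_stage_const[of x 1] that sum1 by (auto simp: f0_def)
    moreover have "limit_deriv 0 0 x = 0" if "\<bar>x\<bar> \<ge> r + 3" for x
      using limit_stage_const[of x 0] that sum1 by (auto simp: f0_def)
    ultimately show ?thesis using limit_deriv[of 0] by (intro exI[of _ "limit_deriv 0"]) blast
  qed
  then have "\<forall>r\<ge>0. \<exists>v. (\<forall>n x. (v n has_real_derivative v (Suc n) x) (at x)) \<and>
     (\<forall>n x. \<bar>v n x\<bar> \<le> (2 / c) ^ n * M n) \<and> (\<forall>x. \<bar>x\<bar> \<le> r \<longrightarrow> v 0 x = 1) \<and> (\<forall>x. \<bar>x\<bar> \<ge> r + 3 \<longrightarrow> v 0 x = 0)"
    by blast
  moreover have "2 / c > 0" using c by simp
  ultimately show ?thesis by blast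
qed

lemma coordinate_function:
  fixes v :: "nat \<Rightarrow> real \<Rightarrow> real" and i :: "'d::finite"
  assumes d: "\<And>n x. (v n has_real_derivative v (Suc n) x) (at x)"
  defines "\<omega> \<equiv> (\<lambda>x :: real^'d. complex_of_real (v 0 (x $ i)))"
  shows "smooth euclidean \<omega>"
    and "pd js \<omega> = (\<lambda>x. if set js \<subseteq> {i} then of_real (v (length js) (x $ i)) else 0)"
proof -
  define G where "G js = (\<lambda>x :: real^'d. if set js \<subseteq> {i} then complex_of_real (v (length js) (x $ i)) else 0)" for js
  have c: "continuous_map euclidean euclidean (G js)" for js
  proof -
    have cv: "continuous_on UNIV (v n)" for n using d DERIV_isCont continuous_at_imp_continuous_on by blast
    have "continuous_on UNIV (\<lambda>x :: real^'d. complex_of_real (v n (x $ i)))" for n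
      by (rule continuous_on_of_real, rule continuous_on_compose2[OF cv])
        (auto intro!: bounded_linear.continuous_on[OF bounded_linear_vec_nth continuous_on_id])
    then show ?thesis unfolding G_def by (cases "set js \<subseteq> {i}") simp_all
  qed
  have der: "has_partial euclidean j (G js) x (G (j # js) x)" for js j x
  proof (cases "set js \<subseteq> {i}")
    case False
    then show ?thesis unfolding has_partial_iff_vector_derivative G_def by auto
  next
    case True
    show ?thesis
    proof (cases "j = i")
      case j: True
      have "((\<lambda>h. v (length js) (x $ i + h)) has_real_derivative v (Suc (length js)) (x $ i)) (at 0)"
        using DERIV_shift[of "v (length js)" "v (Suc (length js)) (x $ i)" 0 "x $ i"] d[of "length js" "x $ i"]
        by (simp add: add.commute)
      then have "((\<lambda>h. complex_of_real (v (length js) (x $ i + h))) has_vector_derivative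
          of_real (v (Suc (length js)) (x $ i))) (at 0)"
        unfolding has_real_derivative_iff_has_vector_derivative
        by (rule bounded_linear.has_vector_derivative[OF bounded_linear_of_real])
      then show ?thesis unfolding has_partial_iff_vector_derivative G_def using True j by (simp add: axis_def)
    next
      case False
      then have "(axis j 1 :: real^'d) $ i = 0" by (simp add: axis_def)
      then show ?thesis unfolding has_partial_iff_vector_derivative G_def using True False by simp
    qed
  qed
  show "smooth euclidean \<omega>" by (rule complex.smoothI(1)[OF _ c der]) (simp add: G_def \<omega>_def)
  show "pd js \<omega> = (\<lambda>x. if set js \<subseteq> {i} then of_real (v (length js) (x $ i)) else 0)"
    using complex.smoothI(2)[OF _ c der, of \<omega> js] by (simp add: G_def \<omega>_def)
qed

text \<open>
  The product of one-dimensional cutoffs in the coordinates. Each multiplication costs a factor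
  \<open>2 ^ k\<close> for the derivatives of order \<open>k\<close>.
\<close>

lemma cutoff:
  "\<exists>H>0. \<forall>r\<ge>0. \<exists>\<omega> :: real^'d::finite \<Rightarrow> complex. smooth euclidean \<omega> \<and>
     (\<forall>js x. cmod (pd js \<omega> x) \<le> H ^ length js * M (length js)) \<and>
     (\<forall>x. norm x \<le> r \<longrightarrow> \<omega> x = 1) \<and> (\<exists>R. \<forall>x. norm x \<ge> R \<longrightarrow> \<omega> x = 0)"
proof -
  obtain h where h: "h > 0" "\<forall>r\<ge>0. \<exists>v. (\<forall>n x. (v n has_real_derivative v (Suc n) x) (at x)) \<and>
     (\<forall>n x. \<bar>v n x\<bar> \<le> h ^ n * M n) \<and> (\<forall>x. \<bar>x\<bar> \<le> r \<longrightarrow> v 0 x = 1) \<and> (\<forall>x. \<bar>x\<bar> \<ge> r + 3 \<longrightarrow> v 0 x = 0)"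
    using real_cutoff by blast
  define H where "H n = 2 ^ n * h" for n :: nat
  have H: "H n > 0" "H (Suc n) = 2 * H n" "h \<le> H n" for n using h(1) unfolding H_def by auto
  have "\<exists>\<omega> :: real^'d \<Rightarrow> complex. smooth euclidean \<omega> \<and>
     (\<forall>js x. cmod (pd js \<omega> x) \<le> H (card (UNIV :: 'd set)) ^ length js * M (length js)) \<and>
     (\<forall>x. norm x \<le> r \<longrightarrow> \<omega> x = 1) \<and> (\<exists>R. \<forall>x. norm x \<ge> R \<longrightarrow> \<omega> x = 0)" if r: "r \<ge> 0" for r
  proof -
    obtain v where v: "\<And>n x. (v n has_real_derivative v (Suc n) x) (at x)" "\<And>n x. \<bar>v n x\<bar> \<le> h ^ n * M n"
      "\<And>x. \<bar>x\<bar> \<le> r \<Longrightarrow> v 0 x = 1" "\<And>x. \<bar>x\<bar> \<ge> r + 3 \<Longrightarrow> v 0 x = 0"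
      using h(2) r by meson
    define \<omega> where "\<omega> I x = (\<Prod>i\<in>I. complex_of_real (v 0 (x $ i)))" for I and x :: "real^'d"
    note cf = coordinate_function[of v, OF v(1)]
    have ind: "smooth euclidean (\<omega> I) \<and> (\<forall>js x. cmod (pd js (\<omega> I) x) \<le> H (card I) ^ length js * M (length js))"
      if "finite I" for I
      using that
    proof (induction I rule: finite_induct)
      case empty
      have c: "continuous_map euclidean euclidean (\<lambda>x :: real^'d. if js = [] then 1 else 0 :: complex)" for js :: "'d list" by simp
      have d: "has_partial euclidean j (\<lambda>x :: real^'d. if js = [] then 1 else 0 :: complex) x (if j # js = [] then 1 else 0)"
        for j x and js :: "'d list" unfolding has_partial_iff_vector_derivative by simp
      have e: "(\<lambda>x :: real^'d. if ([]::'d list) = [] then 1 else 0) = \<omega> {}" by (simp add: \<omega>_def fun_eq_iff)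
      show ?case
        using complex.smoothI[OF e c d] M_pos H(1)[of 0] by (auto simp: M_0 intro: less_imp_le)
    next
      case (insert i I)
      let ?f = "\<lambda>x :: real^'d. complex_of_real (v 0 (x $ i))"
      have eq: "\<omega> (insert i I) = (\<lambda>x. ?f x * \<omega> I x)" using insert by (simp add: \<omega>_def fun_eq_iff)
      have I: "smooth euclidean (\<omega> I)" "\<And>js x. cmod (pd js (\<omega> I) x) \<le> H (card I) ^ length js * M (length js)"
        using insert.IH by auto
      have f: "cmod (pd js ?f x) \<le> H (card I) ^ length js * M (length js)" for js x
      proof -
        have "cmod (pd js ?f x) \<le> h ^ length js * M (length js)"
          unfolding cf(2) using v(2)[of "length js" "x $ i"] M_pos[of "length js"] h(1) by (auto intro: less_imp_le)
        also have "\<dots> \<le> H (card I) ^ length js * M (length js)"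
          using M_pos[of "length js"] h(1) H(3)[of "card I"] by (intro mult_right_mono power_mono) auto
        finally show ?thesis .
      qed
      have "cmod (pd js (\<lambda>x. ?f x * \<omega> I x) x) \<le> 2 ^ length js * (H (card I) ^ length js * M (length js))" for js x
      proof (rule pd_mult_bound[OF cf(1) I(1)])
        fix a b :: "'d list" assume ab: "length a + length b = length js"
        have "cmod (pd a ?f x) * cmod (pd b (\<omega> I) x) \<le>
            (H (card I) ^ length a * M (length a)) * (H (card I) ^ length b * M (length b))"
          using M_pos[of "length a"] H(1)[of "card I"] by (intro mult_mono f I(2)) (auto intro: less_imp_le)
        also have "\<dots> = H (card I) ^ length js * (M (length a) * M (length b))"
          unfolding ab[symmetric] by (simp add: power_add mult_ac)
        also have "\<dots> \<le> H (card I) ^ length js * M (length js)"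
          using M_mult[of "length a" "length b"] H(1)[of "card I"] unfolding ab by (intro mult_left_mono) auto
        finally show "cmod (pd a ?f x) * cmod (pd b (\<omega> I) x) \<le> H (card I) ^ length js * M (length js)" .
      qed
      then show ?case unfolding eq using smooth_mult(1)[OF cf(1) I(1)] insert.hyps H(2)
        by (simp add: power_mult_distrib mult.assoc)
    qed
    have "\<omega> UNIV x = 1" if "norm x \<le> r" for x
      unfolding \<omega>_def
    proof (rule prod.neutral, rule ballI)
      fix i show "complex_of_real (v 0 (x $ i)) = 1"
        using v(3)[of "x $ i"] component_le_norm_cart[of x i] that by simp
    qed
    moreover have "\<omega> UNIV x = 0" if x: "norm x \<ge> real CARD('d) * (r + 3)" for x
    proof -
      have "\<exists>i. \<bar>x $ i\<bar> \<ge> r + 3"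
      proof (rule ccontr)
        assume "\<nexists>i. r + 3 \<le> \<bar>x $ i\<bar>"
        then have "(\<Sum>i\<in>UNIV. \<bar>x $ i\<bar>) < (\<Sum>i\<in>(UNIV::'d set). r + 3)"
          by (intro sum_strict_mono) (auto simp: not_le)
        then show False using norm_le_l1_cart[of x] x by simp
      qed
      then obtain i where "\<bar>x $ i\<bar> \<ge> r + 3" by blast
      then have "complex_of_real (v 0 (x $ i)) = 0" using v(4) by simp
      then show ?thesis unfolding \<omega>_def by (intro prod_zero) auto
    qed
    ultimately show ?thesis using ind[of UNIV] by (intro exI[of _ "\<omega> UNIV"]) auto
  qed
  then show ?thesis using H(1) by blast
qed

end

section \<open>The scalar space\<close>

subsection \<open>Weights\<close>

definition T_prod :: "(nat \<Rightarrow> real) \<Rightarrow> nat \<Rightarrow> real" where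
  "T_prod t k = (\<Prod>j=1..k. t j)"

lemma RR_pos: "t \<in> \<RR> \<Longrightarrow> 1 \<le> j \<Longrightarrow> 0 < t j"
  unfolding RR_def by blast

lemma RR_mono:
  assumes "t \<in> \<RR>" "1 \<le> i" "i \<le> j" shows "t i \<le> t j"
proof -
  have "t (i + n) \<le> t (i + Suc n)" for n using assms(1,2) unfolding RR_def by auto
  then have "t (i + 0) \<le> t (i + (j - i))" by (rule lift_Suc_mono_le[of "\<lambda>n. t (i + n)"]) simp
  then show ?thesis using assms(3) by simp
qed

lemma RR_tendsto: "t \<in> \<RR> \<Longrightarrow> filterlim t at_top sequentially"
  unfolding RR_def by blast

lemma RR_real: "real \<in> \<RR>"
  unfolding RR_def using filterlim_real_sequentially by auto

lemma RR_scale: "t \<in> \<RR> \<Longrightarrow> c > 0 \<Longrightarrow> (\<lambda>j. t j / c) \<in> \<RR>"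
  unfolding RR_def
  by (auto simp: divide_right_mono divide_inverse
      intro!: filterlim_tendsto_pos_mult_at_top[OF _ _, of "\<lambda>_. inverse c" "inverse c"] simp: mult.commute[of _ "inverse c"])

lemma RR_min:
  assumes "s \<in> \<RR>" "t \<in> \<RR>" shows "(\<lambda>j. min (s j) (t j)) \<in> \<RR>"
proof -
  have "filterlim (\<lambda>j. min (s j) (t j)) at_top sequentially"
    unfolding filterlim_at_top
  proof
    fix Z
    have "eventually (\<lambda>j. Z \<le> s j) sequentially" "eventually (\<lambda>j. Z \<le> t j) sequentially"
      using RR_tendsto[OF assms(1)] RR_tendsto[OF assms(2)] unfolding filterlim_at_top by auto
    then show "eventually (\<lambda>j. Z \<le> min (s j) (t j)) sequentially" by eventually_elim auto
  qed
  then show ?thesis using assms unfolding RR_def by (auto intro: min.coboundedI1 min.coboundedI2)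
qed

lemma T_prod_0 [simp]: "T_prod t 0 = 1"
  unfolding T_prod_def by simp

lemma T_prod_Suc: "T_prod t (Suc k) = T_prod t k * t (Suc k)"
  unfolding T_prod_def by simp

lemma T_prod_pos: "t \<in> \<RR> \<Longrightarrow> 0 < T_prod t k"
  by (induction k) (simp_all add: T_prod_Suc RR_pos)

lemma T_prod_scale: "T_prod (\<lambda>j. t j / c) k = T_prod t k / c ^ k"
  by (induction k) (simp_all add: T_prod_Suc)

lemma T_prod_le:
  assumes "s \<in> \<RR>" "\<And>j. 1 \<le> j \<Longrightarrow> s j \<le> t j" shows "T_prod s k \<le> T_prod t k"
  unfolding T_prod_def using assms RR_pos[OF assms(1)] by (intro prod_mono) (auto intro: less_imp_le)

lemma T_prod_mult:
  assumes t: "t \<in> \<RR>" shows "T_prod t k * T_prod t l \<le> T_prod t (k + l)"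
proof (induction l)
  case (Suc l)
  have "T_prod t k * T_prod t (Suc l) = (T_prod t k * T_prod t l) * t (Suc l)" by (simp add: T_prod_Suc)
  also have "\<dots> \<le> T_prod t (k + l) * t (Suc (k + l))"
    using Suc RR_mono[OF t, of "Suc l" "Suc (k + l)"] RR_pos[OF t, of "Suc l"] T_prod_pos[OF t, of "k + l"]
    by (intro mult_mono) (auto intro: less_imp_le)
  finally show ?case by (simp add: T_prod_Suc)
qed simp

text \<open>
  As \<open>t\<close> tends to infinity, only finitely many factors of \<open>T_prod t k\<close> are
  smaller than the base of the power.
\<close>

lemma power_le_T_prod:
  assumes t: "t \<in> \<RR>" and h: "h > 0"
  shows "\<exists>C>0. \<forall>k. h ^ k \<le> C * T_prod t k"
proof -
  obtain J where J: "\<And>j. j \<ge> J \<Longrightarrow> h \<le> t j"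
    using RR_tendsto[OF t] unfolding filterlim_at_top eventually_sequentially by blast
  define C where "C = (\<Sum>k\<le>J. h ^ k / T_prod t k) + 1"
  have pos: "h ^ k / T_prod t k > 0" for k using h T_prod_pos[OF t] by simp
  have "h ^ k / T_prod t k \<le> C" for k
  proof (induction k)
    case 0
    have "h ^ 0 / T_prod t 0 \<le> (\<Sum>k\<le>J. h ^ k / T_prod t k)"
      by (rule member_le_sum) (use pos in \<open>auto intro: less_imp_le\<close>)
    then show ?case unfolding C_def by simp
  next
    case (Suc k)
    show ?case
    proof (cases "Suc k \<le> J")
      case True
      have "h ^ Suc k / T_prod t (Suc k) \<le> (\<Sum>k\<le>J. h ^ k / T_prod t k)"
        by (rule member_le_sum) (use pos True in \<open>auto intro: less_imp_le\<close>)
      then show ?thesis unfolding C_def by simp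
    next
      case False
      then have "h \<le> t (Suc k)" using J by simp
      then have "h / t (Suc k) \<le> 1" using RR_pos[OF t, of "Suc k"] by simp
      then have "(h ^ k / T_prod t k) * (h / t (Suc k)) \<le> h ^ k / T_prod t k"
        by (rule mult_left_le[OF _ less_imp_le[OF pos]])
      then show ?thesis using Suc by (simp add: T_prod_Suc mult.commute)
    qed
  qed
  moreover have "C > 0" unfolding C_def using pos by (intro add_nonneg_pos sum_nonneg) (auto intro: less_imp_le)
  ultimately show ?thesis using T_prod_pos[OF t] by (intro exI[of _ C]) (auto simp: field_simps)
qed

text \<open>
  Komatsu's lemma: a family that is bounded by \<open>T_prod t\<close> for every \<open>t\<close> is bounded by a geometric
  sequence. Otherwise there are indices \<open>i\<close> of growing size \<open>k = n i\<close> at which it exceeds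
  \<open>m * (m + 1) ^ k\<close>, and a sequence \<open>t\<close> that stays below \<open>m + 1\<close> up to the \<open>m\<close>-th of these sizes
  violates the hypothesis.
\<close>

lemma geometric_bound:
  fixes A :: "'i \<Rightarrow> real" and n :: "'i \<Rightarrow> nat"
  assumes bnd: "\<And>t. t \<in> \<RR> \<Longrightarrow> \<exists>C. \<forall>i. A i \<le> C * T_prod t (n i)"
  shows "\<exists>h>0. \<exists>C. \<forall>i. A i \<le> C * h ^ n i"
proof (rule ccontr)
  assume no: "\<not> ?thesis"
  have ex: "\<exists>i. N \<le> n i \<and> A i > real m * (real m + 1) ^ n i" for N m
  proof (rule ccontr)
    assume "\<not> ?thesis"
    then have le: "A i \<le> real m * (real m + 1) ^ n i" if "N \<le> n i" for i using that by force
    obtain C where C: "\<And>i. A i \<le> C * T_prod real (n i)" using bnd[OF RR_real] by blast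
    have fact_mono: "T_prod real k \<le> T_prod real N" if "k \<le> N" for k
    proof -
      have "T_prod real k \<le> T_prod real k * T_prod real (N - k)" 
      proof -
        have "1 \<le> T_prod real l" for l unfolding T_prod_def by (intro prod_ge_1) auto
        then show ?thesis using T_prod_pos[OF RR_real, of k] by simp
      qed
      also have "\<dots> \<le> T_prod real N" using T_prod_mult[OF RR_real, of k "N - k"] that by simp
      finally show ?thesis .
    qed
    define D where "D = max (real m) (\<bar>C\<bar> * T_prod real N)"
    have "A i \<le> D * (real m + 1) ^ n i" for i
    proof (cases "N \<le> n i")
      case True
      have "real m * (real m + 1) ^ n i \<le> D * (real m + 1) ^ n i" unfolding D_def by (intro mult_right_mono) auto
      then show ?thesis by (rule order_trans[OF le[OF True]])
    next
      case False
      have "A i \<le> \<bar>C\<bar> * T_prod real (n i)"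
        using C[of i] T_prod_pos[OF RR_real, of "n i"] by (smt (verit) mult_right_mono)
      also have "\<dots> \<le> \<bar>C\<bar> * T_prod real N" using fact_mono[of "n i"] False by (intro mult_left_mono) auto
      also have "\<dots> \<le> D" unfolding D_def by simp
      also have "\<dots> \<le> D * (real m + 1) ^ n i"
        using one_le_power[of "real m + 1" "n i"] by (simp add: D_def mult_le_cancel_left1)
      finally show ?thesis .
    qed
    moreover have "real m + 1 > 0" by simp
    ultimately show False using no by blast
  qed
  have "\<exists>f. \<forall>m. (Suc m \<le> n (f m) \<and> A (f m) > real m * (real m + 1) ^ n (f m)) \<and> n (f m) < n (f (Suc m))"
  proof (rule dependent_nat_choice)
    show "\<exists>x. Suc 0 \<le> n x \<and> A x > real 0 * (real 0 + 1) ^ n x" using ex[of "Suc 0" 0] by blast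
    fix x m assume "Suc m \<le> n x \<and> A x > real m * (real m + 1) ^ n x"
    show "\<exists>y. (Suc (Suc m) \<le> n y \<and> A y > real (Suc m) * (real (Suc m) + 1) ^ n y) \<and> n x < n y"
      using ex[of "max (Suc (Suc m)) (Suc (n x))" "Suc m"] by (meson Suc_le_eq max.bounded_iff)
  qed
  then obtain f where "\<forall>m. (Suc m \<le> n (f m) \<and> A (f m) > real m * (real m + 1) ^ n (f m)) \<and> n (f m) < n (f (Suc m))"
    by (rule exE)
  then have f: "Suc m \<le> n (f m)" "A (f m) > real m * (real m + 1) ^ n (f m)" "n (f m) < n (f (Suc m))" for m
    by simp_all
  have fmono: "n (f a) \<le> n (f b)" if "a \<le> b" for a b
    by (rule lift_Suc_mono_le[of "\<lambda>m. n (f m)", OF less_imp_le[OF f(3)] that])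
  define t where "t j = real (LEAST m. j \<le> n (f m)) + 1" for j
  have cover: "\<exists>m. j \<le> n (f m)" for j using f(1)[of j] by (intro exI[of _ j]) simp
  have t_le: "t j \<le> real m + 1" if "j \<le> n (f m)" for j m
    unfolding t_def using Least_le[of "\<lambda>m. j \<le> n (f m)" m] that by simp
  have t_ge: "real m + 1 \<le> t j" if "n (f m) < j" for j m
  proof -
    have "j \<le> n (f (LEAST m. j \<le> n (f m)))" using LeastI_ex[OF cover[of j]] .
    then have "\<not> (LEAST m. j \<le> n (f m)) \<le> m" using that fmono[of "LEAST m. j \<le> n (f m)" m] by linarith
    then show ?thesis unfolding t_def by simp
  qed
  have "t \<in> \<RR>" unfolding RR_def
  proof (intro CollectI conjI allI impI)
    show "0 < t j" for j unfolding t_def by simp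
    show "t j \<le> t (j + 1)" for j
    proof -
      have "j + 1 \<le> n (f (LEAST m. j + 1 \<le> n (f m)))" using LeastI_ex[OF cover[of "j + 1"]] .
      then have "j \<le> n (f (LEAST m. j + 1 \<le> n (f m)))" by simp
      then show ?thesis using t_le unfolding t_def[of "j + 1"] by blast
    qed
    show "filterlim t at_top sequentially" unfolding filterlim_at_top
    proof
      fix Z :: real
      obtain m :: nat where m: "Z \<le> real m" using real_arch_simple by blast
      have "Z \<le> t j" if "Suc (n (f m)) \<le> j" for j using t_ge[of m j] m that by simp
      then show "eventually (\<lambda>j. Z \<le> t j) sequentially" unfolding eventually_sequentially by blast
    qed
  qed
  then obtain C where C: "\<And>i. A i \<le> C * T_prod t (n i)" using bnd by blast
  obtain m :: nat where m: "\<bar>C\<bar> \<le> real m" using real_arch_simple by blast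
  have tpos: "0 < T_prod t k" for k using T_prod_pos[OF \<open>t \<in> \<RR>\<close>] .
  have "A (f m) \<le> \<bar>C\<bar> * T_prod t (n (f m))"
    using C[of "f m"] tpos[of "n (f m)"] by (smt (verit) mult_right_mono)
  also have "\<dots> \<le> real m * (real m + 1) ^ n (f m)"
  proof (rule mult_mono[OF m])
    have "T_prod t (n (f m)) \<le> (\<Prod>j=1..n (f m). real m + 1)"
      unfolding T_prod_def by (intro prod_mono) (auto simp: t_le, simp add: t_def)
    then show "T_prod t (n (f m)) \<le> (real m + 1) ^ n (f m)" by simp
  qed (use tpos[of "n (f m)"] in auto)
  finally show False using f(2)[of m] by simp
qed

lemma TM_eq: "TM M t \<alpha> = T_prod t (multi_size \<alpha>) * M (multi_size \<alpha>)"
  unfolding TM_def T_prod_def by simp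

subsection \<open>Locality of the partial derivatives\<close>

lemma pd_local:
  fixes f g :: "real^'d \<Rightarrow> complex"
  assumes "open S" "\<And>x. x \<in> S \<Longrightarrow> f x = g x" "x \<in> S"
  shows "pd js f x = pd js g x"
  using assms(3)
proof (induction js arbitrary: x)
  case Nil then show ?case using assms(2) by simp
next
  case (Cons j js)
  have "has_partial euclidean j (pd js f) x l \<longleftrightarrow> has_partial euclidean j (pd js g) x l" for l
  proof -
    have "((\<lambda>h. x + h *\<^sub>R axis j 1) \<longlongrightarrow> x + 0 *\<^sub>R axis j 1) (at 0)" by (intro tendsto_intros)
    then have ev: "\<forall>\<^sub>F h in at 0. x + h *\<^sub>R axis j 1 \<in> S"
      using assms(1) Cons.prems by (intro topological_tendstoD) auto
    show ?thesis unfolding has_partial_def limitin_canonical_iff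
    proof (rule tendsto_cong)
      show "\<forall>\<^sub>F h in at 0. (pd js f (x + h *\<^sub>R axis j 1) - pd js f x) /\<^sub>R h =
          (pd js g (x + h *\<^sub>R axis j 1) - pd js g x) /\<^sub>R h"
        using ev by eventually_elim (simp add: Cons.IH[OF Cons.prems] Cons.IH)
    qed
  qed
  then have "has_partial euclidean j (pd js f) x = has_partial euclidean j (pd js g) x" by (rule ext)
  then show ?case by (simp add: partial_def[of _ _ "pd js f"] partial_def[of _ _ "pd js g"])
qed

lemma pd_zero: "pd js (\<lambda>x. 0) x = 0" for x :: "real^'d"
proof -
  have "pd js (\<lambda>x :: real^'d. 0 *\<^sub>C 0) = (\<lambda>x. 0 *\<^sub>C pd js (\<lambda>x. 0) x)"
    by (rule complex.smooth_scaleC(2)[OF complex.smooth_zero])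
  then show ?thesis by (simp add: fun_eq_iff)
qed

subsection \<open>The norms\<close>

lemma SUP_pair_UNIV:
  fixes f :: "'a \<Rightarrow> 'b \<Rightarrow> ennreal"
  shows "(SUP a. SUP b. f a b) = (SUP p. f (fst p) (snd p))"
proof (rule antisym)
  show "(SUP a. SUP b. f a b) \<le> (SUP p. f (fst p) (snd p))"
    by (intro SUP_least) (rule SUP_upper2[of "(_, _)"], auto)
  show "(SUP p. f (fst p) (snd p)) \<le> (SUP a. SUP b. f a b)"
    by (intro SUP_least, rule SUP_upper2[OF UNIV_I], rule SUP_upper[OF UNIV_I])
qed

lemma cmod_D_multi:
  fixes \<phi> :: "real^'d::{finite,linorder} \<Rightarrow> complex"
  assumes "smooth euclidean \<phi>"
  shows "cmod (D_multi euclidean \<alpha> \<phi> x) = cmod (pd (multi_list \<alpha>) \<phi> x)"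
  unfolding complex.D_multi_eq[OF assms] by (simp add: scaleC_complex_def norm_mult norm_power norm_inverse del: inverse_i)

lemma cmod_pd_eq_D_multi:
  fixes \<phi> :: "real^'d::{finite,linorder} \<Rightarrow> complex"
  assumes "smooth euclidean \<phi>"
  shows "cmod (pd js \<phi> x) = cmod (D_multi euclidean (count (mset js)) \<phi> x)"
  unfolding cmod_D_multi[OF assms] using pd_mset[OF assms, of js "multi_list (count (mset js))"]
  by (simp add: mset_multi_list_count)

lemma pd_add:
  "smooth euclidean \<phi> \<Longrightarrow> smooth euclidean \<psi> \<Longrightarrow> pd js (\<phi> + \<psi>) x = pd js \<phi> x + pd js \<psi> x"
  for \<phi> \<psi> :: "real^'d \<Rightarrow> complex"
  using complex.smooth_add(2)[of \<phi> \<psi> js] by (simp add: plus_fun_def)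

lemma smooth_plus: "smooth euclidean \<phi> \<Longrightarrow> smooth euclidean \<psi> \<Longrightarrow> smooth euclidean (\<phi> + \<psi>)"
  for \<phi> \<psi> :: "real^'d \<Rightarrow> complex"
  using complex.smooth_add(1)[of \<phi> \<psi>] by (simp add: plus_fun_def)

lemma pd_scale: "smooth euclidean \<phi> \<Longrightarrow> pd js (c *\<^sub>C \<phi>) x = c * pd js \<phi> x"
  for \<phi> :: "real^'d \<Rightarrow> complex"
  using complex.smooth_scaleC(2)[of \<phi> js c] by (simp add: scaleC_fun_def scaleC_complex_def)

lemma smooth_scale: "smooth euclidean \<phi> \<Longrightarrow> smooth euclidean (c *\<^sub>C \<phi>)"
  for \<phi> :: "real^'d \<Rightarrow> complex"
  using complex.smooth_scaleC(1)[of \<phi> c] by (simp add: scaleC_fun_def scaleC_complex_def)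

context weight
begin

abbreviation W :: "(nat \<Rightarrow> real) \<Rightarrow> nat \<Rightarrow> real" where
  "W t k \<equiv> T_prod t k * M k"

lemma W_pos: "t \<in> \<RR> \<Longrightarrow> 0 < W t k"
  using T_prod_pos M_pos by simp

lemma TM_pos: "t \<in> \<RR> \<Longrightarrow> 0 < TM M t \<alpha>"
  unfolding TM_eq by (rule W_pos)

lemma W_mult:
  assumes t: "t \<in> \<RR>" shows "W t k * W t l \<le> W t (k + l)"
proof -
  have "(T_prod t k * T_prod t l) * (M k * M l) \<le> T_prod t (k + l) * M (k + l)"
    using T_prod_mult[OF t] M_mult T_prod_pos[OF t] M_pos by (intro mult_mono) (auto intro: less_imp_le)
  then show ?thesis by (simp add: mult_ac)
qed

lemma ultra_norm_SUP:
  "ultra_norm M t \<phi> = (SUP p. ennreal (cmod (D_multi euclidean (fst p) \<phi> (snd p)) / TM M t (fst p)))"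
  unfolding ultra_norm_def by (rule SUP_pair_UNIV)

lemma pd_le_ultra_norm:
  fixes \<phi> :: "real^'d::{finite,linorder} \<Rightarrow> complex"
  assumes \<phi>: "smooth euclidean \<phi>" and t: "t \<in> \<RR>" and fin: "ultra_norm M t \<phi> < \<infinity>"
  shows "cmod (pd js \<phi> x) \<le> enn2real (ultra_norm M t \<phi>) * W t (length js)"
proof -
  let ?\<alpha> = "count (mset js)"
  have "cmod (D_multi euclidean ?\<alpha> \<phi> x) / TM M t ?\<alpha> \<le> enn2real (ultra_norm M t \<phi>)"
    using le_enn2real_SUP[OF fin[unfolded ultra_norm_SUP], of "(?\<alpha>, x)"] unfolding ultra_norm_SUP by simp
  then show ?thesis
    using TM_pos[OF t, of ?\<alpha>] unfolding cmod_pd_eq_D_multi[OF \<phi>] TM_eq by (simp add: multi_size_count field_simps)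
qed

lemma ultra_norm_le:
  fixes \<phi> :: "real^'d::{finite,linorder} \<Rightarrow> complex"
  assumes \<phi>: "smooth euclidean \<phi>" and t: "t \<in> \<RR>" and r: "0 \<le> r"
    and le: "\<And>js x. cmod (pd js \<phi> x) \<le> r * W t (length js)"
  shows "ultra_norm M t \<phi> \<le> ennreal r" "ultra_norm M t \<phi> < \<infinity>" "enn2real (ultra_norm M t \<phi>) \<le> r"
proof -
  have *: "cmod (D_multi euclidean (fst p) \<phi> (snd p)) / TM M t (fst p) \<le> r" for p
    using le[of "multi_list (fst p)" "snd p"] TM_pos[OF t, of "fst p"]
    unfolding cmod_D_multi[OF \<phi>] TM_eq by (simp add: length_multi_list pos_divide_le_eq)
  then show "ultra_norm M t \<phi> \<le> ennreal r" "ultra_norm M t \<phi> < \<infinity>" "enn2real (ultra_norm M t \<phi>) \<le> r"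
    unfolding ultra_norm_SUP using SUP_ennreal_bound[OF r *] by simp_all
qed

definition DL :: "(real^'d::{finite,linorder} \<Rightarrow> complex) set" where
  "DL = {\<phi>. smooth euclidean \<phi> \<and> (\<forall>t\<in>\<RR>. ultra_norm M t \<phi> < \<infinity>)}"

lemma DL_smooth: "\<phi> \<in> DL \<Longrightarrow> smooth euclidean \<phi>" and DL_finite: "\<phi> \<in> DL \<Longrightarrow> t \<in> \<RR> \<Longrightarrow> ultra_norm M t \<phi> < \<infinity>"
  unfolding DL_def by auto

lemma DL_bound: "\<phi> \<in> DL \<Longrightarrow> t \<in> \<RR> \<Longrightarrow> cmod (pd js \<phi> x) \<le> enn2real (ultra_norm M t \<phi>) * W t (length js)"
  using pd_le_ultra_norm[OF DL_smooth _ DL_finite] by blast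

lemma DL_subspace: "complex_vector.subspace (DL :: (real^'d::{finite,linorder} \<Rightarrow> complex) set)"
  unfolding complex_vector.subspace_def
proof (intro conjI ballI allI)
  have "smooth euclidean (0 :: real^'d::{finite,linorder} \<Rightarrow> complex)" using complex.smooth_zero by (simp add: zero_fun_def)
  moreover have "pd js (0 :: real^'d::{finite,linorder} \<Rightarrow> complex) x = 0" for js x using pd_zero[of js x] by (simp add: zero_fun_def)
  ultimately have "ultra_norm M t (0 :: real^'d::{finite,linorder} \<Rightarrow> complex) < \<infinity>" if "t \<in> \<RR>" for t
    by (intro ultra_norm_le(2)[OF _ that order_refl]) simp_all
  then show "0 \<in> (DL :: (real^'d::{finite,linorder} \<Rightarrow> complex) set)"
    unfolding DL_def using \<open>smooth euclidean 0\<close> by blast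
next
  fix \<phi> \<psi> :: "real^'d::{finite,linorder} \<Rightarrow> complex" assume \<phi>: "\<phi> \<in> DL" and \<psi>: "\<psi> \<in> DL"
  have "ultra_norm M t (\<phi> + \<psi>) < \<infinity>" if t: "t \<in> \<RR>" for t
  proof (rule ultra_norm_le(2)[OF smooth_plus[OF DL_smooth[OF \<phi>] DL_smooth[OF \<psi>]] t])
    show "cmod (pd js (\<phi> + \<psi>) x) \<le> (enn2real (ultra_norm M t \<phi>) + enn2real (ultra_norm M t \<psi>)) * W t (length js)" for js x
      using norm_triangle_ineq[of "pd js \<phi> x" "pd js \<psi> x"] DL_bound[OF \<phi> t, of js x] DL_bound[OF \<psi> t, of js x]
      unfolding pd_add[OF DL_smooth[OF \<phi>] DL_smooth[OF \<psi>]] by (simp add: distrib_right)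
  qed simp
  then show "\<phi> + \<psi> \<in> DL" using smooth_plus[OF DL_smooth[OF \<phi>] DL_smooth[OF \<psi>]] unfolding DL_def by blast
next
  fix c and \<phi> :: "real^'d::{finite,linorder} \<Rightarrow> complex" assume \<phi>: "\<phi> \<in> DL"
  have "ultra_norm M t (c *\<^sub>C \<phi>) < \<infinity>" if t: "t \<in> \<RR>" for t
  proof (rule ultra_norm_le(2)[OF smooth_scale[OF DL_smooth[OF \<phi>]] t])
    show "cmod (pd js (c *\<^sub>C \<phi>) x) \<le> (cmod c * enn2real (ultra_norm M t \<phi>)) * W t (length js)" for js x
      using mult_left_mono[OF DL_bound[OF \<phi> t, of js x], of "cmod c"]
      unfolding pd_scale[OF DL_smooth[OF \<phi>]] by (simp add: norm_mult mult.assoc)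
  qed simp
  then show "c *\<^sub>C \<phi> \<in> DL" using smooth_scale[OF DL_smooth[OF \<phi>]] unfolding DL_def by blast
qed

lemma DL_family: "seminorm_family (DL :: (real^'d::{finite,linorder} \<Rightarrow> complex) set) (ultra_norm M ` \<RR>)"
proof
  let ?V = "DL :: (real^'d::{finite,linorder} \<Rightarrow> complex) set"
  show "complex_vector.subspace ?V" by (rule DL_subspace)
  show "p x < \<infinity>" if "p \<in> ultra_norm M ` \<RR>" "x \<in> ?V" for p x using that DL_finite by auto
  show "ultra_norm M ` \<RR> \<noteq> {}" using RR_real by auto
  show "seminorm_on ?V (\<lambda>x. enn2real (p x))" if "p \<in> ultra_norm M ` \<RR>" for p
  proof -
    obtain t where t: "t \<in> \<RR>" "p = ultra_norm M t" using \<open>p \<in> ultra_norm M ` \<RR>\<close> by blast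
    have "seminorm_on ?V (\<lambda>\<phi>. cmod (D_multi euclidean (fst i) \<phi> (snd i)) / TM M t (fst i))" for i
      unfolding seminorm_on_def
    proof (intro conjI ballI allI)
      fix \<phi> \<psi> assume \<phi>: "\<phi> \<in> ?V" and \<psi>: "\<psi> \<in> ?V"
      note s = DL_smooth[OF \<phi>] DL_smooth[OF \<psi>]
      show "0 \<le> cmod (D_multi euclidean (fst i) \<phi> (snd i)) / TM M t (fst i)"
        using TM_pos[OF t(1), of "fst i"] by (simp add: less_imp_le)
      show "cmod (D_multi euclidean (fst i) (\<phi> + \<psi>) (snd i)) / TM M t (fst i) \<le>
          cmod (D_multi euclidean (fst i) \<phi> (snd i)) / TM M t (fst i) + cmod (D_multi euclidean (fst i) \<psi> (snd i)) / TM M t (fst i)"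
        unfolding cmod_D_multi[OF s(1)] cmod_D_multi[OF s(2)] cmod_D_multi[OF smooth_plus[OF s]] pd_add[OF s] add_divide_distrib[symmetric]
        by (rule divide_right_mono[OF norm_triangle_ineq less_imp_le[OF TM_pos[OF t(1)]]])
    next
      fix c \<phi> assume \<phi>: "\<phi> \<in> ?V"
      note s = DL_smooth[OF \<phi>]
      show "cmod (D_multi euclidean (fst i) (c *\<^sub>C \<phi>) (snd i)) / TM M t (fst i) =
          cmod c * (cmod (D_multi euclidean (fst i) \<phi> (snd i)) / TM M t (fst i))"
        unfolding cmod_D_multi[OF s] cmod_D_multi[OF smooth_scale[OF s]] pd_scale[OF s] by (simp add: norm_mult)
    qed
    then show ?thesis unfolding t(2) ultra_norm_SUP
      by (intro seminorm_on_SUP[OF DL_subspace]) (use DL_finite[OF _ t(1)] in \<open>auto simp: ultra_norm_SUP\<close>)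
  qed
  show "\<exists>r\<in>ultra_norm M ` \<RR>. \<forall>x\<in>?V. p x \<le> r x \<and> p' x \<le> r x" if p: "p \<in> ultra_norm M ` \<RR>" "p' \<in> ultra_norm M ` \<RR>" for p p'
  proof -
    obtain s t where st: "s \<in> \<RR>" "t \<in> \<RR>" "p = ultra_norm M s" "p' = ultra_norm M t" using p by blast
    let ?m = "\<lambda>j. min (s j) (t j)"
    have m: "?m \<in> \<RR>" using RR_min st by blast
    have "ultra_norm M u \<phi> \<le> ultra_norm M ?m \<phi>" if u: "u \<in> \<RR>" "\<And>j. ?m j \<le> u j" for u and \<phi> :: "real^'d::{finite,linorder} \<Rightarrow> complex"
    proof -
      have "TM M ?m \<alpha> \<le> TM M u \<alpha>" for \<alpha> :: "'d \<Rightarrow> nat"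
        unfolding TM_eq using T_prod_le[OF m, of u] u(2) M_pos by (intro mult_right_mono) (auto intro: less_imp_le)
      then show ?thesis unfolding ultra_norm_def
        by (intro SUP_mono' ennreal_leI divide_left_mono mult_pos_pos TM_pos m u) auto
    qed
    then show ?thesis using st m by (intro bexI[of _ "ultra_norm M ?m"]) auto
  qed
  show "\<phi> = 0" if \<phi>: "\<phi> \<in> ?V" "\<And>p. p \<in> ultra_norm M ` \<RR> \<Longrightarrow> p \<phi> = 0" for \<phi>
  proof
    fix x
    have "cmod (pd [] \<phi> x) \<le> 0" using DL_bound[OF \<phi>(1) RR_real, of "[]" x] \<phi>(2)[of "ultra_norm M real"] RR_real by simp
    then show "\<phi> x = 0 x" by simp
  qed
qed

lemma DLinf_tilde_eq: "DLinf_tilde M = seminorm_topology DL (ultra_norm M ` \<RR>)"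
  unfolding DLinf_tilde_def DL_def ..

end

subsection \<open>The closure of the compactly supported functions\<close>

context weight
begin

lemma D_Roumieu_iff:
  "\<psi> \<in> D_Roumieu M \<longleftrightarrow> smooth euclidean \<psi> \<and> (\<exists>R. \<forall>x. R \<le> norm x \<longrightarrow> \<psi> x = 0) \<and>
     (\<exists>h>0. \<exists>C. \<forall>js x. cmod (pd js \<psi> x) \<le> C * (h ^ length js * M (length js)))"
  for \<psi> :: "real^'d::{finite,linorder} \<Rightarrow> complex"
proof (cases "smooth euclidean \<psi>")
  case False
  then show ?thesis unfolding D_Roumieu_def by simp
next
  case True
  have "compact (closure {x. \<psi> x \<noteq> 0}) \<longleftrightarrow> (\<exists>R. \<forall>x. R \<le> norm x \<longrightarrow> \<psi> x = 0)"
  proof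
    assume "compact (closure {x. \<psi> x \<noteq> 0})"
    then have "bounded {x. \<psi> x \<noteq> 0}" using compact_imp_bounded bounded_closure_image bounded_subset closure_subset by metis
    then obtain R where R: "\<And>x. \<psi> x \<noteq> 0 \<Longrightarrow> norm x \<le> R" unfolding bounded_iff by auto
    have "\<psi> x = 0" if "R + 1 \<le> norm x" for x using R[of x] that by force
    then show "\<exists>R. \<forall>x. R \<le> norm x \<longrightarrow> \<psi> x = 0" by blast
  next
    assume "\<exists>R. \<forall>x. R \<le> norm x \<longrightarrow> \<psi> x = 0"
    then obtain R where "\<forall>x. R \<le> norm x \<longrightarrow> \<psi> x = 0" by blast
    then have "\<forall>x\<in>{x. \<psi> x \<noteq> 0}. norm x \<le> R" by force
    then have "bounded {x. \<psi> x \<noteq> 0}" unfolding bounded_iff by blast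
    then show "compact (closure {x. \<psi> x \<noteq> 0})" by (simp add: compact_eq_bounded_closed bounded_closure)
  qed
  moreover have "(SUP \<alpha>. SUP x. ennreal (cmod (D_multi euclidean \<alpha> \<psi> x) / (h ^ multi_size \<alpha> * M (multi_size \<alpha>)))) < \<infinity> \<longleftrightarrow>
      (\<exists>C. \<forall>js x. cmod (pd js \<psi> x) \<le> C * (h ^ length js * M (length js)))" (is "?S < \<infinity> \<longleftrightarrow> ?R") if h: "h > 0" for h
  proof -
    have pos: "h ^ k * M k > 0" for k using h M_pos by simp
    define F where "F p = cmod (D_multi euclidean (fst p) \<psi> (snd p)) / (h ^ multi_size (fst p) * M (multi_size (fst p)))" for p
    have S: "?S = (SUP p. ennreal (F p))" unfolding F_def by (rule SUP_pair_UNIV)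
    show ?thesis
    proof
      assume fin: "?S < \<infinity>"
      have "cmod (pd js \<psi> x) \<le> enn2real ?S * (h ^ length js * M (length js))" for js x
      proof -
        have "F (count (mset js), x) \<le> enn2real ?S" unfolding S by (rule le_enn2real_SUP) (use fin S in auto)
        then show ?thesis unfolding F_def cmod_pd_eq_D_multi[OF True]
          using pos[of "length js"] by (simp add: multi_size_count field_simps)
      qed
      then show ?R by blast
    next
      assume ?R
      then obtain C where C: "\<And>js x. cmod (pd js \<psi> x) \<le> C * (h ^ length js * M (length js))" by blast
      have F: "F p \<le> C" for p
        unfolding F_def cmod_D_multi[OF True]
        using C[of "multi_list (fst p)" "snd p"] pos[of "multi_size (fst p)"] by (simp add: length_multi_list pos_divide_le_eq)
      have "0 \<le> F (\<lambda>_. 0, 0)" unfolding F_def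
        by (rule divide_nonneg_nonneg[OF norm_ge_zero less_imp_le[OF pos]])
      then have "0 \<le> C" using F[of "(\<lambda>_. 0, 0)"] by linarith
      then show "?S < \<infinity>" unfolding S using F by (intro SUP_ennreal_bound(2)) auto
    qed
  qed
  ultimately show ?thesis unfolding D_Roumieu_def using True by auto
qed

text \<open>
  The scalar instance of the condition that defines the vector-valued space. It turns out to be
  the closure of the compactly supported functions, and is what composition with a continuous
  functional yields.
\<close>

definition Bset :: "(real^'d::{finite,linorder} \<Rightarrow> complex) set" where
  "Bset = {\<phi> \<in> DL. \<forall>t\<in>\<RR>. \<forall>e>0. \<exists>R. \<forall>js x. R \<le> norm x \<longrightarrow> cmod (pd js \<phi> x) \<le> e * W t (length js)}"

lemma Bset_DL: "\<phi> \<in> Bset \<Longrightarrow> \<phi> \<in> DL"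
  unfolding Bset_def by simp

lemma Bset_subspace: "complex_vector.subspace (Bset :: (real^'d::{finite,linorder} \<Rightarrow> complex) set)"
  unfolding complex_vector.subspace_def
proof (intro conjI ballI allI)
  have "pd js (0 :: real^'d::{finite,linorder} \<Rightarrow> complex) x = 0" for js x using pd_zero[of js x] by (simp add: zero_fun_def)
  then show "0 \<in> (Bset :: (real^'d::{finite,linorder} \<Rightarrow> complex) set)"
    unfolding Bset_def using complex_vector.subspace_0[OF DL_subspace] W_pos by (auto intro: less_imp_le)
next
  fix \<phi> \<psi> :: "real^'d::{finite,linorder} \<Rightarrow> complex" assume \<phi>: "\<phi> \<in> Bset" and \<psi>: "\<psi> \<in> Bset"
  have "\<exists>R. \<forall>js x. R \<le> norm x \<longrightarrow> cmod (pd js (\<phi> + \<psi>) x) \<le> e * W t (length js)" if t: "t \<in> \<RR>" and e: "e > 0" for t e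
  proof -
    obtain R where R: "\<forall>js x. R \<le> norm x \<longrightarrow> cmod (pd js \<phi> x) \<le> e/2 * W t (length js)"
      using \<phi> t half_gt_zero[OF e] unfolding Bset_def by blast
    obtain R' where R': "\<forall>js x. R' \<le> norm x \<longrightarrow> cmod (pd js \<psi> x) \<le> e/2 * W t (length js)"
      using \<psi> t half_gt_zero[OF e] unfolding Bset_def by blast
    have "cmod (pd js (\<phi> + \<psi>) x) \<le> e * W t (length js)" if x: "max R R' \<le> norm x" for js x
    proof -
      have 1: "cmod (pd js \<phi> x) \<le> e/2 * W t (length js)" using R x by simp
      have 2: "cmod (pd js \<psi> x) \<le> e/2 * W t (length js)" using R' x by simp
      show ?thesis unfolding pd_add[OF DL_smooth[OF Bset_DL[OF \<phi>]] DL_smooth[OF Bset_DL[OF \<psi>]]]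
        using norm_triangle_le[OF add_mono[OF 1 2]] by (simp add: field_simps)
    qed
    then show ?thesis by blast
  qed
  then show "\<phi> + \<psi> \<in> Bset"
    unfolding Bset_def using complex_vector.subspace_add[OF DL_subspace Bset_DL[OF \<phi>] Bset_DL[OF \<psi>]] by blast
next
  fix c and \<phi> :: "real^'d::{finite,linorder} \<Rightarrow> complex" assume \<phi>: "\<phi> \<in> Bset"
  have "\<exists>R. \<forall>js x. R \<le> norm x \<longrightarrow> cmod (pd js (c *\<^sub>C \<phi>) x) \<le> e * W t (length js)" if t: "t \<in> \<RR>" and e: "e > 0" for t e
  proof -
    have pc: "cmod c + 1 > 0" by (smt (verit) norm_ge_zero)
    then have "e / (cmod c + 1) > 0" using e by simp
    then obtain R where R: "\<forall>js x. R \<le> norm x \<longrightarrow> cmod (pd js \<phi> x) \<le> e / (cmod c + 1) * W t (length js)"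
      using \<phi> t unfolding Bset_def by blast
    have "cmod (pd js (c *\<^sub>C \<phi>) x) \<le> e * W t (length js)" if x: "R \<le> norm x" for js x
    proof -
      have "cmod (pd js (c *\<^sub>C \<phi>) x) = cmod c * cmod (pd js \<phi> x)"
        unfolding pd_scale[OF DL_smooth[OF Bset_DL[OF \<phi>]]] by (rule norm_mult)
      also have "\<dots> \<le> (cmod c + 1) * (e / (cmod c + 1) * W t (length js))"
        using R x pc by (intro mult_mono) auto
      finally show ?thesis using pc by simp
    qed
    then show ?thesis by blast
  qed
  then show "c *\<^sub>C \<phi> \<in> Bset"
    unfolding Bset_def using complex_vector.subspace_scale[OF DL_subspace Bset_DL[OF \<phi>]] by blast
qed

lemma D_Roumieu_DL: 
  assumes \<psi>: "\<psi> \<in> D_Roumieu M" shows "\<psi> \<in> DL"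
proof -
  have s: "smooth euclidean \<psi>" using \<psi> D_Roumieu_iff by blast
  obtain h C where h: "h > 0" "\<And>js x. cmod (pd js \<psi> x) \<le> C * (h ^ length js * M (length js))"
    using \<psi> D_Roumieu_iff by blast
  have "ultra_norm M t \<psi> < \<infinity>" if t: "t \<in> \<RR>" for t
  proof -
    obtain D where D: "D > 0" "\<And>k. h ^ k \<le> D * T_prod t k" using power_le_T_prod[OF t h(1)] by blast
    show ?thesis
    proof (rule ultra_norm_le(2)[OF s t])
      show "0 \<le> \<bar>C\<bar> * D" using D by simp
      fix js x
      have "cmod (pd js \<psi> x) \<le> \<bar>C\<bar> * (h ^ length js * M (length js))"
      proof (rule order_trans[OF h(2) mult_right_mono[OF abs_ge_self]])
        show "0 \<le> h ^ length js * M (length js)"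
          using h(1) M_pos[of "length js"] by (intro mult_nonneg_nonneg) auto
      qed
      also have "\<dots> \<le> \<bar>C\<bar> * ((D * T_prod t (length js)) * M (length js))"
        using D(2)[of "length js"] M_pos[of "length js"] by (intro mult_left_mono mult_right_mono) auto
      finally show "cmod (pd js \<psi> x) \<le> \<bar>C\<bar> * D * W t (length js)" by (simp add: mult_ac)
    qed
  qed
  then show ?thesis unfolding DL_def using s by blast
qed

lemma pd_diff:
  fixes \<phi> \<psi> :: "real^'d::{finite,linorder} \<Rightarrow> complex"
  assumes "smooth euclidean \<phi>" "smooth euclidean \<psi>"
  shows "pd js (\<phi> - \<psi>) x = pd js \<phi> x - pd js \<psi> x"
proof -
  have "\<phi> - \<psi> = \<phi> + (-1) *\<^sub>C \<psi>" by (simp add: fun_eq_iff scaleC_minus1)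
  then show ?thesis using pd_add[OF assms(1) smooth_scale[OF assms(2)], of js "-1" x] pd_scale[OF assms(2), of js "-1" x] by simp
qed

text \<open>
  Multiplication by a cutoff function that equals 1 on a large ball: Leibniz' rule costs a factor
  \<open>2 ^ k\<close> for the derivatives of order \<open>k\<close>, which is absorbed by passing from \<open>t\<close> to \<open>t / 2\<close>.
\<close>

lemma approximate_by_cutoff:
  fixes \<phi> :: "real^'d::{finite,linorder} \<Rightarrow> complex"
  assumes \<phi>: "\<phi> \<in> Bset" and t: "t \<in> \<RR>" and e: "e > 0"
  obtains \<psi> where "\<psi> \<in> D_Roumieu M" "enn2real (ultra_norm M t (\<psi> - \<phi>)) < e"
proof -
  have s: "smooth euclidean \<phi>" using \<phi> Bset_DL DL_smooth by blast
  obtain H where H: "H > 0" "\<forall>r\<ge>0. \<exists>\<omega> :: real^'d::{finite,linorder} \<Rightarrow> complex. smooth euclidean \<omega> \<and>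
     (\<forall>js x. cmod (pd js \<omega> x) \<le> H ^ length js * M (length js)) \<and>
     (\<forall>x. norm x \<le> r \<longrightarrow> \<omega> x = 1) \<and> (\<exists>R. \<forall>x. norm x \<ge> R \<longrightarrow> \<omega> x = 0)"
    using cutoff[where 'd = 'd] by blast
  define u where "u j = t j / 2" for j
  have u: "u \<in> \<RR>" unfolding u_def by (rule RR_scale[OF t]) simp
  have Wu: "2 ^ k * W u k = W t k" for k unfolding u_def T_prod_scale by simp
  have Wut: "W u k \<le> W t k" for k
  proof -
    have "1 * W u k \<le> 2 ^ k * W u k" by (rule mult_right_mono[OF _ less_imp_le[OF W_pos[OF u]]]) simp
    then show ?thesis unfolding Wu by simp
  qed
  obtain C where C: "C > 0" "\<And>k. H ^ k \<le> C * T_prod u k" using power_le_T_prod[OF u H(1)] by blast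
  define d where "d = e / (2 * (C + 1))"
  have d: "d > 0" unfolding d_def using e C by simp
  obtain R where R: "\<forall>js x. R \<le> norm x \<longrightarrow> cmod (pd js \<phi> x) \<le> d * W u (length js)"
    using \<phi> u d unfolding Bset_def by blast
  define r where "r = max R 0 + 1"
  have r: "r \<ge> 0" "R < r" unfolding r_def by auto
  obtain \<omega> :: "real^'d::{finite,linorder} \<Rightarrow> complex" where \<omega>: "smooth euclidean \<omega>"
     "\<And>js x. cmod (pd js \<omega> x) \<le> H ^ length js * M (length js)" "\<And>x. norm x \<le> r \<Longrightarrow> \<omega> x = 1"
     "\<exists>R. \<forall>x. norm x \<ge> R \<longrightarrow> \<omega> x = 0"
    using H(2) r(1) by meson
  define \<psi> where "\<psi> = (\<lambda>x. \<phi> x * \<omega> x)"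
  have s\<psi>: "smooth euclidean \<psi>" unfolding \<psi>_def by (rule smooth_mult(1)[OF s \<omega>(1)])
  have "\<psi> \<in> D_Roumieu M" unfolding D_Roumieu_iff
  proof (intro conjI s\<psi>)
    show "\<exists>R. \<forall>x. R \<le> norm x \<longrightarrow> \<psi> x = 0" using \<omega>(4) unfolding \<psi>_def by auto
    have "\<exists>h>0. \<exists>C. \<forall>i. cmod (pd (fst i) \<phi> (snd i)) / M (length (fst i)) \<le> C * h ^ length (fst i)"
    proof (rule geometric_bound)
      fix t assume t: "t \<in> \<RR>"
      have "cmod (pd (fst i) \<phi> (snd i)) / M (length (fst i)) \<le> enn2real (ultra_norm M t \<phi>) * T_prod t (length (fst i))" for i
        using DL_bound[OF Bset_DL[OF \<phi>] t, of "fst i" "snd i"] M_pos[of "length (fst i)"]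
        by (simp add: pos_divide_le_eq mult.assoc)
      then show "\<exists>C. \<forall>i. cmod (pd (fst i) \<phi> (snd i)) / M (length (fst i)) \<le> C * T_prod t (length (fst i))" by blast
    qed
    then obtain h C where hC: "h > 0" "\<And>i. cmod (pd (fst i) \<phi> (snd i)) / M (length (fst i)) \<le> C * h ^ length (fst i)" by blast
    have p\<phi>: "cmod (pd js \<phi> x) \<le> \<bar>C\<bar> * (max h H ^ length js * M (length js))" for js x
    proof -
      have "cmod (pd js \<phi> x) \<le> C * h ^ length js * M (length js)"
        using hC(2)[of "(js, x)"] M_pos[of "length js"] by (simp add: pos_divide_le_eq)
      also have "\<dots> \<le> \<bar>C\<bar> * max h H ^ length js * M (length js)"
        using M_pos[of "length js"] hC(1) by (intro mult_right_mono mult_mono power_mono) auto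
      finally show ?thesis by (simp add: mult.assoc)
    qed
    have p\<omega>: "cmod (pd js \<omega> x) \<le> max h H ^ length js * M (length js)" for js x
    proof -
      have "H ^ length js * M (length js) \<le> max h H ^ length js * M (length js)"
        using M_pos[of "length js"] H(1) by (intro mult_right_mono power_mono) auto
      then show ?thesis using \<omega>(2)[of js x] by linarith
    qed
    have "cmod (pd js \<psi> x) \<le> 2 ^ length js * (\<bar>C\<bar> * (max h H ^ length js * M (length js)))" for js x
      unfolding \<psi>_def
    proof (rule pd_mult_bound[OF s \<omega>(1)])
      fix a b :: "'d list" assume ab: "length a + length b = length js"
      have "cmod (pd a \<phi> x) * cmod (pd b \<omega> x) \<le>
          (\<bar>C\<bar> * (max h H ^ length a * M (length a))) * (max h H ^ length b * M (length b))"
        using M_pos[of "length a"] hC(1) by (intro mult_mono p\<phi> p\<omega>) (auto intro: less_imp_le)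
      also have "\<dots> = \<bar>C\<bar> * max h H ^ length js * (M (length a) * M (length b))"
        unfolding ab[symmetric] by (simp add: power_add mult_ac)
      also have "\<dots> \<le> \<bar>C\<bar> * max h H ^ length js * M (length js)"
        using M_mult[of "length a" "length b"] hC(1) unfolding ab by (intro mult_left_mono) auto
      finally show "cmod (pd a \<phi> x) * cmod (pd b \<omega> x) \<le> \<bar>C\<bar> * (max h H ^ length js * M (length js))"
        by (simp add: mult.assoc)
    qed
    then have "\<forall>js x. cmod (pd js \<psi> x) \<le> \<bar>C\<bar> * ((2 * max h H) ^ length js * M (length js))"
      by (simp add: power_mult_distrib mult_ac)
    then show "\<exists>h>0. \<exists>C. \<forall>js x. cmod (pd js \<psi> x) \<le> C * (h ^ length js * M (length js))"
      using hC(1) by (intro exI[of _ "2 * max h H"]) auto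
  qed
  moreover have "enn2real (ultra_norm M t (\<psi> - \<phi>)) \<le> e / 2"
  proof (rule ultra_norm_le(3)[OF _ t])
    show "smooth euclidean (\<psi> - \<phi>)"
    proof -
      have "\<psi> - \<phi> = \<psi> + (-1) *\<^sub>C \<phi>" by (simp add: fun_eq_iff scaleC_minus1)
      then show ?thesis using smooth_plus[OF s\<psi> smooth_scale[OF s, of "-1"]] by simp
    qed
    show "0 \<le> e / 2" using e by simp
    fix js x
    show "cmod (pd js (\<psi> - \<phi>) x) \<le> e / 2 * W t (length js)"
    proof (cases "norm x < r")
      case True
      have "pd js (\<psi> - \<phi>) x = pd js (\<lambda>x. 0) x"
        by (rule pd_local[of "ball 0 r"]) (use True \<omega>(3) in \<open>auto simp: \<psi>_def\<close>)
      then show ?thesis using e W_pos[OF t, of "length js"] by (simp add: pd_zero)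
    next
      case False
      then have x: "R \<le> norm x" using r by simp
      have p\<phi>: "cmod (pd a \<phi> x) \<le> d * W u (length a)" for a using R x by blast
      have "cmod (pd js \<psi> x) \<le> 2 ^ length js * (d * C * W u (length js))"
        unfolding \<psi>_def
      proof (rule pd_mult_bound[OF s \<omega>(1)])
        fix a b :: "'d list" assume ab: "length a + length b = length js"
        have "cmod (pd b \<omega> x) \<le> C * W u (length b)"
        proof -
          have "H ^ length b * M (length b) \<le> (C * T_prod u (length b)) * M (length b)"
            by (rule mult_right_mono[OF C(2) less_imp_le[OF M_pos]])
          then show ?thesis using \<omega>(2)[of b x] unfolding mult.assoc by linarith
        qed
        then have "cmod (pd a \<phi> x) * cmod (pd b \<omega> x) \<le> (d * W u (length a)) * (C * W u (length b))"
          using d W_pos[OF u, of "length a"] by (intro mult_mono p\<phi>) (auto intro: less_imp_le)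
        also have "\<dots> = d * C * (W u (length a) * W u (length b))" by (simp only: mult_ac)
        also have "\<dots> \<le> d * C * W u (length js)"
          using W_mult[OF u, of "length a" "length b"] d C(1) unfolding ab by (intro mult_left_mono) auto
        finally show "cmod (pd a \<phi> x) * cmod (pd b \<omega> x) \<le> d * C * W u (length js)" .
      qed
      also have "\<dots> = d * C * W t (length js)" unfolding Wu[symmetric] by (simp only: mult_ac)
      finally have 1: "cmod (pd js \<psi> x) \<le> d * C * W t (length js)" .
      have 2: "cmod (pd js \<phi> x) \<le> d * W t (length js)"
        using p\<phi>[of js] mult_left_mono[OF Wut, of d "length js"] d by linarith
      have "cmod (pd js (\<psi> - \<phi>) x) \<le> d * C * W t (length js) + d * W t (length js)"
        unfolding pd_diff[OF s\<psi> s] using norm_triangle_ineq4[of "pd js \<psi> x" "pd js \<phi> x"] 1 2 by linarith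
      also have "\<dots> = (d * (C + 1)) * W t (length js)" by (simp add: algebra_simps)
      also have "d * (C + 1) = e / 2" unfolding d_def using C(1) by (simp add: field_simps)
      finally show ?thesis .
    qed
  qed
  ultimately show ?thesis using that[of \<psi>] e by auto
qed

text \<open>
  A limit of compactly supported functions has small weighted derivatives outside the support of a
  good approximant. The other inclusion is \<open>approximate_by_cutoff\<close>.
\<close>

theorem Bdot_tilde_eq:
  "(Bdot_tilde M :: (real^'d::{finite,linorder} \<Rightarrow> complex) topology) = seminorm_topology Bset (ultra_norm M ` \<RR>)"
proof -
  interpret DL: seminorm_family "DL :: (real^'d::{finite,linorder} \<Rightarrow> complex) set" "ultra_norm M ` \<RR>" by (rule DL_family)
  have "(DLinf_tilde M :: (real^'d::{finite,linorder} \<Rightarrow> complex) topology) closure_of D_Roumieu M = Bset"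
  proof
    show "(DLinf_tilde M :: (real^'d::{finite,linorder} \<Rightarrow> complex) topology) closure_of D_Roumieu M \<subseteq> Bset"
    proof
      fix \<phi> :: "real^'d::{finite,linorder} \<Rightarrow> complex" assume cl: "\<phi> \<in> DLinf_tilde M closure_of D_Roumieu M"
      then have \<phi>: "\<phi> \<in> DL" and near: "\<And>U. \<phi> \<in> U \<Longrightarrow> openin DL.T U \<Longrightarrow> \<exists>y\<in>D_Roumieu M. y \<in> U"
        unfolding in_closure_of DLinf_tilde_eq by auto
      have "\<exists>R. \<forall>js x. R \<le> norm x \<longrightarrow> cmod (pd js \<phi> x) \<le> e * W t (length js)" if t: "t \<in> \<RR>" and e: "e > 0" for t e
      proof -
        have p: "ultra_norm M t \<in> ultra_norm M ` \<RR>" using t by simp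
        obtain \<psi> where \<psi>: "\<psi> \<in> D_Roumieu M" "enn2real (ultra_norm M t (\<psi> - \<phi>)) < e"
          using near[OF DL.center[OF p \<phi> e] DL.openin_ball[OF p \<phi>]] by blast
        have \<psi>D: "\<psi> \<in> DL" using D_Roumieu_DL \<psi>(1) by blast
        obtain R where R: "\<And>x. R \<le> norm x \<Longrightarrow> \<psi> x = 0" using \<psi>(1) D_Roumieu_iff by blast
        have "cmod (pd js \<phi> x) \<le> e * W t (length js)" if x: "R + 1 \<le> norm x" for js x
        proof -
          have "pd js \<psi> x = pd js (\<lambda>x. 0) x"
          proof (rule pd_local[of "- cball 0 R"])
            show "open (- cball 0 R)" by (simp add: open_Compl)
          qed (use x R in auto)
          then have "pd js \<psi> x = 0" by (simp add: pd_zero)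
          then have "cmod (pd js \<phi> x) = cmod (pd js (\<psi> - \<phi>) x)"
            unfolding pd_diff[OF DL_smooth[OF \<psi>D] DL_smooth[OF \<phi>]] by simp
          also have "\<dots> \<le> enn2real (ultra_norm M t (\<psi> - \<phi>)) * W t (length js)"
            by (rule DL_bound[OF DL.diff[OF \<psi>D \<phi>] t])
          also have "\<dots> \<le> e * W t (length js)" using \<psi>(2) W_pos[OF t, of "length js"] by (intro mult_right_mono) auto
          finally show ?thesis .
        qed
        then show ?thesis by blast
      qed
      then show "\<phi> \<in> Bset" unfolding Bset_def using \<phi> by blast
    qed
    show "(Bset :: (real^'d::{finite,linorder} \<Rightarrow> complex) set) \<subseteq> DLinf_tilde M closure_of D_Roumieu M"
    proof
      fix \<phi> :: "real^'d::{finite,linorder} \<Rightarrow> complex" assume \<phi>: "\<phi> \<in> Bset"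
      have "\<exists>y\<in>D_Roumieu M. y \<in> U" if U: "\<phi> \<in> U" "openin DL.T U" for U
      proof -
        obtain p e where p: "p \<in> ultra_norm M ` \<RR>" "e > 0" "\<forall>y\<in>DL. enn2real (p (y - \<phi>)) < e \<longrightarrow> y \<in> U"
          using U unfolding DL.openin_iff by meson
        obtain t where t: "t \<in> \<RR>" "p = ultra_norm M t" using p(1) by blast
        obtain \<psi> where "\<psi> \<in> D_Roumieu M" "enn2real (ultra_norm M t (\<psi> - \<phi>)) < e"
          using approximate_by_cutoff[OF \<phi> t(1) p(2)] .
        then show ?thesis using p(3) t D_Roumieu_DL by blast
      qed
      then show "\<phi> \<in> DLinf_tilde M closure_of D_Roumieu M"
        unfolding in_closure_of DLinf_tilde_eq using Bset_DL[OF \<phi>] by auto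
    qed
  qed
  then show ?thesis
    unfolding Bdot_tilde_def DLinf_tilde_eq
    using DL.subtopology_subspace[OF Bset_subspace] Bset_DL by auto
qed

lemma Bset_family: "seminorm_family (Bset :: (real^'d::{finite,linorder} \<Rightarrow> complex) set) (ultra_norm M ` \<RR>)"
  by (rule seminorm_family.seminorm_family_subspace[OF DL_family Bset_subspace]) (auto dest: Bset_DL)

end

section \<open>The vector-valued space\<close>

locale vector_valued = weight M + lcs E
  for M :: "nat \<Rightarrow> real" and E :: "'e::complex_vector topology" +
  assumes complete: "complete_lcs E"
begin

definition weighted :: "(nat \<Rightarrow> real) \<Rightarrow> (real^'d::{finite,linorder} \<Rightarrow> 'e) \<Rightarrow>
    ('d::{finite,linorder} \<Rightarrow> nat) \<times> (real^'d::{finite,linorder}) \<Rightarrow> 'e" where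
  "weighted t \<phi> p = D_multi E (fst p) \<phi> (snd p) /\<^sub>R TM M t (fst p)"

abbreviation Bv :: "(real^'d::{finite,linorder} \<Rightarrow> 'e) set" where
  "Bv \<equiv> Bdot_tilde_vec_carrier M E"

abbreviation Pv :: "((real^'d::{finite,linorder} \<Rightarrow> 'e) \<Rightarrow> ennreal) set" where
  "Pv \<equiv> {ultra_seminorm E M q t | q t. continuous_seminorm E q \<and> t \<in> \<RR>}"

lemma ultra_seminorm_SUP: "ultra_seminorm E M q t \<phi> = (SUP p. ennreal (q (weighted t \<phi> p)))"
  unfolding ultra_seminorm_def weighted_def by (rule SUP_pair_UNIV)

lemma weighted_in: "smooth E \<phi> \<Longrightarrow> weighted t \<phi> p \<in> topspace E"
  unfolding weighted_def by (intro scaleR_in D_multi_in)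

lemma weighted_add:
  fixes \<phi> \<psi> :: "real^'d::{finite,linorder} \<Rightarrow> 'e"
  assumes \<phi>: "smooth E \<phi>" and \<psi>: "smooth E \<psi>"
  shows "weighted t (\<phi> + \<psi>) p = weighted t \<phi> p + weighted t \<psi> p" "smooth E (\<phi> + \<psi>)"
proof -
  have eq: "\<phi> + \<psi> = (\<lambda>x. \<phi> x + \<psi> x)" by (simp add: fun_eq_iff)
  show "smooth E (\<phi> + \<psi>)" unfolding eq by (rule smooth_add(1)[OF \<phi> \<psi>])
  show "weighted t (\<phi> + \<psi>) p = weighted t \<phi> p + weighted t \<psi> p"
    unfolding weighted_def eq D_multi_eq[OF \<phi>] D_multi_eq[OF \<psi>] D_multi_eq[OF smooth_add(1)[OF \<phi> \<psi>]] smooth_add(2)[OF \<phi> \<psi>]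
    by (simp only: scaleC_add_right scaleR_add_right)
qed

lemma weighted_scale:
  fixes \<phi> :: "real^'d::{finite,linorder} \<Rightarrow> 'e"
  assumes \<phi>: "smooth E \<phi>"
  shows "weighted t (c *\<^sub>C \<phi>) p = c *\<^sub>C weighted t \<phi> p" "smooth E (c *\<^sub>C \<phi>)"
proof -
  have eq: "c *\<^sub>C \<phi> = (\<lambda>x. c *\<^sub>C \<phi> x)" by (simp only: scaleC_fun_def)
  show "smooth E (c *\<^sub>C \<phi>)" unfolding eq by (rule smooth_scaleC(1)[OF \<phi>])
  show "weighted t (c *\<^sub>C \<phi>) p = c *\<^sub>C weighted t \<phi> p"
    unfolding weighted_def eq D_multi_eq[OF \<phi>] D_multi_eq[OF smooth_scaleC(1)[OF \<phi>]] smooth_scaleC(2)[OF \<phi>]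
    by (simp only: scaleR_scaleC scaleC_scaleC mult_ac)
qed

lemma Bv_iff:
  fixes \<phi> :: "real^'d::{finite,linorder} \<Rightarrow> 'e"
  shows "\<phi> \<in> Bv \<longleftrightarrow> smooth E \<phi> \<and>
     (\<forall>q t. continuous_seminorm E q \<longrightarrow> t \<in> \<RR> \<longrightarrow> (\<exists>C. \<forall>p. q (weighted t \<phi> p) \<le> C)) \<and>
     (\<forall>q t e. continuous_seminorm E q \<longrightarrow> t \<in> \<RR> \<longrightarrow> e > 0 \<longrightarrow> (\<exists>R. \<forall>p. R \<le> norm (snd p) \<longrightarrow> q (weighted t \<phi> p) \<le> e))"
proof (cases "smooth E \<phi>")
  case False
  then show ?thesis unfolding Bdot_tilde_vec_carrier_def by simp
next
  case s: True
  have 1: "(\<exists>C>0. ultra_seminorm E M q t \<phi> \<le> ennreal C) \<longleftrightarrow> (\<exists>C. \<forall>p. q (weighted t \<phi> p) \<le> C)"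
    if q: "continuous_seminorm E q" for q t
  proof
    assume "\<exists>C>0. ultra_seminorm E M q t \<phi> \<le> ennreal C"
    then have "ultra_seminorm E M q t \<phi> < \<infinity>" by (auto intro: le_less_trans)
    then have "q (weighted t \<phi> p) \<le> enn2real (ultra_seminorm E M q t \<phi>)" for p
      unfolding ultra_seminorm_SUP by (rule le_enn2real_SUP) simp
    then show "\<exists>C. \<forall>p. q (weighted t \<phi> p) \<le> C" by blast
  next
    assume "\<exists>C. \<forall>p. q (weighted t \<phi> p) \<le> C"
    then obtain C where "\<And>p. q (weighted t \<phi> p) \<le> C" by blast
    then have "q (weighted t \<phi> p) \<le> max C 1" for p by (simp add: le_max_iff_disj)
    then show "\<exists>C>0. ultra_seminorm E M q t \<phi> \<le> ennreal C"
      unfolding ultra_seminorm_SUP by (intro exI[of _ "max C 1"] conjI SUP_ennreal_bound(1)) auto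
  qed
  have 2: "(\<exists>K. compact K \<and> (\<forall>\<alpha>. \<forall>x\<in>- K. q (D_multi E \<alpha> \<phi> x /\<^sub>R TM M t \<alpha>) \<le> e)) \<longleftrightarrow>
      (\<exists>R. \<forall>p. R \<le> norm (snd p) \<longrightarrow> q (weighted t \<phi> p) \<le> e)" for q t e
  proof
    assume "\<exists>K. compact K \<and> (\<forall>\<alpha>. \<forall>x\<in>- K. q (D_multi E \<alpha> \<phi> x /\<^sub>R TM M t \<alpha>) \<le> e)"
    then obtain K where K: "compact K" "\<And>\<alpha> x. x \<notin> K \<Longrightarrow> q (D_multi E \<alpha> \<phi> x /\<^sub>R TM M t \<alpha>) \<le> e" by auto
    obtain R where R: "\<And>x. x \<in> K \<Longrightarrow> norm x \<le> R" using compact_imp_bounded[OF K(1)] unfolding bounded_iff by blast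
    have "q (weighted t \<phi> p) \<le> e" if "R + 1 \<le> norm (snd p)" for p
      unfolding weighted_def by (rule K(2)) (use R[of "snd p"] that in force)
    then show "\<exists>R. \<forall>p. R \<le> norm (snd p) \<longrightarrow> q (weighted t \<phi> p) \<le> e" by blast
  next
    assume "\<exists>R. \<forall>p. R \<le> norm (snd p) \<longrightarrow> q (weighted t \<phi> p) \<le> e"
    then obtain R where R: "\<And>p. R \<le> norm (snd p) \<Longrightarrow> q (weighted t \<phi> p) \<le> e" by blast
    have "q (D_multi E \<alpha> \<phi> x /\<^sub>R TM M t \<alpha>) \<le> e" if "x \<in> - cball 0 R" for \<alpha> x
      using R[of "(\<alpha>, x)"] that unfolding weighted_def by simp
    then show "\<exists>K. compact K \<and> (\<forall>\<alpha>. \<forall>x\<in>- K. q (D_multi E \<alpha> \<phi> x /\<^sub>R TM M t \<alpha>) \<le> e)"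
      by (intro exI[of _ "cball 0 R"]) auto
  qed
  show ?thesis unfolding Bdot_tilde_vec_carrier_def mem_Collect_eq 2 using s 1 by blast
qed

lemma Bv_smooth: "\<phi> \<in> Bv \<Longrightarrow> smooth E \<phi>"
  unfolding Bv_iff by blast

lemma Bv_bound: "\<phi> \<in> Bv \<Longrightarrow> continuous_seminorm E q \<Longrightarrow> t \<in> \<RR> \<Longrightarrow> \<exists>C. \<forall>p. q (weighted t \<phi> p) \<le> C"
  unfolding Bv_iff by blast

lemma Bv_tail: "\<phi> \<in> Bv \<Longrightarrow> continuous_seminorm E q \<Longrightarrow> t \<in> \<RR> \<Longrightarrow> e > 0 \<Longrightarrow>
    \<exists>R. \<forall>p. R \<le> norm (snd p) \<longrightarrow> q (weighted t \<phi> p) \<le> e"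
  unfolding Bv_iff by blast

lemma Bv_finite:
  assumes "\<phi> \<in> Bv" "continuous_seminorm E q" "t \<in> \<RR>" shows "ultra_seminorm E M q t \<phi> < \<infinity>"
proof -
  obtain C where "\<And>p. q (weighted t \<phi> p) \<le> C" using Bv_bound[OF assms] by blast
  then have "q (weighted t \<phi> p) \<le> max C 0" for p by (simp add: le_max_iff_disj)
  then show ?thesis unfolding ultra_seminorm_SUP by (intro SUP_ennreal_bound(2)[of "max C 0"]) auto
qed

lemma Bv_le_seminorm:
  assumes "\<phi> \<in> Bv" "continuous_seminorm E q" "t \<in> \<RR>"
  shows "q (weighted t \<phi> p) \<le> enn2real (ultra_seminorm E M q t \<phi>)"
  using Bv_finite[OF assms] unfolding ultra_seminorm_SUP by (rule le_enn2real_SUP) simp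

lemma Bv_subspace: "complex_vector.subspace (Bv :: (real^'d::{finite,linorder} \<Rightarrow> 'e) set)"
  unfolding complex_vector.subspace_def
proof (intro conjI ballI allI)
  let ?z = "0 :: real^'d::{finite,linorder} \<Rightarrow> 'e"
  have s: "smooth E ?z" using smooth_zero by (simp add: zero_fun_def)
  have "weighted t ?z p = 0" for t p
    using weighted_scale(1)[OF s, of t 0 p] by simp
  then show "?z \<in> Bv" unfolding Bv_iff using s by (auto simp: continuous_seminorm_0 less_imp_le)
next
  fix \<phi> \<psi> :: "real^'d::{finite,linorder} \<Rightarrow> 'e" assume \<phi>: "\<phi> \<in> Bv" and \<psi>: "\<psi> \<in> Bv"
  note s = Bv_smooth[OF \<phi>] Bv_smooth[OF \<psi>]
  have le: "q (weighted t (\<phi> + \<psi>) p) \<le> q (weighted t \<phi> p) + q (weighted t \<psi> p)" if "continuous_seminorm E q" for q t p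
    unfolding weighted_add(1)[OF s] by (rule seminorm_ineqs(1)[OF that weighted_in[OF s(1)] weighted_in[OF s(2)]])
  show "\<phi> + \<psi> \<in> Bv" unfolding Bv_iff
  proof (intro conjI allI impI)
    show "smooth E (\<phi> + \<psi>)" by (rule weighted_add(2)[OF s])
  next
    fix q t assume q: "continuous_seminorm E q" and t: "t \<in> \<RR>"
    obtain C C' where C: "\<And>p. q (weighted t \<phi> p) \<le> C" "\<And>p. q (weighted t \<psi> p) \<le> C'"
      using Bv_bound[OF \<phi> q t] Bv_bound[OF \<psi> q t] by blast
    have "q (weighted t (\<phi> + \<psi>) p) \<le> C + C'" for p using le[OF q, of t p] C(1)[of p] C(2)[of p] by linarith
    then show "\<exists>C. \<forall>p. q (weighted t (\<phi> + \<psi>) p) \<le> C" by blast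
  next
    fix q t and e :: real assume q: "continuous_seminorm E q" and t: "t \<in> \<RR>" and e: "e > 0"
    obtain R where R: "\<And>p. R \<le> norm (snd p) \<Longrightarrow> q (weighted t \<phi> p) \<le> e/2"
      using Bv_tail[OF \<phi> q t half_gt_zero[OF e]] by blast
    obtain R' where R': "\<And>p. R' \<le> norm (snd p) \<Longrightarrow> q (weighted t \<psi> p) \<le> e/2"
      using Bv_tail[OF \<psi> q t half_gt_zero[OF e]] by blast
    have "q (weighted t (\<phi> + \<psi>) p) \<le> e" if "max R R' \<le> norm (snd p)" for p
      using le[OF q, of t p] R[of p] R'[of p] that by simp
    then show "\<exists>R. \<forall>p. R \<le> norm (snd p) \<longrightarrow> q (weighted t (\<phi> + \<psi>) p) \<le> e" by blast
  qed
next
  fix c and \<phi> :: "real^'d::{finite,linorder} \<Rightarrow> 'e" assume \<phi>: "\<phi> \<in> Bv"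
  note s = Bv_smooth[OF \<phi>]
  \<comment> \<open>the scaled seminorm absorbs the factor\<close>
  have eq: "q (weighted t (c *\<^sub>C \<phi>) p) = cmod c * q (weighted t \<phi> p)" if "continuous_seminorm E q" for q t p
    unfolding weighted_scale(1)[OF s] by (rule seminorm_ineqs(2)[OF that weighted_in[OF s]])
  have cq: "continuous_seminorm E (\<lambda>x. cmod c * q x)" if "continuous_seminorm E q" for q
    by (rule continuous_seminorm_mult[OF that]) simp
  show "c *\<^sub>C \<phi> \<in> Bv" unfolding Bv_iff
  proof (intro conjI allI impI)
    show "smooth E (c *\<^sub>C \<phi>)" by (rule weighted_scale(2)[OF s])
  next
    fix q t assume q: "continuous_seminorm E q" and t: "t \<in> \<RR>"
    show "\<exists>C. \<forall>p. q (weighted t (c *\<^sub>C \<phi>) p) \<le> C" unfolding eq[OF q] using Bv_bound[OF \<phi> cq[OF q] t] .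
  next
    fix q t and e :: real assume q: "continuous_seminorm E q" and t: "t \<in> \<RR>" and e: "e > 0"
    show "\<exists>R. \<forall>p. R \<le> norm (snd p) \<longrightarrow> q (weighted t (c *\<^sub>C \<phi>) p) \<le> e"
      unfolding eq[OF q] using Bv_tail[OF \<phi> cq[OF q] t e] .
  qed
qed

lemma weighted_zero_index:
  fixes \<phi> :: "real^'d::{finite,linorder} \<Rightarrow> 'e"
  assumes s: "smooth E \<phi>"
  shows "weighted t \<phi> (\<lambda>_. 0, x) = \<phi> x"
proof -
  have "multi_size (\<lambda>_ :: 'd. 0 :: nat) = 0" by (simp add: multi_size_def)
  moreover have "multi_list (\<lambda>_ :: 'd. 0) = []" by (simp add: multi_list_def)
  ultimately show ?thesis
    unfolding weighted_def D_multi_eq[OF s] by (simp add: TM_eq M_0 scaleC_one)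
qed

lemma Bv_family: "seminorm_family (Bv :: (real^'d::{finite,linorder} \<Rightarrow> 'e) set) Pv"
proof
  let ?V = "Bv :: (real^'d::{finite,linorder} \<Rightarrow> 'e) set"
  show "complex_vector.subspace ?V" by (rule Bv_subspace)
  show "p x < \<infinity>" if "p \<in> Pv" "x \<in> ?V" for p x using that Bv_finite by auto
  show "Pv \<noteq> ({} :: ((real^'d::{finite,linorder} \<Rightarrow> 'e) \<Rightarrow> ennreal) set)"
    using RR_real continuous_seminorm_zero by auto
  show "seminorm_on ?V (\<lambda>x. enn2real (p x))" if p: "p \<in> Pv" for p
  proof -
    obtain q t where qt: "continuous_seminorm E q" "t \<in> \<RR>" "p = ultra_seminorm E M q t" using p by blast
    have "seminorm_on ?V (\<lambda>\<phi>. q (weighted t \<phi> i))" for i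
      unfolding seminorm_on_def
    proof (intro conjI ballI allI)
      fix \<phi> \<psi> assume \<phi>: "\<phi> \<in> ?V" and \<psi>: "\<psi> \<in> ?V"
      note s = Bv_smooth[OF \<phi>] Bv_smooth[OF \<psi>]
      show "0 \<le> q (weighted t \<phi> i)" by (rule seminorm_ineqs(3)[OF qt(1) weighted_in[OF s(1)]])
      show "q (weighted t (\<phi> + \<psi>) i) \<le> q (weighted t \<phi> i) + q (weighted t \<psi> i)"
        unfolding weighted_add(1)[OF s] by (rule seminorm_ineqs(1)[OF qt(1) weighted_in[OF s(1)] weighted_in[OF s(2)]])
    next
      fix c \<phi> assume "\<phi> \<in> ?V"
      then have s: "smooth E \<phi>" by (rule Bv_smooth)
      show "q (weighted t (c *\<^sub>C \<phi>) i) = cmod c * q (weighted t \<phi> i)"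
        unfolding weighted_scale(1)[OF s] by (rule seminorm_ineqs(2)[OF qt(1) weighted_in[OF s]])
    qed
    then show ?thesis unfolding qt(3) ultra_seminorm_SUP
      by (intro seminorm_on_SUP[OF Bv_subspace]) (use Bv_finite[OF _ qt(1,2)] in \<open>auto simp: ultra_seminorm_SUP\<close>)
  qed
  show "\<exists>r\<in>Pv. \<forall>x\<in>?V. p x \<le> r x \<and> p' x \<le> r x" if p: "p \<in> Pv" "p' \<in> Pv" for p p'
  proof -
    obtain q s where qs: "continuous_seminorm E q" "s \<in> \<RR>" "p = ultra_seminorm E M q s" using p(1) by blast
    obtain q' t where qt: "continuous_seminorm E q'" "t \<in> \<RR>" "p' = ultra_seminorm E M q' t" using p(2) by blast
    let ?m = "\<lambda>j. min (s j) (t j)"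
    let ?q = "\<lambda>x. q x + q' x"
    have m: "?m \<in> \<RR>" using RR_min qs qt by blast
    have q: "continuous_seminorm E ?q" by (rule continuous_seminorm_add[OF qs(1) qt(1)])
    have "ultra_seminorm E M n u \<phi> \<le> ultra_seminorm E M ?q ?m \<phi>"
      if \<phi>: "\<phi> \<in> ?V" and n: "continuous_seminorm E n" "\<And>x. x \<in> topspace E \<Longrightarrow> n x \<le> ?q x"
        and u: "u \<in> \<RR>" "\<And>j. ?m j \<le> u j" for n u \<phi>
      unfolding ultra_seminorm_def
    proof (intro SUP_mono' ennreal_leI)
      fix \<alpha> :: "'d \<Rightarrow> nat" and x
      have D: "D_multi E \<alpha> \<phi> x \<in> topspace E" by (rule D_multi_in[OF Bv_smooth[OF \<phi>]])
      have TM: "TM M ?m \<alpha> \<le> TM M u \<alpha>"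
        unfolding TM_eq using T_prod_le[OF m, of u] u(2) M_pos by (intro mult_right_mono) (auto intro: less_imp_le)
      have "n (D_multi E \<alpha> \<phi> x /\<^sub>R TM M u \<alpha>) = n (D_multi E \<alpha> \<phi> x) / TM M u \<alpha>"
        using seminorm_ineqs(4)[OF n(1) D] TM_pos[OF u(1), of \<alpha>] by (simp add: divide_inverse_commute)
      also have "\<dots> \<le> ?q (D_multi E \<alpha> \<phi> x) / TM M ?m \<alpha>"
        using n(2)[OF D] seminorm_ineqs(3)[OF q D] TM TM_pos[OF m, of \<alpha>] by (intro frac_le) auto
      also have "\<dots> = ?q (D_multi E \<alpha> \<phi> x /\<^sub>R TM M ?m \<alpha>)"
        using seminorm_ineqs(4)[OF q D, of "inverse (TM M ?m \<alpha>)"] TM_pos[OF m, of \<alpha>] by (simp add: divide_inverse_commute)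
      finally show "n (D_multi E \<alpha> \<phi> x /\<^sub>R TM M u \<alpha>) \<le> ?q (D_multi E \<alpha> \<phi> x /\<^sub>R TM M ?m \<alpha>)" .
    qed
    from this[OF _ qs(1) _ qs(2)] this[OF _ qt(1) _ qt(2)]
    have "\<forall>x\<in>?V. p x \<le> ultra_seminorm E M ?q ?m x \<and> p' x \<le> ultra_seminorm E M ?q ?m x"
      unfolding qs(3) qt(3) using seminorm_ineqs(3)[OF qs(1)] seminorm_ineqs(3)[OF qt(1)] by simp
    then show ?thesis using q m by blast
  qed
  show "\<phi> = 0" if \<phi>: "\<phi> \<in> ?V" "\<And>p. p \<in> Pv \<Longrightarrow> p \<phi> = 0" for \<phi>
  proof (rule ccontr)
    assume "\<phi> \<noteq> 0"
    then obtain x where x: "\<phi> x \<noteq> 0" by (auto simp: fun_eq_iff)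
    note s = Bv_smooth[OF \<phi>(1)]
    obtain q where q: "continuous_seminorm E q" "q (\<phi> x) > 0" using seminorm_separates[OF smoothD(4)[OF s] x] .
    have "q (weighted real \<phi> (\<lambda>_. 0, x)) \<le> enn2real (ultra_seminorm E M q real \<phi>)"
      by (rule Bv_le_seminorm[OF \<phi>(1) q(1) RR_real])
    moreover have "ultra_seminorm E M q real \<phi> = 0" using \<phi>(2) q(1) RR_real by blast
    ultimately show False using q(2) unfolding weighted_zero_index[OF s] by simp
  qed
qed

end

section \<open>From vector-valued functions to bilinear functionals\<close>

lemma finite_multi_size_le: "finite {\<alpha> :: 'd::finite \<Rightarrow> nat. multi_size \<alpha> \<le> n}"
proof (rule finite_subset)
  show "{\<alpha> :: 'd \<Rightarrow> nat. multi_size \<alpha> \<le> n} \<subseteq> PiE UNIV (\<lambda>_. {..n})"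
  proof
    fix \<alpha> :: "'d \<Rightarrow> nat" assume \<alpha>: "\<alpha> \<in> {\<alpha>. multi_size \<alpha> \<le> n}"
    have "\<alpha> j \<le> n" for j
    proof -
      have "\<alpha> j \<le> multi_size \<alpha>" unfolding multi_size_def by (rule member_le_sum) auto
      then show ?thesis using \<alpha> by simp
    qed
    then show "\<alpha> \<in> PiE UNIV (\<lambda>_. {..n})" by (simp add: PiE_iff)
  qed
  show "finite (PiE (UNIV :: 'd set) (\<lambda>_. {..n}))" by (rule finite_PiE) auto
qed

context weight
begin

abbreviation Bd :: "(real^'d::{finite,linorder} \<Rightarrow> complex) topology" where
  "Bd \<equiv> seminorm_topology Bset (ultra_norm M ` \<RR>)"

abbreviation N :: "(nat \<Rightarrow> real) \<Rightarrow> (real^'d::{finite,linorder} \<Rightarrow> complex) \<Rightarrow> real" where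
  "N t g \<equiv> enn2real (ultra_norm M t g)"

lemma Bd_lcs: "lcs (Bd :: (real^'d::{finite,linorder} \<Rightarrow> complex) topology)"
  by (rule lcs.intro[OF seminorm_family.locally_convex[OF Bset_family]])

lemma N_continuous: "t \<in> \<RR> \<Longrightarrow> continuous_seminorm Bd (N t)"
  by (rule seminorm_family.generator_continuous[OF Bset_family]) simp

lemma Bd_seminorm_bound:
  fixes q :: "(real^'d::{finite,linorder} \<Rightarrow> complex) \<Rightarrow> real"
  assumes "continuous_seminorm Bd q"
  obtains t C where "t \<in> \<RR>" "C > 0" "\<forall>g\<in>Bset. q g \<le> C * N t g"
proof -
  obtain p C where p: "p \<in> ultra_norm M ` \<RR>" "C > 0" "\<forall>g\<in>Bset. q g \<le> C * enn2real (p g)"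
    using seminorm_family.seminorm_le_generator[OF Bset_family assms] .
  from p(1) obtain t where t: "t \<in> \<RR>" "p = ultra_norm M t" by (rule imageE)
  show ?thesis by (rule that[OF t(1) p(2) p(3)[unfolded t(2)]])
qed

definition delta :: "'d list \<Rightarrow> real^'d::{finite,linorder} \<Rightarrow> (real^'d::{finite,linorder} \<Rightarrow> complex) \<Rightarrow> complex" where
  "delta js x g = (if g \<in> Bset then pd js g x else 0)"

lemma Bset_bound: "g \<in> Bset \<Longrightarrow> t \<in> \<RR> \<Longrightarrow> cmod (pd js g x) \<le> N t g * W t (length js)"
  using DL_bound Bset_DL by blast

lemma Bset_smooth: "g \<in> Bset \<Longrightarrow> smooth euclidean g"
  using DL_smooth Bset_DL by blast

lemma delta_dual:
  fixes x :: "real^'d::{finite,linorder}"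
  shows "delta js x \<in> dual Bd"
proof (rule lcs.dualI[OF Bd_lcs])
  show "clinear_on (topspace Bd) (delta js x)"
    unfolding clinear_on_def topspace_seminorm_topology
  proof (intro conjI ballI allI)
    fix g h :: "real^'d::{finite,linorder} \<Rightarrow> complex" assume g: "g \<in> Bset" and h: "h \<in> Bset"
    have "g + h \<in> Bset" by (rule complex_vector.subspace_add[OF Bset_subspace g h])
    then show "delta js x (g + h) = delta js x g + delta js x h"
      using g h pd_add[OF Bset_smooth[OF g] Bset_smooth[OF h]] unfolding delta_def by simp
  next
    fix c and g :: "real^'d::{finite,linorder} \<Rightarrow> complex" assume g: "g \<in> Bset"
    have "c *\<^sub>C g \<in> Bset" by (rule complex_vector.subspace_scale[OF Bset_subspace g])
    then show "delta js x (c *\<^sub>C g) = c *\<^sub>C delta js x g"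
      using g pd_scale[OF Bset_smooth[OF g]] unfolding delta_def scaleC_complex_def by simp
  qed
  show "continuous_seminorm Bd (\<lambda>g. W real (length js) * N real g)"
    by (rule lcs.continuous_seminorm_mult[OF Bd_lcs N_continuous[OF RR_real] less_imp_le[OF W_pos[OF RR_real]]])
  show "cmod (delta js x g) \<le> W real (length js) * N real g" if "g \<in> topspace Bd" for g
    using Bset_bound[OF _ RR_real, of g js x] that unfolding delta_def by (simp add: mult.commute)
qed (simp add: delta_def)

end

lemma (in lcs) precompactD:
  "precompact S \<Longrightarrow> continuous_seminorm E q \<Longrightarrow> e > 0 \<Longrightarrow>
    \<exists>G. finite G \<and> G \<subseteq> topspace E \<and> (\<forall>x\<in>S. \<exists>g\<in>G. q (x - g) < e)"
  unfolding precompact_def by blast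

context vector_valued
begin

text \<open>A scalar function \<open>e \<circ> \<phi>\<close> is controlled by the values of \<open>e\<close> on the weighted derivatives of \<open>\<phi>\<close>.\<close>

lemma cmod_pd_dual:
  fixes \<phi> :: "real^'d::{finite,linorder} \<Rightarrow> 'e"
  assumes \<phi>: "smooth E \<phi>" and e: "e \<in> dual E" and t: "t \<in> \<RR>"
  shows "cmod (pd js (\<lambda>x. e (\<phi> x)) x) = cmod (e (weighted t \<phi> (count (mset js), x))) * W t (length js)"
proof -
  let ?\<alpha> = "count (mset js)"
  have "cmod (pd js (\<lambda>x. e (\<phi> x)) x) = cmod (e (D_multi E ?\<alpha> \<phi> x))"
    unfolding cmod_pd_eq_D_multi[OF smooth_dual(1)[OF e \<phi>]] D_multi_dual[OF e \<phi>] ..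
  moreover have "e (weighted t \<phi> (?\<alpha>, x)) = e (D_multi E ?\<alpha> \<phi> x) /\<^sub>R TM M t ?\<alpha>"
    unfolding weighted_def using dual_scaleR_apply[OF e D_multi_in[OF \<phi>]] by simp
  then have "cmod (e (weighted t \<phi> (?\<alpha>, x))) * TM M t ?\<alpha> = cmod (e (D_multi E ?\<alpha> \<phi> x))"
    using TM_pos[OF t, of ?\<alpha>] by simp
  moreover have "TM M t ?\<alpha> = W t (length js)" unfolding TM_eq multi_size_count ..
  ultimately show ?thesis by simp
qed

lemma N_dual_le:
  fixes \<phi> :: "real^'d::{finite,linorder} \<Rightarrow> 'e"
  assumes \<phi>: "smooth E \<phi>" and e: "e \<in> dual E" and t: "t \<in> \<RR>" and r: "0 \<le> r"
    and le: "\<And>p. cmod (e (weighted t \<phi> p)) \<le> r"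
  shows "ultra_norm M t (\<lambda>x. e (\<phi> x)) < \<infinity>" "N t (\<lambda>x. e (\<phi> x)) \<le> r"
proof -
  have "cmod (pd js (\<lambda>x. e (\<phi> x)) x) \<le> r * W t (length js)" for js x
    unfolding cmod_pd_dual[OF \<phi> e t] by (rule mult_right_mono[OF le less_imp_le[OF W_pos[OF t]]])
  then show "ultra_norm M t (\<lambda>x. e (\<phi> x)) < \<infinity>" "N t (\<lambda>x. e (\<phi> x)) \<le> r"
    using ultra_norm_le(2,3)[OF smooth_dual(1)[OF e \<phi>] t r] by blast+
qed

lemma dual_comp_Bset:
  fixes \<phi> :: "real^'d::{finite,linorder} \<Rightarrow> 'e"
  assumes \<phi>: "\<phi> \<in> Bv" and e: "e \<in> dual E"
  shows "(\<lambda>x. e (\<phi> x)) \<in> Bset"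
proof -
  note s = Bv_smooth[OF \<phi>]
  have q: "continuous_seminorm E (\<lambda>y. cmod (e y))" by (rule dual_seminorm[OF e])
  have "ultra_norm M t (\<lambda>x. e (\<phi> x)) < \<infinity>" if t: "t \<in> \<RR>" for t
  proof -
    obtain C where C: "\<And>p. cmod (e (weighted t \<phi> p)) \<le> C" using Bv_bound[OF \<phi> q t] by blast
    have "0 \<le> C" using C order_trans[OF norm_ge_zero] by blast
    then show ?thesis using N_dual_le(1)[OF s e t _ C] by blast
  qed
  moreover have "\<exists>R. \<forall>js x. R \<le> norm x \<longrightarrow> cmod (pd js (\<lambda>x. e (\<phi> x)) x) \<le> r * W t (length js)"
    if t: "t \<in> \<RR>" and r: "r > 0" for t r
  proof -
    obtain R where R: "\<And>p. R \<le> norm (snd p) \<Longrightarrow> cmod (e (weighted t \<phi> p)) \<le> r" using Bv_tail[OF \<phi> q t r] by blast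
    have "cmod (pd js (\<lambda>x. e (\<phi> x)) x) \<le> r * W t (length js)" if "R \<le> norm x" for js x
      unfolding cmod_pd_dual[OF s e t] using R[of "(_, x)"] that
      by (intro mult_right_mono less_imp_le[OF W_pos[OF t]]) simp
    then show ?thesis by blast
  qed
  ultimately show ?thesis unfolding Bset_def DL_def using smooth_dual(1)[OF e s] by blast
qed

text \<open>
  Derivatives of high order, and derivatives far away, are uniformly small, the former because
  passing from \<open>t\<close> to \<open>t / 2\<close> gains a factor \<open>2 ^ k\<close>. The remaining ones are finitely many compact images.
\<close>

lemma precompact_weighted:
  fixes \<phi> :: "real^'d::{finite,linorder} \<Rightarrow> 'e"
  assumes \<phi>: "\<phi> \<in> Bv" and t: "t \<in> \<RR>"
  shows "precompact (range (weighted t \<phi>))"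
  unfolding precompact_def
proof (intro conjI allI impI)
  note s = Bv_smooth[OF \<phi>]
  show "range (weighted t \<phi>) \<subseteq> topspace E" using weighted_in[OF s] by auto
  fix q and e :: real assume q: "continuous_seminorm E q" and e: "e > 0"
  define u where "u j = t j / 2" for j
  have u: "u \<in> \<RR>" unfolding u_def by (rule RR_scale[OF t]) simp
  obtain C where C: "\<And>p. q (weighted u \<phi> p) \<le> C" using Bv_bound[OF \<phi> q u] by blast
  have half: "q (weighted t \<phi> p) = q (weighted u \<phi> p) / 2 ^ multi_size (fst p)" for p
  proof -
    have TM: "TM M u (fst p) = TM M t (fst p) / 2 ^ multi_size (fst p)" unfolding TM_eq u_def T_prod_scale by simp
    have "weighted t \<phi> p = inverse (2 ^ multi_size (fst p)) *\<^sub>R weighted u \<phi> p"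
      unfolding weighted_def TM by (simp add: divide_inverse mult.commute)
    then show ?thesis using seminorm_ineqs(4)[OF q weighted_in[OF s]] by (simp add: divide_inverse_commute)
  qed
  obtain n :: nat where n: "C / e < 2 ^ n" using real_arch_pow[of 2 "C / e"] by auto
  have high: "q (weighted t \<phi> p) < e" if "n \<le> multi_size (fst p)" for p
  proof -
    have "C / e < 2 ^ multi_size (fst p)" using order.strict_trans2[OF n power_increasing[OF that]] by simp
    then have "C / 2 ^ multi_size (fst p) < e" using e by (simp add: field_simps)
    then show ?thesis unfolding half using C[of p] by (smt (verit) divide_right_mono zero_le_power)
  qed
  obtain R where R: "\<And>p. R \<le> norm (snd p) \<Longrightarrow> q (weighted t \<phi> p) \<le> e/2" using Bv_tail[OF \<phi> q t half_gt_zero[OF e]] by blast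
  define S where "S \<alpha> = (\<lambda>x. weighted t \<phi> (\<alpha>, x)) ` cball 0 R" for \<alpha>
  have "precompact (S \<alpha>)" for \<alpha>
  proof -
    have "continuous_map euclidean E (\<lambda>x. weighted t \<phi> (\<alpha>, x))"
      unfolding weighted_def fst_conv snd_conv D_multi_eq[OF s] scaleR_scaleC
      by (intro continuous_map_scaleC smoothD(1)[OF s]) auto
    then have "compactin E (S \<alpha>)" unfolding S_def by (rule image_compactin[rotated]) auto
    then show ?thesis by (rule compact_imp_precompact)
  qed
  then have "\<forall>\<alpha>. \<exists>G. finite G \<and> G \<subseteq> topspace E \<and> (\<forall>x\<in>S \<alpha>. \<exists>g\<in>G. q (x - g) < e)"
    by (intro allI precompactD[OF _ q e])
  from choice[OF this] obtain G
    where "\<forall>\<alpha>. finite (G \<alpha>) \<and> G \<alpha> \<subseteq> topspace E \<and> (\<forall>x\<in>S \<alpha>. \<exists>g\<in>G \<alpha>. q (x - g) < e)"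
    by (rule exE)
  then have G: "finite (G \<alpha>)" "G \<alpha> \<subseteq> topspace E" "x \<in> S \<alpha> \<Longrightarrow> \<exists>g\<in>G \<alpha>. q (x - g) < e" for \<alpha> x
    by simp_all
  define H where "H = insert 0 (\<Union>\<alpha>\<in>{\<alpha>. multi_size \<alpha> \<le> n}. G \<alpha>)"
  have "\<exists>g\<in>H. q (weighted t \<phi> p - g) < e" for p
  proof (cases "n \<le> multi_size (fst p) \<or> R \<le> norm (snd p)")
    case True
    then have "q (weighted t \<phi> p) < e" using high[of p] R[of p] e by auto
    then show ?thesis unfolding H_def by auto
  next
    case False
    then have "weighted t \<phi> p \<in> S (fst p)" unfolding S_def by (intro image_eqI[of _ _ "snd p"]) auto
    then obtain g where g: "g \<in> G (fst p)" "q (weighted t \<phi> p - g) < e" using G(3) by blast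
    have "multi_size (fst p) \<le> n" using False by simp
    then have "g \<in> H" unfolding H_def using g(1) by blast
    then show ?thesis using g(2) by blast
  qed
  moreover have "finite H" "H \<subseteq> topspace E" unfolding H_def using finite_multi_size_le G(1,2) zero_in by auto
  ultimately show "\<exists>G. finite G \<and> G \<subseteq> topspace E \<and> (\<forall>x\<in>range (weighted t \<phi>). \<exists>g\<in>G. q (x - g) < e)" by blast
qed

definition pairing :: "(real^'d::{finite,linorder} \<Rightarrow> 'e) \<Rightarrow>
    ((real^'d::{finite,linorder} \<Rightarrow> complex) \<Rightarrow> complex) \<Rightarrow> ('e \<Rightarrow> complex) \<Rightarrow> complex" where
  "pairing \<phi> f e = (if f \<in> dual Bd \<and> e \<in> dual E then f (\<lambda>x. e (\<phi> x)) else 0)"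

lemma comp_add:
  "(\<lambda>x. (e + e') (\<phi> x)) = (\<lambda>x. e (\<phi> x)) + (\<lambda>x. e' (\<phi> x))" for e e' :: "'e \<Rightarrow> complex"
  by (simp add: fun_eq_iff)

lemma comp_scale: "(\<lambda>x. (c *\<^sub>C e) (\<phi> x)) = c *\<^sub>C (\<lambda>x. e (\<phi> x))" for e :: "'e \<Rightarrow> complex"
  by (simp only: scaleC_fun_def)

text \<open>Uniform convergence of \<open>e\<close> on compact discs controls \<open>e \<circ> \<phi>\<close>; here the completeness of \<open>E\<close> enters.\<close>

lemma N_comp_continuous:
  fixes \<phi> :: "real^'d::{finite,linorder} \<Rightarrow> 'e"
  assumes \<phi>: "\<phi> \<in> Bv" and t: "t \<in> \<RR>"
  shows "continuous_seminorm (dual_c E) (\<lambda>e. N t (\<lambda>x. e (\<phi> x)))"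
proof -
  obtain K where K: "compactin E K" "convex K" "circled K" "range (weighted t \<phi>) \<subseteq> K"
    using precompact_in_compact_disc[OF complete precompact_weighted[OF \<phi> t]] .
  have "K \<noteq> {}" using K(4) by auto
  then have K': "compact_disc K" unfolding compact_disc_def using K circled_zero_mem by auto
  have sn: "seminorm_on Bset (N t :: (real^'d::{finite,linorder} \<Rightarrow> complex) \<Rightarrow> real)"
  proof -
    have "continuous_seminorm Bd (N t :: (real^'d::{finite,linorder} \<Rightarrow> complex) \<Rightarrow> real)"
      by (rule N_continuous[OF t])
    then show ?thesis by (simp add: continuous_seminorm_iff)
  qed
  show ?thesis
  proof (rule dual_c_seminormI[OF _ K'])
    show "seminorm_on (dual E) (\<lambda>e. N t (\<lambda>x. e (\<phi> x)))"
      unfolding seminorm_on_def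
    proof (intro conjI ballI allI)
      fix e e' assume e: "e \<in> dual E" and e': "e' \<in> dual E"
      have "N t ((\<lambda>x. e (\<phi> x)) + (\<lambda>x. e' (\<phi> x))) \<le> N t (\<lambda>x. e (\<phi> x)) + N t (\<lambda>x. e' (\<phi> x))"
        using sn dual_comp_Bset[OF \<phi> e] dual_comp_Bset[OF \<phi> e'] unfolding seminorm_on_def by blast
      then show "N t (\<lambda>x. (e + e') (\<phi> x)) \<le> N t (\<lambda>x. e (\<phi> x)) + N t (\<lambda>x. e' (\<phi> x))"
        unfolding comp_add[of e e' \<phi>] .
    next
      fix c e assume e: "e \<in> dual E"
      have "N t (c *\<^sub>C (\<lambda>x. e (\<phi> x))) = cmod c * N t (\<lambda>x. e (\<phi> x))"
        using sn dual_comp_Bset[OF \<phi> e] unfolding seminorm_on_def by blast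
      then show "N t (\<lambda>x. (c *\<^sub>C e) (\<phi> x)) = cmod c * N t (\<lambda>x. e (\<phi> x))"
        unfolding comp_scale[of c e \<phi>] .
    qed simp
    show "\<forall>e\<in>dual E. \<forall>r\<ge>0. (\<forall>x\<in>K. cmod (e x) \<le> r) \<longrightarrow> N t (\<lambda>x. e (\<phi> x)) \<le> r"
    proof (intro ballI allI impI)
      fix e and r :: real assume e: "e \<in> dual E" and r: "r \<ge> 0" "\<forall>x\<in>K. cmod (e x) \<le> r"
      show "N t (\<lambda>x. e (\<phi> x)) \<le> r"
        by (rule N_dual_le(2)[OF Bv_smooth[OF \<phi>] e t r(1)]) (use r(2) K(4) in auto)
    qed
  qed
qed

text \<open>
  On the polar, pointwise convergence is uniform on precompact sets, in particular on the weighted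
  derivatives of \<open>\<phi>\<close>. So \<open>e \<mapsto> e \<circ> \<phi>\<close> is continuous
  for pointwise convergence on the polar, which is compact by the theorem of Alaoglu.
\<close>

lemma compact_comp_polar:
  fixes \<phi> :: "real^'d::{finite,linorder} \<Rightarrow> 'e"
  assumes \<phi>: "\<phi> \<in> Bv" and q: "continuous_seminorm E q"
  shows "compactin Bd ((\<lambda>e x. e (\<phi> x)) ` polar q)"
proof -
  interpret B: seminorm_family "Bset :: (real^'d::{finite,linorder} \<Rightarrow> complex) set" "ultra_norm M ` \<RR>"
    by (rule Bset_family)
  let ?X = "product_topology (\<lambda>_::'e. euclidean :: complex topology) UNIV"
  let ?Y = "subtopology ?X (polar q)"
  have pd: "polar q \<subseteq> dual E" unfolding polar_def by auto
  have top: "topspace ?Y = polar q" by simp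
  have ev: "continuous_map ?X euclidean (\<lambda>f. f x)" for x
    using continuous_map_product_projection[of x UNIV "\<lambda>_. euclidean"] by simp
  have "openin ?Y {e \<in> polar q. (\<lambda>x. e (\<phi> x)) \<in> U}" if U: "openin Bd U" for U
  proof (subst openin_subopen, intro ballI)
    fix e0 assume "e0 \<in> {e \<in> polar q. (\<lambda>x. e (\<phi> x)) \<in> U}"
    then have e0: "e0 \<in> polar q" "(\<lambda>x. e0 (\<phi> x)) \<in> U" by auto
    have "\<exists>p\<in>ultra_norm M ` \<RR>. \<exists>r>0. \<forall>y\<in>Bset. enn2real (p (y - (\<lambda>x. e0 (\<phi> x)))) < r \<longrightarrow> y \<in> U"
      using U e0(2) unfolding B.openin_iff by blast
    then obtain t r where t: "t \<in> \<RR>" and r: "r > 0" "\<And>y. y \<in> Bset \<Longrightarrow> N t (y - (\<lambda>x. e0 (\<phi> x))) < r \<Longrightarrow> y \<in> U" by blast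
    have r8: "r / 8 > 0" using r by simp
    obtain G where "finite G \<and> G \<subseteq> topspace E \<and> (\<forall>x\<in>range (weighted t \<phi>). \<exists>g\<in>G. q (x - g) < r/8)"
      using precompactD[OF precompact_weighted[OF \<phi> t] q r8] by (rule exE)
    then have G12: "finite G" "G \<subseteq> topspace E" and net: "\<forall>x\<in>range (weighted t \<phi>). \<exists>g\<in>G. q (x - g) < r/8"
      by blast+
    note G = G12 bspec[OF net rangeI]
    \<comment> \<open>the point 0 keeps the intersection nonempty when the net \<open>G\<close> is empty\<close>
    define Nb where "Nb = \<Inter>((\<lambda>g. {f \<in> topspace ?X. f g \<in> ball (e0 g) (r/4)}) ` insert 0 G)"
    have ob: "openin ?X {f \<in> topspace ?X. f g \<in> ball (e0 g) (r/4)}" for g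
      by (rule openin_continuous_map_preimage[OF ev]) simp
    have "openin ?X Nb" unfolding Nb_def
    proof (rule openin_Inter)
      show "finite ((\<lambda>g. {f \<in> topspace ?X. f g \<in> ball (e0 g) (r/4)}) ` insert 0 G)" using G(1) by blast
      show "openin ?X S" if "S \<in> (\<lambda>g. {f \<in> topspace ?X. f g \<in> ball (e0 g) (r/4)}) ` insert 0 G" for S
        using that ob by blast
    qed blast
    then have "openin ?Y (polar q \<inter> Nb)" by (metis Int_commute openin_subtopology)
    moreover have "e0 \<in> polar q \<inter> Nb" unfolding Nb_def using e0(1) r(1) by auto
    moreover have "polar q \<inter> Nb \<subseteq> {e \<in> polar q. (\<lambda>x. e (\<phi> x)) \<in> U}"
    proof
      fix e assume e: "e \<in> polar q \<inter> Nb"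
      have eE: "e \<in> dual E" "e0 \<in> dual E" using e e0 pd by auto
      have dE: "e - e0 \<in> dual E" by (rule complex_vector.subspace_diff[OF dual_subspace eE])
      have dle: "cmod ((e - e0) (weighted t \<phi> p)) \<le> r / 2" for p
      proof -
        obtain g where g: "g \<in> G" "q (weighted t \<phi> p - g) < r/8" using G(3) by blast
        let ?w = "weighted t \<phi> p"
        have wE: "?w \<in> topspace E" "g \<in> topspace E" using weighted_in[OF Bv_smooth[OF \<phi>]] G(2) g(1) by auto
        have "cmod (e (?w - g)) \<le> q (?w - g)" "cmod (e0 (?w - g)) \<le> q (?w - g)"
          using e e0(1) diff_in[OF wE] unfolding polar_def by auto
        moreover have "cmod (e g - e0 g) < r / 4" using e g(1) unfolding Nb_def by (auto simp: dist_norm norm_minus_commute)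
        moreover have "(e - e0) ?w = e (?w - g) - e0 (?w - g) + (e g - e0 g)"
          using dual_diff_apply[OF eE(1) wE] dual_diff_apply[OF eE(2) wE] by simp
        moreover have "cmod (e (?w - g) - e0 (?w - g) + (e g - e0 g)) \<le> cmod (e (?w - g)) + cmod (e0 (?w - g)) + cmod (e g - e0 g)"
          by (rule order_trans[OF norm_triangle_ineq]) (simp add: norm_triangle_ineq4)
        ultimately show ?thesis using g(2) by simp
      qed
      have "N t (\<lambda>x. (e - e0) (\<phi> x)) \<le> r / 2"
        by (rule N_dual_le(2)[OF Bv_smooth[OF \<phi>] dE t _ dle]) (use r(1) in simp)
      moreover have eq: "(\<lambda>x. (e - e0) (\<phi> x)) = (\<lambda>x. e (\<phi> x)) - (\<lambda>x. e0 (\<phi> x))" by (simp add: fun_eq_iff)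
      ultimately have "N t ((\<lambda>x. e (\<phi> x)) - (\<lambda>x. e0 (\<phi> x))) < r" using r(1) unfolding eq by linarith
      then show "e \<in> {e \<in> polar q. (\<lambda>x. e (\<phi> x)) \<in> U}" using r(2) dual_comp_Bset[OF \<phi> eE(1)] e by blast
    qed
    ultimately show "\<exists>T. openin ?Y T \<and> e0 \<in> T \<and> T \<subseteq> {e \<in> polar q. (\<lambda>x. e (\<phi> x)) \<in> U}" by blast
  qed
  then have "continuous_map ?Y Bd (\<lambda>e x. e (\<phi> x))"
    unfolding continuous_map_def top using dual_comp_Bset[OF \<phi>] pd by auto
  moreover have "compactin ?Y (polar q)" using compact_polar[OF q] by (simp add: compactin_subtopology)
  ultimately show ?thesis by (rule image_compactin[rotated])
qed

lemma compact_disc_comp_polar: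
  fixes \<phi> :: "real^'d::{finite,linorder} \<Rightarrow> 'e"
  assumes \<phi>: "\<phi> \<in> Bv" and q: "continuous_seminorm E q"
  shows "compactin Bd ((\<lambda>e x. e (\<phi> x)) ` polar q) \<and> convex ((\<lambda>e x. e (\<phi> x)) ` polar q) \<and> circled ((\<lambda>e x. e (\<phi> x)) ` polar q)"
proof (intro conjI compact_comp_polar[OF \<phi> q])
  show "convex ((\<lambda>e x. e (\<phi> x)) ` polar q)"
  proof (rule convexI)
    fix g h and u v :: real assume "g \<in> (\<lambda>e x. e (\<phi> x)) ` polar q" "h \<in> (\<lambda>e x. e (\<phi> x)) ` polar q" and uv: "0 \<le> u" "0 \<le> v" "u + v = 1"
    then obtain e e' where e: "e \<in> polar q" "g = (\<lambda>x. e (\<phi> x))" and e': "e' \<in> polar q" "h = (\<lambda>x. e' (\<phi> x))" by auto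
    have "u *\<^sub>R e + v *\<^sub>R e' \<in> polar q" unfolding polar_def
    proof (intro CollectI conjI ballI)
      show "u *\<^sub>R e + v *\<^sub>R e' \<in> dual E"
        using e(1) e'(1) by (intro complex_vector.subspace_add[OF dual_subspace] subspace_scaleR[OF dual_subspace]) (auto simp: polar_def)
      fix x assume x: "x \<in> topspace E"
      have "cmod ((u *\<^sub>R e + v *\<^sub>R e') x) \<le> u * cmod (e x) + v * cmod (e' x)"
        using norm_triangle_ineq[of "u *\<^sub>R e x" "v *\<^sub>R e' x"] uv by (simp add: scaleR_fun_def)
      also have "\<dots> \<le> q x" using convex_bound_le[of "cmod (e x)" "q x" "cmod (e' x)" u v] e(1) e'(1) x uv unfolding polar_def by simp
      finally show "cmod ((u *\<^sub>R e + v *\<^sub>R e') x) \<le> q x" .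
    qed
    moreover have "u *\<^sub>R g + v *\<^sub>R h = (\<lambda>x. (u *\<^sub>R e + v *\<^sub>R e') (\<phi> x))"
      unfolding e e' by (simp add: fun_eq_iff scaleR_fun_def)
    ultimately show "u *\<^sub>R g + v *\<^sub>R h \<in> (\<lambda>e x. e (\<phi> x)) ` polar q" by blast
  qed
  show "circled ((\<lambda>e x. e (\<phi> x)) ` polar q)" unfolding circled_def
  proof (intro ballI allI impI)
    fix g and c :: complex assume "g \<in> (\<lambda>e x. e (\<phi> x)) ` polar q" and c: "cmod c \<le> 1"
    then obtain e where e: "e \<in> polar q" "g = (\<lambda>x. e (\<phi> x))" by auto
    have "c *\<^sub>C e \<in> polar q" unfolding polar_def
    proof (intro CollectI conjI ballI)
      show "c *\<^sub>C e \<in> dual E" using e(1) complex_vector.subspace_scale[OF dual_subspace] by (auto simp: polar_def)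
      fix x assume x: "x \<in> topspace E"
      have "cmod ((c *\<^sub>C e) x) \<le> cmod (e x)"
        using mult_right_mono[OF c, of "cmod (e x)"] by (simp add: scaleC_fun_def scaleC_complex_def norm_mult)
      then show "cmod ((c *\<^sub>C e) x) \<le> q x" using e(1) x unfolding polar_def by force
    qed
    moreover have "c *\<^sub>C g = (\<lambda>x. (c *\<^sub>C e) (\<phi> x))" unfolding e(2) comp_scale[of c e \<phi>] ..
    ultimately show "c *\<^sub>C g \<in> (\<lambda>e x. e (\<phi> x)) ` polar q" by blast
  qed
qed

lemma seminorm_ball_nbhd:
  assumes "lcs S" "continuous_seminorm S p" "e > 0"
  shows "openin S {y \<in> topspace S. p y < e} \<and> 0 \<in> {y \<in> topspace S. p y < e}"
  using lcs.openin_seminorm_ball[OF assms(1,2) lcs.zero_in[OF assms(1)], of e] lcs.zero_in[OF assms(1)]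
    lcs.continuous_seminorm_0[OF assms(1,2)] assms(3) by simp

text \<open>
  Uniformity over an equicontinuous set of functionals \<open>f\<close> comes from
  \<open>N_comp_continuous\<close>; uniformity over an equicontinuous set of functionals
  \<open>e\<close> comes from the compact disc of the functions \<open>e \<circ> \<phi>\<close>.
\<close>

lemma pairing_carrier:
  fixes \<phi> :: "real^'d::{finite,linorder} \<Rightarrow> 'e"
  assumes \<phi>: "\<phi> \<in> Bv"
  shows "pairing \<phi> \<in> eps_product_carrier Bd E"
proof -
  interpret B: seminorm_family "Bset :: (real^'d::{finite,linorder} \<Rightarrow> complex) set" "ultra_norm M ` \<RR>"
    by (rule Bset_family)
  interpret Bc: lcs "dual_c Bd :: ((real^'d::{finite,linorder} \<Rightarrow> complex) \<Rightarrow> complex) topology" by (rule B.lcs_dual_c)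
  interpret Ec: lcs "dual_c E" by (rule lcs_dual_c)
  note comp = dual_comp_Bset[OF \<phi>]
  have compB: "(\<lambda>x. e (\<phi> x)) \<in> topspace Bd" if "e \<in> dual E" for e using comp[OF that] by simp
  have lin1: "clinear_on (dual Bd) (\<lambda>f. pairing \<phi> f e)" if e: "e \<in> dual E" for e
    unfolding clinear_on_def
  proof (intro conjI ballI allI)
    fix f g :: "(real^'d::{finite,linorder} \<Rightarrow> complex) \<Rightarrow> complex" assume "f \<in> dual Bd" "g \<in> dual Bd"
    then show "pairing \<phi> (f + g) e = pairing \<phi> f e + pairing \<phi> g e"
      using complex_vector.subspace_add[OF B.dual_subspace] e unfolding pairing_def by simp
  next
    fix c and f :: "(real^'d::{finite,linorder} \<Rightarrow> complex) \<Rightarrow> complex" assume f: "f \<in> dual Bd"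
    then have "c *\<^sub>C f \<in> dual Bd" by (rule complex_vector.subspace_scale[OF B.dual_subspace])
    then show "pairing \<phi> (c *\<^sub>C f) e = c *\<^sub>C pairing \<phi> f e"
      using e f unfolding pairing_def by (simp add: scaleC_fun_def)
  qed
  have lin2: "clinear_on (dual E) (\<lambda>e. pairing \<phi> f e)" if f: "f \<in> dual Bd" for f
    unfolding clinear_on_def
  proof (intro conjI ballI allI)
    fix e e' assume e: "e \<in> dual E" "e' \<in> dual E"
    then have "e + e' \<in> dual E" by (rule complex_vector.subspace_add[OF dual_subspace])
    then show "pairing \<phi> f (e + e') = pairing \<phi> f e + pairing \<phi> f e'"
      using e f B.dual_add_apply[OF f compB[OF e(1)] compB[OF e(2)]] unfolding pairing_def comp_add[of e e' \<phi>] by simp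
  next
    fix c e assume e: "e \<in> dual E"
    then have "c *\<^sub>C e \<in> dual E" by (rule complex_vector.subspace_scale[OF dual_subspace])
    then show "pairing \<phi> f (c *\<^sub>C e) = c *\<^sub>C pairing \<phi> f e"
      using e f B.dual_scaleC_apply[OF f compB[OF e]] unfolding pairing_def comp_scale[of c e \<phi>] scaleC_complex_def by simp
  qed
  \<comment> \<open>An equicontinuous set of functionals on the scalar space is dominated by one of the norms.\<close>
  have bnd: "\<exists>p. continuous_seminorm (dual_c E) p \<and> (\<forall>f\<in>A. \<forall>e\<in>dual E. cmod (pairing \<phi> f e) \<le> p e)"
    if A: "A \<subseteq> B.polar q" and q: "continuous_seminorm Bd q" for A q
  proof -
    obtain t C where tC: "t \<in> \<RR>" "C > 0" "\<forall>g\<in>Bset. q g \<le> C * N t g" using Bd_seminorm_bound[OF q] .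
    have "cmod (pairing \<phi> f e) \<le> C * N t (\<lambda>x. e (\<phi> x))" if f: "f \<in> A" and e: "e \<in> dual E" for f e
    proof -
      have "f \<in> dual Bd" "cmod (f (\<lambda>x. e (\<phi> x))) \<le> q (\<lambda>x. e (\<phi> x))" using f A compB[OF e] unfolding B.polar_def by auto
      then show ?thesis using tC(3) comp[OF e] e unfolding pairing_def by force
    qed
    moreover have "continuous_seminorm (dual_c E) (\<lambda>e. C * N t (\<lambda>x. e (\<phi> x)))"
      by (rule Ec.continuous_seminorm_mult[OF N_comp_continuous[OF \<phi> tC(1)]]) (use tC(2) in simp)
    ultimately show ?thesis by (intro exI[of _ "\<lambda>e. C * N t (\<lambda>x. e (\<phi> x))"]) blast
  qed
  have hyp: "hypocontinuous (dual_c Bd) (dual_c E) (equicontinuous_subsets Bd) (equicontinuous_subsets E) (pairing \<phi>)"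
    unfolding hypocontinuous_def
  proof (intro conjI ballI allI impI)
    fix e assume "e \<in> topspace (dual_c E)"
    then have e: "e \<in> dual E" by simp
    have "continuous_seminorm (dual_c Bd) (\<lambda>f. cmod (pairing \<phi> f e))"
    proof (rule B.dual_c_seminormI[OF seminorm_on_clinear[OF lin1[OF e]] B.compact_disc_singleton[OF compB[OF e]]], intro ballI allI impI)
      fix f and r :: real assume f: "f \<in> dual Bd" and r: "\<forall>g\<in>(\<lambda>c. c *\<^sub>C (\<lambda>x. e (\<phi> x))) ` cball 0 1. cmod (f g) \<le> r"
      have "(\<lambda>x. e (\<phi> x)) \<in> (\<lambda>c. c *\<^sub>C (\<lambda>x. e (\<phi> x))) ` cball 0 1"
        by (rule image_eqI[of _ _ 1]) (simp_all add: scaleC_one)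
      from bspec[OF r this] show "cmod (pairing \<phi> f e) \<le> r" using f e unfolding pairing_def by simp
    qed
    then have "(\<lambda>f. pairing \<phi> f e) \<in> dual (dual_c Bd)"
      by (intro Bc.dualI[of _ "\<lambda>f. cmod (pairing \<phi> f e)"]) (use lin1[OF e] in \<open>auto simp: pairing_def\<close>)
    then show "continuous_map (dual_c Bd) euclidean (\<lambda>f. pairing \<phi> f e)" by (rule Bc.dual_continuous_map)
  next
    fix f :: "(real^'d::{finite,linorder} \<Rightarrow> complex) \<Rightarrow> complex" assume "f \<in> topspace (dual_c Bd)"
    then have f: "f \<in> dual Bd" by simp
    have "{f} \<subseteq> B.polar (\<lambda>g. cmod (f g))" unfolding B.polar_def using f by auto
    from bnd[OF this B.dual_seminorm[OF f]]
    obtain p where p: "continuous_seminorm (dual_c E) p" "\<forall>f\<in>{f}. \<forall>e\<in>dual E. cmod (pairing \<phi> f e) \<le> p e"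
      by (elim exE conjE)
    then have "(\<lambda>e. pairing \<phi> f e) \<in> dual (dual_c E)"
      by (intro Ec.dualI[of _ p]) (use lin2[OF f] in \<open>auto simp: pairing_def\<close>)
    then show "continuous_map (dual_c E) euclidean (\<lambda>e. pairing \<phi> f e)" by (rule Ec.dual_continuous_map)
  next
    fix A :: "((real^'d::{finite,linorder} \<Rightarrow> complex) \<Rightarrow> complex) set" and r :: real
    assume A: "A \<in> equicontinuous_subsets Bd" and r: "r > 0"
    obtain q where q: "continuous_seminorm Bd q" "A \<subseteq> B.polar q" using B.equicontinuous_dominated[OF A] .
    from bnd[OF q(2,1)]
    obtain p where p: "continuous_seminorm (dual_c E) p" "\<forall>f\<in>A. \<forall>e\<in>dual E. cmod (pairing \<phi> f e) \<le> p e"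
      by (elim exE conjE)
    show "\<exists>V. openin (dual_c E) V \<and> 0 \<in> V \<and> (\<forall>f\<in>A. \<forall>e\<in>V. cmod (pairing \<phi> f e) < r)"
      using seminorm_ball_nbhd[OF lcs_dual_c p(1) r] p(2)
      by (intro exI[of _ "{y \<in> topspace (dual_c E). p y < r}"]) force
  next
    fix A and r :: real assume A: "A \<in> equicontinuous_subsets E" and r: "r > 0"
    obtain q where q: "continuous_seminorm E q" "A \<subseteq> polar q" using equicontinuous_dominated[OF A] .
    let ?K = "(\<lambda>e x. e (\<phi> x)) ` polar q"
    let ?n = "\<lambda>f. SUP g\<in>?K. ennreal (cmod (f g))"
    have n: "?n \<in> {\<lambda>f. SUP x\<in>K. ennreal (cmod (f x)) | K. compactin Bd K \<and> convex K \<and> circled K}"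
      using compact_disc_comp_polar[OF \<phi> q(1)] by blast
    have p: "continuous_seminorm (dual_c Bd) (\<lambda>f. enn2real (?n f))"
      using seminorm_family.generator_continuous[OF B.dual_c_family n] unfolding dual_c_def .
    have "cmod (pairing \<phi> f e) \<le> enn2real (?n f)" if f: "f \<in> dual Bd" and e: "e \<in> A" for f e
    proof -
      have "e \<in> dual E" using e q(2) unfolding polar_def by auto
      moreover have "cmod (f (\<lambda>x. e (\<phi> x))) \<le> enn2real (?n f)"
        by (rule le_enn2real_SUP[OF seminorm_family.fin[OF B.dual_c_family n f]]) (use e q(2) in auto)
      ultimately show ?thesis using f unfolding pairing_def by simp
    qed
    then show "\<exists>U. openin (dual_c Bd) U \<and> 0 \<in> U \<and> (\<forall>f\<in>U. \<forall>e\<in>A. cmod (pairing \<phi> f e) < r)"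
      using seminorm_ball_nbhd[OF B.lcs_dual_c p r]
      by (intro exI[of _ "{y \<in> topspace (dual_c Bd). enn2real (?n y) < r}"]) force
  qed
  have "\<forall>f e. f \<notin> dual Bd \<or> e \<notin> dual E \<longrightarrow> pairing \<phi> f e = 0" by (simp add: pairing_def)
  then show ?thesis unfolding eps_product_carrier_def mem_Collect_eq using lin1 lin2 hyp by blast
qed

end

section \<open>From bilinear functionals to vector-valued functions\<close>

lemma seminorm_on_compose:
  assumes "seminorm_on W n" "clinear_on V f" "f ` V \<subseteq> W"
  shows "seminorm_on V (\<lambda>x. n (f x))"
  using assms unfolding seminorm_on_def clinear_on_def by (simp add: image_subset_iff)

context vector_valued
begin

definition represent :: "((((real^'d::{finite,linorder}) \<Rightarrow> complex) \<Rightarrow> complex) \<Rightarrow> ('e \<Rightarrow> complex) \<Rightarrow> complex) \<Rightarrow>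
    ((real^'d::{finite,linorder} \<Rightarrow> complex) \<Rightarrow> complex) \<Rightarrow> 'e" where
  "represent b f = (SOME y. y \<in> topspace E \<and> (\<forall>e\<in>dual E. e y = b f e))"

lemma weighted_delta_bound:
  fixes g :: "real^'d::{finite,linorder} \<Rightarrow> complex"
  assumes g: "g \<in> Bset" and t: "t \<in> \<RR>"
  shows "cmod ((of_real (inverse (TM M t (fst p))) *\<^sub>C delta (multi_list (fst p)) (snd p)) g) \<le> N t g"
proof -
  have "cmod ((of_real (inverse (TM M t (fst p))) *\<^sub>C delta (multi_list (fst p)) (snd p)) g) =
      cmod (pd (multi_list (fst p)) g (snd p)) / TM M t (fst p)"
    using g TM_pos[OF t, of "fst p"]
    by (simp add: scaleC_fun_def scaleC_complex_def delta_def norm_mult divide_inverse_commute norm_inverse)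
  also have "\<dots> \<le> N t g"
    using Bset_bound[OF g t, of "multi_list (fst p)" "snd p"] TM_pos[OF t, of "fst p"]
    by (simp add: pos_divide_le_eq TM_eq length_multi_list)
  finally show ?thesis .
qed

context
  fixes b :: "((real^'d::{finite,linorder} \<Rightarrow> complex) \<Rightarrow> complex) \<Rightarrow> ('e \<Rightarrow> complex) \<Rightarrow> complex"
  assumes b: "b \<in> eps_product_carrier Bd E"
begin

lemma carrier_lin1: "e \<in> dual E \<Longrightarrow> clinear_on (dual Bd) (\<lambda>f. b f e)"
  and carrier_lin2: "f \<in> dual Bd \<Longrightarrow> clinear_on (dual E) (\<lambda>e. b f e)"
  and carrier_outside: "f \<notin> dual Bd \<or> e \<notin> dual E \<Longrightarrow> b f e = 0"
  using b unfolding eps_product_carrier_def by blast+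

lemma carrier_hypo: "hypocontinuous (dual_c Bd) (dual_c E) (equicontinuous_subsets Bd) (equicontinuous_subsets E) b"
  using b unfolding eps_product_carrier_def by blast

text \<open>
  For fixed \<open>f\<close>, the functional \<open>b f\<close> is continuous for uniform
  convergence on compact discs of \<open>E\<close>, so by the Mackey-Arens theorem it is evaluation
  at a vector.
\<close>

lemma represent:
  assumes f: "f \<in> dual Bd"
  shows "represent b f \<in> topspace E" "e \<in> dual E \<Longrightarrow> e (represent b f) = b f e"
proof -
  have "continuous_map (dual_c E) euclidean (\<lambda>e. b f e)"
    using carrier_hypo f unfolding hypocontinuous_def by (simp add: lcs.topspace_dual_c[OF Bd_lcs])
  then have "continuous_seminorm (dual_c E) (\<lambda>e. cmod (b f e))"
    unfolding continuous_seminorm_iff using seminorm_on_clinear[OF carrier_lin2[OF f]]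
    by (auto intro: continuous_map_norm)
  then have cs: "continuous_seminorm (dual_c E) (\<lambda>e. cmod (b f e))" .
  have "\<exists>y. y \<in> topspace E \<and> (\<forall>e\<in>dual E. e y = b f e)"
  proof (rule Mackey_Arens[OF carrier_lin2[OF f] cs])
    fix y assume "y \<in> topspace E" "\<And>e. e \<in> dual E \<Longrightarrow> e y = b f e"
    then show ?thesis by blast
  qed
  then have "represent b f \<in> topspace E \<and> (\<forall>e\<in>dual E. e (represent b f) = b f e)"
    unfolding represent_def by (rule someI_ex)
  then show "represent b f \<in> topspace E" "e \<in> dual E \<Longrightarrow> e (represent b f) = b f e" by blast+
qed

lemma represent_eqI:
  assumes "f \<in> dual Bd" "y \<in> topspace E" "\<And>e. e \<in> dual E \<Longrightarrow> e y = b f e"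
  shows "represent b f = y"
  by (rule dual_separates[OF represent(1)[OF assms(1)] assms(2)]) (simp add: represent(2)[OF assms(1)] assms(3))

lemma represent_add:
  assumes f: "f \<in> dual Bd" and g: "g \<in> dual Bd"
  shows "represent b (f + g) = represent b f + represent b g"
proof (rule represent_eqI)
  show "f + g \<in> dual Bd" by (rule complex_vector.subspace_add[OF lcs.dual_subspace[OF Bd_lcs] f g])
  show "represent b f + represent b g \<in> topspace E" by (intro add_in represent(1) f g)
  fix e assume e: "e \<in> dual E"
  have "b (f + g) e = b f e + b g e" using carrier_lin1[OF e] f g unfolding clinear_on_def by blast
  then show "e (represent b f + represent b g) = b (f + g) e"
    using dual_add_apply[OF e represent(1)[OF f] represent(1)[OF g]] represent(2)[OF f e] represent(2)[OF g e] by simp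
qed

lemma represent_scale:
  assumes f: "f \<in> dual Bd"
  shows "represent b (c *\<^sub>C f) = c *\<^sub>C represent b f"
proof (rule represent_eqI)
  show "c *\<^sub>C f \<in> dual Bd" by (rule complex_vector.subspace_scale[OF lcs.dual_subspace[OF Bd_lcs] f])
  show "c *\<^sub>C represent b f \<in> topspace E" by (intro scaleC_in represent(1) f)
  fix e assume e: "e \<in> dual E"
  have "b (c *\<^sub>C f) e = c *\<^sub>C b f e" using carrier_lin1[OF e] f unfolding clinear_on_def by blast
  then show "e (c *\<^sub>C represent b f) = b (c *\<^sub>C f) e"
    using dual_scaleC_apply[OF e represent(1)[OF f]] represent(2)[OF f e] by (simp add: scaleC_complex_def)
qed

lemma represent_diff:
  assumes f: "f \<in> dual Bd" and g: "g \<in> dual Bd"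
  shows "represent b (f - g) = represent b f - represent b g"
proof -
  have "(-1) *\<^sub>C g \<in> dual Bd" by (rule complex_vector.subspace_scale[OF lcs.dual_subspace[OF Bd_lcs] g])
  from represent_add[OF f this] have "represent b (f + (-1) *\<^sub>C g) = represent b f + (-1) *\<^sub>C represent b g"
    unfolding represent_scale[OF g] .
  then show ?thesis unfolding scaleC_minus1 by simp
qed

text \<open>Hypocontinuity with respect to the equicontinuous subsets of the dual of \<open>E\<close> makes \<open>represent b\<close> continuous.\<close>

lemma represent_bound:
  assumes q: "continuous_seminorm E q"
  obtains K where "compactin Bd K" "\<forall>f\<in>dual Bd. \<forall>r\<ge>0. (\<forall>g\<in>K. cmod (f g) \<le> r) \<longrightarrow> q (represent b f) \<le> r"
proof -
  obtain U where U: "openin (dual_c Bd) U" "0 \<in> U" "\<forall>f\<in>U. \<forall>e\<in>polar q. cmod (b f e) < 1"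
    using carrier_hypo polar_equicontinuous[OF q] unfolding hypocontinuous_def by (meson zero_less_one)
  have UB: "U \<subseteq> dual Bd" using openin_subset[OF U(1)] by (simp add: lcs.topspace_dual_c[OF Bd_lcs])
  have "continuous_seminorm (dual_c Bd) (\<lambda>f. q (represent b f))"
  proof (rule lcs.seminorm_dominated_imp_continuous[OF lcs.lcs_dual_c[OF Bd_lcs] _ U(1,2), of _ 1])
    show "seminorm_on (topspace (dual_c Bd)) (\<lambda>f. q (represent b f))"
      unfolding seminorm_on_def lcs.topspace_dual_c[OF Bd_lcs]
    proof (intro conjI ballI allI)
      fix f g :: "(real^'d::{finite,linorder} \<Rightarrow> complex) \<Rightarrow> complex" and c
      assume f: "f \<in> dual Bd"
      show "0 \<le> q (represent b f)" by (rule seminorm_ineqs(3)[OF q represent(1)[OF f]])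
      show "q (represent b (c *\<^sub>C f)) = cmod c * q (represent b f)"
        unfolding represent_scale[OF f] by (rule seminorm_ineqs(2)[OF q represent(1)[OF f]])
      assume g: "g \<in> dual Bd"
      show "q (represent b (f + g)) \<le> q (represent b f) + q (represent b g)"
        unfolding represent_add[OF f g] by (rule seminorm_ineqs(1)[OF q represent(1)[OF f] represent(1)[OF g]])
    qed
    fix f assume f: "f \<in> U"
    then have fB: "f \<in> dual Bd" using UB by blast
    have "\<forall>e\<in>polar q. cmod (e (represent b f)) \<le> 1"
    proof
      fix e assume e: "e \<in> polar q"
      then have "e \<in> dual E" unfolding polar_def by simp
      then show "cmod (e (represent b f)) \<le> 1" using U(3) f e represent(2)[OF fB] by force
    qed
    then show "q (represent b f) \<le> 1" using seminorm_le_iff_polar[OF q represent(1)[OF fB]] by blast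
  qed
  then obtain K where K: "lcs.compact_disc Bd K"
      "\<forall>f\<in>dual Bd. \<forall>r\<ge>0. (\<forall>g\<in>K. cmod (f g) \<le> r) \<longrightarrow> q (represent b f) \<le> r"
    by (rule lcs.dual_c_seminorm_bound[OF Bd_lcs])
  then show ?thesis using that[of K] unfolding lcs.compact_disc_def[OF Bd_lcs] by blast
qed

text \<open>Functionals that are uniformly bounded by one norm converge uniformly on compact sets once they converge pointwise.\<close>

lemma represent_tendsto_0:
  fixes F :: "'z filter"
  assumes q: "continuous_seminorm E q" and t: "t \<in> \<RR>"
    and f: "\<And>z. f z \<in> dual Bd" and bnd: "\<And>z g. g \<in> Bset \<Longrightarrow> cmod (f z g) \<le> C * N t g"
    and lim: "\<And>g. g \<in> Bset \<Longrightarrow> ((\<lambda>z. f z g) \<longlongrightarrow> 0) F"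
  shows "((\<lambda>z. q (represent b (f z))) \<longlongrightarrow> 0) F"
proof (rule tendstoI)
  fix e :: real assume e: "e > 0"
  obtain K where K: "compactin Bd K" "\<forall>f\<in>dual Bd. \<forall>r\<ge>0. (\<forall>g\<in>K. cmod (f g) \<le> r) \<longrightarrow> q (represent b f) \<le> r"
    using represent_bound[OF q] .
  define d where "d = e / (4 * (\<bar>C\<bar> + 1))"
  have d: "d > 0" unfolding d_def using e by simp
  obtain G where "finite G \<and> G \<subseteq> topspace Bd \<and> (\<forall>k\<in>K. \<exists>g\<in>G. N t (k - g) < d)"
    using lcs.precompactD[OF Bd_lcs lcs.compact_imp_precompact[OF Bd_lcs K(1)] N_continuous[OF t] d] by (rule exE)
  then have G: "finite G" "G \<subseteq> Bset" "\<forall>k\<in>K. \<exists>g\<in>G. N t (k - g) < d" by simp_all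
  have KB: "K \<subseteq> Bset" using compactin_subset_topspace[OF K(1)] by simp
  have "\<forall>g\<in>G. \<forall>\<^sub>F z in F. cmod (f z g) < e/4"
  proof
    fix g assume "g \<in> G"
    then have "((\<lambda>z. f z g) \<longlongrightarrow> 0) F" using lim G(2) by blast
    then show "\<forall>\<^sub>F z in F. cmod (f z g) < e/4"
      unfolding norm_conv_dist by (rule tendstoD) (use e in simp)
  qed
  then have "\<forall>\<^sub>F z in F. \<forall>g\<in>G. cmod (f z g) < e/4" using G(1) by (simp add: eventually_ball_finite)
  then show "\<forall>\<^sub>F z in F. dist (q (represent b (f z))) 0 < e"
  proof eventually_elim
    case (elim z)
    have "\<forall>k\<in>K. cmod (f z k) \<le> e/2"
    proof
      fix k assume k: "k \<in> K"
      obtain g where g: "g \<in> G" "N t (k - g) < d" using G(3) k by blast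
      have kg: "k \<in> topspace Bd" "g \<in> topspace Bd" using k KB g G(2) by auto
      have kgB: "k - g \<in> Bset" using lcs.diff_in[OF Bd_lcs kg] by simp
      have "f z k = f z (k - g) + f z g" using lcs.dual_diff_apply[OF Bd_lcs f kg] by simp
      then have "cmod (f z k) \<le> cmod (f z (k - g)) + cmod (f z g)" by (simp only: norm_triangle_ineq)
      moreover have "cmod (f z (k - g)) \<le> e/4"
      proof -
        have "cmod (f z (k - g)) \<le> C * N t (k - g)" by (rule bnd[OF kgB])
        also have "\<dots> \<le> (\<bar>C\<bar> + 1) * d" using g(2) by (intro mult_mono) auto
        also have "\<dots> = e/4" unfolding d_def by (simp add: field_simps)
        finally show ?thesis .
      qed
      ultimately show "cmod (f z k) \<le> e/2" using elim g(1) by force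
    qed
    moreover have "0 \<le> e/2" using e by simp
    ultimately have "q (represent b (f z)) \<le> e/2" using K(2) f by blast
    then show ?case using seminorm_ineqs(3)[OF q represent(1)[OF f]] e by (simp add: dist_real_def)
  qed
qed

definition density :: "real^'d::{finite,linorder} \<Rightarrow> 'e" where
  "density x = represent b (delta [] x)"

text \<open>
  The difference quotients of the evaluation functionals, minus the expected limit, converge
  pointwise to 0 and by the mean value inequality are bounded by a common norm.
\<close>

lemma has_partial_represent_delta:
  "has_partial E j (\<lambda>x. represent b (delta js x)) x (represent b (delta (j # js) x))"
  unfolding has_partial_def limitin_iff_seminorm
proof (intro conjI allI impI)
  let ?y = "\<lambda>h. x + h *\<^sub>R axis j 1"
  show "represent b (delta (j # js) x) \<in> topspace E" by (rule represent(1)[OF delta_dual])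
  show "\<forall>\<^sub>F h in at 0. (represent b (delta js (?y h)) - represent b (delta js x)) /\<^sub>R h \<in> topspace E"
    by (intro always_eventually allI scaleR_in diff_in represent(1) delta_dual)
  fix q assume q: "continuous_seminorm E q"
  define f where "f h = of_real (inverse h) *\<^sub>C (delta js (?y h) - delta js x) - delta (j # js) x" for h :: real
  have dd: "delta js (?y h) - delta js x \<in> dual Bd" for h
    by (rule complex_vector.subspace_diff[OF lcs.dual_subspace[OF Bd_lcs] delta_dual delta_dual])
  have sd: "of_real r *\<^sub>C (delta js (?y h) - delta js x) \<in> dual Bd" for h r
    by (rule complex_vector.subspace_scale[OF lcs.dual_subspace[OF Bd_lcs] dd])
  have fd: "f h \<in> dual Bd" for h
    unfolding f_def by (rule complex_vector.subspace_diff[OF lcs.dual_subspace[OF Bd_lcs] sd delta_dual])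
  have rep: "represent b (f h) = (represent b (delta js (?y h)) - represent b (delta js x)) /\<^sub>R h - represent b (delta (j # js) x)" for h
    unfolding f_def represent_diff[OF sd delta_dual] represent_scale[OF dd] represent_diff[OF delta_dual delta_dual] scaleR_scaleC ..
  have f_apply: "f h g = (pd js g (?y h) - pd js g x) /\<^sub>R h - pd (j # js) g x" if "g \<in> Bset" for h g
    unfolding f_def using that by (simp add: delta_def scaleC_fun_def scaleC_complex_def scaleR_conv_of_real del: foldr_Cons)
  have "((\<lambda>h. q (represent b (f h))) \<longlongrightarrow> 0) (at 0)"
  proof (rule represent_tendsto_0[OF q RR_real fd])
    fix h and g :: "real^'d::{finite,linorder} \<Rightarrow> complex" assume g: "g \<in> Bset"
    let ?B = "N real g * W real (length (j # js))"
    have B: "cmod (pd (j # js) g y) \<le> ?B" for y by (rule Bset_bound[OF g RR_real])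
    have B0: "0 \<le> ?B" using B order_trans[OF norm_ge_zero] by blast
    have "cmod (pd js g (?y h) - pd js g x) \<le> ?B * \<bar>h\<bar>" by (rule increment_bound[OF Bset_smooth[OF g] B])
    then have "cmod ((pd js g (?y h) - pd js g x) /\<^sub>R h) \<le> ?B"
    proof (cases "h = 0")
      case True
      then show ?thesis using B0 by (simp only: inverse_zero scaleR_zero_left norm_zero)
    next
      case False
      have "cmod ((pd js g (?y h) - pd js g x) /\<^sub>R h) = cmod (pd js g (?y h) - pd js g x) / \<bar>h\<bar>"
        by (simp only: norm_scaleR abs_inverse divide_inverse_commute)
      then show ?thesis
        using \<open>cmod (pd js g (?y h) - pd js g x) \<le> ?B * \<bar>h\<bar>\<close> False by (simp only: pos_divide_le_eq zero_less_abs_iff not_False_eq_True)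
    qed
    then have "cmod (f h g) \<le> ?B + ?B"
      unfolding f_apply[OF g] by (rule order_trans[OF norm_triangle_ineq4 add_mono[OF _ B]])
    then show "cmod (f h g) \<le> (2 * W real (length (j # js))) * N real g" by (simp add: mult_ac)
  next
    fix g :: "real^'d::{finite,linorder} \<Rightarrow> complex" assume g: "g \<in> Bset"
    have "((\<lambda>h. (pd js g (?y h) - pd js g x) /\<^sub>R h) \<longlongrightarrow> pd (j # js) g x) (at 0)"
      using complex.smoothD(2)[OF Bset_smooth[OF g], of j js x] unfolding has_partial_def by (simp del: foldr_Cons)
    then show "((\<lambda>h. f h g) \<longlongrightarrow> 0) (at 0)" unfolding f_apply[OF g] by (rule LIM_zero)
  qed
  then show "((\<lambda>h. q ((represent b (delta js (?y h)) - represent b (delta js x)) /\<^sub>R h - represent b (delta (j # js) x))) \<longlongrightarrow> 0) (at 0)"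
    unfolding rep .
qed

lemma continuous_represent_delta: "continuous_map euclidean E (\<lambda>x. represent b (delta js x))"
  unfolding continuous_map_atin
proof
  fix x :: "real^'d::{finite,linorder}"
  show "limitin E (\<lambda>x. represent b (delta js x)) (represent b (delta js x)) (atin euclidean x)"
    unfolding limitin_iff_seminorm
  proof (intro conjI allI impI)
    show "represent b (delta js x) \<in> topspace E" by (rule represent(1)[OF delta_dual])
    show "\<forall>\<^sub>F y in atin euclidean x. represent b (delta js y) \<in> topspace E"
      by (intro always_eventually allI represent(1) delta_dual)
    fix q assume q: "continuous_seminorm E q"
    define f where "f y = delta js y - delta js x" for y
    have fd: "f y \<in> dual Bd" for y
      unfolding f_def by (rule complex_vector.subspace_diff[OF lcs.dual_subspace[OF Bd_lcs] delta_dual delta_dual])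
    have "((\<lambda>y. q (represent b (f y))) \<longlongrightarrow> 0) (at x)"
    proof (rule represent_tendsto_0[OF q RR_real fd])
      fix y and g :: "real^'d::{finite,linorder} \<Rightarrow> complex" assume g: "g \<in> Bset"
      have "cmod (f y g) \<le> cmod (pd js g y) + cmod (pd js g x)" unfolding f_def using g by (simp add: delta_def norm_triangle_ineq4)
      then show "cmod (f y g) \<le> (2 * W real (length js)) * N real g"
        using Bset_bound[OF g RR_real, of js y] Bset_bound[OF g RR_real, of js x] by (simp add: mult_ac)
    next
      fix g :: "real^'d::{finite,linorder} \<Rightarrow> complex" assume g: "g \<in> Bset"
      have "isCont (pd js g) x"
        using complex.smoothD(1)[OF Bset_smooth[OF g], of js] by (simp add: continuous_on_eq_continuous_at)
      then show "((\<lambda>y. f y g) \<longlongrightarrow> 0) (at x)"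
        unfolding f_def using g LIM_zero[of "pd js g" "pd js g x" "at x"] by (simp add: delta_def isCont_def)
    qed
    moreover have "atin euclidean x = at x"
      unfolding filter_eq_iff eventually_atin eventually_at_topological by auto
    ultimately show "((\<lambda>y. q (represent b (delta js y) - represent b (delta js x))) \<longlongrightarrow> 0) (atin euclidean x)"
      unfolding f_def represent_diff[OF delta_dual delta_dual] by (simp only:)
  qed
qed

lemma density_smooth: "smooth E density" and density_partials: "partials E js density = (\<lambda>x. represent b (delta js x))"
  using smoothI[of "\<lambda>js x. represent b (delta js x)" density, OF _ continuous_represent_delta has_partial_represent_delta]
  by (auto simp: density_def fun_eq_iff)

lemma weighted_density:
  assumes q: "continuous_seminorm E q" and t: "t \<in> \<RR>"
  shows "q (weighted t density p) = q (represent b (of_real (inverse (TM M t (fst p))) *\<^sub>C delta (multi_list (fst p)) (snd p)))"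
proof -
  let ?y = "represent b (delta (multi_list (fst p)) (snd p))"
  have y: "?y \<in> topspace E" by (rule represent(1)[OF delta_dual])
  have "weighted t density p = of_real (inverse (TM M t (fst p))) *\<^sub>C (inverse \<i>) ^ multi_size (fst p) *\<^sub>C ?y"
    unfolding weighted_def D_multi_eq[OF density_smooth] density_partials scaleR_scaleC ..
  then have "q (weighted t density p) = cmod (of_real (inverse (TM M t (fst p)))) * (cmod ((inverse \<i>) ^ multi_size (fst p)) * q ?y)"
    by (simp only: seminorm_ineqs(2)[OF q scaleC_in[OF y]] seminorm_ineqs(2)[OF q y])
  also have "cmod ((inverse \<i>) ^ multi_size (fst p)) = 1" by (simp add: norm_power norm_inverse del: inverse_i)
  finally show ?thesis unfolding represent_scale[OF delta_dual] seminorm_ineqs(2)[OF q y] by simp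
qed

text \<open>
  The bound holds because every norm of the scalar space is bounded on compact sets; the decay holds
  because the weighted evaluation functionals converge pointwise to 0 at infinity.
\<close>

lemma density_in: "density \<in> Bv"
  unfolding Bv_iff
proof (intro conjI allI impI density_smooth)
  fix q t assume q: "continuous_seminorm E q" and t: "t \<in> \<RR>"
  obtain K where K: "compactin Bd K" "\<forall>f\<in>dual Bd. \<forall>r\<ge>0. (\<forall>g\<in>K. cmod (f g) \<le> r) \<longrightarrow> q (represent b f) \<le> r"
    using represent_bound[OF q] .
  have KB: "K \<subseteq> Bset" using compactin_subset_topspace[OF K(1)] by simp
  have "compactin euclidean (N t ` K)"
  proof (rule image_compactin[OF K(1)])
    have "continuous_seminorm Bd (N t :: (real^'d::{finite,linorder} \<Rightarrow> complex) \<Rightarrow> real)" by (rule N_continuous[OF t])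
    then show "continuous_map Bd euclidean (N t :: (real^'d::{finite,linorder} \<Rightarrow> complex) \<Rightarrow> real)"
      by (simp add: continuous_seminorm_iff)
  qed
  then have "bounded (N t ` K)" by (simp add: compact_imp_bounded)
  then obtain C where C: "\<And>g. g \<in> K \<Longrightarrow> N t g \<le> C" unfolding bounded_iff by force
  have "q (weighted t density p) \<le> max C 0" for p
    unfolding weighted_density[OF q t]
  proof (rule K(2)[rule_format])
    show "of_real (inverse (TM M t (fst p))) *\<^sub>C delta (multi_list (fst p)) (snd p) \<in> dual Bd"
      by (rule complex_vector.subspace_scale[OF lcs.dual_subspace[OF Bd_lcs] delta_dual])
    fix g assume "g \<in> K"
    then show "cmod ((of_real (inverse (TM M t (fst p))) *\<^sub>C delta (multi_list (fst p)) (snd p)) g) \<le> max C 0"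
      using weighted_delta_bound[OF _ t, of g p] C[of g] KB by force
  qed simp
  then show "\<exists>C. \<forall>p. q (weighted t density p) \<le> C" by blast
next
  fix q t and e :: real assume q: "continuous_seminorm E q" and t: "t \<in> \<RR>" and e: "e > 0"
  define f where "f p = of_real (inverse (TM M t (fst p))) *\<^sub>C delta (multi_list (fst p)) (snd p)"
    for p :: "('d \<Rightarrow> nat) \<times> (real^'d::{finite,linorder})"
  have "((\<lambda>p. q (represent b (f p))) \<longlongrightarrow> 0) (filtercomap (\<lambda>p. norm (snd p)) at_top)"
  proof (rule represent_tendsto_0[OF q t])
    show "f p \<in> dual Bd" for p
      unfolding f_def by (rule complex_vector.subspace_scale[OF lcs.dual_subspace[OF Bd_lcs] delta_dual])
    show "cmod (f p g) \<le> 1 * N t g" if "g \<in> Bset" for p g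
      unfolding f_def using weighted_delta_bound[OF that t, of p] by simp
    fix g :: "real^'d::{finite,linorder} \<Rightarrow> complex" assume g: "g \<in> Bset"
    show "((\<lambda>p. f p g) \<longlongrightarrow> 0) (filtercomap (\<lambda>p. norm (snd p)) at_top)"
    proof (rule tendstoI)
      fix r :: real assume r: "r > 0"
      obtain R where R: "\<forall>js x. R \<le> norm x \<longrightarrow> cmod (pd js g x) \<le> r/2 * W t (length js)"
        using g t half_gt_zero[OF r] unfolding Bset_def by blast
      have "dist (f p g) 0 < r" if p: "R \<le> norm (snd p)" for p
      proof -
        have "cmod (f p g) = cmod (pd (multi_list (fst p)) g (snd p)) / TM M t (fst p)"
          unfolding f_def using g TM_pos[OF t, of "fst p"]
          by (simp add: scaleC_fun_def scaleC_complex_def delta_def norm_mult divide_inverse_commute norm_inverse)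
        also have "\<dots> \<le> r/2"
          using R[rule_format, OF p, of "multi_list (fst p)"] TM_pos[OF t, of "fst p"]
          by (simp add: pos_divide_le_eq TM_eq length_multi_list)
        finally show ?thesis using r by simp
      qed
      then show "\<forall>\<^sub>F p in filtercomap (\<lambda>p. norm (snd p)) at_top. dist (f p g) 0 < r"
        unfolding eventually_filtercomap_at_top_linorder by blast
    qed
  qed
  then have "\<forall>\<^sub>F p in filtercomap (\<lambda>p. norm (snd p)) at_top. q (represent b (f p)) < e"
    using e by (rule order_tendstoD(2))
  then obtain R where "\<And>p. R \<le> norm (snd p) \<Longrightarrow> q (represent b (f p)) < e"
    unfolding eventually_filtercomap_at_top_linorder by blast
  then show "\<exists>R. \<forall>p. R \<le> norm (snd p) \<longrightarrow> q (weighted t density p) \<le> e"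
    unfolding weighted_density[OF q t] f_def by (intro exI[of _ R]) (auto intro: less_imp_le)
qed

text \<open>The Mackey-Arens theorem for the scalar space identifies \<open>b\<close> with the functional of \<open>density\<close>.\<close>

lemma pairing_density: "pairing density = b"
proof (intro ext)
  fix f :: "(real^'d::{finite,linorder} \<Rightarrow> complex) \<Rightarrow> complex" and e
  show "pairing density f e = b f e"
  proof (cases "f \<in> dual Bd \<and> e \<in> dual E")
    case False
    then show ?thesis using carrier_outside unfolding pairing_def by auto
  next
    case True
    then have f: "f \<in> dual Bd" and e: "e \<in> dual E" by auto
    have "continuous_map (dual_c Bd) euclidean (\<lambda>f. b f e)"
      using carrier_hypo e unfolding hypocontinuous_def by simp
    then have "continuous_seminorm (dual_c Bd) (\<lambda>f. cmod (b f e))"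
      unfolding continuous_seminorm_iff lcs.topspace_dual_c[OF Bd_lcs] using seminorm_on_clinear[OF carrier_lin1[OF e]]
      by (auto intro: continuous_map_norm)
    then have cs: "continuous_seminorm (dual_c Bd) (\<lambda>f. cmod (b f e))" .
    have "\<exists>g. g \<in> topspace Bd \<and> (\<forall>f\<in>dual Bd. f g = b f e)"
    proof (rule lcs.Mackey_Arens[OF Bd_lcs carrier_lin1[OF e] cs])
      fix g assume "g \<in> topspace Bd" "\<And>f. f \<in> dual Bd \<Longrightarrow> f g = b f e"
      then show ?thesis by blast
    qed
    then obtain g where g: "g \<in> topspace Bd" "\<forall>f\<in>dual Bd. f g = b f e" by (elim exE conjE)
    have "g = (\<lambda>x. e (density x))"
    proof
      fix x
      have "g x = delta [] x g" using g(1) by (simp add: delta_def)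
      also have "\<dots> = b (delta [] x) e" using g(2) delta_dual by blast
      also have "\<dots> = e (density x)" unfolding density_def using represent(2)[OF delta_dual e] by simp
      finally show "g x = e (density x)" .
    qed
    then show ?thesis using g(2) f e unfolding pairing_def by auto
  qed
qed

end

section \<open>The isomorphism\<close>

abbreviation Pe :: "((((real^'d::{finite,linorder} \<Rightarrow> complex) \<Rightarrow> complex) \<Rightarrow> ('e \<Rightarrow> complex) \<Rightarrow> complex) \<Rightarrow> ennreal) set" where
  "Pe \<equiv> {\<lambda>b. SUP (x, y)\<in>A \<times> B. ennreal (cmod (b x y)) | A B.
        A \<in> equicontinuous_subsets Bd \<and> B \<in> equicontinuous_subsets E}"

lemma pairing_image: "pairing ` Bv = eps_product_carrier Bd E"
proof
  show "pairing ` Bv \<subseteq> eps_product_carrier Bd E" using pairing_carrier by auto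
  show "eps_product_carrier Bd E \<subseteq> pairing ` Bv"
  proof
    fix b assume "b \<in> eps_product_carrier Bd E"
    then show "b \<in> pairing ` Bv" using density_in[of b] pairing_density[of b] by force
  qed
qed

lemma pairing_add:
  fixes \<phi> \<psi> :: "real^'d::{finite,linorder} \<Rightarrow> 'e"
  assumes \<phi>: "\<phi> \<in> Bv" and \<psi>: "\<psi> \<in> Bv"
  shows "pairing (\<phi> + \<psi>) = pairing \<phi> + pairing \<psi>"
proof (intro ext)
  fix f e
  show "pairing (\<phi> + \<psi>) f e = (pairing \<phi> + pairing \<psi>) f e"
  proof (cases "f \<in> dual Bd \<and> e \<in> dual E")
    case True
    then have f: "f \<in> dual Bd" and e: "e \<in> dual E" by auto
    have "(\<lambda>x. e ((\<phi> + \<psi>) x)) = (\<lambda>x. e (\<phi> x)) + (\<lambda>x. e (\<psi> x))"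
      using dual_add_apply[OF e smoothD(4)[OF Bv_smooth[OF \<phi>]] smoothD(4)[OF Bv_smooth[OF \<psi>]]] by (simp add: fun_eq_iff)
    then show ?thesis
      using True lcs.dual_add_apply[OF Bd_lcs f, of "\<lambda>x. e (\<phi> x)" "\<lambda>x. e (\<psi> x)"] dual_comp_Bset[OF \<phi> e] dual_comp_Bset[OF \<psi> e]
      by (simp add: pairing_def)
  qed (auto simp: pairing_def)
qed

lemma pairing_scale:
  fixes \<phi> :: "real^'d::{finite,linorder} \<Rightarrow> 'e"
  assumes \<phi>: "\<phi> \<in> Bv"
  shows "pairing (c *\<^sub>C \<phi>) = c *\<^sub>C pairing \<phi>"
proof (intro ext)
  fix f e
  show "pairing (c *\<^sub>C \<phi>) f e = (c *\<^sub>C pairing \<phi>) f e"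
  proof (cases "f \<in> dual Bd \<and> e \<in> dual E")
    case True
    then have f: "f \<in> dual Bd" and e: "e \<in> dual E" by auto
    have "(\<lambda>x. e ((c *\<^sub>C \<phi>) x)) = c *\<^sub>C (\<lambda>x. e (\<phi> x))"
      using dual_scaleC_apply[OF e smoothD(4)[OF Bv_smooth[OF \<phi>]]] by (simp add: fun_eq_iff scaleC_fun_def scaleC_complex_def)
    then show ?thesis
      using True lcs.dual_scaleC_apply[OF Bd_lcs f, of "\<lambda>x. e (\<phi> x)" c] dual_comp_Bset[OF \<phi> e]
      by (simp add: pairing_def scaleC_fun_def scaleC_complex_def)
  qed (auto simp: pairing_def scaleC_fun_def scaleC_complex_def)
qed

lemma pairing_delta:
  fixes \<phi> :: "real^'d::{finite,linorder} \<Rightarrow> 'e"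
  assumes \<phi>: "\<phi> \<in> Bv" and e: "e \<in> dual E"
  shows "pairing \<phi> (delta js x) e = e (partials E js \<phi> x)"
  using dual_comp_Bset[OF \<phi> e] delta_dual[of js x] e smooth_dual(2)[OF e Bv_smooth[OF \<phi>], of js]
  unfolding pairing_def by (simp add: delta_def fun_eq_iff)

lemma inj_on_pairing: "inj_on pairing Bv"
proof (rule inj_onI)
  fix \<phi> \<psi> :: "real^'d::{finite,linorder} \<Rightarrow> 'e"
  assume \<phi>: "\<phi> \<in> Bv" and \<psi>: "\<psi> \<in> Bv" and eq: "pairing \<phi> = pairing \<psi>"
  show "\<phi> = \<psi>"
  proof
    fix x
    show "\<phi> x = \<psi> x"
    proof (rule dual_separates[OF smoothD(4)[OF Bv_smooth[OF \<phi>]] smoothD(4)[OF Bv_smooth[OF \<psi>]]])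
      fix e assume e: "e \<in> dual E"
      have "e (partials E [] \<phi> x) = e (partials E [] \<psi> x)"
        using pairing_delta[OF \<phi> e, of "[]" x] pairing_delta[OF \<psi> e, of "[]" x] eq by simp
      then show "e (\<phi> x) = e (\<psi> x)" by simp
    qed
  qed
qed

text \<open>
  Dominating both equicontinuous sets by seminorms shows that \<open>pairing\<close> is continuous.
\<close>

lemma pairing_bound:
  fixes A :: "((real^'d::{finite,linorder} \<Rightarrow> complex) \<Rightarrow> complex) set"
  assumes A: "A \<in> equicontinuous_subsets Bd" and B: "B \<in> equicontinuous_subsets E"
  obtains q t C where "continuous_seminorm E q" "t \<in> \<RR>" "C > 0"
    "\<forall>\<phi>\<in>Bv. \<forall>f\<in>A. \<forall>e\<in>B. cmod (pairing \<phi> f e) \<le> C * enn2real (ultra_seminorm E M q t \<phi>)"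
proof -
  obtain n where n: "continuous_seminorm Bd n" "A \<subseteq> lcs.polar Bd n" using lcs.equicontinuous_dominated[OF Bd_lcs A] .
  obtain t C where tC: "t \<in> \<RR>" "C > 0" "\<forall>g\<in>Bset. n g \<le> C * N t g" using Bd_seminorm_bound[OF n(1)] .
  obtain q where q: "continuous_seminorm E q" "B \<subseteq> polar q" using equicontinuous_dominated[OF B] .
  have "cmod (pairing \<phi> f e) \<le> C * enn2real (ultra_seminorm E M q t \<phi>)"
    if \<phi>: "\<phi> \<in> Bv" and f: "f \<in> A" and e: "e \<in> B" for \<phi> f e
  proof -
    have eE: "e \<in> dual E" and eq: "\<And>x. x \<in> topspace E \<Longrightarrow> cmod (e x) \<le> q x" using e q(2) unfolding polar_def by auto
    have g: "(\<lambda>x. e (\<phi> x)) \<in> Bset" by (rule dual_comp_Bset[OF \<phi> eE])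
    have fB: "f \<in> dual Bd" and fn: "\<And>g. g \<in> Bset \<Longrightarrow> cmod (f g) \<le> n g"
      using f n(2) unfolding lcs.polar_def[OF Bd_lcs] by auto
    have "N t (\<lambda>x. e (\<phi> x)) \<le> enn2real (ultra_seminorm E M q t \<phi>)"
    proof (rule N_dual_le(2)[OF Bv_smooth[OF \<phi>] eE tC(1)])
      show "cmod (e (weighted t \<phi> p)) \<le> enn2real (ultra_seminorm E M q t \<phi>)" for p
        by (rule order_trans[OF eq[OF weighted_in[OF Bv_smooth[OF \<phi>]]] Bv_le_seminorm[OF \<phi> q(1) tC(1)]])
    qed simp
    then have "C * N t (\<lambda>x. e (\<phi> x)) \<le> C * enn2real (ultra_seminorm E M q t \<phi>)" using tC(2) by simp
    moreover have "cmod (f (\<lambda>x. e (\<phi> x))) \<le> C * N t (\<lambda>x. e (\<phi> x))" using fn[OF g] tC(3) g by force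
    ultimately show ?thesis unfolding pairing_def using fB eE by simp
  qed
  then show ?thesis using that[OF q(1) tC(1,2)] by blast
qed

lemma Pe_SUP: "(SUP (x, y)\<in>A \<times> B. ennreal (cmod (b x y))) = (SUP p\<in>A \<times> B. ennreal (cmod (b (fst p) (snd p))))"
  by (simp add: case_prod_beta)

lemma PeI:
  assumes "A \<in> equicontinuous_subsets Bd" "B \<in> equicontinuous_subsets E"
  shows "(\<lambda>b. SUP (x, y)\<in>A \<times> B. ennreal (cmod (b x y))) \<in> Pe"
  unfolding mem_Collect_eq by (intro exI[of _ A] exI[of _ B] conjI refl assms)

lemma PeE:
  assumes "p \<in> Pe"
  obtains A B where "A \<in> equicontinuous_subsets Bd" "B \<in> equicontinuous_subsets E"
    "p = (\<lambda>b. SUP (x, y)\<in>A \<times> B. ennreal (cmod (b x y)))"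
  using assms unfolding mem_Collect_eq by (elim exE conjE) (rule that)

lemma Pe_fin:
  fixes A :: "((real^'d::{finite,linorder} \<Rightarrow> complex) \<Rightarrow> complex) set"
  assumes A: "A \<in> equicontinuous_subsets Bd" "B \<in> equicontinuous_subsets E" and b: "b \<in> eps_product_carrier Bd E"
  shows "(SUP p\<in>A \<times> B. ennreal (cmod (b (fst p) (snd p)))) < \<infinity>"
proof -
  obtain q t C where C: "continuous_seminorm E q" "t \<in> \<RR>" "C > 0"
    "\<forall>\<phi>\<in>Bv. \<forall>f\<in>A. \<forall>e\<in>B. cmod (pairing \<phi> f e) \<le> C * enn2real (ultra_seminorm E M q t \<phi>)"
    using pairing_bound[OF A] .
  obtain \<phi> where \<phi>: "\<phi> \<in> Bv" "b = pairing \<phi>" using b unfolding pairing_image[symmetric] by blast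
  show ?thesis
    by (rule SUP_ennreal_bound(2)[of "C * enn2real (ultra_seminorm E M q t \<phi>)"]) (use C(3,4) \<phi> in auto)
qed

lemma Pe_finite: "\<forall>p\<in>Pe. \<forall>b\<in>eps_product_carrier (Bd :: (real^'d::{finite,linorder} \<Rightarrow> complex) topology) E. p b < \<infinity>"
  by (intro ballI, erule PeE, simp only: Pe_SUP, rule Pe_fin)

lemma Pe_family: "seminorm_family (eps_product_carrier (Bd :: (real^'d::{finite,linorder} \<Rightarrow> complex) topology) E) Pe"
  apply (rule seminorm_family.intro)
       prefer 2
       apply (drule bspec[OF Pe_finite], drule (1) bspec, assumption)
proof -
  let ?V = "eps_product_carrier (Bd :: (real^'d::{finite,linorder} \<Rightarrow> complex) topology) E"
  let ?Bv = "Bv :: (real^'d::{finite,linorder} \<Rightarrow> 'e) set"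
  have V: "?V = pairing ` ?Bv" by (rule pairing_image[symmetric])
  show sub: "complex_vector.subspace ?V"
    unfolding V complex_vector.subspace_def
  proof (intro conjI ballI allI)
    have "pairing (0 *\<^sub>C (0 :: real^'d::{finite,linorder} \<Rightarrow> 'e)) = 0"
      unfolding pairing_scale[OF complex_vector.subspace_0[OF Bv_subspace]] by simp
    then show "0 \<in> pairing ` ?Bv" using complex_vector.subspace_0[OF Bv_subspace] by (metis image_eqI scaleC_zero_right)
  next
    fix x y assume "x \<in> pairing ` ?Bv" "y \<in> pairing ` ?Bv"
    then obtain \<phi> \<psi> where p: "\<phi> \<in> ?Bv" "x = pairing \<phi>" "\<psi> \<in> ?Bv" "y = pairing \<psi>" by blast
    have "x + y = pairing (\<phi> + \<psi>)" unfolding p(2,4) pairing_add[OF p(1,3)] ..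
    then show "x + y \<in> pairing ` ?Bv" using complex_vector.subspace_add[OF Bv_subspace p(1,3)] by blast
  next
    fix c x assume "x \<in> pairing ` ?Bv"
    then obtain \<phi> where p: "\<phi> \<in> ?Bv" "x = pairing \<phi>" by blast
    have "c *\<^sub>C x = pairing (c *\<^sub>C \<phi>)" unfolding p(2) pairing_scale[OF p(1)] ..
    then show "c *\<^sub>C x \<in> pairing ` ?Bv" using complex_vector.subspace_scale[OF Bv_subspace p(1)] by blast
  qed
  show "seminorm_on ?V (\<lambda>x. enn2real (p x))" if p: "p \<in> Pe" for p
  proof -
    obtain A B where AB: "A \<in> equicontinuous_subsets Bd" "B \<in> equicontinuous_subsets E"
      "p = (\<lambda>b. SUP (x, y)\<in>A \<times> B. ennreal (cmod (b x y)))" using PeE[OF p] .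
    have "seminorm_on ?V (\<lambda>b. cmod (b x y))" for x y
      unfolding seminorm_on_def
      by (auto simp: norm_triangle_ineq scaleC_fun_def scaleC_complex_def norm_mult)
    then show ?thesis unfolding AB(3) Pe_SUP by (intro seminorm_on_SUP[OF sub] Pe_fin[OF AB(1,2)])
  qed
  have emp: "{} \<in> equicontinuous_subsets X" for X :: "'x::complex_vector topology"
    unfolding equicontinuous_subsets_def equicontinuous_on_def by (auto intro: openin_topspace)
  show "Pe \<noteq> ({} :: ((((real^'d::{finite,linorder} \<Rightarrow> complex) \<Rightarrow> complex) \<Rightarrow> ('e \<Rightarrow> complex) \<Rightarrow> complex) \<Rightarrow> ennreal) set)"
  proof -
    have nonempty: "S \<noteq> {}" if "x \<in> S" for x :: 'x and S using that by blast
    show ?thesis by (rule nonempty[OF PeI[OF emp emp]])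
  qed
  show "\<exists>r\<in>Pe. \<forall>x\<in>?V. p x \<le> r x \<and> p' x \<le> r x" if p: "p \<in> Pe" "p' \<in> Pe" for p p'
  proof -
    obtain A B where AB: "A \<in> equicontinuous_subsets Bd" "B \<in> equicontinuous_subsets E"
      "p = (\<lambda>b. SUP (x, y)\<in>A \<times> B. ennreal (cmod (b x y)))" using PeE[OF p(1)] .
    obtain A' B' where AB': "A' \<in> equicontinuous_subsets Bd" "B' \<in> equicontinuous_subsets E"
      "p' = (\<lambda>b. SUP (x, y)\<in>A' \<times> B'. ennreal (cmod (b x y)))" using PeE[OF p(2)] .
    have un: "X \<union> Y \<in> equicontinuous_subsets S" if S: "lcs S" "X \<in> equicontinuous_subsets S" "Y \<in> equicontinuous_subsets S"
      for X Y and S :: "'x::complex_vector topology"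
    proof -
      obtain q where q: "continuous_seminorm S q" "X \<subseteq> lcs.polar S q" using lcs.equicontinuous_dominated[OF S(1,2)] .
      obtain q' where q': "continuous_seminorm S q'" "Y \<subseteq> lcs.polar S q'" using lcs.equicontinuous_dominated[OF S(1,3)] .
      have "X \<union> Y \<subseteq> lcs.polar S (\<lambda>x. q x + q' x)"
        using q q' lcs.seminorm_ineqs(3)[OF S(1) q(1)] lcs.seminorm_ineqs(3)[OF S(1) q'(1)]
        unfolding lcs.polar_def[OF S(1)] by (fastforce intro: add_increasing add_increasing2)
      then show ?thesis
        using lcs.equicontinuous_subset[OF S(1) lcs.polar_equicontinuous[OF S(1) lcs.continuous_seminorm_add[OF S(1) q(1) q'(1)]]] by blast
    qed
    let ?r = "\<lambda>b. SUP (x, y)\<in>(A \<union> A') \<times> (B \<union> B'). ennreal (cmod (b x y))"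
    have "?r \<in> Pe" by (rule PeI[OF un[OF Bd_lcs AB(1) AB'(1)] un[OF lcs_axioms AB(2) AB'(2)]])
    moreover have "p x \<le> ?r x \<and> p' x \<le> ?r x" for x
      unfolding AB(3) AB'(3) by (intro conjI SUP_subset_mono) auto
    ultimately show ?thesis by (intro bexI[of _ ?r] ballI)
  qed
  show "b = 0" if b: "b \<in> ?V" "\<And>p. p \<in> Pe \<Longrightarrow> p b = 0" for b
  proof (intro ext)
    fix f e
    show "b f e = 0 f e"
    proof (cases "f \<in> dual Bd \<and> e \<in> dual E")
      case False
      then show ?thesis using carrier_outside[OF b(1)] by simp
    next
      case True
      have "{f} \<in> equicontinuous_subsets Bd"
        using lcs.equicontinuous_subset[OF Bd_lcs lcs.polar_equicontinuous[OF Bd_lcs lcs.dual_seminorm[OF Bd_lcs]], of f "{f}"] True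
        unfolding lcs.polar_def[OF Bd_lcs] by auto
      from b(2)[OF PeI[OF this, of "{e}"]] have "{e} \<in> equicontinuous_subsets E \<Longrightarrow>
          (SUP (x, y)\<in>{f} \<times> {e}. ennreal (cmod (b x y))) = 0" .
      moreover have "{e} \<in> equicontinuous_subsets E"
        using equicontinuous_subset[OF polar_equicontinuous[OF dual_seminorm], of e "{e}"] True
        unfolding polar_def by auto
      ultimately have "(SUP (x, y)\<in>{f} \<times> {e}. ennreal (cmod (b x y))) = 0" by blast
      then show ?thesis by simp
    qed
  qed
qed

text \<open>
  One direction of continuity is \<open>pairing_bound\<close>. For the other, the weighted
  evaluation functionals form an equicontinuous set, and a seminorm \<open>q\<close> of
  \<open>E\<close> is the supremum over its polar.
\<close>

theorem vector_valued_isomorphism: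
  "lcs_isomorphic (Bdot_tilde_vec M E :: (real^'d::{finite,linorder} \<Rightarrow> 'e) topology)
    ((Bdot_tilde M :: (real^'d::{finite,linorder} \<Rightarrow> complex) topology) \<epsilon>\<otimes> E)"
proof -
  let ?Bv = "Bv :: (real^'d::{finite,linorder} \<Rightarrow> 'e) set"
  let ?C = "eps_product_carrier (Bd :: (real^'d::{finite,linorder} \<Rightarrow> complex) topology) E"
  let ?P = "pairing :: (real^'d::{finite,linorder} \<Rightarrow> 'e) \<Rightarrow> _"
  interpret V: seminorm_family ?Bv Pv by (rule Bv_family)
  interpret T: seminorm_family ?C Pe by (rule Pe_family)
  define Q where "Q = inv_into ?Bv ?P"
  have Q: "Q b \<in> ?Bv" "?P (Q b) = b" if "b \<in> ?C" for b
  proof -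
    have "b \<in> ?P ` ?Bv" using that unfolding pairing_image .
    then show "Q b \<in> ?Bv" "?P (Q b) = b" unfolding Q_def by (rule inv_into_into, rule f_inv_into_f)
  qed
  have QP: "Q (?P \<phi>) = \<phi>" if "\<phi> \<in> ?Bv" for \<phi> unfolding Q_def using inv_into_f_f[OF inj_on_pairing that] .
  have lin: "clinear_on ?Bv ?P" unfolding clinear_on_def using pairing_add pairing_scale by blast
  have linQ: "clinear_on ?C Q" unfolding clinear_on_def
  proof (intro conjI ballI allI)
    fix x y assume x: "x \<in> ?C" and y: "y \<in> ?C"
    have "?P (Q x + Q y) = x + y" using pairing_add[OF Q(1)[OF x] Q(1)[OF y]] Q(2)[OF x] Q(2)[OF y] by simp
    then show "Q (x + y) = Q x + Q y"
      using QP[OF complex_vector.subspace_add[OF Bv_subspace Q(1)[OF x] Q(1)[OF y]]] by simp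
  next
    fix c x assume x: "x \<in> ?C"
    have "?P (c *\<^sub>C Q x) = c *\<^sub>C x" using pairing_scale[OF Q(1)[OF x]] Q(2)[OF x] by simp
    moreover have "Q (?P (c *\<^sub>C Q x)) = c *\<^sub>C Q x"
      by (rule QP[OF complex_vector.subspace_scale[OF Bv_subspace Q(1)[OF x]]])
    ultimately show "Q (c *\<^sub>C x) = c *\<^sub>C Q x" by simp
  qed
  have cont: "continuous_map V.T T.T ?P"
  proof (rule T.continuous_map_linearI[OF V.lcs_axioms])
    show "clinear_on (topspace V.T) ?P" using lin by simp
    show "?P ` topspace V.T \<subseteq> topspace T.T" using pairing_carrier by auto
    fix n assume n: "continuous_seminorm T.T n"
    obtain p D where p: "p \<in> Pe" "D > 0" "\<forall>b\<in>?C. n b \<le> D * enn2real (p b)" using T.seminorm_le_generator[OF n] .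
    obtain A B where AB: "A \<in> equicontinuous_subsets Bd" "B \<in> equicontinuous_subsets E"
      "p = (\<lambda>b. SUP (x, y)\<in>A \<times> B. ennreal (cmod (b x y)))" using PeE[OF p(1)] .
    obtain q t C where C: "continuous_seminorm E q" "t \<in> \<RR>" "C > 0"
      "\<forall>\<phi>\<in>?Bv. \<forall>f\<in>A. \<forall>e\<in>B. cmod (pairing \<phi> f e) \<le> C * enn2real (ultra_seminorm E M q t \<phi>)"
      using pairing_bound[OF AB(1,2)] .
    show "continuous_seminorm V.T (\<lambda>\<phi>. n (?P \<phi>))"
    proof (rule V.continuous_seminorm_le)
      show "continuous_seminorm V.T (\<lambda>\<phi>. (D * C) * enn2real (ultra_seminorm E M q t \<phi>))"
        by (rule V.continuous_seminorm_mult[OF V.generator_continuous]) (use C p(2) in auto)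
      show "seminorm_on (topspace V.T) (\<lambda>\<phi>. n (?P \<phi>))"
        unfolding topspace_seminorm_topology
      proof (rule seminorm_on_compose[OF _ lin])
        show "seminorm_on ?C n" using n unfolding continuous_seminorm_iff by simp
        show "?P ` ?Bv \<subseteq> ?C" using pairing_carrier by blast
      qed
      fix \<phi> assume "\<phi> \<in> topspace V.T"
      then have \<phi>: "\<phi> \<in> ?Bv" by simp
      have "enn2real (p (?P \<phi>)) \<le> C * enn2real (ultra_seminorm E M q t \<phi>)"
        unfolding AB(3) Pe_SUP by (rule SUP_ennreal_bound(3)) (use C(3,4) \<phi> in auto)
      then have "D * enn2real (p (?P \<phi>)) \<le> D * (C * enn2real (ultra_seminorm E M q t \<phi>))" using p(2) by simp
      moreover have "n (?P \<phi>) \<le> D * enn2real (p (?P \<phi>))" using p(3) pairing_carrier[OF \<phi>] by blast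
      ultimately show "n (?P \<phi>) \<le> D * C * enn2real (ultra_seminorm E M q t \<phi>)" by simp
    qed
  qed
  have contQ: "continuous_map T.T V.T Q"
  proof (rule V.continuous_map_linearI[OF T.lcs_axioms])
    show "clinear_on (topspace T.T) Q" using linQ by simp
    show "Q ` topspace T.T \<subseteq> topspace V.T" using Q(1) by auto
    fix n assume n: "continuous_seminorm V.T n"
    obtain p D where p: "p \<in> Pv" "D > 0" "\<forall>\<phi>\<in>?Bv. n \<phi> \<le> D * enn2real (p \<phi>)" using V.seminorm_le_generator[OF n] .
    obtain q t where q: "continuous_seminorm E q" "t \<in> \<RR>" "p = ultra_seminorm E M q t" using p(1) by blast
    let ?A = "lcs.polar Bd (N t :: (real^'d::{finite,linorder} \<Rightarrow> complex) \<Rightarrow> real)"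
    let ?s = "\<lambda>b. SUP (x, y)\<in>?A \<times> polar q. ennreal (cmod (b x y))"
    have s: "?s \<in> Pe"
      by (rule PeI[OF lcs.polar_equicontinuous[OF Bd_lcs N_continuous[OF q(2)]] polar_equicontinuous[OF q(1)]])
    show "continuous_seminorm T.T (\<lambda>b. n (Q b))"
    proof (rule T.continuous_seminorm_le)
      show "continuous_seminorm T.T (\<lambda>b. D * enn2real (?s b))"
        by (rule T.continuous_seminorm_mult[OF T.generator_continuous[OF s]]) (use p(2) in simp)
      show "seminorm_on (topspace T.T) (\<lambda>b. n (Q b))"
        unfolding topspace_seminorm_topology
      proof (rule seminorm_on_compose[OF _ linQ])
        show "seminorm_on ?Bv n" using n unfolding continuous_seminorm_iff by simp
        show "Q ` ?C \<subseteq> ?Bv" using Q(1) by blast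
      qed
      fix b assume "b \<in> topspace T.T"
      then have b: "b \<in> ?C" by simp
      define \<phi> where "\<phi> = Q b"
      have \<phi>: "\<phi> \<in> ?Bv" "pairing \<phi> = b" unfolding \<phi>_def using Q[OF b] by auto
      have "q (weighted t \<phi> i) \<le> enn2real (?s b)" for i
      proof (subst seminorm_le_iff_polar[OF q(1) weighted_in[OF Bv_smooth[OF \<phi>(1)]]], rule ballI)
        fix e assume e: "e \<in> polar q"
        then have eE: "e \<in> dual E" unfolding polar_def by simp
        let ?f = "of_real (inverse (TM M t (fst i))) *\<^sub>C delta (multi_list (fst i)) (snd i)"
        have fB: "?f \<in> dual Bd" by (rule complex_vector.subspace_scale[OF lcs.dual_subspace[OF Bd_lcs] delta_dual])
        have "cmod (?f g) \<le> N t g" if "g \<in> Bset" for g by (rule weighted_delta_bound[OF that q(2)])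
        then have "?f \<in> ?A" unfolding lcs.polar_def[OF Bd_lcs] using fB by simp
        then have "cmod (b (fst (?f, e)) (snd (?f, e))) \<le> enn2real (?s b)"
          unfolding Pe_SUP using T.fin[OF s b] unfolding Pe_SUP by (intro le_enn2real_SUP) (use e in auto)
        moreover have "b ?f e = of_real (inverse (TM M t (fst i))) * e (partials E (multi_list (fst i)) \<phi> (snd i))"
          using carrier_lin1[OF b eE] delta_dual[of "multi_list (fst i)" "snd i"] pairing_delta[OF \<phi>(1) eE] \<phi>(2)
          unfolding clinear_on_def scaleC_complex_def by metis
        moreover have "e (weighted t \<phi> i) = of_real (inverse (TM M t (fst i))) * ((inverse \<i>) ^ multi_size (fst i) * e (partials E (multi_list (fst i)) \<phi> (snd i)))"
          unfolding weighted_def D_multi_eq[OF Bv_smooth[OF \<phi>(1)]] scaleR_scaleC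
          using dual_scaleC_apply[OF eE] scaleC_in smoothD(3)[OF Bv_smooth[OF \<phi>(1)]] by simp
        ultimately show "cmod (e (weighted t \<phi> i)) \<le> enn2real (?s b)"
          by (simp add: norm_mult norm_power norm_inverse del: inverse_i)
      qed
      then have "enn2real (p \<phi>) \<le> enn2real (?s b)"
        unfolding q(3) ultra_seminorm_SUP by (intro SUP_ennreal_bound(3)) auto
      then have "D * enn2real (p \<phi>) \<le> D * enn2real (?s b)" using p(2) by simp
      then show "n (Q b) \<le> D * enn2real (?s b)" using p(3) \<phi>(1) unfolding \<phi>_def by force
    qed
  qed
  have "homeomorphic_maps V.T T.T ?P Q"
    unfolding homeomorphic_maps_def using cont contQ QP Q(2) by simp
  then have "homeomorphic_map V.T T.T ?P" by (rule homeomorphic_maps_imp_map)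
  then show ?thesis
    unfolding lcs_isomorphic_def Bdot_tilde_vec_def eps_product_def Bdot_tilde_eq
    using V.locally_convex T.locally_convex lin by (intro conjI exI[of _ ?P]) simp_all
qed

end

theorem proposition3p3:
  fixes M :: "nat \<Rightarrow> real" and E :: "'e::complex_vector topology"
  assumes "weight_sequence M"
    and "locally_convex_space E" and "complete_lcs E"
  shows "lcs_isomorphic
    (Bdot_tilde_vec M E :: (real^'d::{finite,linorder} \<Rightarrow> 'e) topology)
    ((Bdot_tilde M :: (real^'d::{finite,linorder} \<Rightarrow> complex) topology) \<epsilon>\<otimes> E)"
proof -
  interpret vector_valued M E
    using assms by unfold_locales
  show ?thesis by (rule vector_valued_isomorphism)
qed

end
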